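(* Let $N\ge1$ be an integer, let $\alpha,\lambda,\sigma>0$, let $\mathscr{E}:H\to\mathbb{R}$ be an admissible objective, and suppose the active-subspace condition holds for $(V,Q,\mathscr{E})$. Let the initial condition satisfy $\mathbf{x}_\circ\in H^N$. Then the SDE $$d\mathbb{X}_t=-\lambda\,\mathbb{F}(\mathbb{X}_t)\,dt+\sigma\,\mathbb{D}(\mathbb{F}(\mathbb{X}_t))\,d\mathbb{W}^Q_t,\quad t>0,\qquad\mathbb{X}_0=\mathbf{x}_\circ,$$ admits a unique global strong solution $\mathbb{X}_t$ in $H^N$.
   Context: $H$ is an infinite-dimensional real separable Hilbert space with inner product $\langle\cdot,\cdot\rangle_H$ and norm $\|\cdot\|_H$; $H^N$ is the product Hilbert space. $Q:H\to H$ is a symmetric, positive semi-definite, trace-class operator. Admissible objective: $\mathscr{E}:H\to\mathbb{R}$ is an admissible objective if there exist an exponent $p\ge1$ and constants $C_{\mathscr{E}},c,R_0,L>0$ such that (1) $\inf_{x\in H}\mathscr{E}(x)\ge0$; (2) $\mathscr{E}(x)\le C_{\mathscr{E}}(1+\|x\|_H^p)$ for all $x\in H$; (3) $\mathscr{E}(x)\ge c\|x\|_H^p$ whenever $\|x\|_H>R_0$; (4) $|\mathscr{E}(x)-\mathscr{E}(y)|\le L(1+\|x\|_H^{p-1}+\|y\|_H^{p-1})\|x-y\|_H$ for all $x,y\in H$. Active-subspace condition for $(V,Q,\mathscr{E})$: $V\subset H$ is a linear subspace of finite dimension $d<\infty$, $H=V\oplus V^\perp$; the global minimizer $x^*$ of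 $\mathscr{E}$ lies in $V$; and there is $\lambda_{\min}>0$ with $\langle v,Qv\rangle_H\ge\lambda_{\min}\|v\|_H^2$ for all $v\in V$. Weights: $\omega_\alpha(x)=\exp(-\alpha\mathscr{E}(x))$. Drift: $\mathbb{F}=(\mathbf{F}^i)_{i=1}^N:H^N\to H^N$ with, for $\mathbb{X}=(X^1,\dots,X^N)\in H^N$, $$\mathbf{F}^i(\mathbb{X})=X^i-\frac{\sum_{j=1}^NX^j\,\omega_\alpha(X^j)}{\sum_{k=1}^N\omega_\alpha(X^k)}.$$ Diffusion: $\mathsf{D}(x)=\|x\|_H\,\mathsf{P}_V$, with $\mathsf{P}_V$ the orthogonal projection onto $V$; for $\mathbb{Y}=(Y^1,\dots,Y^N)\in H^N$, $\mathbb{D}(\mathbb{Y})=(\mathsf{D}(Y^i))_{i=1}^N$ acts on $H^N$ componentwise (block-diagonally), $\mathbb{D}(\mathbb{Y})(u^1,\dots,u^N)=(\mathsf{D}(Y^1)u^1,\dots,\mathsf{D}(Y^N)u^N)$. Noise: $\mathbb{W}^Q=(W^{Q,i})_{i=1}^N$, where the $W^{Q,i}$ are independent $H$-valued $Q$-Wiener processes on a filtered probability space satisfying the usual conditions. Global strong solution: an $H^N$-valued predictable process with almost surely continuous paths, belonging to $L^2(\Omega;C([0,T];H^N))$ for every $T>0$, satisfying the equation in integral form almost surely for all $t\ge0$. Uniqueness is pathwise. *)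

theory Defs
  imports "HOL-Probability.Probability"
begin

subsection \<open>Separability of the product Hilbert space\<close>

text \<open>The product space \<open>H\<^sup>N\<close> is the type \<open>'h ^ 'n\<close> with its library inner product. The library lacks the
  following instance, which is needed for Bochner integration in \<open>'h ^ 'n\<close>.\<close>

instance vec :: ("{metric_space, second_countable_topology}", finite) second_countable_topology
proof
  obtain B :: "'a set set" where B: "countable B" "topological_basis B"
    using ex_countable_basis by blast
  define C where "C = (\<lambda>f. {x :: 'a ^ 'b. \<forall>i. x $ i \<in> f i}) ` (UNIV \<rightarrow>\<^sub>E B)"
  have "countable C"
    unfolding C_def by (intro countable_image countable_PiE) (auto simp: B)
  moreover have "topological_basis C"
  proof (rule topological_basisI)
    fix O' assume "O' \<in> C"
    then obtain f where f: "\<And>i. f i \<in> B" and O': "O' = {x. \<forall>i. x $ i \<in> f i}"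
      unfolding C_def by (auto simp: PiE_def Pi_def)
    have "open (f i)" for i
      using f topological_basis_open[OF B(2)] by blast
    then show "open O'"
      unfolding O' open_vec_def by blast
  next
    fix O' :: "('a ^ 'b) set" and x assume "open O'" "x \<in> O'"
    then have "\<exists>A. (\<forall>i. open (A i) \<and> x $ i \<in> A i) \<and> (\<forall>y. (\<forall>i. y $ i \<in> A i) \<longrightarrow> y \<in> O')"
      unfolding open_vec_def by simp
    then obtain A where "(\<forall>i. open (A i) \<and> x $ i \<in> A i) \<and> (\<forall>y. (\<forall>i. y $ i \<in> A i) \<longrightarrow> y \<in> O')"
      by (rule exE)
    then have A: "open (A i)" "x $ i \<in> A i" "(\<forall>i. y $ i \<in> A i) \<Longrightarrow> y \<in> O'" for i y
      by simp_all
    have "\<exists>b. b \<in> B \<and> x $ i \<in> b \<and> b \<subseteq> A i" for i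
      by (rule topological_basisE[OF B(2) A(1) A(2)[of i]]) blast
    then have "\<forall>i. \<exists>b. b \<in> B \<and> x $ i \<in> b \<and> b \<subseteq> A i" by blast
    then obtain f where f: "\<And>i. f i \<in> B" "\<And>i. x $ i \<in> f i" "\<And>i. f i \<subseteq> A i"
      by (auto dest!: choice)
    have "{y. \<forall>i. y $ i \<in> f i} \<in> C" unfolding C_def using f(1) by auto
    moreover have "x \<in> {y. \<forall>i. y $ i \<in> f i}"
      using f(2) by simp
    moreover have "{y. \<forall>i. y $ i \<in> f i} \<subseteq> O'"
    proof
      fix y assume "y \<in> {y. \<forall>i. y $ i \<in> f i}"
      then have "y $ i \<in> A i" for i using f(3)[of i] by auto
      then show "y \<in> O'" using A(3) by simp
    qed
    ultimately show "\<exists>B'\<in>C. x \<in> B' \<and> B' \<subseteq> O'"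
      by (intro bexI[of _ "{y. \<forall>i. y $ i \<in> f i}"] conjI)
  qed
  ultimately show "\<exists>B :: ('a ^ 'b) set set. countable B \<and> open = generate_topology B"
    by (intro exI[of _ C] conjI topological_basis_imp_subbasis)
qed

subsection \<open>Operators on a Hilbert space\<close>

definition finite_dimensional :: "'h::real_vector set \<Rightarrow> bool" where
  "finite_dimensional V \<longleftrightarrow> (\<exists>B. finite B \<and> V = span B)"

definition orthonormal :: "'h::real_inner set \<Rightarrow> bool" where
  "orthonormal B \<longleftrightarrow> pairwise orthogonal B \<and> (\<forall>e\<in>B. norm e = 1)"

text \<open>Trace-class (nuclear) operators: \<open>A x = (\<Sum>j. \<langle>a\<^sub>j, x\<rangle> b\<^sub>j)\<close> with
  \<open>(\<Sum>j. \<parallel>a\<^sub>j\<parallel> \<parallel>b\<^sub>j\<parallel>) < \<infinity>\<close>.\<close>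

definition trace_class :: "('h::real_inner \<Rightarrow> 'h) \<Rightarrow> bool" where
  "trace_class A \<longleftrightarrow> bounded_linear A \<and>
     (\<exists>a b. summable (\<lambda>j::nat. norm (a j) * norm (b j)) \<and>
            (\<forall>x. (\<lambda>j. (a j \<bullet> x) *\<^sub>R b j) sums A x))"

definition covariance_operator :: "('h::real_inner \<Rightarrow> 'h) \<Rightarrow> bool" where
  "covariance_operator Q \<longleftrightarrow>
     (\<forall>x y. Q x \<bullet> y = x \<bullet> Q y) \<and> (\<forall>x. 0 \<le> x \<bullet> Q x) \<and> trace_class Q"

text \<open>The squared Hilbert-Schmidt norm of \<open>A Q\<^sup>1\<^sup>/\<^sup>2\<close>, i.e. the trace of \<open>A Q A\<^sup>*\<close>. The trace of a
  positive semi-definite operator, its diagonal sum over an orthonormal basis, is written as the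
  supremum of the diagonal sums over finite orthonormal sets, so that no basis has to be chosen.\<close>

definition hs_norm_sq :: "('h::real_inner \<Rightarrow> 'h) \<Rightarrow> ('h \<Rightarrow> 'h) \<Rightarrow> ennreal" where
  "hs_norm_sq Q A =
     (SUP B\<in>{B. finite B \<and> orthonormal B}. \<Sum>e\<in>B. ennreal (Q (adjoint A e) \<bullet> adjoint A e))"

definition orth_proj :: "'h::real_inner set \<Rightarrow> 'h \<Rightarrow> 'h" where
  "orth_proj V x = (THE v. v \<in> V \<and> x - v \<in> V\<^sup>\<bottom>)"

subsection \<open>Stochastic bases and \<open>Q\<close>-Wiener processes\<close>

text \<open>Filtered probability spaces satisfying the usual conditions. Time runs over \<open>[0, \<infinity>)\<close>;
  here and below nothing is required of the values at negative times.\<close>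

locale stochastic_basis = prob_space M for M :: "'w measure" +
  fixes F :: "real \<Rightarrow> 'w measure"
  assumes subalgebra_F: "0 \<le> t \<Longrightarrow> subalgebra M (F t)"
    and F_mono: "0 \<le> s \<Longrightarrow> s \<le> t \<Longrightarrow> sets (F s) \<subseteq> sets (F t)"
    and F_right_continuous: "0 \<le> t \<Longrightarrow> sets (F t) = (\<Inter>s\<in>{t<..}. sets (F s))"
    and F_complete: "A \<in> null_sets M \<Longrightarrow> B \<subseteq> A \<Longrightarrow> B \<in> sets (F 0)"

text \<open>The normal law with mean \<open>0\<close> and variance \<open>v \<ge> 0\<close>; \<open>v = 0\<close> gives the Dirac measure.\<close>

definition centred_normal :: "real \<Rightarrow> real measure" where
  "centred_normal v =
     (if v = 0 then return borel 0 else density lborel (normal_density 0 (sqrt v)))"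

definition centred_gaussian ::
  "'w measure \<Rightarrow> ('h::real_inner \<Rightarrow> 'h) \<Rightarrow> ('w \<Rightarrow> 'h) \<Rightarrow> bool" where
  "centred_gaussian M C X \<longleftrightarrow> X \<in> borel_measurable M \<and>
     (\<forall>h. distr M borel (\<lambda>\<omega>. X \<omega> \<bullet> h) = centred_normal (C h \<bullet> h))"

definition Q_wiener_process ::
  "'w measure \<Rightarrow> (real \<Rightarrow> 'w measure) \<Rightarrow> ('h::real_inner \<Rightarrow> 'h) \<Rightarrow> (real \<Rightarrow> 'w \<Rightarrow> 'h) \<Rightarrow> bool" where
  "Q_wiener_process M F Q W \<longleftrightarrow>
     (\<forall>t\<ge>0. W t \<in> borel_measurable (F t)) \<and>
     (AE \<omega> in M. W 0 \<omega> = 0) \<and>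
     (AE \<omega> in M. continuous_on {0..} (\<lambda>t. W t \<omega>)) \<and>
     (\<forall>s t. 0 \<le> s \<longrightarrow> s < t \<longrightarrow>
        centred_gaussian M (\<lambda>h. (t - s) *\<^sub>R Q h) (\<lambda>\<omega>. W t \<omega> - W s \<omega>) \<and>
        prob_space.indep_set M (sets (F s))
          {(\<lambda>\<omega>. W t \<omega> - W s \<omega>) -` B \<inter> space M | B. B \<in> sets borel})"

text \<open>An \<open>'h ^ 'n\<close>-valued process whose components are independent \<open>Q\<close>-Wiener processes.\<close>

definition independent_Q_wiener ::
  "'w measure \<Rightarrow> (real \<Rightarrow> 'w measure) \<Rightarrow> ('h::real_inner \<Rightarrow> 'h) \<Rightarrow>
   (real \<Rightarrow> 'w \<Rightarrow> 'h ^ 'n) \<Rightarrow> bool" where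
  "independent_Q_wiener M F Q W \<longleftrightarrow>
     (\<forall>i. Q_wiener_process M F Q (\<lambda>t \<omega>. W t \<omega> $ i)) \<and>
     prob_space.indep_vars M (\<lambda>_. PiM {0..} (\<lambda>_. borel))
       (\<lambda>i \<omega>. \<lambda>t\<in>{0..}. W t \<omega> $ i) UNIV"

text \<open>Its covariance operator on \<open>'h ^ 'n\<close>.\<close>

definition diag_op :: "('h \<Rightarrow> 'h) \<Rightarrow> 'h ^ 'n \<Rightarrow> 'h ^ 'n" where
  "diag_op Q u = (\<chi> i. Q (u $ i))"

subsection \<open>Predictability and the stochastic integral\<close>

definition predictable_algebra ::
  "'w measure \<Rightarrow> (real \<Rightarrow> 'w measure) \<Rightarrow> (real \<times> 'w) measure" where
  "predictable_algebra M F = sigma ({0..} \<times> space M)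
     ({{s<..t} \<times> A | s t A. 0 \<le> s \<and> s < t \<and> A \<in> sets (F s)} \<union> {{0} \<times> A | A. A \<in> sets (F 0)})"

definition predictable ::
  "'w measure \<Rightarrow> (real \<Rightarrow> 'w measure) \<Rightarrow> (real \<Rightarrow> 'w \<Rightarrow> 'h::topological_space) \<Rightarrow> bool" where
  "predictable M F X \<longleftrightarrow> (\<lambda>(t, \<omega>). X t \<omega>) \<in> borel_measurable (predictable_algebra M F)"

text \<open>Elementary operator-valued processes \<open>\<Sum>k<m. 1\<^bsub>(\<tau> k, \<tau> (k+1)]\<^esub>(t) A\<^sub>k(\<omega>)\<close>, where \<open>A\<^sub>k\<close> takes
  finitely many values among the bounded operators and is measurable at time \<open>\<tau> k\<close>.\<close>

definition elementary_data ::
  "(real \<Rightarrow> 'w measure) \<Rightarrow> nat \<Rightarrow> (nat \<Rightarrow> real) \<Rightarrow> (nat \<Rightarrow> 'w \<Rightarrow> 'h::real_normed_vector \<Rightarrow> 'h) \<Rightarrow> bool"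
  where
  "elementary_data F m \<tau> A \<longleftrightarrow> 0 \<le> \<tau> 0 \<and> (\<forall>k<m. \<tau> k < \<tau> (Suc k)) \<and>
     (\<forall>k<m. simple_function (F (\<tau> k)) (A k) \<and> (\<forall>\<omega>\<in>space (F (\<tau> k)). bounded_linear (A k \<omega>)))"

definition elementary_process ::
  "nat \<Rightarrow> (nat \<Rightarrow> real) \<Rightarrow> (nat \<Rightarrow> 'w \<Rightarrow> 'h \<Rightarrow> 'h) \<Rightarrow> real \<Rightarrow> 'w \<Rightarrow> 'h \<Rightarrow> 'h::real_normed_vector"
  where
  "elementary_process m \<tau> A t \<omega> h = (\<Sum>k<m. if t \<in> {\<tau> k<..\<tau> (Suc k)} then A k \<omega> h else 0)"

definition elementary_integral ::
  "nat \<Rightarrow> (nat \<Rightarrow> real) \<Rightarrow> (nat \<Rightarrow> 'w \<Rightarrow> 'h \<Rightarrow> 'h) \<Rightarrow> (real \<Rightarrow> 'w \<Rightarrow> 'h) \<Rightarrow>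
   real \<Rightarrow> 'w \<Rightarrow> 'h::real_normed_vector" where
  "elementary_integral m \<tau> A W t \<omega> =
     (\<Sum>k<m. A k \<omega> (W (min t (\<tau> (Suc k))) \<omega> - W (min t (\<tau> k)) \<omega>))"

text \<open>\<open>is_stochastic_integral M F Q W \<Phi> I\<close>: \<open>\<Phi>\<close> is predictable and square-integrable on compact time
  intervals, and \<open>I\<close> is (a continuous version of) its Ito integral against \<open>W\<close>, defined as the usual
  closure of the elementary integral: for each \<open>T\<close> there are elementary \<open>\<Psi>\<^sub>n\<close> such that
  \<open>E \<integral>\<^sub>0\<^sup>T \<parallel>(\<Psi>\<^sub>n(s) - \<Phi>(s)) Q\<^sup>1\<^sup>/\<^sup>2\<parallel>\<^sub>H\<^sub>S\<^sup>2 ds\<close> tends to \<open>0\<close> and the integrals of \<open>\<Psi>\<^sub>n\<close> converge to \<open>I\<close>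
  in \<open>L\<^sup>2(\<Omega>; C[0,T])\<close>. By the Ito isometry the limit does not depend on the choice of \<open>\<Psi>\<^sub>n\<close>.
  Square-integrability of \<open>\<Phi>\<close> follows from the existence of such an approximation.\<close>

definition is_stochastic_integral ::
  "'w measure \<Rightarrow> (real \<Rightarrow> 'w measure) \<Rightarrow> ('h \<Rightarrow> 'h) \<Rightarrow> (real \<Rightarrow> 'w \<Rightarrow> 'h) \<Rightarrow>
   (real \<Rightarrow> 'w \<Rightarrow> 'h \<Rightarrow> 'h) \<Rightarrow> (real \<Rightarrow> 'w \<Rightarrow> 'h::real_inner) \<Rightarrow> bool" where
  "is_stochastic_integral M F Q W \<Phi> I \<longleftrightarrow>
     (\<forall>t\<ge>0. \<forall>\<omega>\<in>space M. bounded_linear (\<Phi> t \<omega>)) \<and>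
     (\<forall>h. predictable M F (\<lambda>t \<omega>. \<Phi> t \<omega> h)) \<and>
     (\<forall>t\<ge>0. I t \<in> borel_measurable (F t)) \<and>
     (AE \<omega> in M. continuous_on {0..} (\<lambda>t. I t \<omega>)) \<and>
     (\<forall>T>0. \<exists>m \<tau> A.
        (\<forall>n::nat. elementary_data F (m n) (\<tau> n) (A n)) \<and>
        (\<lambda>n. \<integral>\<^sup>+ \<omega>. (\<integral>\<^sup>+ s\<in>{0..T}.
               hs_norm_sq Q (\<lambda>h. elementary_process (m n) (\<tau> n) (A n) s \<omega> h - \<Phi> s \<omega> h)
             \<partial>lborel) \<partial>M) \<longlonglongrightarrow> 0 \<and>
        (\<lambda>n. \<integral>\<^sup>+ \<omega>. (SUP t\<in>{0..T}.
               ennreal ((norm (elementary_integral (m n) (\<tau> n) (A n) W t \<omega> - I t \<omega>))\<^sup>2))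
             \<partial>M) \<longlonglongrightarrow> 0)"

subsection \<open>Strong solutions\<close>

text \<open>\<open>dX = b(X) dt + S(X) dW\<close>, \<open>X\<^sub>0 = x0\<close>, where \<open>W\<close> has covariance operator \<open>C\<close>.\<close>

definition global_strong_solution ::
  "'w measure \<Rightarrow> (real \<Rightarrow> 'w measure) \<Rightarrow> ('h \<Rightarrow> 'h) \<Rightarrow> (real \<Rightarrow> 'w \<Rightarrow> 'h) \<Rightarrow>
   ('h \<Rightarrow> 'h) \<Rightarrow> ('h \<Rightarrow> 'h \<Rightarrow> 'h) \<Rightarrow> 'h \<Rightarrow>
   (real \<Rightarrow> 'w \<Rightarrow> 'h::{real_inner, banach, second_countable_topology}) \<Rightarrow> bool" where
  "global_strong_solution M F C W b S x0 X \<longleftrightarrow>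
     predictable M F X \<and>
     (AE \<omega> in M. continuous_on {0..} (\<lambda>t. X t \<omega>)) \<and>
     (\<forall>T>0. (\<integral>\<^sup>+ \<omega>. (SUP t\<in>{0..T}. ennreal ((norm (X t \<omega>))\<^sup>2)) \<partial>M) < \<infinity>) \<and>
     (\<exists>I. is_stochastic_integral M F C W (\<lambda>t \<omega>. S (X t \<omega>)) I \<and>
        (AE \<omega> in M. \<forall>t\<ge>0.
           set_integrable lborel {0..t} (\<lambda>s. b (X s \<omega>)) \<and>
           X t \<omega> = x0 + (LINT s:{0..t}|lborel. b (X s \<omega>)) + I t \<omega>))"

text \<open>Existence together with pathwise uniqueness on the given stochastic basis.\<close>

definition unique_global_strong_solution ::
  "'w measure \<Rightarrow> (real \<Rightarrow> 'w measure) \<Rightarrow> ('h \<Rightarrow> 'h) \<Rightarrow> (real \<Rightarrow> 'w \<Rightarrow> 'h) \<Rightarrow>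
   ('h \<Rightarrow> 'h) \<Rightarrow> ('h \<Rightarrow> 'h \<Rightarrow> 'h) \<Rightarrow>
   'h::{real_inner, banach, second_countable_topology} \<Rightarrow> bool" where
  "unique_global_strong_solution M F C W b S x0 \<longleftrightarrow>
     (\<exists>X. global_strong_solution M F C W b S x0 X) \<and>
     (\<forall>X Y. global_strong_solution M F C W b S x0 X \<longrightarrow>
            global_strong_solution M F C W b S x0 Y \<longrightarrow>
            (AE \<omega> in M. \<forall>t\<ge>0. X t \<omega> = Y t \<omega>))"

subsection \<open>Objective, active subspace and coefficients\<close>

text \<open>For \<open>p = 1\<close> the library's convention \<open>0 powr 0 = 0\<close> changes the right-hand side of the last
  condition at \<open>x = 0\<close> or \<open>y = 0\<close> by at most a constant factor, which \<open>L\<close> absorbs.\<close>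

definition admissible_objective :: "('h::real_normed_vector \<Rightarrow> real) \<Rightarrow> bool" where
  "admissible_objective E \<longleftrightarrow>
     (\<exists>p C c R0 L. p \<ge> 1 \<and> C > 0 \<and> c > 0 \<and> R0 > 0 \<and> L > 0 \<and>
        (INF x. ereal (E x)) \<ge> 0 \<and>
        (\<forall>x. E x \<le> C * (1 + norm x powr p)) \<and>
        (\<forall>x. norm x > R0 \<longrightarrow> E x \<ge> c * norm x powr p) \<and>
        (\<forall>x y. \<bar>E x - E y\<bar> \<le> L * (1 + norm x powr (p - 1) + norm y powr (p - 1)) * norm (x - y)))"

definition active_subspace ::
  "'h::real_inner set \<Rightarrow> ('h \<Rightarrow> 'h) \<Rightarrow> ('h \<Rightarrow> real) \<Rightarrow> bool" where
  "active_subspace V Q E \<longleftrightarrow>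
     subspace V \<and> finite_dimensional V \<and> (\<forall>x. \<exists>!v. v \<in> V \<and> x - v \<in> V\<^sup>\<bottom>) \<and>
     (\<exists>x_star. is_arg_min E (\<lambda>_. True) x_star \<and> x_star \<in> V) \<and>
     (\<exists>lam_min>0. \<forall>v\<in>V. v \<bullet> Q v \<ge> lam_min * (norm v)\<^sup>2)"

definition weight :: "real \<Rightarrow> ('h \<Rightarrow> real) \<Rightarrow> 'h \<Rightarrow> real" where
  "weight \<alpha> E x = exp (- \<alpha> * E x)"

definition consensus_drift ::
  "real \<Rightarrow> ('h \<Rightarrow> real) \<Rightarrow> 'h::real_vector ^ 'n \<Rightarrow> 'h ^ 'n" where
  "consensus_drift \<alpha> E X =
     (\<chi> i. X $ i - (\<Sum>j\<in>UNIV. weight \<alpha> E (X $ j) *\<^sub>R (X $ j)) /\<^sub>R (\<Sum>k\<in>UNIV. weight \<alpha> E (X $ k)))"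

definition diffusion :: "'h::real_inner set \<Rightarrow> 'h \<Rightarrow> 'h \<Rightarrow> 'h" where
  "diffusion V x u = norm x *\<^sub>R orth_proj V u"

definition block_diffusion :: "'h::real_inner set \<Rightarrow> 'h ^ 'n \<Rightarrow> 'h ^ 'n \<Rightarrow> 'h ^ 'n" where
  "block_diffusion V Y u = (\<chi> i. diffusion V (Y $ i) (u $ i))"

end

theory Submission
  imports Defs
begin

text \<open>The drift is locally Lipschitz of linear growth, because the weights are locally bounded below and
  locally Lipschitz, and the noise enters only through the finitely many real integrals
  \<open>\<integral> \<parallel>F\<^sup>i(X)\<parallel> \<langle>e, dW\<^sup>i\<rangle>\<close>, \<open>e\<close> in an orthonormal basis of \<open>V\<close>. Solutions of the equations with radially
  truncated coefficients exist by Picard iteration, agree as long as they stay in a ball, and satisfy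
  a moment bound independent of the truncation, so they patch together to a global one. For
  uniqueness among all strong solutions, an arbitrary stochastic integral process is identified with the
  constructed one by pairing it with vectors \<open>e\<close>: this turns it into a real Ito integral of the adjoint
  integrand, to which the isometry applies.\<close>

subsection \<open>Hilbert space preliminaries\<close>

text \<open>What prevents explosion is that the consensus point is a convex combination of the
  particles: its norm is at most that of the whole configuration, so the growth constant is global
  although the weights, and with them the Lipschitz constant, degenerate on large balls. Every
  stochastic estimate ends in Gronwall's inequality, so bounds with factors 4 and 16 take the place
  of the exact Ito isometry for limits. Instead of stopping at a random time, a path is switched off
  by a decreasing adapted predicate, and second moments are estimated on the surviving event. Two
  obstacles shape the rest. The noises of different particles are independent of each other and each
  is independent of the past, but they are not assumed jointly independent of it, so the vanishing
  of their covariation has to be proved. And a competing strong solution carries an integral process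
  known only through some approximating operators, so it can be compared with the constructed one
  only through its real components.\<close>

lemma parallelogram_law:
  fixes x y :: "'a::real_inner"
  shows "(norm (x + y))\<^sup>2 + (norm (x - y))\<^sup>2 = 2 * (norm x)\<^sup>2 + 2 * (norm y)\<^sup>2"
  by (simp add: power2_norm_eq_inner inner_add_left inner_add_right inner_diff_left inner_diff_right)

text \<open>The minimiser of \<open>J x = (norm x)\<^sup>2 - 2 * f x\<close> represents
  \<open>f\<close>: the parallelogram law makes a minimising sequence Cauchy, and completeness
  provides the limit. This is what guarantees that adjoints exist.\<close>

lemma riesz_representation:
  fixes f :: "'a::{real_inner, banach} \<Rightarrow> real"
  assumes "bounded_linear f"
  obtains z where "\<And>x. f x = x \<bullet> z"
proof -
  interpret f: bounded_linear f by fact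
  define J where "J x = (norm x)\<^sup>2 - 2 * f x" for x
  obtain K where K: "\<And>x. norm (f x) \<le> norm x * K" and K0: "K > 0"
    using f.pos_bounded by blast
  have lower: "J x \<ge> - K\<^sup>2" for x
  proof -
    have "f x \<le> norm x * K" using K[of x] by simp
    moreover have "(norm x - K)\<^sup>2 \<ge> 0" by simp
    ultimately show ?thesis unfolding J_def by (simp add: power2_diff)
  qed
  define m where "m = Inf (range J)"
  have bdd: "bdd_below (range J)" using lower by (auto intro: bdd_belowI[where m = "- K\<^sup>2"])
  have m_le: "m \<le> J x" for x unfolding m_def using bdd by (simp add: cInf_lower)
  have "\<exists>x. J x < m + inverse (real (Suc n))" for n
  proof -
    have "\<exists>y\<in>range J. y < m + inverse (real (Suc n))"
      by (rule cInf_lessD) (auto simp: m_def)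
    then show ?thesis by auto
  qed
  then obtain x where x: "\<And>n. J (x n) < m + inverse (real (Suc n))" by metis
  \<comment> \<open>The midpoint of two almost minimisers cannot fall below \<open>m\<close>; the
    parallelogram law turns this into a bound on their distance.\<close>
  have diff: "(norm (x i - x j))\<^sup>2 \<le> 2 * inverse (real (Suc i)) + 2 * inverse (real (Suc j))" for i j
  proof -
    have h: "J ((1/2) *\<^sub>R (a + b)) = (norm (a + b))\<^sup>2 / 4 - f a - f b" for a b
      by (simp add: J_def f.scaleR f.add power2_eq_square, simp add: field_simps)
    have "4 * m \<le> 4 * J ((1/2) *\<^sub>R (x i + x j))" using m_le by simp
    also have "\<dots> = (norm (x i + x j))\<^sup>2 - 4 * f (x i) - 4 * f (x j)"
      by (simp add: h)
    also have "\<dots> = 2 * J (x i) + 2 * J (x j) - (norm (x i - x j))\<^sup>2"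
      using parallelogram_law[of "x i" "x j"] by (simp add: J_def)
    finally show ?thesis using x[of i] x[of j] by simp
  qed
  have "Cauchy x"
  proof (rule metric_CauchyI)
    fix e :: real assume e: "e > 0"
    obtain N where N: "inverse (real (Suc N)) < e\<^sup>2 / 4"
      using reals_Archimedean[of "e\<^sup>2/4"] e by auto
    have "dist (x i) (x j) < e" if "i \<ge> N" "j \<ge> N" for i j
    proof -
      have "inverse (real (Suc i)) \<le> inverse (real (Suc N))" "inverse (real (Suc j)) \<le> inverse (real (Suc N))"
        using that by (auto intro!: le_imp_inverse_le)
      then have "(norm (x i - x j))\<^sup>2 < e\<^sup>2" using diff[of i j] N by linarith
      then show ?thesis using e by (simp add: dist_norm power2_less_imp_less)
    qed
    then show "\<exists>N. \<forall>i\<ge>N. \<forall>j\<ge>N. dist (x i) (x j) < e" by blast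
  qed
  then obtain z where z: "x \<longlonglongrightarrow> z" using Cauchy_convergent convergent_def by blast
  have "(\<lambda>n. J (x n)) \<longlonglongrightarrow> J z"
    unfolding J_def by (intro tendsto_intros z f.tendsto)
  moreover have "(\<lambda>n. m + inverse (real (Suc n))) \<longlonglongrightarrow> m + 0"
    by (intro tendsto_intros LIMSEQ_inverse_real_of_nat)
  ultimately have "J z \<le> m + 0"
    using x by (intro LIMSEQ_le[of "\<lambda>n. J (x n)" _ "\<lambda>n. m + inverse (real (Suc n))"]) (auto intro!: less_imp_le)
  then have zmin: "J z \<le> J y" for y using m_le[of y] by simp
  have "f y = y \<bullet> z" for y
  proof (cases "y = 0")
    case True then show ?thesis by (simp add: f.zero)
  next
    case False
    define a where "a = y \<bullet> z - f y"
      have "(norm (z + t *\<^sub>R y))\<^sup>2 = (norm z)\<^sup>2 + 2 * t * (y \<bullet> z) + t\<^sup>2 * (norm y)\<^sup>2" for t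
      unfolding power2_norm_eq_inner power2_eq_square[of t]
      by (simp add: inner_add_left inner_add_right inner_commute[of z y] algebra_simps)
    then have J: "J (z + t *\<^sub>R y) = J z + 2 * t * a + t\<^sup>2 * (norm y)\<^sup>2" for t
      unfolding J_def a_def by (simp add: f.add f.scaleR algebra_simps)
    define q where "q = (norm y)\<^sup>2"
    have n: "q > 0" using False by (simp add: q_def)
    have "0 \<le> 2 * t * a + t\<^sup>2 * q" for t using zmin[of "z + t *\<^sub>R y"] unfolding J q_def by simp
    \<comment> \<open>The minimum of the quadratic in \<open>t\<close>; it is negative unless
      \<open>a = 0\<close>.\<close>
    from this[of "- a / q"] have "0 \<le> - (a\<^sup>2 / q)"
      using n by (simp add: power2_eq_square field_simps)
    then have "a\<^sup>2 / q \<le> 0" by linarith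
    then have "a = 0" using n by (simp add: divide_le_0_iff)
    then show ?thesis by (simp add: a_def)
  qed
  then show thesis using that by blast
qed

text \<open>\<open>adjoint\<close> is a choice, meaningful only once some adjoint exists; the Riesz
  representation provides one.\<close>

lemma adjoint_inner:
  fixes f :: "'a::{real_inner, banach} \<Rightarrow> 'b::real_inner"
  assumes "bounded_linear f"
  shows "f x \<bullet> y = x \<bullet> adjoint f y"
proof -
  have "\<exists>z. \<forall>x. f x \<bullet> y = x \<bullet> z" for y
    using riesz_representation[OF bounded_linear_compose[OF bounded_linear_inner_left[of y] assms]]
    by metis
  then obtain g where "\<forall>x y. f x \<bullet> y = x \<bullet> g y" by metis
  moreover from this have "adjoint f = g" by (rule adjoint_unique)
  ultimately show ?thesis by simp
qed

lemma orthonormal_finite_basis: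
  fixes V :: "'a::real_inner set"
  assumes "finite_dimensional V"
  obtains B where "finite B" "orthonormal B" "span B = V"
proof -
  obtain B0 where B0: "finite B0" "V = span B0"
    using assms unfolding finite_dimensional_def by blast
  obtain C where C: "finite C" "span C = span B0" "pairwise orthogonal C"
    using basis_orthogonal[OF B0(1)] by blast
  \<comment> \<open>Orthogonalisation may produce the zero vector, which cannot be normalised and
    does not change the span.\<close>
  define B where "B = (\<lambda>x. x /\<^sub>R norm x) ` (C - {0})"
  have "orthonormal B"
    using C(3) unfolding orthonormal_def B_def pairwise_def orthogonal_def by auto
  moreover have "span B = V"
  proof -
    have "span B = span (C - {0})"
      unfolding B_def using C(1) by (intro span_image_scale) auto
    then show ?thesis using C(2) B0(2) by simp
  qed
  ultimately show thesis using that[of B] C(1) unfolding B_def by simp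
qed

lemma orthonormal_inner:
  assumes "orthonormal B" "x \<in> B" "y \<in> B"
  shows "x \<bullet> y = (if x = y then 1 else 0)"
  using assms unfolding orthonormal_def pairwise_def orthogonal_def by (auto simp: norm_eq_1)

lemma bessel_inequality:
  assumes "finite B" "orthonormal B"
  shows "(\<Sum>e\<in>B. (x \<bullet> e)\<^sup>2) \<le> (norm x)\<^sup>2"
proof -
  define y where "y = (\<Sum>e\<in>B. (x \<bullet> e) *\<^sub>R e)"
  have xy: "x \<bullet> y = (\<Sum>e\<in>B. (x \<bullet> e)\<^sup>2)"
    by (simp add: y_def inner_sum_right power2_eq_square)
  have "y \<bullet> y = (\<Sum>e\<in>B. (x \<bullet> e) * (e \<bullet> y))" by (simp add: y_def inner_sum_left)
  also have "\<dots> = (\<Sum>e\<in>B. (x \<bullet> e)\<^sup>2)"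
  proof (rule sum.cong[OF refl])
    fix e assume e: "e \<in> B"
    have "e \<bullet> y = (\<Sum>e'\<in>B. (x \<bullet> e') * (if e' = e then 1 else 0))"
      unfolding y_def inner_sum_right
      by (intro sum.cong) (auto simp: orthonormal_inner[OF assms(2) e])
    also have "\<dots> = x \<bullet> e" using e assms(1) by (simp add: if_distrib sum.delta cong: if_cong)
    finally show "(x \<bullet> e) * (e \<bullet> y) = (x \<bullet> e)\<^sup>2" by (simp add: power2_eq_square)
  qed
  finally have yy: "y \<bullet> y = (\<Sum>e\<in>B. (x \<bullet> e)\<^sup>2)" .
  have "0 \<le> (x - y) \<bullet> (x - y)" by simp
  also have "\<dots> = (norm x)\<^sup>2 - (\<Sum>e\<in>B. (x \<bullet> e)\<^sup>2)"
    using xy yy by (simp add: inner_diff_left inner_diff_right power2_norm_eq_inner inner_commute)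
  finally show ?thesis by simp
qed

text \<open>Replaces the definite description by a finite sum; uniqueness holds because
  \<open>V\<close> meets its orthogonal complement only in zero. Through this formula the diffusion
  acts by finitely many real coefficients.\<close>

lemma orth_proj_expand:
  assumes "finite B" "orthonormal B" "span B = V"
  shows "orth_proj V u = (\<Sum>e\<in>B. (u \<bullet> e) *\<^sub>R e)"
  unfolding orth_proj_def
proof (rule the_equality)
  let ?p = "\<Sum>e\<in>B. (u \<bullet> e) *\<^sub>R e"
  have "?p \<in> V" unfolding assms(3)[symmetric] by (intro span_sum span_scale span_base)
  moreover have e0: "e \<bullet> (u - ?p) = 0" if e: "e \<in> B" for e
  proof -
    have "e \<bullet> ?p = (\<Sum>e'\<in>B. (u \<bullet> e') * (if e' = e then 1 else 0))"
      unfolding inner_sum_right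
      by (intro sum.cong) (auto simp: orthonormal_inner[OF assms(2) e])
    also have "\<dots> = u \<bullet> e" using e assms(1) by (simp add: if_distrib sum.delta cong: if_cong)
    finally show ?thesis by (simp add: inner_diff_right inner_commute)
  qed
  have "orthogonal (u - ?p) y" if "y \<in> V" for y
  proof (rule orthogonal_to_span)
    show "y \<in> span B" using that assms(3) by simp
    show "orthogonal (u - ?p) e" if "e \<in> B" for e
      using e0[OF that] by (simp add: orthogonal_def inner_commute)
  qed
  ultimately show p: "?p \<in> V \<and> u - ?p \<in> V\<^sup>\<bottom>"
    unfolding orthogonal_comp_def by (auto simp: orthogonal_commute)
  fix v assume v: "v \<in> V \<and> u - v \<in> V\<^sup>\<bottom>"
  have V: "v - ?p \<in> V" using v p assms(3) by (metis span_diff)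
  have "v - ?p = (u - ?p) - (u - v)" by simp
  then have "v - ?p \<in> V\<^sup>\<bottom>" using v p subspace_orthogonal_comp[of V] by (metis subspace_diff)
  then have "orthogonal (v - ?p) (v - ?p)" using V by (simp add: orthogonal_comp_def)
  then show "v = ?p" by (simp add: orthogonal_self)
qed

text \<open>For \<open>a \<le> b\<close> factor out \<open>exp (- a) \<le> 1\<close> and use
  \<open>1 - exp (- u) \<le> u\<close>.\<close>

lemma finite_Lipschitz_exp_neg:
  fixes a b :: real
  assumes "a \<ge> 0" "b \<ge> 0"
  shows "\<bar>exp (- a) - exp (- b)\<bar> \<le> \<bar>a - b\<bar>"
proof -
  have *: "exp (- a) - exp (- b) \<le> b - a" if "a \<le> b" "a \<ge> 0" for a b :: real
  proof -
    have "1 - (b - a) \<le> exp (- (b - a))" using exp_ge_add_one_self[of "- (b - a)"] by linarith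
    then have "1 - exp (- (b - a)) \<le> b - a" by simp
    moreover have "exp (- a) - exp (- b) = exp (- a) * (1 - exp (- (b - a)))"
      by (simp add: algebra_simps flip: exp_add)
    moreover have "exp (- a) \<le> 1" using that by simp
    moreover have "1 - exp (- (b - a)) \<ge> 0" using that by simp
    ultimately show ?thesis
      by (metis (no_types, lifting) mult_left_le_one_le exp_ge_zero order_trans)
  qed
  show ?thesis
    using *[of a b] *[of b a] assms by (cases "a \<le> b") (auto simp: abs_if)
qed

subsection \<open>The consensus drift\<close>

lemma norm_vec_le_sum: "norm (x :: 'a::real_normed_vector ^ 'n) \<le> (\<Sum>i\<in>UNIV. norm (x $ i))"
  unfolding norm_vec_def by (simp add: L2_set_le_sum)

context
  fixes \<alpha> :: real and E :: "'h::real_inner \<Rightarrow> real"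
  assumes \<alpha>: "\<alpha> > 0" and E: "admissible_objective E"
begin

lemma objective_nonneg: "E x \<ge> 0"
proof -
  have "(INF x. ereal (E x)) \<ge> 0" using E unfolding admissible_objective_def by blast
  also have "(INF x. ereal (E x)) \<le> ereal (E x)" by (rule INF_lower) simp
  finally show ?thesis by simp
qed

lemma weight_pos: "weight \<alpha> E x > 0" by (simp add: weight_def)

lemma weight_le_1: "weight \<alpha> E x \<le> 1"
  using objective_nonneg[of x] \<alpha> by (simp add: weight_def)

text \<open>The growth condition bounds the objective from above on a ball, so the weights stay away
  from zero there. The local Lipschitz condition passes to the weights because the exponential is
  1-Lipschitz on the negative half-line.\<close>

lemma weight_local_bounds:
  assumes "R \<ge> 0"
  obtains w L where "w > 0" "L \<ge> 0" "\<And>x. norm x \<le> R \<Longrightarrow> weight \<alpha> E x \<ge> w"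
    "\<And>x y. norm x \<le> R \<Longrightarrow> norm y \<le> R \<Longrightarrow> \<bar>weight \<alpha> E x - weight \<alpha> E y\<bar> \<le> L * norm (x - y)"
proof -
  from E obtain p C L where p: "p \<ge> 1" "C > 0" "L > 0"
    and C: "\<And>x. E x \<le> C * (1 + norm x powr p)"
    and L: "\<And>x y. \<bar>E x - E y\<bar> \<le> L * (1 + norm x powr (p - 1) + norm y powr (p - 1)) * norm (x - y)"
    unfolding admissible_objective_def by blast
  let ?w = "exp (- \<alpha> * (C * (1 + R powr p)))"
  let ?L = "\<alpha> * (L * (1 + R powr (p - 1) + R powr (p - 1)))"
  show thesis
  proof (rule that[of ?w ?L])
    show "?w > 0" by simp
    show "?L \<ge> 0" using \<alpha> p by simp
    fix x :: 'h assume x: "norm x \<le> R"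
    have "E x \<le> C * (1 + R powr p)"
      by (rule order_trans[OF C]) (use x p in \<open>auto intro!: powr_mono2\<close>)
    then show "weight \<alpha> E x \<ge> ?w" using \<alpha> by (simp add: weight_def)
    fix y :: 'h assume y: "norm y \<le> R"
    have "\<bar>weight \<alpha> E x - weight \<alpha> E y\<bar> \<le> \<bar>\<alpha> * E x - \<alpha> * E y\<bar>"
      using finite_Lipschitz_exp_neg[of "\<alpha> * E x" "\<alpha> * E y"] \<alpha> objective_nonneg by (simp add: weight_def)
    also have "\<dots> = \<alpha> * \<bar>E x - E y\<bar>" using \<alpha> by (simp add: abs_mult flip: right_diff_distrib)
    also have "\<dots> \<le> \<alpha> * (L * (1 + norm x powr (p - 1) + norm y powr (p - 1)) * norm (x - y))"
      using L \<alpha> by (intro mult_left_mono) auto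
    \<comment> \<open>The power is monotone for \<open>p = 1\<close> as well: the convention
      \<open>0 powr 0 = 0\<close> only makes the value at zero smaller.\<close>
    also have "\<dots> \<le> \<alpha> * (L * (1 + R powr (p - 1) + R powr (p - 1)) * norm (x - y))"
      using \<alpha> p x y
      by (intro mult_left_mono mult_right_mono add_mono powr_mono2) auto
    finally show "\<bar>weight \<alpha> E x - weight \<alpha> E y\<bar> \<le> ?L * norm (x - y)" by (simp add: algebra_simps)
  qed
qed

definition consensus_point :: "'h ^ 'n \<Rightarrow> 'h" where
  "consensus_point X = (\<Sum>j\<in>UNIV. weight \<alpha> E (X $ j) *\<^sub>R (X $ j)) /\<^sub>R (\<Sum>k\<in>UNIV. weight \<alpha> E (X $ k))"

lemma weight_sum_pos: "(\<Sum>k\<in>UNIV. weight \<alpha> E ((X :: 'h ^ 'n) $ k)) > 0"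
  using weight_pos by (intro sum_pos) auto

text \<open>A convex combination of the particles: the constant is 1 whatever the weights are. This
  is the source of the global linear growth.\<close>

lemma norm_consensus_point_le: "norm (consensus_point (X :: 'h ^ 'n)) \<le> norm X"
proof -
  let ?S = "\<Sum>k\<in>UNIV. weight \<alpha> E (X $ k)"
  have "norm (\<Sum>j\<in>UNIV. weight \<alpha> E (X $ j) *\<^sub>R (X $ j)) \<le> (\<Sum>j\<in>UNIV. weight \<alpha> E (X $ j) * norm X)"
    by (rule sum_norm_le) (auto simp: weight_pos less_imp_le abs_of_pos Finite_Cartesian_Product.norm_nth_le intro!: mult_left_mono)
  also have "\<dots> = ?S * norm X" by (simp add: sum_distrib_right)
  finally show ?thesis
    using weight_sum_pos[of X] by (simp add: consensus_point_def divide_simps abs_of_pos mult.commute)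
qed

lemma consensus_drift_nth: "consensus_drift \<alpha> E X $ i = X $ i - consensus_point X"
  by (simp add: consensus_drift_def consensus_point_def)

lemma norm_consensus_drift_nth_le: "norm (consensus_drift \<alpha> E (X :: 'h ^ 'n) $ i) \<le> 2 * norm X"
  unfolding consensus_drift_nth
  using norm_triangle_ineq4[of "X $ i" "consensus_point X"] norm_consensus_point_le[of X] Finite_Cartesian_Product.norm_nth_le[of X i]
  by linarith

text \<open>Instead of a difference of quotients, the difference multiplied by the total weight
  \<open>S X\<close> is estimated: it equals
  \<open>(T X - T Y) - (S X - S Y) *\<^sub>R consensus_point Y\<close>. The two parts cost
  \<open>1 + L * R\<close> and \<open>L * R\<close> per particle, and \<open>S X\<close> is at least
  \<open>w\<close>, being a sum of positive terms one of which already is.\<close>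

lemma consensus_point_local_Lipschitz:
  assumes "R \<ge> 0"
  obtains L where "L \<ge> 0" "\<And>X Y :: 'h ^ 'n. norm X \<le> R \<Longrightarrow> norm Y \<le> R \<Longrightarrow>
     norm (consensus_point X - consensus_point Y) \<le> L * norm (X - Y)"
proof -
  obtain w L where w: "w > 0" "L \<ge> 0" "\<And>x. norm x \<le> R \<Longrightarrow> weight \<alpha> E x \<ge> w"
    "\<And>x y. norm x \<le> R \<Longrightarrow> norm y \<le> R \<Longrightarrow> \<bar>weight \<alpha> E x - weight \<alpha> E y\<bar> \<le> L * norm (x - y)"
    using weight_local_bounds[OF assms] by blast
  let ?N = "real CARD('n)"
  let ?L = "?N * (1 + 2 * L * R) / w"
  show thesis
  proof (rule that[of ?L])
    show "?L \<ge> 0" using w assms by simp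
    fix X Y :: "'h ^ 'n" assume X: "norm X \<le> R" and Y: "norm Y \<le> R"
    have Xi: "norm (X $ i) \<le> R" and Yi: "norm (Y $ i) \<le> R" for i
      by (rule order_trans[OF Finite_Cartesian_Product.norm_nth_le X], rule order_trans[OF Finite_Cartesian_Product.norm_nth_le Y])
    have D: "\<bar>weight \<alpha> E (X $ i) - weight \<alpha> E (Y $ i)\<bar> \<le> L * norm (X - Y)" for i
      by (rule order_trans[OF w(4)[OF Xi Yi]])
        (metis mult_left_mono Finite_Cartesian_Product.norm_nth_le vector_minus_component w(2))
    define S where "S Z = (\<Sum>k\<in>UNIV. weight \<alpha> E (Z $ k))" for Z :: "'h ^ 'n"
    define T where "T Z = (\<Sum>j\<in>UNIV. weight \<alpha> E (Z $ j) *\<^sub>R (Z $ j))" for Z :: "'h ^ 'n"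
    have S0: "S Z > 0" for Z unfolding S_def by (rule weight_sum_pos)
    have T: "T Z = S Z *\<^sub>R consensus_point Z" for Z
      using S0[of Z] by (simp add: consensus_point_def S_def T_def)
    have "S X *\<^sub>R (consensus_point X - consensus_point Y) = (T X - T Y) - (S X - S Y) *\<^sub>R consensus_point Y"
      by (simp add: T algebra_simps)
    then have "S X * norm (consensus_point X - consensus_point Y) = norm ((T X - T Y) - (S X - S Y) *\<^sub>R consensus_point Y)"
      using S0[of X] by (metis abs_of_pos norm_scaleR)
    also have "\<dots> \<le> norm (T X - T Y) + \<bar>S X - S Y\<bar> * norm (consensus_point Y)"
      by (metis norm_scaleR norm_triangle_ineq4)
    also have "norm (T X - T Y) \<le> ?N * ((1 + L * R) * norm (X - Y))"
    proof -
      have "T X - T Y = (\<Sum>j\<in>UNIV. weight \<alpha> E (X $ j) *\<^sub>R (X $ j - Y $ j)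
          + (weight \<alpha> E (X $ j) - weight \<alpha> E (Y $ j)) *\<^sub>R (Y $ j))"
        by (simp add: T_def algebra_simps flip: sum_subtractf)
      also have "norm \<dots> \<le> (\<Sum>j\<in>(UNIV::'n set). (1 + L * R) * norm (X - Y))"
      proof (rule sum_norm_le)
        fix j :: 'n assume "j \<in> UNIV"
        have "norm (weight \<alpha> E (X $ j) *\<^sub>R (X $ j - Y $ j)) \<le> 1 * norm (X - Y)"
          unfolding norm_scaleR
          by (intro mult_mono) (use weight_pos[of "X $ j"] weight_le_1[of "X $ j"] Finite_Cartesian_Product.norm_nth_le[of "X - Y" j] in auto)
        moreover have "norm ((weight \<alpha> E (X $ j) - weight \<alpha> E (Y $ j)) *\<^sub>R (Y $ j)) \<le> (L * norm (X - Y)) * R"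
          unfolding norm_scaleR by (intro mult_mono D Yi) (use w(2) in auto)
        ultimately have "norm (weight \<alpha> E (X $ j) *\<^sub>R (X $ j - Y $ j)
          + (weight \<alpha> E (X $ j) - weight \<alpha> E (Y $ j)) *\<^sub>R (Y $ j)) \<le> 1 * norm (X - Y) + (L * norm (X - Y)) * R"
          by (intro norm_triangle_le add_mono)
        also have "\<dots> = (1 + L * R) * norm (X - Y)" by (simp add: algebra_simps)
        finally show "norm (weight \<alpha> E (X $ j) *\<^sub>R (X $ j - Y $ j)
          + (weight \<alpha> E (X $ j) - weight \<alpha> E (Y $ j)) *\<^sub>R (Y $ j)) \<le> (1 + L * R) * norm (X - Y)" .
      qed
      finally show ?thesis by simp
    qed
    also have "\<bar>S X - S Y\<bar> * norm (consensus_point Y) \<le> (?N * (L * norm (X - Y))) * R"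
    proof (rule mult_mono)
      have "\<bar>S X - S Y\<bar> = \<bar>\<Sum>j\<in>UNIV. weight \<alpha> E (X $ j) - weight \<alpha> E (Y $ j)\<bar>"
        by (simp add: S_def sum_subtractf)
      also have "\<dots> \<le> (\<Sum>j\<in>(UNIV::'n set). L * norm (X - Y))"
        by (rule order_trans[OF sum_abs]) (intro sum_mono D)
      finally show "\<bar>S X - S Y\<bar> \<le> ?N * (L * norm (X - Y))" by simp
      show "norm (consensus_point Y) \<le> R" using norm_consensus_point_le[of Y] Y by simp
    qed (use w assms in auto)
    finally have 1: "S X * norm (consensus_point X - consensus_point Y) \<le> ?N * (1 + 2 * L * R) * norm (X - Y)"
      by (simp add: algebra_simps)
    have "w \<le> S X"
    proof -
      obtain i :: 'n where True by blast
      have "w \<le> weight \<alpha> E (X $ i)" using w(3) Xi by blast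
      also have "\<dots> \<le> S X" unfolding S_def
        by (rule member_le_sum) (auto simp: less_imp_le weight_pos)
      finally show ?thesis .
    qed
    then have "w * norm (consensus_point X - consensus_point Y) \<le> S X * norm (consensus_point X - consensus_point Y)"
      by (intro mult_right_mono) auto
    with 1 show "norm (consensus_point X - consensus_point Y) \<le> ?L * norm (X - Y)"
      using w(1) by (simp add: field_simps)
  qed
qed

lemma consensus_drift_local_Lipschitz:
  assumes "R \<ge> 0"
  obtains L where "L \<ge> 0" "\<And>(X :: 'h ^ 'n) Y i. norm X \<le> R \<Longrightarrow> norm Y \<le> R \<Longrightarrow>
     norm (consensus_drift \<alpha> E X $ i - consensus_drift \<alpha> E Y $ i) \<le> L * norm (X - Y)"
proof -
  obtain L where L: "L \<ge> 0" "\<And>X Y :: 'h ^ 'n. norm X \<le> R \<Longrightarrow> norm Y \<le> R \<Longrightarrow>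
     norm (consensus_point X - consensus_point Y) \<le> L * norm (X - Y)"
    using consensus_point_local_Lipschitz[OF assms] by blast
  show thesis
  proof (rule that[of "1 + L"])
    fix X Y :: "'h ^ 'n" and i assume XY: "norm X \<le> R" "norm Y \<le> R"
    have "consensus_drift \<alpha> E X $ i - consensus_drift \<alpha> E Y $ i
      = (X - Y) $ i - (consensus_point X - consensus_point Y)"
      by (simp add: consensus_drift_nth)
    also have "norm \<dots> \<le> norm (X - Y) + L * norm (X - Y)"
      using norm_triangle_ineq4[of "(X - Y) $ i" "consensus_point X - consensus_point Y"]
        L(2)[OF XY] Finite_Cartesian_Product.norm_nth_le[of "X - Y" i] by linarith
    finally show "norm (consensus_drift \<alpha> E X $ i - consensus_drift \<alpha> E Y $ i) \<le> (1 + L) * norm (X - Y)"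
      by (simp add: algebra_simps)
  qed (use L in auto)
qed

end

subsection \<open>Radial truncation\<close>

text \<open>For \<open>R > 0\<close> the radial retraction onto the closed ball of radius
  \<open>R\<close>; the maximum merges the two cases and keeps the denominator positive.\<close>

definition trunc :: "real \<Rightarrow> 'a::real_normed_vector \<Rightarrow> 'a" where
  "trunc R x = (R / max R (norm x)) *\<^sub>R x"

lemma norm_trunc_le:
  assumes "R > 0" shows "norm (trunc R x) \<le> R" "norm (trunc R x) \<le> norm x"
proof -
  have m: "max R (norm x) > 0" using assms by simp
  have n: "norm (trunc R x) = R * norm x / max R (norm x)" using assms by (simp add: trunc_def)
  have "R * norm x \<le> R * max R (norm x)" using assms by (intro mult_left_mono) auto
  then show "norm (trunc R x) \<le> R" unfolding n using m by (simp only: pos_divide_le_eq)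
  have "R * norm x \<le> max R (norm x) * norm x" by (intro mult_right_mono) auto
  then show "norm (trunc R x) \<le> norm x" unfolding n using m by (simp only: pos_divide_le_eq mult.commute)
qed

lemma trunc_ident: "R > 0 \<Longrightarrow> norm x \<le> R \<Longrightarrow> trunc R x = x"
  by (simp add: trunc_def max_absorb1)

text \<open>The constant 2 is valid in every normed space: one part comes from moving the point at
  fixed scale, the other from the change of scale.\<close>

lemma trunc_Lipschitz:
  assumes R: "R > 0" shows "norm (trunc R x - trunc R y) \<le> 2 * norm (x - y)"
proof -
  define a where "a = max R (norm x)" define b where "b = max R (norm y)"
  have ab: "a \<ge> R" "b \<ge> R" "b \<ge> norm y" "\<bar>a - b\<bar> \<le> \<bar>norm x - norm y\<bar>" "a > 0" "b > 0"
    using R unfolding a_def b_def by auto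
  have "trunc R x - trunc R y = (R / a) *\<^sub>R (x - y) + (R / a - R / b) *\<^sub>R y"
    by (simp add: trunc_def a_def b_def algebra_simps)
  then have "norm (trunc R x - trunc R y) \<le> norm ((R / a) *\<^sub>R (x - y)) + norm ((R / a - R / b) *\<^sub>R y)"
    by (metis norm_triangle_ineq)
  also have "norm ((R / a) *\<^sub>R (x - y)) \<le> 1 * norm (x - y)"
    unfolding norm_scaleR using ab R by (intro mult_right_mono) auto
  also have "norm ((R / a - R / b) *\<^sub>R y) \<le> norm (x - y)"
  proof -
    have "R / a - R / b = (R / a) * (b - a) / b" using ab by (simp add: field_simps)
    then have "norm ((R / a - R / b) *\<^sub>R y) = (R / a) * \<bar>a - b\<bar> * (norm y / b)"
      using ab R by (simp add: abs_mult abs_minus_commute)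
    also have "\<dots> \<le> 1 * \<bar>a - b\<bar> * 1"
      using ab R by (intro mult_mono) auto
    also have "\<dots> \<le> norm (x - y)" using order_trans[OF ab(4) norm_triangle_ineq3[of x y]] by simp
    finally show ?thesis .
  qed
  finally show ?thesis by simp
qed

subsection \<open>Calculus lemmas\<close>

text \<open>Rounding \<open>t\<close> down to the grid of mesh \<open>T / n\<close>. Every time is
  thus a limit of grid points, so a continuous path is controlled by countably many of its
  values.\<close>

lemma grid_seq:
  fixes t T :: real
  assumes "0 \<le> t" "t \<le> T"
  obtains k :: "nat \<Rightarrow> nat" where "\<And>n. k n \<le> n" "(\<lambda>n. T * real (k n) / real n) \<longlonglongrightarrow> t"
proof (cases "T = 0")
  case True
  then show ?thesis using assms that[of "\<lambda>_. 0"] by simp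
next
  case False
  then have T: "T > 0" using assms by simp
  define k where "k n = nat \<lfloor>real n * (t / T)\<rfloor>" for n
  have k1: "real (k n) \<le> real n * (t / T)" and k2: "real n * (t / T) < real (k n) + 1" for n
    using assms T by (auto simp: k_def)
  have "real n * (t / T) \<le> real n * 1" for n
    using assms T by (intro mult_left_mono) auto
  with k1 have kn: "k n \<le> n" for n by (metis mult.right_neutral of_nat_le_iff order_trans)
  have b: "\<bar>T * real (k n) / real n - t\<bar> \<le> T / real n" if n: "n > 0" for n
  proof -
    have "T * real (k n) / n \<le> T * (n * (t / T)) / n"
      using k1[of n] T by (intro divide_right_mono mult_left_mono) auto
    moreover have "T * (n * (t / T)) / n \<le> T * (real (k n) + 1) / n"
      using k2[of n] T by (intro divide_right_mono mult_left_mono) auto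
    moreover have "T * (n * (t / T)) / n = t" using T n by simp
    ultimately show ?thesis by (simp add: field_simps add_divide_distrib)
  qed
  have "(\<lambda>n. T * real (k n) / real n) \<longlonglongrightarrow> t"
  proof (rule LIM_zero_cancel, rule Lim_null_comparison)
    show "(\<lambda>n. T / real n) \<longlonglongrightarrow> 0" by (rule lim_const_over_n)
    show "\<forall>\<^sub>F n in sequentially. norm (T * real (k n) / real n - t) \<le> T / real n"
      using eventually_gt_at_top[of 0] by eventually_elim (simp only: real_norm_def, rule b)
  qed
  then show ?thesis using kn that by blast
qed

text \<open>For \<open>n = 0\<close> the quotient is zero by the convention for division and still
  lies in the interval.\<close>

lemma grid_in_Icc: "0 \<le> T \<Longrightarrow> k \<le> n \<Longrightarrow> T * real k / real n \<in> {0..T}"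
  by (cases "n = 0") (auto simp: field_simps mult_left_mono)

lemma sq_cont_tendsto:
  fixes x :: "real \<Rightarrow> 'a::real_normed_vector"
  assumes "continuous_on {0..T} x" "t \<in> {0..T}" "\<And>n. s n \<in> {0..T}" "s \<longlonglongrightarrow> t"
  shows "(\<lambda>n. ennreal ((norm (x (s n)))\<^sup>2)) \<longlonglongrightarrow> ennreal ((norm (x t))\<^sup>2)"
proof -
  have "(\<lambda>n. x (s n)) \<longlonglongrightarrow> x t"
    by (rule continuous_on_tendsto_compose[OF assms(1) assms(4)]) (use assms in auto)
  then show ?thesis by (intro tendsto_ennrealI tendsto_intros)
qed

text \<open>The first form gives measurability of the supremum. The second is meant for Fatou's
  lemma: the grids for successive \<open>n\<close> are not nested, so the maxima over them need not
  increase.\<close>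

lemma sup_sq_grid:
  fixes x :: "real \<Rightarrow> 'a::real_normed_vector"
  assumes c: "continuous_on {0..T} x" and T: "0 \<le> T"
  shows "(SUP t\<in>{0..T}. ennreal ((norm (x t))\<^sup>2)) = (SUP n. SUP k\<in>{..n}. ennreal ((norm (x (T * real k / real n)))\<^sup>2))"
    and "(SUP t\<in>{0..T}. ennreal ((norm (x t))\<^sup>2)) \<le> liminf (\<lambda>n. SUP k\<in>{..n}. ennreal ((norm (x (T * real k / real n)))\<^sup>2))"
proof -
  let ?f = "\<lambda>t. ennreal ((norm (x t))\<^sup>2)"
  have lim: "\<exists>k. (\<forall>n. k n \<le> n) \<and> (\<lambda>n. ?f (T * real (k n) / real n)) \<longlonglongrightarrow> ?f t" if t: "t \<in> {0..T}" for t
  proof -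
    obtain k :: "nat \<Rightarrow> nat" where k: "\<And>n. k n \<le> n" "(\<lambda>n. T * real (k n) / real n) \<longlonglongrightarrow> t"
      using grid_seq[of t T] t by auto
    show ?thesis
      by (intro exI[of _ k] conjI allI k sq_cont_tendsto[OF c t]) (use grid_in_Icc T k in auto)
  qed
  show "(SUP t\<in>{0..T}. ?f t) = (SUP n. SUP k\<in>{..n}. ?f (T * real k / real n))"
  proof (rule antisym)
    show "(SUP t\<in>{0..T}. ?f t) \<le> (SUP n. SUP k\<in>{..n}. ?f (T * real k / real n))"
    proof (rule SUP_least)
      fix t assume "t \<in> {0..T}"
      then obtain k where k: "\<And>n. k n \<le> n" "(\<lambda>n. ?f (T * real (k n) / real n)) \<longlonglongrightarrow> ?f t"
        using lim by blast
      show "?f t \<le> (SUP n. SUP k\<in>{..n}. ?f (T * real k / real n))"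
      proof (rule LIMSEQ_le_const2[OF k(2)], intro exI[of _ 0] allI impI)
        fix n
        have "?f (T * real (k n) / real n) \<le> (SUP k\<in>{..n}. ?f (T * real k / real n))"
          by (rule SUP_upper) (use k in auto)
        also have "\<dots> \<le> (SUP n. SUP k\<in>{..n}. ?f (T * real k / real n))" by (rule SUP_upper) simp
        finally show "?f (T * real (k n) / real n) \<le> (SUP n. SUP k\<in>{..n}. ?f (T * real k / real n))" .
      qed
    qed
    show "(SUP n. SUP k\<in>{..n}. ?f (T * real k / real n)) \<le> (SUP t\<in>{0..T}. ?f t)"
      by (intro SUP_least SUP_upper) (use grid_in_Icc T in auto)
  qed
  show "(SUP t\<in>{0..T}. ?f t) \<le> liminf (\<lambda>n. SUP k\<in>{..n}. ?f (T * real k / real n))"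
  proof (rule SUP_least)
    fix t assume "t \<in> {0..T}"
    then obtain k where k: "\<And>n. k n \<le> n" "(\<lambda>n. ?f (T * real (k n) / real n)) \<longlonglongrightarrow> ?f t"
      using lim by blast
    have "?f t = liminf (\<lambda>n. ?f (T * real (k n) / real n))"
      using lim_imp_Liminf[OF _ k(2)] by simp
    also have "\<dots> \<le> liminf (\<lambda>n. SUP k\<in>{..n}. ?f (T * real k / real n))"
      by (intro Liminf_mono always_eventually allI SUP_upper) (use k in auto)
    finally show "?f t \<le> liminf (\<lambda>n. SUP k\<in>{..n}. ?f (T * real k / real n))" .
  qed
qed

lemma continuous_on_atLeast_iff:
  fixes f :: "real \<Rightarrow> 'a::topological_space"
  shows "continuous_on {0..} f \<longleftrightarrow> (\<forall>T\<ge>0. continuous_on {0..T} f)"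
proof
  assume "continuous_on {0..} f"
  then show "\<forall>T\<ge>0. continuous_on {0..T} f" by (auto elim: continuous_on_subset)
next
  assume *: "\<forall>T\<ge>0. continuous_on {0..T} f"
  show "continuous_on {0..} f"
    unfolding continuous_on_def
  proof
    fix x :: real assume x: "x \<in> {0..}"
    have "at x within {0..} = at x within {0..x+1}"
      by (rule at_within_nhd[of x "{..<x+1}"]) auto
    moreover have "continuous_on {0..x+1} f" using * x by simp
    ultimately show "(f \<longlongrightarrow> f x) (at x within {0..})"
      using x by (auto simp: continuous_on_def)
  qed
qed

lemma nn_integral_exp_le:
  assumes "\<beta> > 0" "0 \<le> t"
  shows "(\<integral>\<^sup>+ s\<in>{0..t}. ennreal (exp (\<beta> * s)) \<partial>lborel) \<le> ennreal (exp (\<beta> * t) / \<beta>)"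
proof -
  have "(\<integral>\<^sup>+ s\<in>{0..t}. ennreal (exp (\<beta> * s)) \<partial>lborel) = ennreal (exp (\<beta> * t) / \<beta> - exp (\<beta> * 0) / \<beta>)"
    by (rule nn_integral_FTC_Icc) (use assms in \<open>auto intro!: derivative_eq_intros\<close>)
  also have "\<dots> \<le> ennreal (exp (\<beta> * t) / \<beta>)" using assms by (intro ennreal_leI) auto
  finally show ?thesis .
qed

text \<open>Integrating \<open>C * exp (2 * C * s)\<close> gains a factor 1/2, so each use of the
  integral inequality halves the part of the bound that stems from the a priori bound
  \<open>B\<close>. The integral of \<open>a\<close> is only compared by monotonicity, so
  \<open>a\<close> may be any function into \<open>ennreal\<close>.\<close>

lemma gronwall_ennreal:
  fixes a :: "real \<Rightarrow> ennreal"
  assumes C: "C > 0" and A: "A \<ge> 0"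
    and int: "\<And>t. t \<in> {0..T} \<Longrightarrow> a t \<le> ennreal A + ennreal C * (\<integral>\<^sup>+ s\<in>{0..t}. a s \<partial>lborel)"
    and bdd: "\<And>t. t \<in> {0..T} \<Longrightarrow> a t \<le> ennreal B"
    and t: "t \<in> {0..T}"
  shows "a t \<le> ennreal (2 * A * exp (2 * C * t))"
proof -
  define B' where "B' = max B 0"
  have B: "B' \<ge> 0" "\<And>t. t \<in> {0..T} \<Longrightarrow> a t \<le> ennreal B'"
    unfolding B'_def by (simp, rule order_trans[OF bdd ennreal_leI]) simp_all
  have *: "a t \<le> ennreal ((2 * A + B' / 2^n) * exp (2 * C * t))" if "t \<in> {0..T}" for n t
    using that
  proof (induction n arbitrary: t)
    case 0
    have "B' \<le> (2 * A + B') * exp (2 * C * t)"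
      using mult_mono[of B' "2 * A + B'" 1 "exp (2 * C * t)"] A B C 0 by simp
    then show ?case using B(2)[OF 0] by (auto intro: order_trans ennreal_leI)
  next
    case (Suc n)
    define K where "K = 2 * A + B' / 2^n"
    have K: "K \<ge> 0" unfolding K_def using A B by simp
    have "a t \<le> ennreal A + ennreal C * (\<integral>\<^sup>+ s\<in>{0..t}. a s \<partial>lborel)" by (rule int[OF Suc.prems])
    also have "(\<integral>\<^sup>+ s\<in>{0..t}. a s \<partial>lborel) \<le> (\<integral>\<^sup>+ s\<in>{0..t}. ennreal K * ennreal (exp (2 * C * s)) \<partial>lborel)"
      using Suc K by (intro nn_integral_mono) (auto simp: K_def split: split_indicator simp flip: ennreal_mult)
    also have "\<dots> = ennreal K * (\<integral>\<^sup>+ s\<in>{0..t}. ennreal (exp (2 * C * s)) \<partial>lborel)"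
      by (simp add: mult.assoc nn_integral_cmult)
    also have "\<dots> \<le> ennreal K * ennreal (exp (2 * C * t) / (2 * C))"
      using C Suc.prems by (intro mult_left_mono nn_integral_exp_le) auto
    finally have "a t \<le> ennreal A + ennreal C * (ennreal K * ennreal (exp (2 * C * t) / (2 * C)))"
      by (simp add: add_left_mono mult_left_mono)
    also have "\<dots> = ennreal (A + C * (K * (exp (2 * C * t) / (2 * C))))"
      using A C K by (simp flip: ennreal_mult ennreal_plus)
    also have "\<dots> \<le> ennreal ((2 * A + B' / 2^Suc n) * exp (2 * C * t))"
    proof (rule ennreal_leI)
      have "C * (K * (exp (2 * C * t) / (2 * C))) = (A + B' / 2^Suc n) * exp (2 * C * t)"
        using C by (simp add: K_def field_simps)
      moreover have "A * 1 \<le> A * exp (2 * C * t)" using A C Suc.prems by (intro mult_left_mono) auto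
      ultimately show "A + C * (K * (exp (2 * C * t) / (2 * C))) \<le> (2 * A + B' / 2^Suc n) * exp (2 * C * t)"
        by (simp add: algebra_simps)
    qed
    finally show ?case .
  qed
  have "(\<lambda>n. ennreal ((2 * A + B' * (1/2)^n) * exp (2 * C * t))) \<longlonglongrightarrow> ennreal ((2 * A + B' * 0) * exp (2 * C * t))"
    by (intro tendsto_ennrealI tendsto_intros LIMSEQ_power_zero) auto
  then show ?thesis
    by (intro LIMSEQ_le_const[where X="\<lambda>n. ennreal ((2 * A + B' * (1/2)^n) * exp (2 * C * t))"])
       (use *[OF t] in \<open>auto simp: power_one_over field_simps\<close>)
qed

text \<open>Peel off the first term and use
  \<open>(x + y)\<^sup>2 \<le> 2 * x\<^sup>2 + 2 * y\<^sup>2\<close> repeatedly. The weights do not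
  depend on \<open>k\<close>, so the bound survives the passage to an infinite series.\<close>

lemma sum_sq_weighted:
  fixes a :: "nat \<Rightarrow> real"
  shows "(\<Sum>j<k. a j)\<^sup>2 \<le> (\<Sum>j<k. 2^(j+1) * (a j)\<^sup>2)"
proof (induction k arbitrary: a)
  case (Suc k)
  have sq: "(x + y)\<^sup>2 \<le> 2 * x\<^sup>2 + 2 * y\<^sup>2" for x y :: real
    using sum_squares_bound[of x y] by (simp add: power2_sum)
  have "(\<Sum>j<Suc k. a j)\<^sup>2 = (a 0 + (\<Sum>j<k. a (Suc j)))\<^sup>2" by (simp only: sum.lessThan_Suc_shift)
  also have "\<dots> \<le> 2 * (a 0)\<^sup>2 + 2 * (\<Sum>j<k. a (Suc j))\<^sup>2" by (rule sq)
  also have "\<dots> \<le> 2 * (a 0)\<^sup>2 + 2 * (\<Sum>j<k. 2^(j+1) * (a (Suc j))\<^sup>2)" using Suc.IH[of "\<lambda>j. a (Suc j)"] by simp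
  also have "\<dots> = (\<Sum>j<Suc k. 2^(j+1) * (a j)\<^sup>2)"
    by (simp only: sum.lessThan_Suc_shift) (simp add: sum_distrib_left mult.assoc)
  finally show ?case .
qed simp

lemma power2_norm_add_le:
  fixes x y :: "'a::real_normed_vector"
  shows "(norm (x + y))\<^sup>2 \<le> 2 * (norm x)\<^sup>2 + 2 * (norm y)\<^sup>2"
proof -
  have "(norm (x + y))\<^sup>2 \<le> (norm x + norm y)\<^sup>2" by (intro power_mono norm_triangle_ineq) auto
  also have "\<dots> \<le> 2 * (norm x)\<^sup>2 + 2 * (norm y)\<^sup>2"
    using sum_squares_bound[of "norm x" "norm y"] by (simp add: power2_sum)
  finally show ?thesis .
qed

lemma power2_norm_sum_le:
  fixes x :: "'i \<Rightarrow> 'a::real_normed_vector"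
  assumes "finite I"
  shows "(norm (\<Sum>i\<in>I. x i))\<^sup>2 \<le> real (card I) * (\<Sum>i\<in>I. (norm (x i))\<^sup>2)"
proof -
  have "(norm (\<Sum>i\<in>I. x i))\<^sup>2 \<le> (\<Sum>i\<in>I. norm (x i))\<^sup>2" by (intro power_mono norm_sum) auto
  also have "\<dots> \<le> real (card I) * (\<Sum>i\<in>I. (norm (x i))\<^sup>2)"
    using sum_squared_le_sum_of_squares[of "\<lambda>i. norm (x i)" I] by (simp add: mult.commute)
  finally show ?thesis .
qed

text \<open>With time rounded down, only countably many times occur and joint measurability is
  clear; continuity of the paths recovers the process in the limit.\<close>

lemma joint_measurable_continuous:
  fixes X :: "real \<Rightarrow> 'w \<Rightarrow> 'a::metric_space"
  assumes X: "\<And>t. t \<in> {0..T} \<Longrightarrow> X t \<in> borel_measurable G"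
    and c: "\<And>w. w \<in> space G \<Longrightarrow> continuous_on {0..T} (\<lambda>t. X t w)"
  shows "(\<lambda>x. X (fst x) (snd x)) \<in> borel_measurable (restrict_space borel {0..T} \<Otimes>\<^sub>M G)"
proof (cases "T \<ge> 0")
  case False
  then show ?thesis
    by (intro measurableI) (auto simp: space_pair_measure space_restrict_space)
next
  case True
  define q where "q n s = real_of_int \<lfloor>real (Suc n) * s\<rfloor> / real (Suc n)" for n s
  have q: "0 \<le> q n s" "q n s \<le> s" "\<bar>q n s - s\<bar> \<le> inverse (real (Suc n))" if "0 \<le> s" for n s
  proof -
    have 1: "real_of_int \<lfloor>real (Suc n) * s\<rfloor> \<le> real (Suc n) * s" "real (Suc n) * s < real_of_int \<lfloor>real (Suc n) * s\<rfloor> + 1"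
      by linarith+
    show "0 \<le> q n s" using that by (auto simp: q_def)
    have "q n s \<le> (real (Suc n) * s) / real (Suc n)" unfolding q_def using 1 by (intro divide_right_mono) auto
    then show le: "q n s \<le> s" by simp
    have "(real (Suc n) * s) / real (Suc n) \<le> (real_of_int \<lfloor>real (Suc n) * s\<rfloor> + 1) / real (Suc n)"
      using 1 by (intro divide_right_mono) auto
    then have "s \<le> q n s + inverse (real (Suc n))" by (simp add: q_def add_divide_distrib inverse_eq_divide)
    with le show "\<bar>q n s - s\<bar> \<le> inverse (real (Suc n))" by linarith
  qed
  show ?thesis
  proof (rule borel_measurable_LIMSEQ_metric)
    fix n
    \<comment> \<open>The clamp has no effect at the times that are used; it makes every member of
      the integer-indexed family refer to a time in \<open>{0..T}\<close>.\<close>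
    let ?f = "\<lambda>(i::int) x. X (max 0 (min T (real_of_int i / real (Suc n)))) (snd x)"
    have "(\<lambda>x. ?f \<lfloor>real (Suc n) * fst x\<rfloor> x) \<in> borel_measurable (restrict_space borel {0..T} \<Otimes>\<^sub>M G)"
    proof (rule measurable_compose_countable[where f = ?f])
      show "?f i \<in> borel_measurable (restrict_space borel {0..T} \<Otimes>\<^sub>M G)" for i
        using True by (intro measurable_compose[OF measurable_snd X]) auto
      show "(\<lambda>x. \<lfloor>real (Suc n) * fst x\<rfloor>) \<in> restrict_space borel {0..T} \<Otimes>\<^sub>M G \<rightarrow>\<^sub>M count_space UNIV"
      proof -
        have "(\<lambda>s. \<lfloor>real (Suc n) * s\<rfloor>) \<in> restrict_space borel {0..T} \<rightarrow>\<^sub>M count_space UNIV"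
          by (intro measurable_restrict_space1) measurable
        then show ?thesis by (rule measurable_compose[OF measurable_fst])
      qed
    qed
    then show "(\<lambda>x. X (max 0 (min T (q n (fst x)))) (snd x)) \<in> borel_measurable (restrict_space borel {0..T} \<Otimes>\<^sub>M G)"
      by (simp add: q_def)
  next
    fix x assume "x \<in> space (restrict_space borel {0..T} \<Otimes>\<^sub>M G)"
    then have s: "fst x \<in> {0..T}" and w: "snd x \<in> space G"
      by (auto simp: space_pair_measure space_restrict_space)
    have eq: "max 0 (min T (q n (fst x))) = q n (fst x)" for n
      using q[of "fst x" n] s by auto
    have "(\<lambda>n. q n (fst x)) \<longlonglongrightarrow> fst x"
    proof (rule LIM_zero_cancel, rule Lim_null_comparison)
      show "(\<lambda>n. inverse (real (Suc n))) \<longlonglongrightarrow> 0" by (rule LIMSEQ_inverse_real_of_nat)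
      show "\<forall>\<^sub>F n in sequentially. norm (q n (fst x) - fst x) \<le> inverse (real (Suc n))"
        using q s by (intro always_eventually allI) (simp only: real_norm_def atLeastAtMost_iff)
    qed
    then show "(\<lambda>n. X (max 0 (min T (q n (fst x)))) (snd x)) \<longlonglongrightarrow> X (fst x) (snd x)"
      unfolding eq
      by (rule continuous_on_tendsto_compose[OF c[OF w]]) (use q(1,2)[of "fst x"] s in \<open>auto intro!: always_eventually order_trans[of _ "fst x" T]\<close>)
  qed
qed

subsection \<open>Integrals of continuous functions\<close>

text \<open>The square of \<open>norm (f s) - I / t\<close>, where \<open>I / t\<close> is the mean
  of the norm, has nonnegative integral; expanding it yields the inequality.\<close>

lemma Icc_integral_Cauchy_Schwarz:
  fixes f :: "real \<Rightarrow> 'a::{banach, second_countable_topology}"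
  assumes f: "continuous_on {0..t} f" and t: "0 \<le> t"
  shows "ennreal ((norm (LINT s:{0..t}|lborel. f s))\<^sup>2) \<le> ennreal t * (\<integral>\<^sup>+ s\<in>{0..t}. ennreal ((norm (f s))\<^sup>2) \<partial>lborel)"
proof (cases "t = 0")
  case True
  have "set_lebesgue_integral lborel {0..0} f = 0"
    unfolding set_lebesgue_integral_def
    by (rule integral_eq_zero_AE, rule AE_mp[OF AE_lborel_singleton[of 0]]) auto
  then show ?thesis using True by simp
next
  case False
  then have t: "t > 0" using t by simp
  have cn: "continuous_on {0..t} (\<lambda>s. norm (f s))" by (intro continuous_intros f)
  have i0: "set_integrable lborel {0..t} f" by (rule borel_integrable_atLeastAtMost'[OF f])
  have i1: "set_integrable lborel {0..t} (\<lambda>s. norm (f s))" by (rule borel_integrable_atLeastAtMost'[OF cn])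
  have i2: "set_integrable lborel {0..t} (\<lambda>s. (norm (f s))\<^sup>2)"
    by (rule borel_integrable_atLeastAtMost') (intro continuous_intros cn)
  define I where "I = (LINT s:{0..t}|lborel. norm (f s))"
  define J where "J = (LINT s:{0..t}|lborel. (norm (f s))\<^sup>2)"
  have "norm (LINT s:{0..t}|lborel. f s) \<le> I"
    unfolding I_def using i0 by (rule set_integral_norm_bound)
  then have 1: "(norm (LINT s:{0..t}|lborel. f s))\<^sup>2 \<le> I\<^sup>2" by (intro power_mono) auto
  have c: "(LINT s:{0..t}|lborel. c) = c * t" for c :: real
    using t by (simp add: set_lebesgue_integral_def mult.commute)
  have ic: "set_integrable lborel {0..t} (\<lambda>s. c)" for c :: real
    by (rule borel_integrable_atLeastAtMost') (rule continuous_on_const)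
  have "0 \<le> (LINT s:{0..t}|lborel. (norm (f s) - I / t)\<^sup>2)"
    unfolding set_lebesgue_integral_def by (rule integral_nonneg_AE) auto
  also have "(\<lambda>s. (norm (f s) - I / t)\<^sup>2) = (\<lambda>s. ((norm (f s))\<^sup>2 - (2 * I / t) * norm (f s)) + (I / t)\<^sup>2)"
    by (auto simp: power2_diff algebra_simps)
  also have "(LINT s:{0..t}|lborel. ((norm (f s))\<^sup>2 - (2 * I / t) * norm (f s)) + (I / t)\<^sup>2) = J - (2 * I / t) * I + (I / t)\<^sup>2 * t"
    using i1 i2 ic by (simp add: set_integral_add set_integral_diff set_integral_mult_right c I_def J_def)
  also have "\<dots> = J - I\<^sup>2 / t" using t by (simp add: power2_eq_square field_simps)
  finally have "I\<^sup>2 \<le> t * J" using t by (simp add: field_simps)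
  moreover have "ennreal J = (\<integral>\<^sup>+ s\<in>{0..t}. ennreal ((norm (f s))\<^sup>2) \<partial>lborel)"
    unfolding J_def set_lebesgue_integral_def
    by (subst nn_integral_eq_integral[OF i2[unfolded set_integrable_def], symmetric])
       (auto intro!: nn_integral_cong split: split_indicator)
  moreover have "J \<ge> 0" unfolding J_def set_lebesgue_integral_def by (rule integral_nonneg_AE) auto
  ultimately show ?thesis using 1 t
    by (metis (no_types, lifting) ennreal_leI ennreal_mult less_imp_le order_trans)
qed

text \<open>On a compact interval the integral is Lipschitz, with a bound for the norm of
  \<open>f\<close> as constant.\<close>

lemma continuous_on_Icc_integral:
  fixes f :: "real \<Rightarrow> 'a::{banach, second_countable_topology}"
  assumes f: "continuous_on {0..} f"
  shows "continuous_on {0..} (\<lambda>t. LINT s:{0..t}|lborel. f s)"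
  unfolding continuous_on_atLeast_iff
proof (intro allI impI)
  fix T :: real assume T: "T \<ge> 0"
  have fT: "continuous_on {0..T} f" using f by (rule continuous_on_subset) auto
  have "compact (f ` {0..T})" by (rule compact_continuous_image[OF fT compact_Icc])
  then obtain K where K: "\<And>s. s \<in> {0..T} \<Longrightarrow> norm (f s) \<le> K" "K > 0"
    by (metis bounded_pos compact_imp_bounded imageI)
  have i: "set_integrable lborel {0..T} f" by (rule borel_integrable_atLeastAtMost'[OF fT])
  have *: "norm ((LINT s:{0..b}|lborel. f s) - (LINT s:{0..a}|lborel. f s)) \<le> K * (b - a)"
    if ab: "0 \<le> a" "a \<le> b" "b \<le> T" for a b
  proof -
    have "{0..b} = {0..a} \<union> {a<..b}" using ab by auto
    then have "(LINT s:{0..b}|lborel. f s) = (LINT s:{0..a}|lborel. f s) + (LINT s:{a<..b}|lborel. f s)"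
      using ab by (simp only:) (intro set_integral_Un set_integrable_subset[OF i]; auto)
    then have "norm ((LINT s:{0..b}|lborel. f s) - (LINT s:{0..a}|lborel. f s)) = norm (LINT s:{a<..b}|lborel. f s)"
      by simp
    also have "\<dots> \<le> (LINT s:{a<..b}|lborel. norm (f s))"
      by (intro set_integral_norm_bound set_integrable_subset[OF i]) (use ab in auto)
    also have "\<dots> \<le> (LINT s:{a<..b}|lborel. K)"
      by (intro set_integral_mono set_integrable_norm set_integrable_subset[OF i])
         (use ab K in \<open>auto simp: set_integrable_def\<close>)
    also have "\<dots> = K * (b - a)" using ab by (simp add: set_lebesgue_integral_def mult.commute)
    finally show ?thesis .
  qed
  have "dist (LINT s:{0..x}|lborel. f s) (LINT s:{0..y}|lborel. f s) \<le> K * dist x y"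
    if "x \<in> {0..T}" "y \<in> {0..T}" for x y
    using *[of x y] *[of y x] that
    by (cases "x \<le> y") (auto simp: dist_norm norm_minus_commute abs_if)
  then have "K-lipschitz_on {0..T} (\<lambda>t. LINT s:{0..t}|lborel. f s)"
    using K(2) by (intro lipschitz_onI) auto
  then show "continuous_on {0..T} (\<lambda>t. LINT s:{0..t}|lborel. f s)"
    by (rule lipschitz_on_continuous_on)
qed

text \<open>A parametrised integral needs joint measurability of the integrand, which continuity of
  the paths supplies.\<close>

lemma measurable_Icc_integral:
  fixes X :: "real \<Rightarrow> 'w \<Rightarrow> 'a::{banach, second_countable_topology}"
  assumes X: "\<And>s. s \<in> {0..t} \<Longrightarrow> X s \<in> borel_measurable G"
    and c: "\<And>w. w \<in> space G \<Longrightarrow> continuous_on {0..t} (\<lambda>s. X s w)"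
  shows "(\<lambda>w. LINT s:{0..t}|lborel. X s w) \<in> borel_measurable G"
proof -
  have s: "sigma_finite_measure (restrict_space lborel {0..t})"
    by (rule sigma_finite_measure_restrict_space) (auto intro: sigma_finite_lborel)
  have "(\<lambda>x. X (fst x) (snd x)) \<in> borel_measurable (restrict_space borel {0..t} \<Otimes>\<^sub>M G)"
    by (rule joint_measurable_continuous[OF X c])
  moreover have "sets (restrict_space lborel {0..t} \<Otimes>\<^sub>M G) = sets (restrict_space borel {0..t} \<Otimes>\<^sub>M G)"
    by (intro sets_pair_measure_cong sets_restrict_space_cong) auto
  ultimately have "(\<lambda>x. X (fst x) (snd x)) \<in> borel_measurable (restrict_space lborel {0..t} \<Otimes>\<^sub>M G)"
    using measurable_cong_sets by blast
  then have "(\<lambda>(w, s). X s w) \<in> borel_measurable (G \<Otimes>\<^sub>M restrict_space lborel {0..t})"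
    by (subst (asm) measurable_pair_swap_iff) (simp add: split_beta)
  then have "(\<lambda>w. \<integral>s. X s w \<partial>restrict_space lborel {0..t}) \<in> borel_measurable G"
    by (rule sigma_finite_measure.borel_measurable_lebesgue_integral[OF s])
  then show ?thesis by (simp add: integral_restrict_space set_lebesgue_integral_def)
qed

subsection \<open>Continuous adapted processes\<close>

context stochastic_basis
begin

lemma space_F: "0 \<le> t \<Longrightarrow> space (F t) = space M"
  using subalgebra_F by (simp add: subalgebra_def)

lemma measurable_F_M: "0 \<le> t \<Longrightarrow> f \<in> measurable (F t) N \<Longrightarrow> f \<in> measurable M N"
  using subalgebra_F by (rule measurable_from_subalg)

lemma sets_F_M: "0 \<le> t \<Longrightarrow> A \<in> sets (F t) \<Longrightarrow> A \<in> sets M"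
  using subalgebra_F by (auto simp: subalgebra_def)

lemma measurable_F_mono:
  assumes "0 \<le> s" "s \<le> t" "f \<in> measurable (F s) N"
  shows "f \<in> measurable (F t) N"
proof (rule measurable_from_subalg[OF _ assms(3)])
  show "subalgebra (F t) (F s)"
    using assms F_mono[of s t] space_F[of s] space_F[of t] by (simp add: subalgebra_def)
qed

lemma null_sets_F: "0 \<le> t \<Longrightarrow> N \<in> null_sets M \<Longrightarrow> N \<in> sets (F t)"
  using F_complete[of N N] F_mono[of 0 t] by auto

text \<open>A consequence of completeness of the filtration: a process may be altered on a null set
  without losing adaptedness, so its paths can be made continuous everywhere.\<close>

lemma measurable_F_modify:
  assumes "0 \<le> t" "f \<in> measurable (F t) N" "A \<in> null_sets M" "c \<in> space N"
  shows "(\<lambda>w. if w \<in> A then c else f w) \<in> measurable (F t) N"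
  using assms null_sets_F[OF assms(1,3)] by (intro measurable_If_set measurable_const) auto

text \<open>Continuity is demanded for every sample point; exceptional null sets are removed
  beforehand by modification.\<close>

definition cont_adapted :: "(real \<Rightarrow> 'w \<Rightarrow> 'b::{real_normed_vector, second_countable_topology}) \<Rightarrow> bool" where
  "cont_adapted X \<longleftrightarrow> (\<forall>t\<ge>0. X t \<in> borel_measurable (F t)) \<and> (\<forall>w\<in>space M. continuous_on {0..} (\<lambda>t. X t w))"

text \<open>The squared norm of L^2(Omega; C([0,T])), with values in \<open>ennreal\<close> so that
  finiteness can be the conclusion of an estimate.\<close>

abbreviation ES :: "(real \<Rightarrow> 'w \<Rightarrow> 'b::real_normed_vector) \<Rightarrow> real \<Rightarrow> ennreal" where
  "ES X T \<equiv> (\<integral>\<^sup>+ w. (SUP t\<in>{0..T}. ennreal ((norm (X t w))\<^sup>2)) \<partial>M)"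

definition S2_process :: "(real \<Rightarrow> 'w \<Rightarrow> 'b::{real_normed_vector, second_countable_topology}) \<Rightarrow> bool" where
  "S2_process X \<longleftrightarrow> cont_adapted X \<and> (\<forall>T\<ge>0. ES X T < \<infinity>)"

definition PT :: "real \<Rightarrow> (real \<times> 'w) measure" where
  "PT T = restrict_space lborel {0..T} \<Otimes>\<^sub>M M"

text \<open>The expected time integral over \<open>{0..T}\<close>, taken over the product space so
  that both orders of iterated integration are at hand.\<close>

definition EI :: "real \<Rightarrow> (real \<Rightarrow> 'w \<Rightarrow> ennreal) \<Rightarrow> ennreal" where
  "EI T f = (\<integral>\<^sup>+ x. f (fst x) (snd x) \<partial>PT T)"

lemma S2_cont_adapted: "S2_process X \<Longrightarrow> cont_adapted X"
  by (simp add: S2_process_def)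

lemma S2_ES: "S2_process X \<Longrightarrow> 0 \<le> T \<Longrightarrow> ES X T < \<infinity>"
  by (simp add: S2_process_def)

lemma cont_adapted_F: "cont_adapted X \<Longrightarrow> 0 \<le> t \<Longrightarrow> X t \<in> borel_measurable (F t)"
  by (simp add: cont_adapted_def)

lemma cont_adapted_M: "cont_adapted X \<Longrightarrow> 0 \<le> t \<Longrightarrow> X t \<in> borel_measurable M"
  using cont_adapted_F measurable_F_M by blast

lemma cont_adapted_cont: "cont_adapted X \<Longrightarrow> w \<in> space M \<Longrightarrow> continuous_on {0..} (\<lambda>t. X t w)"
  by (simp add: cont_adapted_def)

lemma cont_adapted_cont_Icc: "cont_adapted X \<Longrightarrow> w \<in> space M \<Longrightarrow> 0 \<le> S \<Longrightarrow> continuous_on {S..T} (\<lambda>t. X t w)"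
  by (rule continuous_on_subset[OF cont_adapted_cont]) auto

section \<open>Integration over time and sample space\<close>

lemma space_PT: "space (PT T) = {0..T} \<times> space M"
  by (simp add: PT_def space_pair_measure space_restrict_space)

lemma sets_PT: "sets (PT T) = sets (restrict_space borel {0..T} \<Otimes>\<^sub>M M)"
  unfolding PT_def by (intro sets_pair_measure_cong sets_restrict_space_cong) auto

lemma measurable_PT_cont:
  assumes "cont_adapted X"
  shows "(\<lambda>x. X (fst x) (snd x)) \<in> borel_measurable (PT T)"
  unfolding measurable_cong_sets[OF sets_PT refl]
  by (rule joint_measurable_continuous)
     (use assms in \<open>auto intro: cont_adapted_M cont_adapted_cont_Icc\<close>)

lemma sigma_finite_restrict_Icc: "sigma_finite_measure (restrict_space lborel {0..T::real})"
  by (rule sigma_finite_measure_restrict_space) (auto intro: sigma_finite_lborel)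

lemma EI_eq_space_time:
  assumes "(\<lambda>x. f (fst x) (snd x)) \<in> borel_measurable (PT T)"
  shows "EI T f = (\<integral>\<^sup>+ s\<in>{0..T}. (\<integral>\<^sup>+ w. f s w \<partial>M) \<partial>lborel)"
proof -
  have "EI T f = (\<integral>\<^sup>+ s. (\<integral>\<^sup>+ w. f s w \<partial>M) \<partial>restrict_space lborel {0..T})"
    unfolding EI_def PT_def
    by (subst nn_integral_fst[symmetric]) (use assms in \<open>auto simp: PT_def split_beta\<close>)
  then show ?thesis by (simp add: nn_integral_restrict_space)
qed

lemma EI_eq_time_space:
  assumes "(\<lambda>x. f (fst x) (snd x)) \<in> borel_measurable (PT T)"
  shows "EI T f = (\<integral>\<^sup>+ w. (\<integral>\<^sup>+ s\<in>{0..T}. f s w \<partial>lborel) \<partial>M)"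
proof -
  interpret R: sigma_finite_measure "restrict_space lborel {0..T}" by (rule sigma_finite_restrict_Icc)
  interpret P: pair_sigma_finite "restrict_space lborel {0..T}" M ..
  have "EI T f = (\<integral>\<^sup>+ w. (\<integral>\<^sup>+ s. f s w \<partial>restrict_space lborel {0..T}) \<partial>M)"
    unfolding EI_def PT_def
    by (subst P.nn_integral_snd[symmetric]) (use assms in \<open>auto simp: PT_def split_beta\<close>)
  then show ?thesis by (simp add: nn_integral_restrict_space)
qed

lemma measurable_time_integral:
  assumes "(\<lambda>x. f (fst x) (snd x)) \<in> borel_measurable (PT T)"
  shows "(\<lambda>w. \<integral>\<^sup>+ s\<in>{0..T}. (f s w :: ennreal) \<partial>lborel) \<in> borel_measurable M"
proof -
  have "(\<lambda>(w, s). f s w) \<in> borel_measurable (M \<Otimes>\<^sub>M restrict_space lborel {0..T})"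
    using assms unfolding PT_def by (subst (asm) measurable_pair_swap_iff) (simp add: split_beta)
  then have "(\<lambda>w. \<integral>\<^sup>+ s. f s w \<partial>restrict_space lborel {0..T}) \<in> borel_measurable M"
    by (rule sigma_finite_measure.borel_measurable_nn_integral[OF sigma_finite_restrict_Icc])
  then show ?thesis by (simp add: nn_integral_restrict_space)
qed

lemma EI_mono:
  assumes "\<And>s w. s \<in> {0..T} \<Longrightarrow> w \<in> space M \<Longrightarrow> f s w \<le> g s w"
  shows "EI T f \<le> EI T g"
  unfolding EI_def by (rule nn_integral_mono) (use assms in \<open>auto simp: space_PT\<close>)

lemma EI_cong:
  assumes "\<And>s w. s \<in> {0..T} \<Longrightarrow> w \<in> space M \<Longrightarrow> f s w = g s w"
  shows "EI T f = EI T g"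
  unfolding EI_def by (rule nn_integral_cong) (use assms in \<open>auto simp: space_PT\<close>)

lemma EI_add:
  assumes "(\<lambda>x. f (fst x) (snd x)) \<in> borel_measurable (PT T)" "(\<lambda>x. g (fst x) (snd x)) \<in> borel_measurable (PT T)"
  shows "EI T (\<lambda>s w. f s w + g s w) = EI T f + EI T g"
  unfolding EI_def by (rule nn_integral_add[OF assms])

lemma EI_cmult:
  assumes "(\<lambda>x. f (fst x) (snd x)) \<in> borel_measurable (PT T)"
  shows "EI T (\<lambda>s w. c * f s w) = c * EI T f"
  unfolding EI_def by (rule nn_integral_cmult[OF assms])

lemma EI_sum:
  assumes "\<And>i. i \<in> I \<Longrightarrow> (\<lambda>x. f i (fst x) (snd x)) \<in> borel_measurable (PT T)"
  shows "EI T (\<lambda>s w. \<Sum>i\<in>I. f i s w) = (\<Sum>i\<in>I. EI T (f i))"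
  unfolding EI_def using assms by (rule nn_integral_sum)

section \<open>Second moments of running suprema\<close>

lemma sup_sq_measurable:
  assumes X: "cont_adapted X" and T: "0 \<le> T"
  shows "(\<lambda>w. SUP t\<in>{0..T}. ennreal ((norm (X t w))\<^sup>2)) \<in> borel_measurable M"
proof -
  have "(\<lambda>w. SUP n. SUP k\<in>{..n}. ennreal ((norm (X (T * real k / real n) w))\<^sup>2)) \<in> borel_measurable M"
  proof (intro borel_measurable_SUP countableI_type)
    fix n k :: nat assume "k \<in> {..n}"
    then have [measurable]: "X (T * real k / real n) \<in> borel_measurable M"
      using grid_in_Icc[OF T, of k n] by (intro cont_adapted_M[OF X]) auto
    show "(\<lambda>w. ennreal ((norm (X (T * real k / real n) w))\<^sup>2)) \<in> borel_measurable M" by measurable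
  qed
  then show ?thesis
    by (rule measurable_cong[THEN iffD1, rotated])
       (use sup_sq_grid(1)[OF cont_adapted_cont_Icc[OF X] T] in auto)
qed

text \<open>The affine right-hand side covers both the splitting of a sum and linear growth. The
  pointwise bound is almost sure because solutions satisfy their equations only off a null
  set.\<close>

lemma ES_mono_le:
  assumes X: "cont_adapted X" and Y: "cont_adapted Y" and T: "0 \<le> T" and B: "0 \<le> A" "0 \<le> B" "0 \<le> C"
    and le: "AE w in M. \<forall>t\<in>{0..T}. (norm (Z t w))\<^sup>2 \<le> A + B * (norm (X t w))\<^sup>2 + C * (norm (Y t w))\<^sup>2"
  shows "ES Z T \<le> ennreal A + ennreal B * ES X T + ennreal C * ES Y T"
proof -
  note [measurable] = sup_sq_measurable[OF X T] sup_sq_measurable[OF Y T]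
  have "ES Z T \<le> (\<integral>\<^sup>+ w. ennreal A + ennreal B * (SUP t\<in>{0..T}. ennreal ((norm (X t w))\<^sup>2))
      + ennreal C * (SUP t\<in>{0..T}. ennreal ((norm (Y t w))\<^sup>2)) \<partial>M)"
  proof (rule nn_integral_mono_AE, use le in eventually_elim, rule SUP_least)
    fix w t assume h: "\<forall>t\<in>{0..T}. (norm (Z t w))\<^sup>2 \<le> A + B * (norm (X t w))\<^sup>2 + C * (norm (Y t w))\<^sup>2" and t: "t \<in> {0..T}"
    have "ennreal ((norm (Z t w))\<^sup>2) \<le> ennreal (A + B * (norm (X t w))\<^sup>2 + C * (norm (Y t w))\<^sup>2)"
      by (rule ennreal_leI) (use h t in auto)
    also have "\<dots> = ennreal A + ennreal B * ennreal ((norm (X t w))\<^sup>2) + ennreal C * ennreal ((norm (Y t w))\<^sup>2)"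
      using B by (simp add: ennreal_mult)
    also have "\<dots> \<le> ennreal A + ennreal B * (SUP t\<in>{0..T}. ennreal ((norm (X t w))\<^sup>2))
      + ennreal C * (SUP t\<in>{0..T}. ennreal ((norm (Y t w))\<^sup>2))"
      by (intro add_mono mult_left_mono SUP_upper t order_refl) auto
    finally show "ennreal ((norm (Z t w))\<^sup>2) \<le> \<dots>" .
  qed
  also have "\<dots> = ennreal A + ennreal B * ES X T + ennreal C * ES Y T"
    by (simp add: nn_integral_add nn_integral_cmult emeasure_space_1)
  finally show ?thesis .
qed

lemma cont_adapted_const [simp, intro]: "cont_adapted (\<lambda>t w. c)"
  by (simp add: cont_adapted_def)

lemma S2_bound:
  assumes X: "S2_process X" and Y: "S2_process Y" and Z: "cont_adapted Z" and B: "0 \<le> A" "0 \<le> B" "0 \<le> C"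
    and le: "\<And>w t. w \<in> space M \<Longrightarrow> 0 \<le> t \<Longrightarrow> (norm (Z t w))\<^sup>2 \<le> A + B * (norm (X t w))\<^sup>2 + C * (norm (Y t w))\<^sup>2"
  shows "S2_process Z"
  unfolding S2_process_def
proof (intro conjI Z allI impI)
  fix T :: real assume T: "0 \<le> T"
  have "ES Z T \<le> ennreal A + ennreal B * ES X T + ennreal C * ES Y T"
    by (rule ES_mono_le[OF S2_cont_adapted[OF X] S2_cont_adapted[OF Y] T B]) (use le in auto)
  also have "\<dots> < \<infinity>"
    using S2_ES[OF X T] S2_ES[OF Y T] by (simp add: ennreal_mult_less_top)
  finally show "ES Z T < \<infinity>" .
qed

lemma S2_const [simp, intro]: "S2_process (\<lambda>t w. c)"
  unfolding S2_process_def
proof (intro conjI cont_adapted_const allI impI)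
  fix T :: real assume "0 \<le> T"
  then have "ES (\<lambda>t w. c) T = ennreal ((norm c)\<^sup>2)"
    by (simp add: emeasure_space_1)
  then show "ES (\<lambda>t w. c) T < \<infinity>" by simp
qed

lemma cont_adapted_compose:
  assumes X: "cont_adapted X" and f: "continuous_on UNIV f"
  shows "cont_adapted (\<lambda>t w. f (X t w))"
  unfolding cont_adapted_def
proof (intro conjI allI impI ballI)
  fix t :: real assume "0 \<le> t"
  then show "(\<lambda>w. f (X t w)) \<in> borel_measurable (F t)"
    by (intro borel_measurable_continuous_on[OF f] cont_adapted_F[OF X])
next
  fix w assume "w \<in> space M"
  then show "continuous_on {0..} (\<lambda>t. f (X t w))"
    by (intro continuous_on_compose2[OF f cont_adapted_cont[OF X]]) auto
qed

lemma cont_adapted_add: "cont_adapted X \<Longrightarrow> cont_adapted Y \<Longrightarrow> cont_adapted (\<lambda>t w. X t w + Y t w)"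
  unfolding cont_adapted_def by (auto intro!: continuous_intros borel_measurable_add)

lemma cont_adapted_diff: "cont_adapted X \<Longrightarrow> cont_adapted Y \<Longrightarrow> cont_adapted (\<lambda>t w. X t w - Y t w)"
  unfolding cont_adapted_def by (auto intro!: continuous_intros borel_measurable_diff)

text \<open>Linear growth is what keeps the second moment of the supremum finite.\<close>

lemma S2_compose:
  assumes X: "S2_process X" and f: "continuous_on UNIV f" and K: "0 \<le> K"
    and g: "\<And>x. norm (f x) \<le> K * (1 + norm x)"
  shows "S2_process (\<lambda>t w. f (X t w))"
proof (rule S2_bound[OF X X cont_adapted_compose[OF S2_cont_adapted[OF X] f], of "2 * K\<^sup>2" "2 * K\<^sup>2" 0])
  fix w t
  have "(norm (f (X t w)))\<^sup>2 \<le> (K * (1 + norm (X t w)))\<^sup>2" by (intro power_mono g) auto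
  also have "\<dots> \<le> 2 * K\<^sup>2 + 2 * K\<^sup>2 * (norm (X t w))\<^sup>2 + 0 * (norm (X t w))\<^sup>2"
  proof -
    have "(1 + norm (X t w))\<^sup>2 \<le> 2 + 2 * (norm (X t w))\<^sup>2"
      using power2_norm_add_le[of 1 "norm (X t w)"] by simp
    then have "K\<^sup>2 * (1 + norm (X t w))\<^sup>2 \<le> K\<^sup>2 * (2 + 2 * (norm (X t w))\<^sup>2)"
      by (intro mult_left_mono) auto
    then show ?thesis unfolding power_mult_distrib by (simp add: distrib_left mult.left_commute)
  qed
  finally show "(norm (f (X t w)))\<^sup>2 \<le> 2 * K\<^sup>2 + 2 * K\<^sup>2 * (norm (X t w))\<^sup>2 + 0 * (norm (X t w))\<^sup>2" .
qed auto

lemma S2_add: 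
  assumes "S2_process X" "S2_process Y" shows "S2_process (\<lambda>t w. X t w + Y t w)"
  by (rule S2_bound[OF assms cont_adapted_add, of _ _ 0 2 2])
     (use assms in \<open>auto intro: S2_cont_adapted simp: power2_norm_add_le\<close>)

lemma S2_scaleR: "S2_process X \<Longrightarrow> S2_process (\<lambda>t w. c *\<^sub>R X t w)"
  by (rule S2_compose[where K = "\<bar>c\<bar>"]) (auto intro!: continuous_intros mult_left_mono)

lemma S2_scaleR_left: "S2_process X \<Longrightarrow> S2_process (\<lambda>t w. X t w *\<^sub>R c)"
  by (rule S2_compose[where K = "norm c"])
     (auto intro!: continuous_intros simp: mult.commute[of _ "norm c"] intro!: mult_left_mono)

lemma S2_diff: 
  assumes "S2_process X" "S2_process Y" shows "S2_process (\<lambda>t w. X t w - Y t w)"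
  using S2_add[OF assms(1) S2_scaleR[OF assms(2), of "-1"]] by simp

lemma S2_sum: "(\<And>i. i \<in> I \<Longrightarrow> S2_process (X i)) \<Longrightarrow> S2_process (\<lambda>t w. \<Sum>i\<in>I. X i t w)"
  by (induction I rule: infinite_finite_induct) (auto intro: S2_add)

lemma EI_le_ES:
  assumes X: "cont_adapted X" and T: "0 \<le> T"
  shows "EI T (\<lambda>s w. ennreal ((norm (X s w))\<^sup>2)) \<le> ennreal T * ES X T"
proof -
  note [measurable] = measurable_PT_cont[OF X]
  have "EI T (\<lambda>s w. ennreal ((norm (X s w))\<^sup>2)) = (\<integral>\<^sup>+ w. (\<integral>\<^sup>+ s\<in>{0..T}. ennreal ((norm (X s w))\<^sup>2) \<partial>lborel) \<partial>M)"
    by (rule EI_eq_time_space) measurable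
  also have "\<dots> \<le> (\<integral>\<^sup>+ w. ennreal T * (SUP t\<in>{0..T}. ennreal ((norm (X t w))\<^sup>2)) \<partial>M)"
  proof (rule nn_integral_mono)
    fix w
    let ?S = "SUP t\<in>{0..T}. ennreal ((norm (X t w))\<^sup>2)"
    have "(\<integral>\<^sup>+ s\<in>{0..T}. ennreal ((norm (X s w))\<^sup>2) \<partial>lborel) \<le> (\<integral>\<^sup>+ s\<in>{0..T}. ?S \<partial>lborel)"
      by (intro nn_integral_mono) (auto split: split_indicator intro: SUP_upper)
    also have "\<dots> = ennreal T * ?S" using T by (subst nn_integral_cmult_indicator) (auto simp: mult.commute)
    finally show "(\<integral>\<^sup>+ s\<in>{0..T}. ennreal ((norm (X s w))\<^sup>2) \<partial>lborel) \<le> ennreal T * ?S" .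
  qed
  also have "\<dots> = ennreal T * ES X T" by (rule nn_integral_cmult[OF sup_sq_measurable[OF X T]])
  finally show ?thesis .
qed

lemma EI_S2_finite: "S2_process X \<Longrightarrow> 0 \<le> T \<Longrightarrow> EI T (\<lambda>s w. ennreal ((norm (X s w))\<^sup>2)) < \<infinity>"
  by (rule le_less_trans[OF EI_le_ES[OF S2_cont_adapted]])
     (auto dest: S2_ES simp: ennreal_mult_less_top)

lemma E_le_ES: "0 \<le> t \<Longrightarrow> t \<le> T \<Longrightarrow> (\<integral>\<^sup>+ w. ennreal ((norm (X t w))\<^sup>2) \<partial>M) \<le> ES X T"
  by (intro nn_integral_mono SUP_upper) auto

text \<open>The Cauchy-Schwarz inequality in time, applied to each path and uniformly in the upper
  limit.\<close>

lemma S2_Icc_integral: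
  fixes X :: "real \<Rightarrow> 'w \<Rightarrow> 'b::{banach, second_countable_topology}"
  assumes X: "S2_process X"
  shows "S2_process (\<lambda>t w. LINT s:{0..t}|lborel. X s w)" (is "S2_process ?I")
    and "0 \<le> T \<Longrightarrow> ES (\<lambda>t w. LINT s:{0..t}|lborel. X s w) T \<le> ennreal T * EI T (\<lambda>s w. ennreal ((norm (X s w))\<^sup>2))"
proof -
  note ca = S2_cont_adapted[OF X]
  have c: "cont_adapted ?I"
    unfolding cont_adapted_def
  proof (intro conjI allI impI ballI)
    fix t :: real assume t: "0 \<le> t"
    show "?I t \<in> borel_measurable (F t)"
    proof (rule measurable_Icc_integral)
      show "X s \<in> borel_measurable (F t)" if "s \<in> {0..t}" for s
        using that cont_adapted_F[OF ca, of s] measurable_F_mono[of s t] by auto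
      show "continuous_on {0..t} (\<lambda>s. X s w)" if "w \<in> space (F t)" for w
        using that t by (intro cont_adapted_cont_Icc[OF ca]) (auto simp: space_F)
    qed
  next
    fix w assume "w \<in> space M"
    then show "continuous_on {0..} (\<lambda>t. ?I t w)"
      by (intro continuous_on_Icc_integral cont_adapted_cont[OF ca])
  qed
  have le: "ES ?I T \<le> ennreal T * EI T (\<lambda>s w. ennreal ((norm (X s w))\<^sup>2))" if T: "0 \<le> T" for T
  proof -
    note [measurable] = measurable_PT_cont[OF ca]
    have "ES ?I T \<le> (\<integral>\<^sup>+ w. ennreal T * (\<integral>\<^sup>+ s\<in>{0..T}. ennreal ((norm (X s w))\<^sup>2) \<partial>lborel) \<partial>M)"
    proof (intro nn_integral_mono SUP_least)
      fix w t assume w: "w \<in> space M" and t: "t \<in> {0..T}"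
      have "ennreal ((norm (?I t w))\<^sup>2) \<le> ennreal t * (\<integral>\<^sup>+ s\<in>{0..t}. ennreal ((norm (X s w))\<^sup>2) \<partial>lborel)"
        by (rule Icc_integral_Cauchy_Schwarz) (use cont_adapted_cont_Icc[OF ca w] t in auto)
      also have "\<dots> \<le> ennreal T * (\<integral>\<^sup>+ s\<in>{0..T}. ennreal ((norm (X s w))\<^sup>2) \<partial>lborel)"
        using t by (intro mult_mono nn_integral_mono ennreal_leI) (auto split: split_indicator)
      finally show "ennreal ((norm (?I t w))\<^sup>2) \<le> \<dots>" .
    qed
    also have "\<dots> = ennreal T * EI T (\<lambda>s w. ennreal ((norm (X s w))\<^sup>2))"
      by (subst EI_eq_time_space, measurable, rule nn_integral_cmult, rule measurable_time_integral, measurable)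
    finally show ?thesis .
  qed
  then show "0 \<le> T \<Longrightarrow> ES ?I T \<le> ennreal T * EI T (\<lambda>s w. ennreal ((norm (X s w))\<^sup>2))" .
  show "S2_process ?I"
    unfolding S2_process_def
  proof (intro conjI c allI impI)
    fix T :: real assume T: "0 \<le> T"
    show "ES ?I T < \<infinity>"
      using EI_S2_finite[OF X T] by (intro le_less_trans[OF le[OF T]]) (auto simp: ennreal_mult_less_top)
  qed
qed

end

subsection \<open>Completeness of the space of continuous adapted processes\<close>

context stochastic_basis
begin

text \<open>The complement of an event of full measure is null, and completeness places it in every
  \<open>F t\<close>.\<close>

lemma AE_Ball_sets_F:
  assumes "AE w in M. P w" "{w\<in>space M. P w} \<in> sets M" "0 \<le> t"
  shows "{w\<in>space M. P w} \<in> sets (F t)"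
proof -
  have "{w\<in>space M. \<not> P w} = space M - {w\<in>space M. P w}" by auto
  then have m: "{w\<in>space M. \<not> P w} \<in> sets M" using assms(2) by auto
  have "emeasure M {w\<in>space M. \<not> P w} = 0"
    using assms(1) m by (simp add: AE_iff_measurable[OF m])
  then have "{w\<in>space M. \<not> P w} \<in> null_sets M" using m by (simp add: null_setsI)
  then have "space (F t) - {w\<in>space M. \<not> P w} \<in> sets (F t)" using null_sets_F[OF assms(3)] by blast
  moreover have "space (F t) - {w\<in>space M. \<not> P w} = {w\<in>space M. P w}" using space_F[OF assms(3)] by auto
  ultimately show ?thesis by simp
qed

text \<open>Completeness along rapidly convergent sequences. The rate leaves room for two weights:
  16^n to obtain uniform convergence of almost every path, and 2^(j+1) to sum the tail of the
  squared increments.\<close>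

lemma S2_complete:
  fixes X :: "nat \<Rightarrow> real \<Rightarrow> 'w \<Rightarrow> 'b::{banach, second_countable_topology}"
  assumes X: "\<And>n. S2_process (X n)"
    and fast: "\<And>T. 0 \<le> T \<Longrightarrow> \<exists>A\<ge>0. \<forall>n. ES (\<lambda>t w. X (Suc n) t w - X n t w) T \<le> ennreal (A / 64^n)"
  obtains Y where "S2_process Y" "\<And>T. 0 \<le> T \<Longrightarrow> (\<lambda>n. ES (\<lambda>t w. X n t w - Y t w) T) \<longlonglongrightarrow> 0"
proof -
  define D where "D n t w = X (Suc n) t w - X n t w" for n t w
  define d where "d T n w = (SUP t\<in>{0..T}. ennreal ((norm (D n t w))\<^sup>2))" for T n w
  \<comment> \<open>Since 16/64 = 1/4, the weighted series has finite expectation; where it is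
    finite, the increments are at most a constant times 4^-n, uniformly in time.\<close>
  define g where "g T w = (\<Sum>n. ennreal (16^n) * d T n w)" for T w
  have D: "S2_process (D n)" for n unfolding D_def by (intro S2_diff X)
  have dm: "d T n \<in> borel_measurable M" if "0 \<le> T" for T n
    unfolding d_def by (rule sup_sq_measurable[OF S2_cont_adapted[OF D] that])
  have gm: "g T \<in> borel_measurable M" if "0 \<le> T" for T
    unfolding g_def using dm[OF that] by measurable
  have A: "\<exists>A\<ge>0. \<forall>n. (\<integral>\<^sup>+ w. d T n w \<partial>M) \<le> ennreal (A / 64^n)" if "0 \<le> T" for T
    using fast[OF that] unfolding d_def D_def .
  have "AE w in M. g T w \<noteq> \<infinity>" if T: "0 \<le> T" for T
  proof (rule nn_integral_noteq_infinite[OF gm[OF T]])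
    obtain A where A: "A \<ge> 0" "\<And>n. (\<integral>\<^sup>+ w. d T n w \<partial>M) \<le> ennreal (A / 64^n)" using A[OF T] by blast
    have "(\<integral>\<^sup>+ w. g T w \<partial>M) = (\<Sum>n. ennreal (16^n) * (\<integral>\<^sup>+ w. d T n w \<partial>M))"
      unfolding g_def using dm[OF T] by (subst nn_integral_suminf) (auto simp: nn_integral_cmult)
    also have "\<dots> \<le> (\<Sum>n. ennreal (A * (1/4)^n))"
    proof (rule suminf_le)
      fix n
      have "ennreal (16^n) * (\<integral>\<^sup>+ w. d T n w \<partial>M) \<le> ennreal (16^n) * ennreal (A / 64^n)"
        by (intro mult_left_mono A) auto
      also have "\<dots> = ennreal (A * (1/4)^n)"
      proof -
        have "(64::real)^n = 16^n * 4^n" by (simp flip: power_mult_distrib)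
        then show ?thesis using A by (simp add: power_one_over field_simps flip: ennreal_mult)
      qed
      finally show "ennreal (16^n) * (\<integral>\<^sup>+ w. d T n w \<partial>M) \<le> ennreal (A * (1/4)^n)" .
    qed auto
    also have "\<dots> < \<infinity>"
      using A by (subst suminf_ennreal2) (auto intro!: summable_mult summable_geometric)
    finally show "(\<integral>\<^sup>+ w. g T w \<partial>M) \<noteq> \<infinity>" by simp
  qed
  then have "AE w in M. \<forall>k::nat. g (real k) w \<noteq> \<infinity>" by (simp add: AE_all_countable)
  \<comment> \<open>Integer horizons suffice, so the exceptional set is a countable union of null
    sets and \<open>G\<close> belongs to every \<open>F t\<close>.\<close>
  moreover define G where "G = {w\<in>space M. \<forall>k::nat. g (real k) w \<noteq> \<infinity>}"
  ultimately have AEG: "AE w in M. w \<in> G" unfolding G_def by (auto intro: AE_mp[OF _ AE_I2])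
  have G_M: "G \<in> sets M" unfolding G_def using gm by measurable
  have G_F: "G \<in> sets (F t)" if "0 \<le> t" for t
  proof -
    have "{w\<in>space M. w \<in> G} = G" using G_def by auto
    then show ?thesis using AE_Ball_sets_F[OF AEG _ that] G_M by simp
  qed
  define Y where "Y t w = (if w \<in> G then X 0 t w + (\<Sum>n. D n t w) else 0)" for t w
  have X_sum: "X n t w = X 0 t w + (\<Sum>j<n. D j t w)" for n t w
    using sum_lessThan_telescope[of "\<lambda>j. X j t w" n] by (simp add: D_def)
  have unif: "uniform_limit {0..real k} (\<lambda>n t. X n t w) (\<lambda>t. Y t w) sequentially" if w: "w \<in> G" for k w
  proof -
    have "g (real k) w < \<infinity>" using w by (auto simp: G_def less_top)
    then obtain K where K: "g (real k) w = ennreal K" "K \<ge> 0" by (metis ennreal_cases infinity_ennreal_def less_irrefl)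
    have bd: "norm (D n t w) \<le> sqrt K * (1/4)^n" if t: "t \<in> {0..real k}" for n t
    proof -
      have "ennreal (16^n) * ennreal ((norm (D n t w))\<^sup>2) \<le> ennreal (16^n) * d (real k) n w"
        unfolding d_def by (intro mult_left_mono SUP_upper t) auto
      also have "\<dots> \<le> g (real k) w" unfolding g_def
        using sum_le_suminf[of "\<lambda>n. ennreal (16^n) * d (real k) n w" "{n}"] by simp
      finally have "16^n * (norm (D n t w))\<^sup>2 \<le> K" using K by (simp flip: ennreal_mult)
      then have "(4^n * norm (D n t w))\<^sup>2 \<le> K"
      proof -
        have "((4::real)^n)\<^sup>2 = 16^n" by (simp add: power2_eq_square flip: power_mult_distrib)
        then show "16^n * (norm (D n t w))\<^sup>2 \<le> K \<Longrightarrow> ?thesis" by (simp add: power_mult_distrib)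
      qed
      then have "4^n * norm (D n t w) \<le> sqrt K" by (rule real_le_rsqrt)
      then show ?thesis by (simp add: power_one_over field_simps)
    qed
    have "uniform_limit {0..real k} (\<lambda>n t. \<Sum>j<n. D j t w) (\<lambda>t. \<Sum>j. D j t w) sequentially"
      by (rule Weierstrass_m_test[OF bd]) (auto intro!: summable_mult summable_geometric)
    then have "uniform_limit {0..real k} (\<lambda>n t. X 0 t w + (\<Sum>j<n. D j t w)) (\<lambda>t. X 0 t w + (\<Sum>j. D j t w)) sequentially"
      by (intro uniform_limit_intros)
    then show ?thesis using w by (simp add: Y_def flip: X_sum)
  qed
  have lim: "(\<lambda>n. X n t w) \<longlonglongrightarrow> Y t w" if "w \<in> G" "0 \<le> t" for t w
  proof -
    obtain k :: nat where "t \<le> real k" using real_arch_simple by blast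
    then show ?thesis using tendsto_uniform_limitI[OF unif[OF that(1)], of t k] that by auto
  qed
  have Y_ca: "cont_adapted Y"
    unfolding cont_adapted_def
  proof (intro conjI allI impI ballI)
    fix t :: real assume t: "0 \<le> t"
    show "Y t \<in> borel_measurable (F t)"
    proof (rule borel_measurable_LIMSEQ_metric)
      show "(\<lambda>w. if w \<in> G then X n t w else 0) \<in> borel_measurable (F t)" for n
        using G_F[OF t] cont_adapted_F[OF S2_cont_adapted[OF X] t] by measurable
      show "(\<lambda>n. if w \<in> G then X n t w else 0) \<longlonglongrightarrow> Y t w" for w
        using lim[OF _ t] by (cases "w \<in> G") (auto simp: Y_def)
    qed
  next
    fix w assume w: "w \<in> space M"
    show "continuous_on {0..} (\<lambda>t. Y t w)"
    proof (cases "w \<in> G")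
      case True
      show ?thesis unfolding continuous_on_atLeast_iff
      proof (intro allI impI)
        fix T :: real assume "T \<ge> 0"
        obtain k :: nat where k: "T \<le> real k" using real_arch_simple by blast
        have "continuous_on {0..real k} (\<lambda>t. Y t w)"
          by (rule uniform_limit_theorem[OF _ unif[OF True]])
             (auto intro!: always_eventually cont_adapted_cont_Icc[OF S2_cont_adapted[OF X] w])
        then show "continuous_on {0..T} (\<lambda>t. Y t w)" by (rule continuous_on_subset) (use k in auto)
      qed
    qed (simp add: Y_def)
  qed
  have est: "\<exists>A\<ge>0. \<forall>n. ES (\<lambda>t w. X n t w - Y t w) T \<le> ennreal (A / 64^n)" if T: "0 \<le> T" for T
  proof -
    obtain A where A: "A \<ge> 0" "\<And>n. (\<integral>\<^sup>+ w. d T n w \<partial>M) \<le> ennreal (A / 64^n)" using A[OF T] by blast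
    have "ES (\<lambda>t w. X n t w - Y t w) T \<le> ennreal (4 * A / 64^n)" for n
    proof -
      \<comment> \<open>The integrand bounds the distance to every later iterate, with weights
        independent of how far away that iterate is, and hence also the distance to the
        limit.\<close>
      have "ES (\<lambda>t w. X n t w - Y t w) T \<le> (\<integral>\<^sup>+ w. (\<Sum>j. ennreal (2^(j+1)) * d T (n + j) w) \<partial>M)"
      proof (rule nn_integral_mono_AE, use AEG in eventually_elim, rule SUP_least)
        fix w t assume w: "w \<in> G" and t: "t \<in> {0..T}"
        have bd: "ennreal ((norm (X n t w - X (n + k) t w))\<^sup>2) \<le> (\<Sum>j. ennreal (2^(j+1)) * d T (n + j) w)" for k
        proof -
          have "X (n + k) t w - X n t w = (\<Sum>j<k. D (n + j) t w)"
            using sum_lessThan_telescope[of "\<lambda>j. X (n + j) t w" k] by (simp add: D_def)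
          then have "(norm (X n t w - X (n + k) t w))\<^sup>2 \<le> (\<Sum>j<k. norm (D (n + j) t w))\<^sup>2"
            by (metis norm_minus_commute norm_sum power_mono norm_ge_zero)
          also have "\<dots> \<le> (\<Sum>j<k. 2^(j+1) * (norm (D (n + j) t w))\<^sup>2)" by (rule sum_sq_weighted)
          finally have "ennreal ((norm (X n t w - X (n + k) t w))\<^sup>2) \<le> ennreal (\<Sum>j<k. 2^(j+1) * (norm (D (n + j) t w))\<^sup>2)"
            by (rule ennreal_leI)
          also have "\<dots> = (\<Sum>j<k. ennreal (2^(j+1)) * ennreal ((norm (D (n + j) t w))\<^sup>2))"
            by (subst sum_ennreal[symmetric]) (auto simp: ennreal_mult)
          also have "\<dots> \<le> (\<Sum>j<k. ennreal (2^(j+1)) * d T (n + j) w)"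
            unfolding d_def by (intro sum_mono mult_left_mono SUP_upper t) auto
          also have "\<dots> \<le> (\<Sum>j. ennreal (2^(j+1)) * d T (n + j) w)" by (intro sum_le_suminf) auto
          finally show ?thesis .
        qed
        have "(\<lambda>k. ennreal ((norm (X n t w - X (n + k) t w))\<^sup>2)) \<longlonglongrightarrow> ennreal ((norm (X n t w - Y t w))\<^sup>2)"
          using LIMSEQ_ignore_initial_segment[OF lim[OF w], of t n] t
          by (intro tendsto_ennrealI tendsto_intros) (auto simp: add.commute)
        then show "ennreal ((norm (X n t w - Y t w))\<^sup>2) \<le> (\<Sum>j. ennreal (2^(j+1)) * d T (n + j) w)"
          by (rule LIMSEQ_le_const2) (use bd in blast)
      qed
      also have "\<dots> = (\<Sum>j. ennreal (2^(j+1)) * (\<integral>\<^sup>+ w. d T (n + j) w \<partial>M))"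
        using dm[OF T] by (subst nn_integral_suminf) (auto simp: nn_integral_cmult)
      also have "\<dots> \<le> (\<Sum>j. ennreal (2 * A / 64^n * (1/32)^j))"
      proof (rule suminf_le)
        fix j
        have "ennreal (2^(j+1)) * (\<integral>\<^sup>+ w. d T (n + j) w \<partial>M) \<le> ennreal (2^(j+1)) * ennreal (A / 64^(n+j))"
          by (intro mult_left_mono A) auto
        also have "\<dots> = ennreal (2 * A / 64^n * (1/32)^j)"
        proof -
          have "(64::real)^j = 2^j * 32^j" by (simp flip: power_mult_distrib)
          then show ?thesis using A by (simp add: power_add power_one_over field_simps flip: ennreal_mult)
        qed
        finally show "ennreal (2^(j+1)) * (\<integral>\<^sup>+ w. d T (n + j) w \<partial>M) \<le> ennreal (2 * A / 64^n * (1/32)^j)" .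
      qed auto
      also have "\<dots> = ennreal (\<Sum>j. 2 * A / 64^n * (1/32)^j)"
        using A by (intro suminf_ennreal2) (auto intro!: summable_mult summable_geometric)
      \<comment> \<open>A geometric series with ratio 2/64; afterwards 2 * 32/31 is rounded up to
        4.\<close>
      also have "(\<Sum>j. 2 * A / 64^n * (1/32)^j) = 2 * A / 64^n * (32/31)"
        by (subst suminf_mult) (auto simp: suminf_geometric intro!: summable_geometric)
      also have "ennreal (2 * A / 64^n * (32/31)) \<le> ennreal (4 * A / 64^n)"
        using A by (intro ennreal_leI) (auto simp: field_simps)
      finally show ?thesis .
    qed
    then show ?thesis using A by (intro exI[of _ "4 * A"]) auto
  qed
  have conv: "(\<lambda>n. ES (\<lambda>t w. X n t w - Y t w) T) \<longlonglongrightarrow> 0" if T: "0 \<le> T" for T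
  proof -
    obtain A where A: "A \<ge> 0" "\<And>n. ES (\<lambda>t w. X n t w - Y t w) T \<le> ennreal (A / 64^n)" using est[OF T] by blast
    have "(\<lambda>n. ennreal (A * (1/64)^n)) \<longlonglongrightarrow> ennreal (A * 0)"
      by (intro tendsto_ennrealI tendsto_intros LIMSEQ_power_zero) auto
    then have "(\<lambda>n. ennreal (A / 64^n)) \<longlonglongrightarrow> 0"
      by (simp only: power_one_over times_divide_eq_right mult_1_right mult_zero_right ennreal_0)
    then show ?thesis
      by (rule tendsto_sandwich[OF always_eventually always_eventually tendsto_const, rotated 2])
         (simp_all only: zero_le A(2) simp_thms)
  qed
  have "S2_process Y"
    unfolding S2_process_def
  proof (intro conjI Y_ca allI impI)
    fix T :: real assume T: "0 \<le> T"
    obtain A where A: "A \<ge> 0" "\<And>n. ES (\<lambda>t w. X n t w - Y t w) T \<le> ennreal (A / 64^n)" using est[OF T] by blast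
    have "ES Y T \<le> ennreal 0 + ennreal 2 * ES (X 0) T + ennreal 2 * ES (\<lambda>t w. X 0 t w - Y t w) T"
    proof (rule ES_mono_le[OF S2_cont_adapted[OF X] cont_adapted_diff[OF S2_cont_adapted[OF X] Y_ca] T], goal_cases)
      case 4
      have "(norm (Y t w))\<^sup>2 \<le> 2 * (norm (X 0 t w))\<^sup>2 + 2 * (norm (X 0 t w - Y t w))\<^sup>2" for t w
        using power2_norm_add_le[of "X 0 t w" "- (X 0 t w - Y t w)"] by (simp add: norm_minus_commute)
      then show ?case by simp
    qed auto
    also have "\<dots> < \<infinity>"
      using S2_ES[OF X T, of 0] le_less_trans[OF A(2)[of 0]] by (simp add: ennreal_mult_less_top)
    finally show "ES Y T < \<infinity>" .
  qed
  then show thesis using that conv by blast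
qed

subsection \<open>Square-integrable martingales\<close>

lemma integrable_mult_L2:
  fixes f g :: "'w \<Rightarrow> real"
  assumes "f \<in> borel_measurable M" "g \<in> borel_measurable M"
    "integrable M (\<lambda>w. (f w)\<^sup>2)" "integrable M (\<lambda>w. (g w)\<^sup>2)"
  shows "integrable M (\<lambda>w. f w * g w)"
proof (rule Bochner_Integration.integrable_bound)
  show "integrable M (\<lambda>w. (f w)\<^sup>2 + (g w)\<^sup>2)" using assms by simp
  show "AE w in M. norm (f w * g w) \<le> norm ((f w)\<^sup>2 + (g w)\<^sup>2)"
  proof (rule AE_I2)
    fix w
    have "2 * \<bar>f w\<bar> * \<bar>g w\<bar> \<le> (f w)\<^sup>2 + (g w)\<^sup>2" using sum_squares_bound[of "\<bar>f w\<bar>" "\<bar>g w\<bar>"] by simp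
    moreover have "0 \<le> \<bar>f w\<bar> * \<bar>g w\<bar>" by simp
    ultimately show "norm (f w * g w) \<le> norm ((f w)\<^sup>2 + (g w)\<^sup>2)" unfolding real_norm_def abs_mult by linarith
  qed
qed (use assms in measurable)

text \<open>Truncating \<open>Z\<close> at height \<open>n\<close> gives admissible bounded
  multipliers. The products are dominated by that of \<open>Z\<close> and \<open>D\<close>, which is
  integrable because both are square-integrable.\<close>

lemma orthogonal_L2_multiplier:
  fixes D Z :: "'w \<Rightarrow> real"
  assumes s: "0 \<le> s" and D: "D \<in> borel_measurable M" "integrable M (\<lambda>w. (D w)\<^sup>2)"
    and orth: "\<And>c K. c \<in> borel_measurable (F s) \<Longrightarrow> (\<And>w. \<bar>c w\<bar> \<le> K) \<Longrightarrow> (\<integral>w. c w * D w \<partial>M) = 0"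
    and Z: "Z \<in> borel_measurable (F s)" "integrable M (\<lambda>w. (Z w)\<^sup>2)"
  shows "integrable M (\<lambda>w. Z w * D w)" "(\<integral>w. Z w * D w \<partial>M) = 0"
proof -
  have ZM: "Z \<in> borel_measurable M" using measurable_F_M[OF s Z(1)] .
  show i: "integrable M (\<lambda>w. Z w * D w)" by (rule integrable_mult_L2[OF ZM D(1) Z(2) D(2)])
  define c where "c n w = max (- real n) (min (real n) (Z w))" for n w
  have cm: "c n \<in> borel_measurable (F s)" for n unfolding c_def using Z(1) by measurable
  have cM: "c n \<in> borel_measurable M" for n using measurable_F_M[OF s cm] .
  have "(\<lambda>n. \<integral>w. c n w * D w \<partial>M) \<longlonglongrightarrow> (\<integral>w. Z w * D w \<partial>M)"
  proof (rule integral_dominated_convergence[where w = "\<lambda>w. norm (Z w * D w)"])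
    show "AE w in M. (\<lambda>n. c n w * D w) \<longlonglongrightarrow> Z w * D w"
    proof (rule AE_I2, intro tendsto_intros)
      fix w
      obtain N :: nat where "\<bar>Z w\<bar> \<le> real N" using real_arch_simple by blast
      then have "\<forall>\<^sub>F n in sequentially. c n w = Z w"
        unfolding eventually_sequentially c_def by (intro exI[of _ N]) auto
      then show "(\<lambda>n. c n w) \<longlonglongrightarrow> Z w" by (rule tendsto_eventually)
    qed
    show "AE w in M. norm (c n w * D w) \<le> norm (Z w * D w)" for n
      by (rule AE_I2) (auto simp: abs_mult c_def intro!: mult_right_mono)
  qed (use cM D ZM integrable_norm[OF i] in measurable)
  moreover have "(\<integral>w. c n w * D w \<partial>M) = 0" for n
    by (rule orth[OF cm, of _ "real n"]) (auto simp: c_def)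
  ultimately show "(\<integral>w. Z w * D w \<partial>M) = 0" by (simp add: LIMSEQ_const_iff)
qed

text \<open>The martingale property is expressed by orthogonality of the increments to bounded
  variables of the past. This avoids conditional expectations and passes easily to limits.\<close>

definition L2_martingale :: "(real \<Rightarrow> 'w \<Rightarrow> real) \<Rightarrow> bool" where
  "L2_martingale S \<longleftrightarrow> (\<forall>t\<ge>0. S t \<in> borel_measurable (F t) \<and> integrable M (\<lambda>w. (S t w)\<^sup>2)) \<and>
     (\<forall>s t c K. 0 \<le> s \<longrightarrow> s \<le> t \<longrightarrow> c \<in> borel_measurable (F s) \<longrightarrow> (\<forall>w. \<bar>c w\<bar> \<le> K) \<longrightarrow>
        (\<integral>w. c w * (S t w - S s w) \<partial>M) = 0)"

lemma L2_martingale_multiplier: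
  assumes S: "L2_martingale S" and st: "0 \<le> s" "s \<le> t"
    and Z: "Z \<in> borel_measurable (F s)" "integrable M (\<lambda>w. (Z w)\<^sup>2)"
  shows "integrable M (\<lambda>w. Z w * (S t w - S s w))" "(\<integral>w. Z w * (S t w - S s w) \<partial>M) = 0"
    "integrable M (\<lambda>w. (S t w - S s w)\<^sup>2)"
proof -
  have S2: "S s \<in> borel_measurable M" "S t \<in> borel_measurable M"
    "integrable M (\<lambda>w. (S s w)\<^sup>2)" "integrable M (\<lambda>w. (S t w)\<^sup>2)"
  proof -
    have "\<forall>t\<ge>0. S t \<in> borel_measurable (F t) \<and> integrable M (\<lambda>w. (S t w)\<^sup>2)"
      using S unfolding L2_martingale_def by blast
    then show "S s \<in> borel_measurable M" "S t \<in> borel_measurable M"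
      "integrable M (\<lambda>w. (S s w)\<^sup>2)" "integrable M (\<lambda>w. (S t w)\<^sup>2)"
      using measurable_F_M[OF st(1), of "S s" borel] measurable_F_M[OF order_trans[OF st], of "S t" borel]
        st order_trans[OF st] by blast+
  qed
  have "integrable M (\<lambda>w. (S t w)\<^sup>2 - 2 * (S t w * S s w) + (S s w)\<^sup>2)"
    using integrable_mult_L2[OF S2(2,1,4,3)] S2 by simp
  then show i: "integrable M (\<lambda>w. (S t w - S s w)\<^sup>2)" by (simp add: power2_diff algebra_simps)
  have m: "(\<lambda>w. S t w - S s w) \<in> borel_measurable M" using S2 by measurable
  have o: "(\<integral>w. c w * (S t w - S s w) \<partial>M) = 0"
    if "c \<in> borel_measurable (F s)" "\<And>w. \<bar>c w\<bar> \<le> K" for c K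
    using S st that unfolding L2_martingale_def by blast
  show "integrable M (\<lambda>w. Z w * (S t w - S s w))"
    by (rule orthogonal_L2_multiplier(1)[OF st(1) m i _ Z], rule o, assumption+)
  show "(\<integral>w. Z w * (S t w - S s w) \<partial>M) = 0"
    by (rule orthogonal_L2_multiplier(2)[OF st(1) m i _ Z], rule o, assumption+)
qed

end

section \<open>Doob's maximal inequality\<close>

text \<open>A deterministic form of Doob's inequality: \<open>m\<close> is the running maximum, and
  the sum is a discrete integral of \<open>m\<close> against \<open>s\<close>, whose expectation is
  controlled later. The factor 4 comes from \<open>(2 * s n - m n)\<^sup>2 \<ge> 0\<close>.\<close>

lemma doob_pathwise:
  fixes s m :: "nat \<Rightarrow> real"
  assumes s: "\<And>k. 0 \<le> s k" and m0: "m 0 = s 0" and mS: "\<And>k. m (Suc k) = max (m k) (s (Suc k))"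
  shows "(m n)\<^sup>2 + 4 * (\<Sum>k<n. m k * (s (Suc k) - s k)) \<le> 4 * (s n)\<^sup>2"
proof -
  \<comment> \<open>Summation by parts for the maximum: while the maximum stays the bound is
    preserved exactly, and when it is renewed the slack is half of a square.\<close>
  have *: "(\<Sum>k<n. m k * (s (Suc k) - s k)) \<le> m n * s n - (m n)\<^sup>2 / 2"
  proof (induction n)
    case 0
    then show ?case by (simp add: m0 power2_eq_square)
  next
    case (Suc n)
    have "(\<Sum>k<Suc n. m k * (s (Suc k) - s k)) \<le> m n * s (Suc n) - (m n)\<^sup>2 / 2"
      using Suc by (simp add: algebra_simps)
    also have "\<dots> \<le> m (Suc n) * s (Suc n) - (m (Suc n))\<^sup>2 / 2"
    proof (cases "s (Suc n) \<le> m n")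
      case False
      have "0 \<le> (s (Suc n) - m n)\<^sup>2" by simp
      then show ?thesis using False mS[of n] by (simp add: power2_eq_square algebra_simps)
    qed (use mS[of n] in simp)
    finally show ?case .
  qed
  have "0 \<le> (2 * s n - m n)\<^sup>2" by simp
  then show ?thesis using * by (simp add: power2_eq_square algebra_simps)
qed

context stochastic_basis
begin

text \<open>The absolute value is convex: its increment dominates the increment of \<open>S\<close>
  times the sign at the left endpoint. So the sum in the pathwise inequality is bounded below by a
  martingale transform of mean zero.\<close>

lemma doob_discrete:
  assumes S: "L2_martingale S" and t: "\<And>k. 0 \<le> t k" "\<And>k. t k \<le> t (Suc k)"
  shows "(\<integral>\<^sup>+ w. (SUP k\<in>{..n}. ennreal ((S (t k) w)\<^sup>2)) \<partial>M) \<le> 4 * (\<integral>\<^sup>+ w. ennreal ((S (t n) w)\<^sup>2) \<partial>M)"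
proof -
  define s where "s k w = \<bar>S (t k) w\<bar>" for k w
  define m where "m k w = rec_nat (s 0 w) (\<lambda>k y. max y (s (Suc k) w)) k" for k w
  have m0: "m 0 w = s 0 w" and mS: "m (Suc k) w = max (m k w) (s (Suc k) w)" for k w
    by (simp_all add: m_def)
  have mono: "t j \<le> t k" if "j \<le> k" for j k by (rule lift_Suc_mono_le[of t, OF t(2) that])
  have SF: "S (t k) \<in> borel_measurable (F (t k))" and SI: "integrable M (\<lambda>w. (S (t k) w)\<^sup>2)" for k
    using S t(1) unfolding L2_martingale_def by auto
  have sF: "s j \<in> borel_measurable (F (t k))" if "j \<le> k" for j k
    using measurable_F_mono[OF t(1) mono[OF that] SF] unfolding s_def by measurable
  have mF: "m j \<in> borel_measurable (F (t k))" if "j \<le> k" for j k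
    using that
  proof (induction j)
    case 0 then show ?case using sF[of 0 k] by (simp add: m0)
  next
    case (Suc j) then show ?case using sF[of "Suc j" k] by (simp add: mS)
  qed
  have s_le: "s j w \<le> m k w" if "j \<le> k" for j k w
    using that by (induction k) (auto simp: m0 mS le_Suc_eq)
  have m_nn: "0 \<le> m k w" for k w using s_le[of 0 k w] by (auto simp: s_def intro: order_trans)
  have mI: "integrable M (\<lambda>w. (m k w)\<^sup>2)" for k
  proof (induction k)
    case 0 then show ?case using SI[of 0] by (simp add: m0 s_def)
  next
    case (Suc k)
    show ?case
    proof (rule Bochner_Integration.integrable_bound)
      show "integrable M (\<lambda>w. (m k w)\<^sup>2 + (S (t (Suc k)) w)\<^sup>2)" using Suc SI by simp
      show "(\<lambda>w. (m (Suc k) w)\<^sup>2) \<in> borel_measurable M"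
        using measurable_F_M[OF t(1) mF[OF order_refl]] by measurable
    qed (auto simp: mS max_def s_def)
  qed
  define N where "N k w = m k w * (s (Suc k) w - s k w)" for k w
  define L where "L k w = (m k w * sgn (S (t k) w)) * (S (t (Suc k)) w - S (t k) w)" for k w
  have LN: "L k w \<le> N k w" for k w
  proof -
    have "sgn x * (y - x) \<le> \<bar>y\<bar> - \<bar>x\<bar>" for x y :: real by (auto simp: sgn_if)
    then show ?thesis unfolding L_def N_def s_def mult.assoc by (intro mult_left_mono m_nn)
  qed
  have L: "integrable M (L k)" "(\<integral>w. L k w \<partial>M) = 0" for k
  proof -
    have Zm: "(\<lambda>w. m k w * sgn (S (t k) w)) \<in> borel_measurable (F (t k))"
      using mF[of k k] SF[of k] by measurable
    have ZI: "integrable M (\<lambda>w. (m k w * sgn (S (t k) w))\<^sup>2)"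
    proof (rule Bochner_Integration.integrable_bound[OF mI[of k]])
      show "(\<lambda>w. (m k w * sgn (S (t k) w))\<^sup>2) \<in> borel_measurable M"
        using measurable_F_M[OF t(1) Zm] by measurable
    qed (auto simp: power_mult_distrib sgn_if)
    show "integrable M (L k)" "(\<integral>w. L k w \<partial>M) = 0"
      using L2_martingale_multiplier[OF S t(1) t(2) Zm ZI] unfolding L_def by blast+
  qed
  have pw: "(m n w)\<^sup>2 \<le> 4 * (S (t n) w)\<^sup>2 - 4 * (\<Sum>k<n. L k w)" for w
  proof -
    have "(m n w)\<^sup>2 + 4 * (\<Sum>k<n. N k w) \<le> 4 * (s n w)\<^sup>2"
      unfolding N_def by (rule doob_pathwise) (auto simp: m0 mS s_def)
    moreover have "(\<Sum>k<n. L k w) \<le> (\<Sum>k<n. N k w)" by (intro sum_mono LN)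
    ultimately show ?thesis by (simp add: s_def)
  qed
  have "(\<integral>w. (m n w)\<^sup>2 \<partial>M) \<le> (\<integral>w. 4 * (S (t n) w)\<^sup>2 - 4 * (\<Sum>k<n. L k w) \<partial>M)"
    by (rule integral_mono) (use mI SI L pw in auto)
  also have "\<dots> = 4 * (\<integral>w. (S (t n) w)\<^sup>2 \<partial>M)" using SI L by simp
  finally have I: "(\<integral>w. (m n w)\<^sup>2 \<partial>M) \<le> 4 * (\<integral>w. (S (t n) w)\<^sup>2 \<partial>M)" .
  have "(\<integral>\<^sup>+ w. (SUP k\<in>{..n}. ennreal ((S (t k) w)\<^sup>2)) \<partial>M) \<le> (\<integral>\<^sup>+ w. ennreal ((m n w)\<^sup>2) \<partial>M)"
  proof (intro nn_integral_mono SUP_least ennreal_leI)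
    fix w k assume "k \<in> {..n}"
    then have "s k w \<le> m n w" by (auto intro: s_le)
    then have "(s k w)\<^sup>2 \<le> (m n w)\<^sup>2" by (intro power_mono) (auto simp: s_def)
    then show "(S (t k) w)\<^sup>2 \<le> (m n w)\<^sup>2" by (simp add: s_def)
  qed
  also have "\<dots> = ennreal (\<integral>w. (m n w)\<^sup>2 \<partial>M)" by (rule nn_integral_eq_integral[OF mI]) auto
  also have "\<dots> \<le> ennreal (4 * (\<integral>w. (S (t n) w)\<^sup>2 \<partial>M))" using I by (rule ennreal_leI)
  also have "\<dots> = 4 * ennreal (\<integral>w. (S (t n) w)\<^sup>2 \<partial>M)" by (simp add: ennreal_mult)
  also have "ennreal (\<integral>w. (S (t n) w)\<^sup>2 \<partial>M) = (\<integral>\<^sup>+ w. ennreal ((S (t n) w)\<^sup>2) \<partial>M)"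
    by (rule nn_integral_eq_integral[OF SI, symmetric]) auto
  finally show ?thesis .
qed

lemma doob_continuous:
  assumes S: "L2_martingale S" and c: "cont_adapted S" and T: "0 \<le> T"
  shows "ES S T \<le> 4 * (\<integral>\<^sup>+ w. ennreal ((S T w)\<^sup>2) \<partial>M)"
proof -
  define u where "u n w = (SUP k\<in>{..n}. ennreal ((norm (S (T * real k / real n) w))\<^sup>2))" for n w
  have um: "u n \<in> borel_measurable M" for n
    unfolding u_def
  proof (intro borel_measurable_SUP countableI_type)
    fix k :: nat assume "k \<in> {..n}"
    then have [measurable]: "S (T * real k / real n) \<in> borel_measurable M"
      using grid_in_Icc[OF T, of k n] by (intro cont_adapted_M[OF c]) auto
    show "(\<lambda>w. ennreal ((norm (S (T * real k / real n) w))\<^sup>2)) \<in> borel_measurable M" by measurable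
  qed
  have "ES S T \<le> (\<integral>\<^sup>+ w. liminf (\<lambda>n. u n w) \<partial>M)"
    unfolding u_def
    by (intro nn_integral_mono sup_sq_grid(2)) (use cont_adapted_cont_Icc[OF c] T in auto)
  also have "\<dots> \<le> liminf (\<lambda>n. \<integral>\<^sup>+ w. u n w \<partial>M)" by (rule nn_integral_liminf[OF um])
  also have "\<dots> \<le> liminf (\<lambda>n. 4 * (\<integral>\<^sup>+ w. ennreal ((S T w)\<^sup>2) \<partial>M))"
  proof (rule Liminf_mono, rule eventually_sequentiallyI[of 1])
    \<comment> \<open>For \<open>n = 0\<close> the grid collapses to time zero and does not end at
      \<open>T\<close>.\<close>
    fix n :: nat assume n: "1 \<le> n"
    have "(\<integral>\<^sup>+ w. (SUP k\<in>{..n}. ennreal ((S (T * real k / real n) w)\<^sup>2)) \<partial>M)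
      \<le> 4 * (\<integral>\<^sup>+ w. ennreal ((S (T * real n / real n) w)\<^sup>2) \<partial>M)"
      by (rule doob_discrete[OF S]) (use T n in \<open>auto simp: divide_right_mono mult_left_mono\<close>)
    then show "(\<integral>\<^sup>+ w. u n w \<partial>M) \<le> 4 * (\<integral>\<^sup>+ w. ennreal ((S T w)\<^sup>2) \<partial>M)"
      using n by (simp add: u_def)
  qed
  also have "\<dots> = 4 * (\<integral>\<^sup>+ w. ennreal ((S T w)\<^sup>2) \<partial>M)" by (simp add: Liminf_const)
  finally show ?thesis .
qed

end

subsection \<open>Localisation by decreasing predicates\<close>

text \<open>A left-continuous step approximation of time: \<open>left_grid t m s < s\<close> for \<open>0 < s \<le> t\<close>, and it is
  constant on the intervals \<open>(t k / n, t (k + 1) / n]\<close> with \<open>n = m + 1\<close>.\<close>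

definition left_grid :: "real \<Rightarrow> nat \<Rightarrow> real \<Rightarrow> real" where
  "left_grid t m s = max 0 (t * (real_of_int \<lceil>real (Suc m) * s / t\<rceil> - 1) / real (Suc m))"

lemma left_grid:
  assumes "0 < s" "0 < t"
  shows "0 \<le> left_grid t m s" "left_grid t m s < s" "s - t / real (Suc m) \<le> left_grid t m s"
proof -
  let ?n = "real (Suc m)"
  have t: "t > 0" using assms by simp
  have 1: "real_of_int \<lceil>?n * s / t\<rceil> - 1 < ?n * s / t" "?n * s / t \<le> real_of_int \<lceil>?n * s / t\<rceil>" by linarith+
  have "t * (real_of_int \<lceil>?n * s / t\<rceil> - 1) / ?n < t * (?n * s / t) / ?n"
    using t 1 by (intro divide_strict_right_mono mult_strict_left_mono) auto
  also have "\<dots> = s" using t by simp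
  finally show "left_grid t m s < s" using assms by (simp add: left_grid_def)
  have "t * (?n * s / t - 1) / ?n \<le> t * (real_of_int \<lceil>?n * s / t\<rceil> - 1) / ?n"
    using t 1 by (intro divide_right_mono mult_left_mono) auto
  moreover have "t * (n * s / t - 1) / n = s - t / n" if "n > 0" for n
    using t that by (simp add: field_simps)
  then have "t * (?n * s / t - 1) / ?n = s - t / ?n" by simp
  ultimately show "s - t / ?n \<le> left_grid t m s" unfolding left_grid_def by linarith
qed (simp add: left_grid_def)

lemma left_grid_on_interval:
  assumes t: "t > 0" and s: "t * real k / real (Suc m) < s" "s \<le> t * real (Suc k) / real (Suc m)"
  shows "left_grid t m s = t * real k / real (Suc m)"
proof -
  have "\<lceil>real (Suc m) * s / t\<rceil> = int k + 1"
  proof (rule ceiling_unique)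
    show "real_of_int (int k + 1) - 1 < real (Suc m) * s / t" using s t by (simp add: field_simps)
    show "real (Suc m) * s / t \<le> real_of_int (int k + 1)" using s t by (simp add: field_simps)
  qed
  then show ?thesis using t by (simp add: left_grid_def max_def)
qed

lemma left_grid_tendsto:
  assumes "0 < s" "0 < t"
  shows "(\<lambda>m. left_grid t m s) \<longlonglongrightarrow> s"
proof (rule LIM_zero_cancel, rule Lim_null_comparison)
  show "(\<lambda>m. t * inverse (real (Suc m))) \<longlonglongrightarrow> 0"
    by (intro tendsto_mult_right_zero LIMSEQ_inverse_real_of_nat)
  show "\<forall>\<^sub>F m in sequentially. norm (left_grid t m s - s) \<le> t * inverse (real (Suc m))"
    using left_grid[OF assms] by (intro always_eventually allI) (auto simp: abs_if divide_inverse less_imp_le algebra_simps)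
qed

context stochastic_basis
begin

text \<open>Localisation without stopping times: \<open>P t w\<close> reads ``\<open>w\<close> has not been stopped by time \<open>t\<close>'',
  for instance because the path has stayed in a ball up to \<open>t\<close>.\<close>

definition killing :: "(real \<Rightarrow> 'w \<Rightarrow> bool) \<Rightarrow> bool" where
  "killing P \<longleftrightarrow> (\<forall>t\<ge>0. {w\<in>space M. P t w} \<in> sets (F t)) \<and>
     (\<forall>s t w. 0 \<le> s \<longrightarrow> s \<le> t \<longrightarrow> P t w \<longrightarrow> P s w) \<and>
     (\<forall>t>0. \<forall>w\<in>space M. (\<forall>s\<in>{0..<t}. P s w) \<longrightarrow> P t w)"

lemma killing_F: "killing P \<Longrightarrow> 0 \<le> t \<Longrightarrow> {w\<in>space M. P t w} \<in> sets (F t)"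
  by (simp add: killing_def)

lemma killing_M: "killing P \<Longrightarrow> 0 \<le> t \<Longrightarrow> {w\<in>space M. P t w} \<in> sets M"
  using killing_F sets_F_M by blast

lemma killing_mono: "killing P \<Longrightarrow> 0 \<le> s \<Longrightarrow> s \<le> t \<Longrightarrow> P t w \<Longrightarrow> P s w"
  unfolding killing_def by blast

lemma killing_left: "killing P \<Longrightarrow> 0 < t \<Longrightarrow> w \<in> space M \<Longrightarrow> (\<And>s. 0 \<le> s \<Longrightarrow> s < t \<Longrightarrow> P s w) \<Longrightarrow> P t w"
  unfolding killing_def by (metis atLeastLessThan_iff)

lemma killing_conj:
  assumes "killing P" "killing P'"
  shows "killing (\<lambda>t w. P t w \<and> P' t w)"
  unfolding killing_def
proof (intro conjI allI impI ballI)
  fix t :: real assume t: "0 \<le> t"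
  have "{w\<in>space M. P t w \<and> P' t w} = {w\<in>space M. P t w} \<inter> {w\<in>space M. P' t w}" by auto
  then show "{w\<in>space M. P t w \<and> P' t w} \<in> sets (F t)"
    using killing_F[OF assms(1) t] killing_F[OF assms(2) t] by auto
next
  fix s t w assume "0 \<le> s" "s \<le> t" "P t w \<and> P' t w"
  then show "P s w" "P' s w" using assms killing_mono by blast+
next
  fix t w assume *: "0 < t" "w \<in> space M" "\<forall>s\<in>{0..<t}. P s w \<and> P' s w"
  show "P t w" by (rule killing_left[OF assms(1) *(1,2)]) (use *(3) in auto)
  show "P' t w" by (rule killing_left[OF assms(2) *(1,2)]) (use *(3) in auto)
qed

text \<open>Grid points approach a positive \<open>s\<close> strictly from the left. A path dead at
  \<open>s\<close> was dead at some earlier \<open>r\<close>, by the last clause of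
  \<open>killing\<close>, and the grid points eventually pass \<open>r\<close>.\<close>

lemma killing_grid_lim:
  assumes P: "killing P" and s: "0 \<le> s" "s \<le> t" and w: "w \<in> space M"
  shows "\<forall>\<^sub>F m in sequentially. P (left_grid t m s) w \<longleftrightarrow> P s w"
proof (cases "s = 0")
  case True
  then have "left_grid t m s = 0" for m using s by (simp add: left_grid_def mult_nonneg_nonpos divide_nonpos_pos)
  then show ?thesis using True by simp
next
  case False
  then have s0: "0 < s" using s by simp
  note lg = left_grid[OF s0 less_le_trans[OF s0 s(2)]]
  show ?thesis
  proof (cases "P s w")
    case True
    then show ?thesis using killing_mono[OF P lg(1) less_imp_le[OF lg(2)]] by simp
  next
    case False
    then obtain r where r: "0 \<le> r" "r < s" "\<not> P r w" using killing_left[OF P s0 w] by blast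
    have "\<forall>\<^sub>F m in sequentially. r < left_grid t m s"
      using left_grid_tendsto[OF s0 less_le_trans[OF s0 s(2)]] r(2) by (rule order_tendstoD(1))
    then show ?thesis
      by eventually_elim (use False r killing_mono[OF P r(1)] in \<open>auto dest: less_imp_le\<close>)
  qed
qed

lemma killing_grid_measurable:
  assumes P: "killing P"
  shows "Measurable.pred (PT t) (\<lambda>x. P (left_grid t m (fst x)) (snd x))"
proof -
  let ?Q = "\<lambda>(i::int) x. P (max 0 (t * (real_of_int i - 1) / real (Suc m))) (snd x)"
  have "(\<lambda>x. ?Q \<lceil>real (Suc m) * fst x / t\<rceil> x) \<in> PT t \<rightarrow>\<^sub>M count_space UNIV"
  proof (rule measurable_compose_countable[where f = ?Q])
    fix i
    have "Measurable.pred M (P (max 0 (t * (real_of_int i - 1) / real (Suc m))))"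
      using killing_M[OF P] by (simp add: pred_def)
    then show "?Q i \<in> PT t \<rightarrow>\<^sub>M count_space UNIV"
      unfolding PT_def by (rule measurable_compose[OF measurable_snd])
    have "(\<lambda>s. \<lceil>real (Suc m) * s / t\<rceil>) \<in> restrict_space lborel {0..t} \<rightarrow>\<^sub>M count_space UNIV"
      by (intro measurable_restrict_space1) measurable
    then show "(\<lambda>x. \<lceil>real (Suc m) * fst x / t\<rceil>) \<in> PT t \<rightarrow>\<^sub>M count_space UNIV"
      unfolding PT_def by (rule measurable_compose[OF measurable_fst])
  qed
  then show ?thesis by (simp add: left_grid_def)
qed

text \<open>Measurability at each single time does not give joint measurability; it is obtained here
  as a limit of the grid approximations.\<close>

lemma killing_measurable_PT:
  assumes P: "killing P"
  shows "Measurable.pred (PT t) (\<lambda>x. P (fst x) (snd x))"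
proof -
  have "(\<lambda>x. of_bool (P (fst x) (snd x)) :: real) \<in> borel_measurable (PT t)"
  proof (rule borel_measurable_LIMSEQ_metric)
    show "(\<lambda>x. of_bool (P (left_grid t m (fst x)) (snd x)) :: real) \<in> borel_measurable (PT t)" for m
      using killing_grid_measurable[OF P] by measurable
    fix x assume "x \<in> space (PT t)"
    then have "\<forall>\<^sub>F m in sequentially. P (left_grid t m (fst x)) (snd x) \<longleftrightarrow> P (fst x) (snd x)"
      by (intro killing_grid_lim[OF P]) (auto simp: space_PT)
    then show "(\<lambda>m. of_bool (P (left_grid t m (fst x)) (snd x)) :: real) \<longlonglongrightarrow> of_bool (P (fst x) (snd x))"
      by (intro tendsto_eventually) (auto elim: eventually_mono)
  qed
  then have "Measurable.pred (PT t) (\<lambda>x. (of_bool (P (fst x) (snd x)) :: real) = 1)" by measurable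
  then show ?thesis by simp
qed

text \<open>Freeze the predicate at the left endpoint of each grid interval. On an event of the past
  the cross term between the current value and the next increment vanishes, so the surviving second
  moment grows by at most the bound for that increment. Refining the grid gives the claim, with
  \<open>q\<close> as integrable majorant.\<close>

lemma killing_isometry:
  fixes I :: "real \<Rightarrow> 'w \<Rightarrow> real" and q :: "real \<Rightarrow> 'w \<Rightarrow> ennreal"
  assumes P: "killing P" and I: "L2_martingale I" and I0: "AE w in M. I 0 w = 0"
    and t: "0 \<le> t"
    and q: "(\<lambda>x. q (fst x) (snd x)) \<in> borel_measurable (PT t)" and fin: "EI t q < \<infinity>"
    and iso: "\<And>s u A. 0 \<le> s \<Longrightarrow> s \<le> u \<Longrightarrow> u \<le> t \<Longrightarrow> A \<in> sets (F s) \<Longrightarrow>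
       (\<integral>\<^sup>+ w\<in>A. ennreal ((I u w - I s w)\<^sup>2) \<partial>M) \<le> (\<integral>\<^sup>+ w\<in>A. (\<integral>\<^sup>+ r\<in>{s<..u}. q r w \<partial>lborel) \<partial>M)"
  shows "(\<integral>\<^sup>+ w. (if P t w then ennreal ((I t w)\<^sup>2) else 0) \<partial>M) \<le> EI t (\<lambda>s w. if P s w then q s w else 0)"
proof (cases "t = 0")
  case True
  have "(\<integral>\<^sup>+ w. (if P t w then ennreal ((I t w)\<^sup>2) else 0) \<partial>M) = (\<integral>\<^sup>+ w. 0 \<partial>M)"
    using I0 True by (intro nn_integral_cong_AE) (auto elim!: eventually_mono)
  then show ?thesis by simp
next
  case False
  then have t0: "0 < t" using t by simp
  have grid: "(\<integral>\<^sup>+ w. (if P t w then ennreal ((I t w)\<^sup>2) else 0) \<partial>M)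
      \<le> EI t (\<lambda>s w. if P (left_grid t m s) w then q s w else 0)" for m
  proof -
    define \<tau> where "\<tau> k = t * real k / real (Suc m)" for k
    define f where "f s w = (if P (left_grid t m s) w then q s w else 0)" for s w
    have fm: "(\<lambda>x. f (fst x) (snd x)) \<in> borel_measurable (PT t)"
      unfolding f_def using killing_grid_measurable[OF P] q by measurable
    have \<tau>: "0 \<le> \<tau> k" "\<tau> k \<le> \<tau> (Suc k)" for k
      unfolding \<tau>_def using t0 by (auto intro!: divide_right_mono mult_left_mono)
    have \<tau>t: "\<tau> k \<le> t" if "k \<le> Suc m" for k
      using grid_in_Icc[OF t that] by (simp add: \<tau>_def)
    have fs: "(\<lambda>s. f s w * indicator {0..t} s) \<in> borel_measurable lborel" if "w \<in> space M" for w
    proof -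
      have "(\<lambda>s. f s w) \<in> borel_measurable (restrict_space lborel {0..t})"
        using measurable_compose[OF measurable_Pair2'[OF that] fm[unfolded PT_def]] by simp
      then show ?thesis by (simp add: borel_measurable_restrict_space_iff_ennreal)
    qed
    have fI: "(\<lambda>s. f s w * indicator B s) \<in> borel_measurable lborel"
      if "w \<in> space M" "B \<subseteq> {0..t}" "B \<in> sets borel" for w B
    proof -
      have "(\<lambda>s. f s w * indicator {0..t} s * indicator B s) \<in> borel_measurable lborel"
        using fs[OF that(1)] that(3) by measurable
      moreover have "f s w * indicator {0..t} s * indicator B s = f s w * indicator B s" for s
        using that(2) by (auto split: split_indicator)
      ultimately show ?thesis by simp
    qed
    have fM: "(\<lambda>w. \<integral>\<^sup>+ s\<in>{a<..b}. f s w \<partial>lborel) \<in> borel_measurable M" if "0 \<le> a" "b \<le> t" for a b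
    proof -
      have i: "Measurable.pred (PT t) (\<lambda>x. fst x \<in> {a<..b})"
      proof -
        have "Measurable.pred (restrict_space lborel {0..t}) (\<lambda>s. s \<in> {a<..b})"
          by (intro measurable_restrict_space1) simp
        then show ?thesis unfolding PT_def by (rule measurable_compose[OF measurable_fst])
      qed
      have "(\<lambda>x. (if fst x \<in> {a<..b} then f (fst x) (snd x) else 0)) \<in> borel_measurable (PT t)"
        using i fm by measurable
      from measurable_time_integral[of "\<lambda>s w. if s \<in> {a<..b} then f s w else 0", OF this]
      show ?thesis
        by (rule measurable_cong[THEN iffD1, rotated], intro nn_integral_cong)
           (use that in \<open>auto split: split_indicator\<close>)
    qed
    define a where "a k = (\<integral>\<^sup>+ w. (if P (\<tau> k) w then ennreal ((I (\<tau> k) w)\<^sup>2) else 0) \<partial>M)" for k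
    define b where "b k = (\<integral>\<^sup>+ w. (\<integral>\<^sup>+ s\<in>{0<..\<tau> k}. f s w \<partial>lborel) \<partial>M)" for k
    have IM: "I (\<tau> k) \<in> borel_measurable M" and IF: "I (\<tau> k) \<in> borel_measurable (F (\<tau> k))"
      and II: "integrable M (\<lambda>w. (I (\<tau> k) w)\<^sup>2)" for k
      using I \<tau>(1)[of k] measurable_F_M[OF \<tau>(1)[of k], of "I (\<tau> k)" borel] unfolding L2_martingale_def by blast+
    have "a k \<le> b k" if "k \<le> Suc m" for k
      using that
    proof (induction k)
      case 0
      have "a 0 = (\<integral>\<^sup>+ w. 0 \<partial>M)"
        unfolding a_def using I0 by (intro nn_integral_cong_AE) (auto elim!: eventually_mono simp: \<tau>_def)
      then show ?case by simp
    next
      case (Suc k)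
      define A where "A = {w\<in>space M. P (\<tau> k) w}"
      define \<Delta> where "\<Delta> w = I (\<tau> (Suc k)) w - I (\<tau> k) w" for w
      define c where "c w = (indicator A w :: real)" for w
      have AF: "A \<in> sets (F (\<tau> k))" unfolding A_def by (rule killing_F[OF P \<tau>(1)])
      then have AM: "A \<in> sets M" by (rule sets_F_M[OF \<tau>(1)])
      have cM: "c \<in> borel_measurable M" unfolding c_def using AM by measurable
      have c01: "c w = 0 \<or> c w = 1" for w by (auto simp: c_def split: split_indicator)
      have ZF: "(\<lambda>w. c w * I (\<tau> k) w) \<in> borel_measurable (F (\<tau> k))"
        unfolding c_def using AF IF by measurable
      have ZI: "integrable M (\<lambda>w. (c w * I (\<tau> k) w)\<^sup>2)"
      proof (rule Bochner_Integration.integrable_bound[OF II[of k]])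
        show "(\<lambda>w. (c w * I (\<tau> k) w)\<^sup>2) \<in> borel_measurable M"
          using measurable_F_M[OF \<tau>(1) ZF] by measurable
      qed (auto simp: c_def split: split_indicator)
      note mm = L2_martingale_multiplier[OF I \<tau> ZF ZI, folded \<Delta>_def]
      have i1: "integrable M (\<lambda>w. c w * (I (\<tau> k) w)\<^sup>2)"
        using ZI by (rule Bochner_Integration.integrable_cong[THEN iffD1, OF refl, rotated])
           (auto simp: c_def split: split_indicator)
      have i2: "integrable M (\<lambda>w. c w * (\<Delta> w)\<^sup>2)"
        unfolding c_def using mm(3) AM by (simp add: integrable_mult_indicator[where 'b=real, simplified])
      \<comment> \<open>Survival to the right endpoint implies survival to the left one; paths
        killed inside the interval are simply kept.\<close>
      have "a (Suc k) \<le> (\<integral>\<^sup>+ w. ennreal (c w * (I (\<tau> (Suc k)) w)\<^sup>2) \<partial>M)"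
        unfolding a_def
      proof (rule nn_integral_mono)
        fix w assume "w \<in> space M"
        then show "(if P (\<tau> (Suc k)) w then ennreal ((I (\<tau> (Suc k)) w)\<^sup>2) else 0) \<le> ennreal (c w * (I (\<tau> (Suc k)) w)\<^sup>2)"
          using killing_mono[OF P \<tau>] by (auto simp: c_def A_def)
      qed
      also have "(\<lambda>w. c w * (I (\<tau> (Suc k)) w)\<^sup>2) = (\<lambda>w. c w * (I (\<tau> k) w)\<^sup>2 + 2 * (c w * I (\<tau> k) w * \<Delta> w) + c w * (\<Delta> w)\<^sup>2)"
        by (auto simp: \<Delta>_def power2_eq_square algebra_simps)
      also have "(\<integral>\<^sup>+ w. ennreal (c w * (I (\<tau> k) w)\<^sup>2 + 2 * (c w * I (\<tau> k) w * \<Delta> w) + c w * (\<Delta> w)\<^sup>2) \<partial>M)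
        = ennreal (\<integral>w. c w * (I (\<tau> k) w)\<^sup>2 + 2 * (c w * I (\<tau> k) w * \<Delta> w) + c w * (\<Delta> w)\<^sup>2 \<partial>M)"
      proof (rule nn_integral_eq_integral)
        show "integrable M (\<lambda>w. c w * (I (\<tau> k) w)\<^sup>2 + 2 * (c w * I (\<tau> k) w * \<Delta> w) + c w * (\<Delta> w)\<^sup>2)"
          using i1 i2 mm(1) by simp
        show "AE w in M. 0 \<le> c w * (I (\<tau> k) w)\<^sup>2 + 2 * (c w * I (\<tau> k) w * \<Delta> w) + c w * (\<Delta> w)\<^sup>2"
        proof (rule AE_I2)
          fix w
          have "c w * (I (\<tau> k) w)\<^sup>2 + 2 * (c w * I (\<tau> k) w * \<Delta> w) + c w * (\<Delta> w)\<^sup>2 = c w * (I (\<tau> k) w + \<Delta> w)\<^sup>2"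
            by (simp add: power2_eq_square algebra_simps)
          also have "\<dots> \<ge> 0" by (simp add: c_def)
          finally show "0 \<le> c w * (I (\<tau> k) w)\<^sup>2 + 2 * (c w * I (\<tau> k) w * \<Delta> w) + c w * (\<Delta> w)\<^sup>2" .
        qed
      qed
      also have "(\<integral>w. c w * (I (\<tau> k) w)\<^sup>2 + 2 * (c w * I (\<tau> k) w * \<Delta> w) + c w * (\<Delta> w)\<^sup>2 \<partial>M)
        = (\<integral>w. c w * (I (\<tau> k) w)\<^sup>2 \<partial>M) + (\<integral>w. c w * (\<Delta> w)\<^sup>2 \<partial>M)"
        using i1 i2 mm(1,2) by simp
      also have "ennreal \<dots> = ennreal (\<integral>w. c w * (I (\<tau> k) w)\<^sup>2 \<partial>M) + ennreal (\<integral>w. c w * (\<Delta> w)\<^sup>2 \<partial>M)"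
        by (intro ennreal_plus integral_nonneg_AE AE_I2) (auto simp: c_def)
      also have "ennreal (\<integral>w. c w * (I (\<tau> k) w)\<^sup>2 \<partial>M) = (\<integral>\<^sup>+ w. ennreal (c w * (I (\<tau> k) w)\<^sup>2) \<partial>M)"
        by (rule nn_integral_eq_integral[OF i1, symmetric]) (auto simp: c_def)
      also have "\<dots> = a k"
        unfolding a_def by (rule nn_integral_cong) (auto simp: c_def A_def)
      also have "ennreal (\<integral>w. c w * (\<Delta> w)\<^sup>2 \<partial>M) = (\<integral>\<^sup>+ w. ennreal (c w * (\<Delta> w)\<^sup>2) \<partial>M)"
        by (rule nn_integral_eq_integral[OF i2, symmetric]) (auto simp: c_def)
      also have "\<dots> = (\<integral>\<^sup>+ w\<in>A. ennreal ((I (\<tau> (Suc k)) w - I (\<tau> k) w)\<^sup>2) \<partial>M)"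
        by (rule nn_integral_cong) (auto simp: c_def \<Delta>_def split: split_indicator)
      also have "\<dots> \<le> (\<integral>\<^sup>+ w\<in>A. (\<integral>\<^sup>+ r\<in>{\<tau> k<..\<tau> (Suc k)}. q r w \<partial>lborel) \<partial>M)"
        by (rule iso[OF \<tau> \<tau>t[OF Suc.prems] AF])
      also have "\<dots> \<le> (\<integral>\<^sup>+ w. (\<integral>\<^sup>+ r\<in>{\<tau> k<..\<tau> (Suc k)}. f r w \<partial>lborel) \<partial>M)"
      proof (rule nn_integral_mono)
        fix w assume "w \<in> space M"
        show "(\<integral>\<^sup>+ r\<in>{\<tau> k<..\<tau> (Suc k)}. q r w \<partial>lborel) * indicator A w \<le> (\<integral>\<^sup>+ r\<in>{\<tau> k<..\<tau> (Suc k)}. f r w \<partial>lborel)"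
        proof (cases "w \<in> A")
          case True
          have "(\<integral>\<^sup>+ r\<in>{\<tau> k<..\<tau> (Suc k)}. q r w \<partial>lborel) = (\<integral>\<^sup>+ r\<in>{\<tau> k<..\<tau> (Suc k)}. f r w \<partial>lborel)"
          proof (rule nn_integral_cong)
            fix r
            have "left_grid t m r = \<tau> k" if "r \<in> {\<tau> k<..\<tau> (Suc k)}"
              using left_grid_on_interval[OF t0, of k m r] that by (simp add: \<tau>_def)
            then show "q r w * indicator {\<tau> k<..\<tau> (Suc k)} r = f r w * indicator {\<tau> k<..\<tau> (Suc k)} r"
              using True by (auto simp: f_def A_def split: split_indicator)
          qed
          then show ?thesis using True by simp
        qed simp
      qed
      finally have "a (Suc k) \<le> b k + (\<integral>\<^sup>+ w. (\<integral>\<^sup>+ r\<in>{\<tau> k<..\<tau> (Suc k)}. f r w \<partial>lborel) \<partial>M)"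
        using Suc by (meson Suc_leD add_mono order_refl order_trans)
      also have "\<dots> = (\<integral>\<^sup>+ w. (\<integral>\<^sup>+ s\<in>{0<..\<tau> k}. f s w \<partial>lborel) + (\<integral>\<^sup>+ r\<in>{\<tau> k<..\<tau> (Suc k)}. f r w \<partial>lborel) \<partial>M)"
        unfolding b_def using \<tau> \<tau>t[OF Suc.prems] \<tau>t[of k] Suc.prems by (intro nn_integral_add[symmetric] fM) auto
      also have "\<dots> = b (Suc k)"
        unfolding b_def
      proof (rule nn_integral_cong)
        fix w assume w: "w \<in> space M"
        have "(\<integral>\<^sup>+ s\<in>{0<..\<tau> k}. f s w \<partial>lborel) + (\<integral>\<^sup>+ r\<in>{\<tau> k<..\<tau> (Suc k)}. f r w \<partial>lborel)
          = (\<integral>\<^sup>+ s. f s w * indicator {0<..\<tau> k} s + f s w * indicator {\<tau> k<..\<tau> (Suc k)} s \<partial>lborel)"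
          using \<tau>[of k] \<tau>t[OF Suc.prems] by (intro nn_integral_add[symmetric] fI[OF w]) auto
        also have "\<dots> = (\<integral>\<^sup>+ s\<in>{0<..\<tau> (Suc k)}. f s w \<partial>lborel)"
          using \<tau>[of k] by (intro nn_integral_cong) (auto split: split_indicator)
        finally show "(\<integral>\<^sup>+ s\<in>{0<..\<tau> k}. f s w \<partial>lborel) + (\<integral>\<^sup>+ r\<in>{\<tau> k<..\<tau> (Suc k)}. f r w \<partial>lborel)
          = (\<integral>\<^sup>+ s\<in>{0<..\<tau> (Suc k)}. f s w \<partial>lborel)" .
      qed
      finally show ?case .
    qed
    from this[OF order_refl] have "a (Suc m) \<le> b (Suc m)" .
    also have "b (Suc m) \<le> (\<integral>\<^sup>+ w. (\<integral>\<^sup>+ s\<in>{0..t}. f s w \<partial>lborel) \<partial>M)"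
      unfolding b_def using \<tau>t[OF order_refl]
      by (intro nn_integral_mono) (auto split: split_indicator)
    also have "\<dots> = EI t f" by (rule EI_eq_time_space[OF fm, symmetric])
    finally have "a (Suc m) \<le> EI t f" .
    moreover have "\<tau> (Suc m) = t" by (simp add: \<tau>_def del: of_nat_Suc)
    ultimately show ?thesis by (simp only: a_def f_def[abs_def])
  qed
  have "(\<lambda>m. EI t (\<lambda>s w. if P (left_grid t m s) w then q s w else 0)) \<longlonglongrightarrow> EI t (\<lambda>s w. if P s w then q s w else 0)"
    unfolding EI_def
  proof (rule nn_integral_dominated_convergence[where w = "\<lambda>x. q (fst x) (snd x)"])
    show "(\<lambda>x. if P (left_grid t m (fst x)) (snd x) then q (fst x) (snd x) else 0) \<in> borel_measurable (PT t)" for m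
      using killing_grid_measurable[OF P] q by measurable
    show "(\<lambda>x. if P (fst x) (snd x) then q (fst x) (snd x) else 0) \<in> borel_measurable (PT t)"
      using killing_measurable_PT[OF P] q by measurable
    show "(\<integral>\<^sup>+ x. q (fst x) (snd x) \<partial>PT t) < \<infinity>" using fin by (simp add: EI_def)
    show "AE x in PT t. (\<lambda>m. if P (left_grid t m (fst x)) (snd x) then q (fst x) (snd x) else 0)
      \<longlonglongrightarrow> (if P (fst x) (snd x) then q (fst x) (snd x) else 0)"
    proof (rule AE_I2)
      fix x assume "x \<in> space (PT t)"
      then have "\<forall>\<^sub>F m in sequentially. P (left_grid t m (fst x)) (snd x) \<longleftrightarrow> P (fst x) (snd x)"
        by (intro killing_grid_lim[OF P]) (auto simp: space_PT)
      then show "(\<lambda>m. if P (left_grid t m (fst x)) (snd x) then q (fst x) (snd x) else 0)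
        \<longlonglongrightarrow> (if P (fst x) (snd x) then q (fst x) (snd x) else 0)"
        by (intro tendsto_eventually) (erule eventually_mono, simp)
    qed
  qed (use q in auto)
  then show ?thesis by (rule LIMSEQ_le_const) (use grid in auto)
qed

definition stay :: "(real \<Rightarrow> 'w \<Rightarrow> 'b::real_normed_vector) \<Rightarrow> real \<Rightarrow> real \<Rightarrow> 'w \<Rightarrow> bool" where
  "stay X R t w \<longleftrightarrow> (\<forall>s\<in>{0..t}. norm (X s w) \<le> R)"

text \<open>Continuity reduces the condition to grid times, which gives measurability. Closedness of
  the ball gives the left-limit clause: a path inside it before \<open>t\<close> is inside it at
  \<open>t\<close>.\<close>

lemma killing_stay:
  assumes X: "cont_adapted X" and R: "0 \<le> R"
  shows "killing (stay X R)"
  unfolding killing_def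
proof (intro conjI allI impI ballI)
  fix t :: real assume t: "0 \<le> t"
  have "{w\<in>space M. stay X R t w} = {w\<in>space M. \<forall>n k. k \<le> n \<longrightarrow> norm (X (t * real k / real n) w) \<le> R}"
  proof (intro Collect_cong conj_cong refl)
    fix w assume w: "w \<in> space M"
    show "stay X R t w \<longleftrightarrow> (\<forall>n k. k \<le> n \<longrightarrow> norm (X (t * real k / real n) w) \<le> R)"
    proof
      assume "stay X R t w"
      then show "\<forall>n k. k \<le> n \<longrightarrow> norm (X (t * real k / real n) w) \<le> R"
        unfolding stay_def using grid_in_Icc[OF t] by blast
    next
      assume *: "\<forall>n k. k \<le> n \<longrightarrow> norm (X (t * real k / real n) w) \<le> R"
      show "stay X R t w" unfolding stay_def
      proof
        fix s assume s: "s \<in> {0..t}"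
        then obtain k :: "nat \<Rightarrow> nat" where k: "\<And>n. k n \<le> n" "(\<lambda>n. t * real (k n) / real n) \<longlonglongrightarrow> s"
          using grid_seq[of s t] by auto
        have "(\<lambda>n. X (t * real (k n) / real n) w) \<longlonglongrightarrow> X s w"
          by (rule continuous_on_tendsto_compose[OF cont_adapted_cont_Icc[OF X w order_refl, of t] k(2) s])
             (use grid_in_Icc[OF t k(1)] in auto)
        then show "norm (X s w) \<le> R"
          by (intro Lim_norm_ubound[where f = "\<lambda>n. X (t * real (k n) / real n) w"]) (use * k(1) in auto)
      qed
    qed
  qed
  \<comment> \<open>Replacing \<open>k\<close> by \<open>min k n\<close> turns a bounded quantifier
    into one over all pairs.\<close>
  also have "\<dots> = {w\<in>space (F t). \<forall>n k. norm (X (t * real (min k n) / real n) w) \<le> R}"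
  proof -
    have "(\<forall>n k. k \<le> n \<longrightarrow> P n k) \<longleftrightarrow> (\<forall>n k. P n (min k n))" for P :: "nat \<Rightarrow> nat \<Rightarrow> bool"
      by (auto simp: min_def)
    from this[of "\<lambda>n k. norm (X (t * real k / real n) w) \<le> R" for w] show ?thesis by (simp only: space_F[OF t])
  qed
  also have "\<dots> \<in> sets (F t)"
  proof -
    have [measurable]: "X (t * real (min k n) / real n) \<in> borel_measurable (F t)" for n k :: nat
    proof (rule measurable_F_mono)
      have g: "t * real (min k n) / real n \<in> {0..t}" by (rule grid_in_Icc[OF t]) simp
      then show "0 \<le> t * real (min k n) / real n" "t * real (min k n) / real n \<le> t" by auto
      then show "X (t * real (min k n) / real n) \<in> borel_measurable (F (t * real (min k n) / real n))"
        by (intro cont_adapted_F[OF X])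
    qed
    show ?thesis by measurable
  qed
  finally show "{w\<in>space M. stay X R t w} \<in> sets (F t)" .
next
  fix s t w assume "0 \<le> s" "s \<le> t" "stay X R t w"
  then show "stay X R s w" by (auto simp: stay_def)
next
  fix t w assume t: "0 < t" and w: "w \<in> space M" and *: "\<forall>s\<in>{0..<t}. stay X R s w"
  have le: "norm (X s w) \<le> R" if "0 \<le> s" "s < t" for s using * that by (auto simp: stay_def)
  have "norm (X t w) \<le> R"
  proof (rule Lim_norm_ubound)
    have "(\<lambda>n. left_grid t n t) \<longlonglongrightarrow> t" by (rule left_grid_tendsto) (use t in auto)
    then show "(\<lambda>n. X (left_grid t n t) w) \<longlonglongrightarrow> X t w"
      by (rule continuous_on_tendsto_compose[OF cont_adapted_cont[OF X w]])
         (use t left_grid[OF t t] in auto)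
  qed (use le left_grid[OF t t] in auto)
  then show "stay X R t w"
    unfolding stay_def using le by (metis atLeastAtMost_iff order_le_imp_less_or_eq)
qed

end

subsection \<open>Increments of Wiener processes\<close>

text \<open>Degenerate directions have \<open>v = 0\<close>; the law is then a Dirac measure without
  density and is treated apart.\<close>

lemma centred_normal_moments:
  assumes v: "0 \<le> v"
  shows "integrable (centred_normal v) (\<lambda>x. x)" "(\<integral>x. x \<partial>centred_normal v) = 0"
    "integrable (centred_normal v) (\<lambda>x. x\<^sup>2)" "(\<integral>x. x\<^sup>2 \<partial>centred_normal v) = v"
proof -
  have "integrable (centred_normal v) (\<lambda>x. x) \<and> (\<integral>x. x \<partial>centred_normal v) = 0
    \<and> integrable (centred_normal v) (\<lambda>x. x\<^sup>2) \<and> (\<integral>x. x\<^sup>2 \<partial>centred_normal v) = v"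
  proof (cases "v = 0")
    case True
    have r: "integrable (return borel 0) f \<and> (\<integral>x. f x \<partial>return borel 0) = f 0"
      if "f \<in> borel_measurable borel" for f :: "real \<Rightarrow> real"
      using that by (auto intro!: integrableI_bounded integral_return simp: nn_integral_return)
    show ?thesis using r[of "\<lambda>x. x"] r[of "\<lambda>x. x\<^sup>2"] True by (simp add: centred_normal_def)
  next
    case False
    then have s: "sqrt v > 0" using v by simp
    have 1: "integrable (density lborel (normal_density 0 (sqrt v))) (\<lambda>x. x)"
      using integrable_normal_moment[OF s, of 0 1] by (subst integrable_real_density) auto
    have 2: "integrable (density lborel (normal_density 0 (sqrt v))) (\<lambda>x. x\<^sup>2)"
      using integrable_normal_moment[OF s, of 0 2] by (subst integrable_real_density) auto
    have 3: "(\<integral>x. x \<partial>density lborel (normal_density 0 (sqrt v))) = 0"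
      using integral_normal_moment_odd[OF s, of 0 0] by (subst integral_real_density) auto
    have 4: "(\<integral>x. x\<^sup>2 \<partial>density lborel (normal_density 0 (sqrt v))) = v"
      using integral_normal_moment_even[OF s, of 0 1] v by (subst integral_real_density) (auto simp: fact_numeral)
    show ?thesis using 1 2 3 4 False by (simp add: centred_normal_def)
  qed
  then show "integrable (centred_normal v) (\<lambda>x. x)" "(\<integral>x. x \<partial>centred_normal v) = 0"
    "integrable (centred_normal v) (\<lambda>x. x\<^sup>2)" "(\<integral>x. x\<^sup>2 \<partial>centred_normal v) = v" by blast+
qed

text \<open>Independence of increments is given on the level of events. This transfers it to
  \<open>c\<close> and a measurable function of the increment, in the form required by the product
  rule for expectations.\<close>

lemma (in prob_space) indep_var_of_indep_set:
  assumes i: "indep_set A {D -` B \<inter> space M | B. B \<in> sets N}" and A: "A = sets G" "space G = space M" "sets G \<subseteq> sets M"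
    and c: "c \<in> borel_measurable G" and D: "D \<in> measurable M N" and f: "f \<in> borel_measurable N"
  shows "indep_var borel c borel (\<lambda>w. f (D w))"
proof -
  have cM: "c \<in> borel_measurable M"
    using c A by (intro measurable_from_subalg[of M G]) (auto simp: subalgebra_def)
  have 1: "sigma_sets (space M) {c -` S \<inter> space M | S. S \<in> sets borel} \<subseteq> A"
    unfolding A(1) A(2)[symmetric]
    by (intro sets.sigma_sets_subset) (use measurable_sets[OF c] in auto)
  let ?V = "vimage_algebra (space M) D N"
  have V: "sets ?V = {D -` B \<inter> space M | B. B \<in> sets N}"
    using D by (intro sets_vimage_algebra2) (auto dest: measurable_space)
  have Dv: "D \<in> measurable ?V N"
    using D by (intro measurable_vimage_algebra1) (auto dest: measurable_space)
  have fD: "(\<lambda>w. f (D w)) \<in> borel_measurable ?V" using measurable_compose[OF Dv f] .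
  have 2: "sigma_sets (space M) {(\<lambda>w. f (D w)) -` S \<inter> space M | S. S \<in> sets borel} \<subseteq> {D -` B \<inter> space M | B. B \<in> sets N}"
  proof -
    have "{(\<lambda>w. f (D w)) -` S \<inter> space M | S. S \<in> sets borel} \<subseteq> sets ?V"
      using measurable_sets[OF fD] by auto
    then have "sigma_sets (space ?V) {(\<lambda>w. f (D w)) -` S \<inter> space M | S. S \<in> sets borel} \<subseteq> sets ?V"
      by (rule sets.sigma_sets_subset)
    then show ?thesis unfolding V by simp
  qed
  have "indep_set (sigma_sets (space M) {c -` S \<inter> space M | S. S \<in> sets borel})
     (sigma_sets (space M) {(\<lambda>w. f (D w)) -` S \<inter> space M | S. S \<in> sets borel})"
    using i 1 2 indep_setD_ev1[OF i] indep_setD_ev2[OF i] indep_setD[OF i] unfolding indep_sets2_eq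
    by (meson order_trans subsetD)
  then show ?thesis
    unfolding indep_var_eq using cM measurable_compose[OF D f] by auto
qed

context stochastic_basis
begin

context
  fixes Q :: "'h::{real_inner, banach, second_countable_topology} \<Rightarrow> 'h" and U :: "real \<Rightarrow> 'w \<Rightarrow> 'h"
  assumes Q: "covariance_operator Q" and U: "Q_wiener_process M F Q U"
begin

lemma covariance_linear: "bounded_linear Q"
  using Q by (simp add: covariance_operator_def trace_class_def)

lemma covariance_psd: "0 \<le> Q h \<bullet> h"
  using Q by (simp add: covariance_operator_def inner_commute)

lemma covariance_sym: "Q x \<bullet> y = x \<bullet> Q y"
  using Q by (simp add: covariance_operator_def)

lemma Q_wiener_measurable: "0 \<le> t \<Longrightarrow> U t \<in> borel_measurable (F t)"
  using U by (simp add: Q_wiener_process_def)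

lemma Q_wiener_increment_measurable:
  "0 \<le> s \<Longrightarrow> s \<le> t \<Longrightarrow> (\<lambda>w. U t w - U s w) \<in> borel_measurable (F t)"
  using Q_wiener_measurable[of t] measurable_F_mono[of s t, OF _ _ Q_wiener_measurable[of s]]
  by (intro borel_measurable_diff) auto

lemma Q_wiener_increment_measurable_M:
  assumes "0 \<le> s" "s \<le> t" shows "(\<lambda>w. U t w - U s w) \<in> borel_measurable M"
  using Q_wiener_increment_measurable[OF assms] measurable_F_M assms by (meson order_trans)

lemma Q_wiener_increment_indep:
  assumes st: "0 \<le> s" "s < t" and c: "c \<in> borel_measurable (F s)" and f: "f \<in> borel_measurable borel"
  shows "indep_var borel c borel (\<lambda>w. f (U t w - U s w))"
proof -
  have "indep_set (sets (F s)) {(\<lambda>w. U t w - U s w) -` B \<inter> space M | B. B \<in> sets borel}"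
    using U st unfolding Q_wiener_process_def by blast
  then show ?thesis
    using subalgebra_F[OF st(1)] st c f
    by (intro indep_var_of_indep_set[where G = "F s" and D = "\<lambda>w. U t w - U s w" and N = borel])
       (auto simp: subalgebra_def intro: Q_wiener_increment_measurable_M)
qed

lemma Q_wiener_increment_moments:
  assumes st: "0 \<le> s" "s < t"
  shows "integrable M (\<lambda>w. (U t w - U s w) \<bullet> h)" "(\<integral>w. (U t w - U s w) \<bullet> h \<partial>M) = 0"
    "integrable M (\<lambda>w. ((U t w - U s w) \<bullet> h)\<^sup>2)" "(\<integral>w. ((U t w - U s w) \<bullet> h)\<^sup>2 \<partial>M) = (t - s) * (Q h \<bullet> h)"
proof -
  let ?D = "\<lambda>w. (U t w - U s w) \<bullet> h"
  have d: "distr M borel ?D = centred_normal ((t - s) * (Q h \<bullet> h))"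
    using U st unfolding Q_wiener_process_def centred_gaussian_def by simp
  have v: "0 \<le> (t - s) * (Q h \<bullet> h)" using st covariance_psd by simp
  have m: "?D \<in> borel_measurable M"
    using Q_wiener_increment_measurable_M[of s t] st by (intro borel_measurable_inner) auto
  note cm = centred_normal_moments[OF v, folded d]
  show "integrable M ?D" using cm(1) integrable_distr_eq[OF m, of "\<lambda>x. x"] by simp
  show "(\<integral>w. ?D w \<partial>M) = 0" using cm(2) integral_distr[OF m, of "\<lambda>x. x"] by simp
  show "integrable M (\<lambda>w. (?D w)\<^sup>2)" using cm(3) integrable_distr_eq[OF m, of "\<lambda>x. x\<^sup>2"] by simp
  show "(\<integral>w. (?D w)\<^sup>2 \<partial>M) = (t - s) * (Q h \<bullet> h)" using cm(4) integral_distr[OF m, of "\<lambda>x. x\<^sup>2"] by simp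
qed

text \<open>Polarisation, since the Gaussian law is prescribed in each single direction
  only.\<close>

lemma Q_wiener_increment_cov:
  assumes st: "0 \<le> s" "s < t"
  shows "integrable M (\<lambda>w. ((U t w - U s w) \<bullet> h) * ((U t w - U s w) \<bullet> h'))"
    "(\<integral>w. ((U t w - U s w) \<bullet> h) * ((U t w - U s w) \<bullet> h') \<partial>M) = (t - s) * (Q h \<bullet> h')"
proof -
  let ?D = "\<lambda>h w. (U t w - U s w) \<bullet> h"
  note m = Q_wiener_increment_moments[OF st]
  have eq: "?D h w * ?D h' w = ((?D (h + h') w)\<^sup>2 - (?D h w)\<^sup>2 - (?D h' w)\<^sup>2) / 2" for w
    by (simp add: inner_add_right power2_eq_square algebra_simps)
  show "integrable M (\<lambda>w. ?D h w * ?D h' w)" unfolding eq using m(3) by simp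
  have "(\<integral>w. ?D h w * ?D h' w \<partial>M) = ((t - s) * (Q (h + h') \<bullet> (h + h')) - (t - s) * (Q h \<bullet> h) - (t - s) * (Q h' \<bullet> h')) / 2"
    unfolding eq using m(3,4) by simp
  also have "Q (h + h') \<bullet> (h + h') = Q h \<bullet> h + 2 * (Q h \<bullet> h') + Q h' \<bullet> h'"
    using covariance_sym[of h' h]
    by (simp add: linear_add[OF bounded_linear.linear[OF covariance_linear]] inner_add_left inner_add_right inner_commute)
  finally show "(\<integral>w. ?D h w * ?D h' w \<partial>M) = (t - s) * (Q h \<bullet> h')" by (simp add: algebra_simps)
qed

lemma Q_wiener_increment_mean:
  assumes st: "0 \<le> s" "s < t" and c: "c \<in> borel_measurable (F s)" "integrable M c"
  shows "integrable M (\<lambda>w. c w * ((U t w - U s w) \<bullet> h))" "(\<integral>w. c w * ((U t w - U s w) \<bullet> h) \<partial>M) = 0"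
proof -
  have iv: "indep_var borel c borel (\<lambda>w. (U t w - U s w) \<bullet> h)"
    by (rule Q_wiener_increment_indep[OF st c(1), of "\<lambda>x. x \<bullet> h"]) measurable
  show "integrable M (\<lambda>w. c w * ((U t w - U s w) \<bullet> h))"
    by (rule indep_var_integrable[OF iv c(2) Q_wiener_increment_moments(1)[OF st]])
  show "(\<integral>w. c w * ((U t w - U s w) \<bullet> h) \<partial>M) = 0"
    using indep_var_lebesgue_integral[OF iv c(2) Q_wiener_increment_moments(1)[OF st]]
      Q_wiener_increment_moments(2)[OF st] by simp
qed

lemma Q_wiener_increment_cond_cov:
  assumes st: "0 \<le> s" "s < t" and c: "c \<in> borel_measurable (F s)" "integrable M c"
  shows "(\<integral>w. c w * (((U t w - U s w) \<bullet> h) * ((U t w - U s w) \<bullet> h')) \<partial>M) = (t - s) * (Q h \<bullet> h') * (\<integral>w. c w \<partial>M)"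
proof -
  have iv: "indep_var borel c borel (\<lambda>w. ((U t w - U s w) \<bullet> h) * ((U t w - U s w) \<bullet> h'))"
    by (rule Q_wiener_increment_indep[OF st c(1), of "\<lambda>x. (x \<bullet> h) * (x \<bullet> h')"]) measurable
  show ?thesis
    using indep_var_lebesgue_integral[OF iv c(2) Q_wiener_increment_cov(1)[OF st]]
      Q_wiener_increment_cov(2)[OF st] by (simp add: mult.commute)
qed

end

lemma indep_vars_pair_integral:
  fixes f g :: "'b \<Rightarrow> real"
  assumes iv: "indep_vars (\<lambda>_. N) X (UNIV :: 'n::finite set)" and ij: "i \<noteq> j"
    and f: "f \<in> borel_measurable N" "integrable M (\<lambda>w. f (X i w))"
    and g: "g \<in> borel_measurable N" "integrable M (\<lambda>w. g (X j w))"
  shows "integrable M (\<lambda>w. f (X i w) * g (X j w))"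
    "(\<integral>w. f (X i w) * g (X j w) \<partial>M) = (\<integral>w. f (X i w) \<partial>M) * (\<integral>w. g (X j w) \<partial>M)"
proof -
  \<comment> \<open>Composition asks for a function at every index; the value outside
    \<open>{i, j}\<close> is immaterial because the family is restricted to that pair next.\<close>
  define Y where "Y k = (if k = i then f else g)" for k
  have "indep_vars (\<lambda>_. borel) (\<lambda>k w. Y k (X k w)) UNIV"
    by (rule indep_vars_compose2[OF iv]) (use f g in \<open>auto simp: Y_def\<close>)
  then have iv': "indep_vars (\<lambda>_. borel) (\<lambda>k w. Y k (X k w)) {i, j}" by (rule indep_vars_subset) auto
  have int: "integrable M (\<lambda>w. Y k (X k w))" if "k \<in> {i, j}" for k
    using that f g ij by (auto simp: Y_def)
  show "integrable M (\<lambda>w. f (X i w) * g (X j w))"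
    using indep_vars_integrable[OF _ iv' int] ij by (simp add: Y_def)
  show "(\<integral>w. f (X i w) * g (X j w) \<partial>M) = (\<integral>w. f (X i w) \<partial>M) * (\<integral>w. g (X j w) \<partial>M)"
    using indep_vars_lebesgue_integral[OF _ iv' int] ij by (simp add: Y_def)
qed

text \<open>The components are only assumed to be Wiener processes for the common filtration and to be
  independent of each other, not to be jointly independent of the past. Their covariation still
  vanishes: it is a limit of sums of products of increments over fine partitions, and those sums
  tend to zero in \<open>L\<^sup>2\<close> by the mutual independence alone.\<close>

lemma Q_wiener_cross_covariation:
  fixes W :: "real \<Rightarrow> 'w \<Rightarrow> 'h::{real_inner, banach, second_countable_topology} ^ 'n"
  assumes Q: "covariance_operator Q" and W: "independent_Q_wiener M F Q W" and ij: "i \<noteq> j"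
    and st: "0 \<le> s" "s < t" and c: "c \<in> borel_measurable (F s)" "\<And>w. \<bar>c w\<bar> \<le> K"
  shows "(\<integral>w. c w * (((W t w - W s w) $ i \<bullet> h) * ((W t w - W s w) $ j \<bullet> h')) \<partial>M) = 0"
    "integrable M (\<lambda>w. ((W t w - W s w) $ i \<bullet> h) * ((W t w - W s w) $ j \<bullet> h'))"
proof -
  define X where "X k w = (\<lambda>t\<in>{0..}. W t w $ k)" for k w
  have Wk: "Q_wiener_process M F Q (\<lambda>t w. W t w $ k)" for k using W by (simp add: independent_Q_wiener_def)
  have iv: "indep_vars (\<lambda>_. PiM {0..} (\<lambda>_. borel)) X UNIV"
    using W by (simp add: independent_Q_wiener_def X_def[abs_def])
  note mom = Q_wiener_increment_moments[OF Q Wk] and mean = Q_wiener_increment_mean[OF Q Wk]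
  have inc_F: "(\<lambda>w. (W b w $ k - W a w $ k) \<bullet> h) \<in> borel_measurable (F b)" if "0 \<le> a" "a \<le> b" for a b k h
    using Q_wiener_increment_measurable[OF Q Wk that] by measurable
  have cM: "c \<in> borel_measurable M" by (rule measurable_F_M[OF st(1) c(1)])
  have K: "0 \<le> K" using c(2) by (meson abs_ge_zero order_trans)
  have cint: "integrable M (\<lambda>w. c w * f w)" if "integrable M f" for f
  proof (rule Bochner_Integration.integrable_bound)
    show "integrable M (\<lambda>w. K * f w)" using that by simp
    show "AE w in M. norm (c w * f w) \<le> norm (K * f w)"
      using c(2) K by (intro AE_I2) (auto simp: abs_mult intro!: mult_right_mono)
  qed (use cM that in measurable)
  show int0: "integrable M (\<lambda>w. ((W t w - W s w) $ i \<bullet> h) * ((W t w - W s w) $ j \<bullet> h'))"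
    using integrable_mult_L2[OF _ _ mom(3)[OF st, of i h] mom(3)[OF st, of j h']]
      measurable_F_M[OF _ inc_F[of s t i h]] measurable_F_M[OF _ inc_F[of s t j h']] st by simp
  define E where "E = (\<integral>w. c w * (((W t w - W s w) $ i \<bullet> h) * ((W t w - W s w) $ j \<bullet> h')) \<partial>M)"
  \<comment> \<open>On a partition into n intervals of length (t - s)/n, each diagonal product has
    second moment equal to the square of that length times the two quadratic forms. The n terms add
    up to A/n.\<close>
  define A where "A = (t - s)\<^sup>2 * (Q h \<bullet> h) * (Q h' \<bullet> h')"
  have bound: "E\<^sup>2 \<le> K\<^sup>2 * A * inverse (real (Suc n'))" for n'
  proof -
    define n where "n = Suc n'"
    define \<delta> where "\<delta> = (t - s) / real n"
    have \<delta>: "\<delta> > 0" using st by (simp add: \<delta>_def n_def)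
    define \<tau> where "\<tau> k = s + \<delta> * real k" for k
    have \<tau>0: "0 \<le> \<tau> k" and \<tau>S: "\<tau> k < \<tau> (Suc k)" and \<tau>d: "\<tau> (Suc k) - \<tau> k = \<delta>" and s\<tau>: "s \<le> \<tau> k" for k
      using st \<delta> by (auto simp: \<tau>_def algebra_simps)
    have \<tau>mono: "\<tau> k \<le> \<tau> l" if "k \<le> l" for k l using that \<delta> by (simp add: \<tau>_def)
    have \<tau>n: "\<tau> 0 = s" "\<tau> n = t" by (simp_all add: \<tau>_def \<delta>_def n_def del: of_nat_Suc)
    define m where "m k w = (W (\<tau> (Suc k)) w $ i - W (\<tau> k) w $ i) \<bullet> h" for k w
    define p where "p k w = (W (\<tau> (Suc k)) w $ j - W (\<tau> k) w $ j) \<bullet> h'" for k w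
    have mF: "m k \<in> borel_measurable (F (\<tau> (Suc k)))" and pF: "p k \<in> borel_measurable (F (\<tau> (Suc k)))" for k
      unfolding m_def p_def using inc_F[OF \<tau>0 less_imp_le[OF \<tau>S]] by auto
    have mM: "m k \<in> borel_measurable M" and pM: "p k \<in> borel_measurable M" for k
      using measurable_F_M[OF \<tau>0 mF] measurable_F_M[OF \<tau>0 pF] by auto
    have m2: "integrable M (\<lambda>w. (m k w)\<^sup>2)" "(\<integral>w. (m k w)\<^sup>2 \<partial>M) = \<delta> * (Q h \<bullet> h)"
      and p2: "integrable M (\<lambda>w. (p k w)\<^sup>2)" "(\<integral>w. (p k w)\<^sup>2 \<partial>M) = \<delta> * (Q h' \<bullet> h')" for k
      unfolding m_def p_def using mom(3,4)[OF \<tau>0 \<tau>S] by (simp_all add: \<tau>d)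
    have mm: "integrable M (\<lambda>w. m k w * m l w)" and pp: "integrable M (\<lambda>w. p k w * p l w)"
      and mp: "integrable M (\<lambda>w. m k w * p l w)" for k l
      using integrable_mult_L2 mM pM m2 p2 by blast+
    \<comment> \<open>Square-integrable multipliers have to be allowed, because the product of
      \<open>c\<close> with an increment is unbounded.\<close>
    have orth: "(\<integral>w. Z w * m l w \<partial>M) = 0" "(\<integral>w. Z w * p l w \<partial>M) = 0"
      if Z: "Z \<in> borel_measurable (F (\<tau> l))" "integrable M (\<lambda>w. (Z w)\<^sup>2)" for Z l
    proof -
      have b: "integrable M c'" if "c' \<in> borel_measurable (F (\<tau> l))" "\<And>w. \<bar>c' w\<bar> \<le> K'" for c' :: "'w \<Rightarrow> real" and K' :: real
        using that measurable_F_M[OF \<tau>0 that(1)] by (intro integrable_const_bound[where B = K']) auto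
      show "(\<integral>w. Z w * m l w \<partial>M) = 0"
        by (rule orthogonal_L2_multiplier(2)[OF \<tau>0 mM m2(1) _ Z])
           (auto simp: m_def intro!: mean(2)[OF \<tau>0 \<tau>S] b)
      show "(\<integral>w. Z w * p l w \<partial>M) = 0"
        by (rule orthogonal_L2_multiplier(2)[OF \<tau>0 pM p2(1) _ Z])
           (auto simp: p_def intro!: mean(2)[OF \<tau>0 \<tau>S] b)
    qed
    have F_up: "f \<in> borel_measurable (F (\<tau> l))" if "f \<in> borel_measurable (F (\<tau> (Suc k)))" "k < l" for f :: "'w \<Rightarrow> real" and k l
      using measurable_F_mono[OF \<tau>0 \<tau>mono that(1)] that(2) by simp
    have c_up: "c \<in> borel_measurable (F (\<tau> l))" for l
      by (rule measurable_F_mono[OF st(1) s\<tau> c(1)])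
    have csq: "integrable M (\<lambda>w. (c w * f w)\<^sup>2)" if "f \<in> borel_measurable M" "integrable M (\<lambda>w. (f w)\<^sup>2)" for f
    proof (rule Bochner_Integration.integrable_bound)
      show "integrable M (\<lambda>w. K\<^sup>2 * (f w)\<^sup>2)" using that by simp
      show "AE w in M. norm ((c w * f w)\<^sup>2) \<le> norm (K\<^sup>2 * (f w)\<^sup>2)"
        using c(2) K by (intro AE_I2) (auto simp: power_mult_distrib abs_le_square_iff[symmetric] intro!: mult_right_mono)
    qed (use cM that in measurable)
    \<comment> \<open>The later of the two increments is orthogonal to what is known at its left
      endpoint, which includes \<open>c\<close> and the earlier increment.\<close>
    have mp0: "(\<integral>w. c w * (m k w * p l w) \<partial>M) = 0" if "k \<noteq> l" for k l
    proof (cases "k < l")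
      case True
      have "(\<integral>w. (c w * m k w) * p l w \<partial>M) = 0"
        using c_up[of l] F_up[OF mF True] by (intro orth(2) csq mM m2) measurable
      then show ?thesis by (simp add: mult.assoc)
    next
      case False
      then have "l < k" using that by simp
      then have "(\<integral>w. (c w * p l w) * m k w \<partial>M) = 0"
        using c_up[of k] F_up[OF pF] by (intro orth(1) csq pM p2) measurable
      then show ?thesis by (simp add: mult_ac)
    qed
    have mm0: "(\<integral>w. m k w * m l w \<partial>M) = (if k = l then \<delta> * (Q h \<bullet> h) else 0)" for k l
    proof -
      have "(\<integral>w. m k w * m l w \<partial>M) = 0" if "k < l" for k l
        by (rule orth(1)[OF F_up[OF mF that] m2(1)])
      from this[of k l] this[of l k] show ?thesis
        using m2(2)[of k] by (cases k l rule: linorder_cases) (auto simp: power2_eq_square mult.commute)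
    qed
    have telm: "(W t w - W s w) $ i \<bullet> h = (\<Sum>k<n. m k w)" for w
      using sum_lessThan_telescope[of "\<lambda>k. W (\<tau> k) w $ i \<bullet> h" n] by (simp add: m_def \<tau>n inner_diff_left)
    have telp: "(W t w - W s w) $ j \<bullet> h' = (\<Sum>k<n. p k w)" for w
      using sum_lessThan_telescope[of "\<lambda>k. W (\<tau> k) w $ j \<bullet> h'" n] by (simp add: p_def \<tau>n inner_diff_left)
    \<comment> \<open>Only the diagonal products contribute to the expectation; unlike the full
      product, their sum is small in L^2.\<close>
    define Y where "Y w = (\<Sum>k<n. m k w * p k w)" for w
    have "E = (\<integral>w. (\<Sum>k<n. \<Sum>l<n. c w * (m k w * p l w)) \<partial>M)"
      unfolding E_def telm telp sum_product by (simp only: sum_distrib_left)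
    also have "\<dots> = (\<Sum>k<n. \<Sum>l<n. \<integral>w. c w * (m k w * p l w) \<partial>M)"
      using cint[OF mp] by simp
    also have "\<dots> = (\<Sum>k<n. \<integral>w. c w * (m k w * p k w) \<partial>M)"
    proof (rule sum.cong[OF refl])
      fix k assume "k \<in> {..<n}"
      then have "(\<Sum>l<n. \<integral>w. c w * (m k w * p l w) \<partial>M) = (\<Sum>l<n. if l = k then \<integral>w. c w * (m k w * p k w) \<partial>M else 0)"
        by (intro sum.cong) (auto simp: mp0)
      then show "(\<Sum>l<n. \<integral>w. c w * (m k w * p l w) \<partial>M) = (\<integral>w. c w * (m k w * p k w) \<partial>M)"
        using \<open>k \<in> {..<n}\<close> by simp
    qed
    also have "\<dots> = (\<integral>w. c w * Y w \<partial>M)"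
      unfolding Y_def using cint[OF mp] by (simp add: sum_distrib_left)
    finally have EY: "E = (\<integral>w. c w * Y w \<partial>M)" .
    \<comment> \<open>Products of two increments of one component, written as functionals of its
      path, because the independence of the components is stated for whole paths.\<close>
    define f where "f k l x = ((x (\<tau> (Suc k)) - x (\<tau> k)) \<bullet> h) * ((x (\<tau> (Suc l)) - x (\<tau> l)) \<bullet> h)" for k l and x :: "real \<Rightarrow> 'h"
    define g where "g k l x = ((x (\<tau> (Suc k)) - x (\<tau> k)) \<bullet> h') * ((x (\<tau> (Suc l)) - x (\<tau> l)) \<bullet> h')" for k l and x :: "real \<Rightarrow> 'h"
    have comp: "(\<lambda>x. x (\<tau> k)) \<in> borel_measurable (PiM {0..} (\<lambda>_. borel :: 'h measure))" for k
      using \<tau>0[of k] by (intro measurable_component_singleton) auto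
    have fm: "f k l \<in> borel_measurable (PiM {0..} (\<lambda>_. borel))" and gm: "g k l \<in> borel_measurable (PiM {0..} (\<lambda>_. borel))" for k l
      unfolding f_def g_def by (intro borel_measurable_times borel_measurable_inner borel_measurable_diff comp borel_measurable_const)+
    have fX: "f k l (X i w) = m k w * m l w" and gX: "g k l (X j w) = p k w * p l w" for k l w
      using \<tau>0 by (simp_all add: f_def g_def m_def p_def X_def)
    have mmpp: "integrable M (\<lambda>w. (m k w * m l w) * (p k w * p l w))"
      "(\<integral>w. (m k w * m l w) * (p k w * p l w) \<partial>M) = (\<integral>w. m k w * m l w \<partial>M) * (\<integral>w. p k w * p l w \<partial>M)" for k l
      using indep_vars_pair_integral[OF iv ij fm _ gm, of k l k l] mm pp unfolding fX gX by blast+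
    have Ysq: "(Y w)\<^sup>2 = (\<Sum>k<n. \<Sum>l<n. (m k w * m l w) * (p k w * p l w))" for w
      unfolding Y_def power2_eq_square sum_product by (simp add: mult_ac)
    have YI: "integrable M (\<lambda>w. (Y w)\<^sup>2)" unfolding Ysq using mmpp by simp
    have YM: "Y \<in> borel_measurable M" unfolding Y_def using mM pM by measurable
    have "(\<integral>w. (Y w)\<^sup>2 \<partial>M) = (\<Sum>k<n. \<Sum>l<n. (\<integral>w. m k w * m l w \<partial>M) * (\<integral>w. p k w * p l w \<partial>M))"
      unfolding Ysq using mmpp by simp
    also have "\<dots> = (\<Sum>k<n. (\<delta> * (Q h \<bullet> h)) * (\<delta> * (Q h' \<bullet> h')))"
    proof (rule sum.cong[OF refl])
      fix k assume k: "k \<in> {..<n}"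
      have "(\<Sum>l<n. (\<integral>w. m k w * m l w \<partial>M) * (\<integral>w. p k w * p l w \<partial>M))
         = (\<Sum>l<n. if l = k then (\<delta> * (Q h \<bullet> h)) * (\<delta> * (Q h' \<bullet> h')) else 0)"
        using p2(2)[of k] by (intro sum.cong) (auto simp: mm0 power2_eq_square)
      then show "(\<Sum>l<n. (\<integral>w. m k w * m l w \<partial>M) * (\<integral>w. p k w * p l w \<partial>M)) = (\<delta> * (Q h \<bullet> h)) * (\<delta> * (Q h' \<bullet> h'))"
        using k by simp
    qed
    also have "\<dots> = A * inverse (real n)"
      by (simp add: A_def \<delta>_def power2_eq_square field_simps n_def del: of_nat_Suc)
    finally have EY2: "(\<integral>w. (Y w)\<^sup>2 \<partial>M) = A * inverse (real n)" .
    have cY: "integrable M (\<lambda>w. (c w * Y w)\<^sup>2)" by (rule csq[OF YM YI])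
    have cY1: "integrable M (\<lambda>w. c w * Y w)" unfolding Y_def sum_distrib_left using cint[OF mp] by simp
    \<comment> \<open>Nonnegativity of the variance.\<close>
    have "(\<integral>w. c w * Y w \<partial>M)\<^sup>2 \<le> (\<integral>w. (c w * Y w)\<^sup>2 \<partial>M)"
      using variance_positive[of "\<lambda>w. c w * Y w"] variance_eq[OF cY1 cY] by simp
    also have "\<dots> \<le> (\<integral>w. K\<^sup>2 * (Y w)\<^sup>2 \<partial>M)"
      using cY YI c(2) K
      by (intro integral_mono) (auto simp: power_mult_distrib abs_le_square_iff[symmetric] intro!: mult_right_mono)
    also have "\<dots> = K\<^sup>2 * A * inverse (real (Suc n'))" using EY2 by (simp add: n_def)
    finally show ?thesis using EY by simp
  qed
  have "(\<lambda>n. K\<^sup>2 * A * inverse (real (Suc n))) \<longlonglongrightarrow> K\<^sup>2 * A * 0"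
    by (intro tendsto_intros LIMSEQ_inverse_real_of_nat)
  then have "E\<^sup>2 \<le> K\<^sup>2 * A * 0" by (rule LIMSEQ_le_const) (use bound in auto)
  then show "E = 0" unfolding E_def by simp
qed

end

subsection \<open>Driving noise\<close>

text \<open>What is used of a Wiener process with covariance operator \<open>C\<close>: continuous adapted paths and
  the first two conditional moments of the increments.\<close>

locale hilbert_noise = stochastic_basis M F for M :: "'w measure" and F +
  fixes W :: "real \<Rightarrow> 'w \<Rightarrow> 'k::{real_inner, banach, second_countable_topology}" and C :: "'k \<Rightarrow> 'k"
  assumes W_ca: "cont_adapted W"
    and C_lin: "bounded_linear C" and C_sym: "C x \<bullet> y = x \<bullet> C y" and C_psd: "0 \<le> C x \<bullet> x"
    and W_sq: "0 \<le> s \<Longrightarrow> s \<le> t \<Longrightarrow> integrable M (\<lambda>w. ((W t w - W s w) \<bullet> h)\<^sup>2)"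
    and W_mean: "0 \<le> s \<Longrightarrow> s \<le> t \<Longrightarrow> c \<in> borel_measurable (F s) \<Longrightarrow> (\<And>w. \<bar>c w\<bar> \<le> K) \<Longrightarrow>
       (\<integral>w. c w * ((W t w - W s w) \<bullet> h) \<partial>M) = 0"
    and W_cov: "0 \<le> s \<Longrightarrow> s \<le> t \<Longrightarrow> c \<in> borel_measurable (F s) \<Longrightarrow> (\<And>w. \<bar>c w\<bar> \<le> K) \<Longrightarrow>
       (\<integral>w. c w * (((W t w - W s w) \<bullet> h) * ((W t w - W s w) \<bullet> h')) \<partial>M) = (t - s) * (C h \<bullet> h') * (\<integral>w. c w \<partial>M)"

lemma vec_eq_sum_axis: "(x :: 'a::real_normed_vector ^ 'n) = (\<Sum>i\<in>UNIV. axis i (x $ i))"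
  by (simp add: vec_eq_iff axis_def sum.delta if_distrib cong: if_cong)

lemma bounded_linear_axis: "bounded_linear (axis i :: 'a::real_normed_vector \<Rightarrow> 'a ^ 'n)"
proof (rule bounded_linear_intro)
  show "norm (axis i x :: 'a ^ 'n) \<le> norm x * 1" for x
    unfolding norm_vec_def L2_set_def
    by (simp add: axis_def if_distrib[of norm] if_distrib[of "\<lambda>x. x\<^sup>2"] sum.delta cong: if_cong)
qed (simp_all add: vec_eq_iff axis_def)

lemma borel_measurable_vec:
  fixes X :: "'w \<Rightarrow> 'a::{real_normed_vector, second_countable_topology} ^ 'n"
  assumes "\<And>i. (\<lambda>w. X w $ i) \<in> borel_measurable G"
  shows "X \<in> borel_measurable G"
proof -
  have "(\<lambda>w. \<Sum>i\<in>UNIV. axis i (X w $ i)) \<in> borel_measurable G"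
    by (intro borel_measurable_sum borel_measurable_continuous_on[OF _ assms]
        linear_continuous_on bounded_linear_axis)
  then show ?thesis by (simp flip: vec_eq_sum_axis)
qed

lemma bounded_linear_diag_op:
  fixes Q :: "'a::real_normed_vector \<Rightarrow> 'a"
  assumes "bounded_linear Q"
  shows "bounded_linear (diag_op Q :: 'a ^ 'n \<Rightarrow> 'a ^ 'n)"
proof -
  interpret Q: bounded_linear Q by fact
  have "bounded_linear (\<lambda>u :: 'a ^ 'n. \<Sum>i\<in>UNIV. axis i (Q (u $ i)))"
    by (intro bounded_linear_sum bounded_linear_compose[OF bounded_linear_axis] 
        bounded_linear_compose[OF assms] bounded_linear_vec_nth)
  moreover have "(\<lambda>u :: 'a ^ 'n. \<Sum>i\<in>UNIV. axis i (Q (u $ i))) = diag_op Q"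
    by (rule ext, subst (2) vec_eq_sum_axis) (simp add: diag_op_def)
  ultimately show ?thesis by simp
qed

text \<open>The paths are made continuous everywhere by a change on a null set. Distinct components
  contribute no covariance, by \<open>Q_wiener_cross_covariation\<close>, which leaves the
  block-diagonal operator.\<close>

lemma (in stochastic_basis) independent_Q_wiener_hilbert_noise:
  fixes W :: "real \<Rightarrow> 'w \<Rightarrow> 'h::{real_inner, banach, second_countable_topology} ^ 'n"
  assumes Q: "covariance_operator Q" and W: "independent_Q_wiener M F Q W"
  obtains W' where "hilbert_noise M F W' (diag_op Q)" "AE w in M. \<forall>t\<ge>0. W' t w = W t w"
proof -
  have Wk: "Q_wiener_process M F Q (\<lambda>t w. W t w $ k)" for k using W by (simp add: independent_Q_wiener_def)
  have "AE w in M. \<forall>k. continuous_on {0..} (\<lambda>t. W t w $ k)"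
    using Wk by (simp add: Q_wiener_process_def AE_all_countable)
  then have "AE w in M. continuous_on {0..} (\<lambda>t. W t w)"
  proof eventually_elim
    fix w assume "\<forall>k. continuous_on {0..} (\<lambda>t. W t w $ k)"
    then have "continuous_on {0..} (\<lambda>t. \<chi> k. W t w $ k)" by (intro continuous_on_vec_lambda) auto
    then show "continuous_on {0..} (\<lambda>t. W t w)" by simp
  qed
  then obtain N where N: "{w\<in>space M. \<not> continuous_on {0..} (\<lambda>t. W t w)} \<subseteq> N" "N \<in> null_sets M"
    by (auto elim!: AE_E simp: null_sets_def)
  define W' where "W' t w = (if w \<in> N then 0 else W t w)" for t w
  have eq: "AE w in M. \<forall>t\<ge>0. W' t w = W t w"
    using AE_not_in[OF N(2)] by eventually_elim (simp add: W'_def)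
  have WF: "W t \<in> borel_measurable (F t)" if "0 \<le> t" for t
    by (rule borel_measurable_vec) (rule Q_wiener_measurable[OF Q Wk that])
  have ca: "cont_adapted W'"
    unfolding cont_adapted_def
  proof (intro conjI allI impI ballI)
    fix t :: real assume "0 \<le> t"
    then show "W' t \<in> borel_measurable (F t)"
      unfolding W'_def by (intro measurable_F_modify WF N(2)) auto
  next
    fix w assume "w \<in> space M"
    then show "continuous_on {0..} (\<lambda>t. W' t w)" using N(1) by (cases "w \<in> N") (auto simp: W'_def)
  qed
  have W'M: "(\<lambda>w. W' t w) \<in> borel_measurable M" if "0 \<le> t" for t by (rule cont_adapted_M[OF ca that])
  have WM: "(\<lambda>w. W t w $ k) \<in> borel_measurable M" if "0 \<le> t" for t k
    using measurable_F_M[OF that Q_wiener_measurable[OF Q Wk that]] .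
  have inc: "AE w in M. (W' t w - W' s w) \<bullet> h = (\<Sum>k\<in>UNIV. (W t w $ k - W s w $ k) \<bullet> (h $ k))"
    if "0 \<le> s" "s \<le> t" for s t h
    using eq by eventually_elim (use that in \<open>simp add: inner_vec_def\<close>)
  note mom = Q_wiener_increment_moments[OF Q Wk] and mean = Q_wiener_increment_mean[OF Q Wk]
  have sqsum: "(\<Sum>k\<in>(UNIV::'n set). x k)\<^sup>2 \<le> real CARD('n) * (\<Sum>k\<in>UNIV. (x k)\<^sup>2)" for x :: "'n \<Rightarrow> real"
    using power2_norm_sum_le[of UNIV x] by simp
  have bint: "integrable M c" if "0 \<le> s" "c \<in> borel_measurable (F s)" "\<And>w. \<bar>c w\<bar> \<le> K" for c :: "'w \<Rightarrow> real" and s K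
    using that measurable_F_M[OF that(1,2)] by (intro integrable_const_bound[where B = K]) auto
  have "hilbert_noise M F W' (diag_op Q)"
  proof (rule hilbert_noise.intro[OF stochastic_basis_axioms], rule hilbert_noise_axioms.intro)
    show "cont_adapted W'" by (rule ca)
    show "bounded_linear (diag_op Q :: 'h ^ 'n \<Rightarrow> 'h ^ 'n)"
      by (rule bounded_linear_diag_op[OF covariance_linear[OF Q Wk]])
    show "diag_op Q x \<bullet> y = x \<bullet> diag_op Q y" for x y :: "'h ^ 'n"
      by (simp add: inner_vec_def diag_op_def covariance_sym[OF Q Wk])
    show "0 \<le> diag_op Q x \<bullet> x" for x :: "'h ^ 'n"
      by (simp add: inner_vec_def diag_op_def covariance_psd[OF Q Wk] sum_nonneg)
  next
    fix s t :: real and h assume st: "0 \<le> s" "s \<le> t"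
    have t0: "0 \<le> t" using st by simp
    note [measurable] = W'M[OF st(1)] W'M[OF t0] WM[OF st(1)] WM[OF t0]
    show "integrable M (\<lambda>w. ((W' t w - W' s w) \<bullet> h)\<^sup>2)"
    proof (cases "s = t")
      case False
      then have st': "s < t" using st by simp
      have "integrable M (\<lambda>w. real CARD('n) * (\<Sum>k\<in>UNIV. ((W t w $ k - W s w $ k) \<bullet> (h $ k))\<^sup>2))"
        using mom(3)[OF st(1) st'] by simp
      then show ?thesis
      proof (rule Bochner_Integration.integrable_bound)
        show "(\<lambda>w. ((W' t w - W' s w) \<bullet> h)\<^sup>2) \<in> borel_measurable M"
          by measurable
        show "AE w in M. norm (((W' t w - W' s w) \<bullet> h)\<^sup>2) \<le> norm (real CARD('n) * (\<Sum>k\<in>UNIV. ((W t w $ k - W s w $ k) \<bullet> (h $ k))\<^sup>2))"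
          using inc[OF st, of h] by eventually_elim (use sqsum in \<open>auto simp: sum_nonneg\<close>)
      qed
    qed simp
  next
    fix s t :: real and c :: "'w \<Rightarrow> real" and K h
    assume st: "0 \<le> s" "s \<le> t" and c: "c \<in> borel_measurable (F s)" "\<And>w. \<bar>c w\<bar> \<le> K"
    have t0: "0 \<le> t" using st by simp
    note [measurable] = W'M[OF st(1)] W'M[OF t0] WM[OF st(1)] WM[OF t0]
    have cM: "c \<in> borel_measurable M" by (rule measurable_F_M[OF st(1) c(1)])
    show "(\<integral>w. c w * ((W' t w - W' s w) \<bullet> h) \<partial>M) = 0"
    proof (cases "s = t")
      case False
      then have st': "s < t" using st by simp
      have "(\<integral>w. c w * ((W' t w - W' s w) \<bullet> h) \<partial>M)
         = (\<integral>w. (\<Sum>k\<in>UNIV. c w * ((W t w $ k - W s w $ k) \<bullet> (h $ k))) \<partial>M)"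
      proof (rule integral_cong_AE)
        show "AE w in M. c w * ((W' t w - W' s w) \<bullet> h) = (\<Sum>k\<in>UNIV. c w * ((W t w $ k - W s w $ k) \<bullet> (h $ k)))"
          using inc[OF st, of h] by eventually_elim (simp add: sum_distrib_left)
      qed (use cM in measurable)
      also have "\<dots> = 0"
        using mean[OF st(1) st' c(1) bint[OF st(1) c]] by simp
      finally show ?thesis .
    qed simp
    fix h'
    show "(\<integral>w. c w * (((W' t w - W' s w) \<bullet> h) * ((W' t w - W' s w) \<bullet> h')) \<partial>M)
       = (t - s) * (diag_op Q h \<bullet> h') * (\<integral>w. c w \<partial>M)"
    proof (cases "s = t")
      case False
      then have st': "s < t" using st by simp
      let ?D = "\<lambda>k h w. (W t w $ k - W s w $ k) \<bullet> (h $ k)"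
      have i: "integrable M (\<lambda>w. ?D k h w * ?D l h' w)" for k l h h'
        by (rule integrable_mult_L2[OF _ _ mom(3)[OF st(1) st'] mom(3)[OF st(1) st']])
           measurable
      have ci: "integrable M (\<lambda>w. c w * (?D k h w * ?D l h' w))" for k l
      proof (rule Bochner_Integration.integrable_bound)
        show "integrable M (\<lambda>w. K * (?D k h w * ?D l h' w))" using i by simp
        have "0 \<le> K" using c(2) by (meson abs_ge_zero order_trans)
        then show "AE w in M. norm (c w * (?D k h w * ?D l h' w)) \<le> norm (K * (?D k h w * ?D l h' w))"
          using c(2) by (intro AE_I2) (auto simp: abs_mult intro!: mult_right_mono)
      qed (use cM in measurable)
      have "(\<integral>w. c w * (((W' t w - W' s w) \<bullet> h) * ((W' t w - W' s w) \<bullet> h')) \<partial>M)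
         = (\<integral>w. (\<Sum>k\<in>UNIV. \<Sum>l\<in>UNIV. c w * (?D k h w * ?D l h' w)) \<partial>M)"
      proof (rule integral_cong_AE)
        show "AE w in M. c w * (((W' t w - W' s w) \<bullet> h) * ((W' t w - W' s w) \<bullet> h'))
          = (\<Sum>k\<in>UNIV. \<Sum>l\<in>UNIV. c w * (?D k h w * ?D l h' w))"
          using inc[OF st, of h] inc[OF st, of h']
          by eventually_elim (simp only: sum_product, simp only: sum_distrib_left)
      qed (use cM in measurable)
      also have "\<dots> = (\<Sum>k\<in>UNIV. \<Sum>l\<in>UNIV. \<integral>w. c w * (?D k h w * ?D l h' w) \<partial>M)"
        using ci by simp
      also have "\<dots> = (\<Sum>k\<in>UNIV. \<Sum>l\<in>UNIV. if l = k then (t - s) * (Q (h $ k) \<bullet> (h' $ k)) * (\<integral>w. c w \<partial>M) else 0)"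
      proof (intro sum.cong refl)
        fix k l :: 'n
        show "(\<integral>w. c w * (?D k h w * ?D l h' w) \<partial>M) = (if l = k then (t - s) * (Q (h $ k) \<bullet> (h' $ k)) * (\<integral>w. c w \<partial>M) else 0)"
          using Q_wiener_increment_cond_cov[OF Q Wk st(1) st' c(1) bint[OF st(1) c], of k "h $ k" "h' $ k"]
            Q_wiener_cross_covariation(1)[OF Q W _ st(1) st' c, of k l "h $ k" "h' $ l"]
          by (cases "l = k") auto
      qed
      also have "\<dots> = (\<Sum>k\<in>UNIV. (t - s) * (Q (h $ k) \<bullet> (h' $ k)) * (\<integral>w. c w \<partial>M))" by simp
      also have "\<dots> = (t - s) * (diag_op Q h \<bullet> h') * (\<integral>w. c w \<partial>M)"
        by (simp add: inner_vec_def diag_op_def sum_distrib_left sum_distrib_right)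
      finally show ?thesis .
    qed simp
  qed
  then show thesis using that eq by blast
qed

subsection \<open>Elementary integrals\<close>

context hilbert_noise
begin

text \<open>Integrand and integral are generated side by side, so the integral never has to be shown
  independent of a representation. Intervals may overlap and the real multipliers are merely
  bounded, which makes closure under sums and restrictions immediate.\<close>

inductive elem :: "(real \<Rightarrow> 'w \<Rightarrow> 'k) \<Rightarrow> (real \<Rightarrow> 'w \<Rightarrow> real) \<Rightarrow> bool" where
  elem_0: "elem (\<lambda>s w. 0) (\<lambda>t w. 0)"
| elem_step: "0 \<le> a \<Longrightarrow> a \<le> b \<Longrightarrow> c \<in> borel_measurable (F a) \<Longrightarrow> (\<forall>w. \<bar>c w\<bar> \<le> K) \<Longrightarrow> elem \<psi> S \<Longrightarrow>
    elem (\<lambda>s w. (if s \<in> {a<..b} then c w else 0) *\<^sub>R h + \<psi> s w)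
      (\<lambda>t w. c w * ((W (min t b) w - W (min t a) w) \<bullet> h) + S t w)"

lemma elem_single:
  assumes "0 \<le> a" "a \<le> b" "c \<in> borel_measurable (F a)" "\<And>w. \<bar>c w\<bar> \<le> K"
  shows "elem (\<lambda>s w. (if s \<in> {a<..b} then c w else 0) *\<^sub>R h) (\<lambda>t w. c w * ((W (min t b) w - W (min t a) w) \<bullet> h))"
  using elem_step[OF assms(1-3) _ elem_0, of K h] assms(4) by simp

lemma elem_add:
  assumes "elem \<psi> S" "elem \<psi>' S'"
  shows "elem (\<lambda>s w. \<psi> s w + \<psi>' s w) (\<lambda>t w. S t w + S' t w)"
  using assms(1)
proof induction
  case elem_0
  then show ?case using assms(2) by simp
next
  case (elem_step a b c K \<psi> S h)
  from elem.elem_step[OF elem_step(1-4,6), of h] show ?case by (simp add: add.assoc)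
qed

lemma elem_scale:
  assumes "elem \<psi> S"
  shows "elem (\<lambda>s w. r *\<^sub>R \<psi> s w) (\<lambda>t w. r * S t w)"
  using assms
proof induction
  case elem_0
  then show ?case using elem.elem_0 by simp
next
  case (elem_step a b c K \<psi> S h)
  have "\<forall>w. \<bar>r * c w\<bar> \<le> \<bar>r\<bar> * K" using elem_step(4) by (auto simp: abs_mult intro!: mult_left_mono)
  moreover have "(\<lambda>w. r * c w) \<in> borel_measurable (F a)" using elem_step(3) by measurable
  ultimately have "elem (\<lambda>s w. (if s \<in> {a<..b} then r * c w else 0) *\<^sub>R h + r *\<^sub>R \<psi> s w)
      (\<lambda>t w. (r * c w) * ((W (min t b) w - W (min t a) w) \<bullet> h) + r * S t w)"
    by (intro elem.elem_step[OF elem_step(1,2) _ _ elem_step(6)]) auto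
  moreover have "(\<lambda>s w. (if s \<in> {a<..b} then r * c w else 0) *\<^sub>R h + r *\<^sub>R \<psi> s w)
     = (\<lambda>s w. r *\<^sub>R ((if s \<in> {a<..b} then c w else 0) *\<^sub>R h + \<psi> s w))"
    by (intro ext) (simp add: scaleR_add_right)
  ultimately show ?case by (simp add: distrib_left mult.assoc)
qed

lemma elem_diff:
  assumes "elem \<psi> S" "elem \<psi>' S'"
  shows "elem (\<lambda>s w. \<psi> s w - \<psi>' s w) (\<lambda>t w. S t w - S' t w)"
  using elem_add[OF assms(1) elem_scale[OF assms(2), of "-1"]] by simp

lemma elem_sum:
  assumes "\<And>i. i \<in> I \<Longrightarrow> elem (\<psi> i) (S i)"
  shows "elem (\<lambda>s w. \<Sum>i\<in>I. \<psi> i s w) (\<lambda>t w. \<Sum>i\<in>I. S i t w)"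
  using assms by (induction I rule: infinite_finite_induct) (auto intro: elem_0 elem_add)

text \<open>Turns a statement about an increment of the integral, tested against a bounded variable
  of the past, into a statement about another elementary integral. Both the martingale property and
  the bounds on events of the past rest on it.\<close>

lemma elem_restrict:
  assumes "elem \<psi> S" and u: "0 \<le> u" and d: "d \<in> borel_measurable (F u)" "\<And>w. \<bar>d w\<bar> \<le> L"
  shows "elem (\<lambda>s w. (if u < s then d w else 0) *\<^sub>R \<psi> s w) (\<lambda>t w. d w * (S (max t u) w - S u w))"
  using assms(1)
proof induction
  case elem_0
  then show ?case using elem.elem_0 by simp
next
  case (elem_step a b c K \<psi> S h)
  have L: "0 \<le> L" using d(2) by (meson abs_ge_zero order_trans)
  have m: "(\<lambda>w. d w * c w) \<in> borel_measurable (F (max a u))"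
    using measurable_F_mono[OF elem_step(1) _ elem_step(3), of "max a u"] measurable_F_mono[OF u _ d(1), of "max a u"]
    by (intro borel_measurable_times) auto
  have b: "\<forall>w. \<bar>d w * c w\<bar> \<le> L * K"
    using elem_step(4) d(2) L by (auto simp: abs_mult intro!: mult_mono)
  have "elem (\<lambda>s w. (if s \<in> {max a u<..max b u} then d w * c w else 0) *\<^sub>R h + (if u < s then d w else 0) *\<^sub>R \<psi> s w)
      (\<lambda>t w. (d w * c w) * ((W (min t (max b u)) w - W (min t (max a u)) w) \<bullet> h) + d w * (S (max t u) w - S u w))"
    using elem_step(1,2) u by (intro elem.elem_step[OF _ _ m b elem_step(6)]) auto
  moreover have "(\<lambda>s w. (if s \<in> {max a u<..max b u} then d w * c w else 0) *\<^sub>R h + (if u < s then d w else 0) *\<^sub>R \<psi> s w)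
     = (\<lambda>s w. (if u < s then d w else 0) *\<^sub>R ((if s \<in> {a<..b} then c w else 0) *\<^sub>R h + \<psi> s w))"
    by (intro ext) (auto simp: scaleR_add_right)
  moreover have "(d w * c w) * ((W (min t (max b u)) w - W (min t (max a u)) w) \<bullet> h) + d w * (S (max t u) w - S u w)
     = d w * ((c w * ((W (min (max t u) b) w - W (min (max t u) a) w) \<bullet> h) + S (max t u) w)
         - (c w * ((W (min u b) w - W (min u a) w) \<bullet> h) + S u w))" for t w
  proof -
    \<comment> \<open>Before \<open>u\<close> both sides vanish. From \<open>u\<close> on, an
      endpoint below \<open>u\<close> is moved up to \<open>u\<close>, which removes the part of the
      increment that precedes \<open>u\<close>.\<close>
    have X: "(W (min t (max b u)) w - W (min t (max a u)) w) \<bullet> h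
       = (W (min (max t u) b) w - W (min (max t u) a) w) \<bullet> h - (W (min u b) w - W (min u a) w) \<bullet> h"
    proof (cases "t < u")
      case True
      then show ?thesis by (simp add: min_def max_def)
    next
      case False
      have e: "W (min t (max z u)) w = W (min (max t u) z) w + (W u w - W (min u z) w)" for z
        using False by (cases "z \<le> u") (auto simp: min_def max_def)
      show ?thesis unfolding e by (simp add: inner_diff_left inner_add_left)
    qed
    show ?thesis unfolding X by (simp add: algebra_simps)
  qed
  ultimately show ?case by simp
qed

lemma elem_bounded:
  assumes "elem \<psi> S" shows "\<exists>K\<ge>0. \<forall>s w. norm (\<psi> s w) \<le> K"
  using assms
proof induction
  case (elem_step a b c K \<psi> S h)
  then obtain K' where K': "K' \<ge> 0" "\<And>s w. norm (\<psi> s w) \<le> K'" by blast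
  have K: "0 \<le> K" using elem_step(4) by (meson abs_ge_zero order_trans)
  have "norm ((if s \<in> {a<..b} then c w else 0) *\<^sub>R h + \<psi> s w) \<le> K * norm h + K'" for s w
    using elem_step(4) K K' by (intro norm_triangle_le add_mono) (auto intro!: mult_right_mono)
  then show ?case using K K' by (intro exI[of _ "K * norm h + K'"]) auto
qed auto

lemma elem_measurable_PT:
  assumes "elem \<psi> S" shows "(\<lambda>x. \<psi> (fst x) (snd x)) \<in> borel_measurable (PT T)"
  using assms
proof induction
  case (elem_step a b c K \<psi> S h)
  have c: "(\<lambda>x. c (snd x)) \<in> borel_measurable (PT T)"
    unfolding PT_def by (rule measurable_compose[OF measurable_snd measurable_F_M[OF elem_step(1,3)]])
  have "Measurable.pred (restrict_space lborel {0..T}) (\<lambda>s. s \<in> {a<..b})"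
    by (intro measurable_restrict_space1) simp
  then have i: "Measurable.pred (PT T) (\<lambda>x. fst x \<in> {a<..b})"
    unfolding PT_def by (rule measurable_compose[OF measurable_fst])
  show ?case using c i elem_step(6) by measurable
qed simp

lemma elem_measurable:
  assumes "elem \<psi> S" shows "\<psi> s \<in> borel_measurable M"
  using assms
proof induction
  case (elem_step a b c K \<psi> S h)
  show ?case using measurable_F_M[OF elem_step(1,3)] elem_step(6) by (cases "s \<in> {a<..b}") auto
qed simp

lemma elem_cont_adapted:
  assumes "elem \<psi> S" shows "cont_adapted S"
  using assms
proof induction
  case (elem_step a b c K \<psi> S h)
  have "cont_adapted (\<lambda>t w. c w * ((W (min t b) w - W (min t a) w) \<bullet> h))"
    unfolding cont_adapted_def
  proof (intro conjI allI impI ballI)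
    fix t :: real assume t: "0 \<le> t"
    show "(\<lambda>w. c w * ((W (min t b) w - W (min t a) w) \<bullet> h)) \<in> borel_measurable (F t)"
    \<comment> \<open>\<open>c\<close> is measurable only from time \<open>a\<close> on, but before
      that the increment it multiplies is zero.\<close>
    proof (cases "t \<le> a")
      case True
      then show ?thesis using elem_step(2) by (simp add: min_def)
    next
      case False
      have [measurable]: "c \<in> borel_measurable (F t)"
        using measurable_F_mono[OF elem_step(1) _ elem_step(3)] False by simp
      have [measurable]: "W (min t b) \<in> borel_measurable (F t)" "W (min t a) \<in> borel_measurable (F t)"
        using t elem_step(1,2)
        by (intro measurable_F_mono[of "min t b" t] measurable_F_mono[of "min t a" t] cont_adapted_F[OF W_ca]; simp)+
      show ?thesis by measurable
    qed
  next
    fix w assume w: "w \<in> space M"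
    have "continuous_on {0..} (\<lambda>t. W (min t z) w)" if "0 \<le> z" for z
      by (rule continuous_on_compose2[OF cont_adapted_cont[OF W_ca w]]) (use that in \<open>auto intro!: continuous_intros\<close>)
    then show "continuous_on {0..} (\<lambda>t. c w * ((W (min t b) w - W (min t a) w) \<bullet> h))"
      using elem_step(1,2) by (intro continuous_intros) auto
  qed
  then show ?case using elem_step(6) by (rule cont_adapted_add)
qed simp

lemma elem_at_0:
  assumes "elem \<psi> S" shows "S 0 w = 0"
  using assms by induction auto

end

subsection \<open>The Ito isometry for elementary integrals\<close>

context hilbert_noise
begin

lemma W_inc_F:
  assumes "0 \<le> s" "s \<le> t" "t \<le> u"
  shows "(\<lambda>w. (W t w - W s w) \<bullet> h) \<in> borel_measurable (F u)"
proof -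
  have [measurable]: "W t \<in> borel_measurable (F u)" "W s \<in> borel_measurable (F u)"
    using assms by (auto intro: measurable_F_mono[OF _ _ cont_adapted_F[OF W_ca]])
  show ?thesis by measurable
qed

lemma W_inc_M: "0 \<le> s \<Longrightarrow> s \<le> t \<Longrightarrow> (\<lambda>w. (W t w - W s w) \<bullet> h) \<in> borel_measurable M"
  by (rule measurable_F_M[of t], simp, rule W_inc_F) auto

lemma W_orthogonal:
  assumes st: "0 \<le> s" "s \<le> t" and Z: "Z \<in> borel_measurable (F s)" "integrable M (\<lambda>w. (Z w)\<^sup>2)"
  shows "integrable M (\<lambda>w. Z w * ((W t w - W s w) \<bullet> h))" "(\<integral>w. Z w * ((W t w - W s w) \<bullet> h) \<partial>M) = 0"
  by (rule orthogonal_L2_multiplier[OF st(1) W_inc_M[OF st] W_sq[OF st] _ Z], rule W_mean[OF st], assumption+)+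

lemma bounded_mult_sq_integrable:
  fixes c f :: "'w \<Rightarrow> real"
  assumes "c \<in> borel_measurable M" "f \<in> borel_measurable M" "\<And>w. \<bar>c w\<bar> \<le> K" "integrable M (\<lambda>w. (f w)\<^sup>2)"
  shows "integrable M (\<lambda>w. (c w * f w)\<^sup>2)"
proof (rule Bochner_Integration.integrable_bound)
  show "integrable M (\<lambda>w. K\<^sup>2 * (f w)\<^sup>2)" using assms(4) by simp
  have K: "0 \<le> K" using assms(3) by (meson abs_ge_zero order_trans)
  show "AE w in M. norm ((c w * f w)\<^sup>2) \<le> norm (K\<^sup>2 * (f w)\<^sup>2)"
    using assms(3) K by (intro AE_I2) (auto simp: power_mult_distrib abs_le_square_iff[symmetric] intro!: mult_right_mono)
qed (use assms in measurable)

text \<open>With \<open>a \<le> a'\<close>, both increments are cut at \<open>a'\<close> and at the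
  end \<open>\<mu>\<close> of the overlap. Every product other than the one over the overlap either
  has a factor lying after everything else, and then mean zero, or vanishes identically.\<close>

lemma interval_overlap_isometry:
  assumes ab: "0 \<le> a" "a \<le> b" and ab': "0 \<le> a'" "a' \<le> b'" and t: "0 \<le> t"
    and c: "c \<in> borel_measurable (F a)" "\<And>w. \<bar>c w\<bar> \<le> K"
    and c': "c' \<in> borel_measurable (F a')" "\<And>w. \<bar>c' w\<bar> \<le> K'"
  shows "(\<integral>w. (c w * ((W (min t b) w - W (min t a) w) \<bullet> h)) * (c' w * ((W (min t b') w - W (min t a') w) \<bullet> h')) \<partial>M)
    = (C h \<bullet> h') * (\<integral>w. c w * c' w \<partial>M) * measure lborel ({0..t} \<inter> {a<..b} \<inter> {a'<..b'})"
  using assms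
\<comment> \<open>Symmetry of \<open>C\<close> allows \<open>a \<le> a'\<close> to be assumed; all
  other data must be free to change places.\<close>
proof (induction a a' arbitrary: b b' c c' h h' K K' rule: linorder_wlog)
  case (sym a a')
  have "(\<integral>w. (c' w * ((W (min t b') w - W (min t a') w) \<bullet> h')) * (c w * ((W (min t b) w - W (min t a) w) \<bullet> h)) \<partial>M)
    = (C h' \<bullet> h) * (\<integral>w. c' w * c w \<partial>M) * measure lborel ({0..t} \<inter> {a'<..b'} \<inter> {a<..b})"
    by (rule sym(1)) (use sym in auto)
  then show ?case using C_sym[of h h'] by (simp add: mult.commute inner_commute Int_ac)
next
  case (le a a' b b' c c' h h' K K')
  note ab = le(2,3) and ab' = le(4,5) and c = le(7,8) and c' = le(9,10)
  show ?case
  proof (cases "t \<le> a'")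
    case True
    have "{0..t} \<inter> {a<..b} \<inter> {a'<..b'} = {}" using True by auto
    then show ?thesis using True ab' by (simp add: min_absorb1)
  next
    case False
    define \<beta> where "\<beta> = min t b"
    define \<beta>' where "\<beta>' = min t b'"
    have o: "min t a' = a'" "min t a = a" "a \<le> \<beta>" "a' \<le> \<beta>'" using False le(1) ab ab' by (auto simp: \<beta>_def \<beta>'_def)
    define D where "D s u w = (W u w - W s w) \<bullet> h" for s u w
    define D' where "D' s u w = (W u w - W s w) \<bullet> h'" for s u w
    define k where "k w = c w * c' w" for w
    have K: "0 \<le> K" using c(2) by (meson abs_ge_zero order_trans)
    have k_b: "\<bar>k w\<bar> \<le> K * K'" for w using c(2) c'(2) K by (auto simp: k_def abs_mult intro!: mult_mono)
    have k_F: "k \<in> borel_measurable (F u)" if "a' \<le> u" for u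
    proof -
      have [measurable]: "c \<in> borel_measurable (F u)" "c' \<in> borel_measurable (F u)"
        using measurable_F_mono[OF ab(1) _ c(1)] measurable_F_mono[OF ab'(1) _ c'(1)] that le(1) by auto
      show ?thesis unfolding k_def by measurable
    qed
    have k_M: "k \<in> borel_measurable M" using measurable_F_M[OF ab'(1) k_F] by simp
    have sqD: "integrable M (\<lambda>w. (k w * D s u w)\<^sup>2)" "integrable M (\<lambda>w. (k w * D' s u w)\<^sup>2)" if "0 \<le> s" "s \<le> u" for s u
      unfolding D_def D'_def by (rule bounded_mult_sq_integrable[OF k_M W_inc_M[OF that] k_b W_sq[OF that]])+
    have kD_F: "(\<lambda>w. k w * D s u w) \<in> borel_measurable (F v)" "(\<lambda>w. k w * D' s u w) \<in> borel_measurable (F v)"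
      if "0 \<le> s" "s \<le> u" "u \<le> v" "a' \<le> v" for s u v
      unfolding D_def D'_def using k_F[OF that(4)] W_inc_F[OF that(1-3)] by (intro borel_measurable_times; simp)+
    have past: "integrable M (\<lambda>w. k w * D s u w * D' v z w)" "(\<integral>w. k w * D s u w * D' v z w \<partial>M) = 0"
      if "0 \<le> s" "s \<le> u" "u \<le> v" "a' \<le> v" "v \<le> z" for s u v z
    proof -
      have v: "0 \<le> v" using that by simp
      note W_orthogonal[OF v that(5) kD_F(1)[OF that(1-4)] sqD(1)[OF that(1,2)], of h', folded D'_def]
      then show "integrable M (\<lambda>w. k w * D s u w * D' v z w)" "(\<integral>w. k w * D s u w * D' v z w \<partial>M) = 0" .
    qed
    have past': "integrable M (\<lambda>w. k w * D' s u w * D v z w)" "(\<integral>w. k w * D' s u w * D v z w \<partial>M) = 0"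
      if "0 \<le> s" "s \<le> u" "u \<le> v" "a' \<le> v" "v \<le> z" for s u v z
    proof -
      have v: "0 \<le> v" using that by simp
      note W_orthogonal[OF v that(5) kD_F(2)[OF that(1-4)] sqD(2)[OF that(1,2)], of h, folded D_def]
      then show "integrable M (\<lambda>w. k w * D' s u w * D v z w)" "(\<integral>w. k w * D' s u w * D v z w \<partial>M) = 0" .
    qed
    have LHS: "(\<integral>w. (c w * ((W (min t b) w - W (min t a) w) \<bullet> h)) * (c' w * ((W (min t b') w - W (min t a') w) \<bullet> h')) \<partial>M)
      = (\<integral>w. k w * D a \<beta> w * D' a' \<beta>' w \<partial>M)"
      by (rule Bochner_Integration.integral_cong) (simp_all add: k_def D_def D'_def o \<beta>_def \<beta>'_def mult_ac)
    show ?thesis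
    proof (cases "b \<le> a'")
      case True
      have "{0..t} \<inter> {a<..b} \<inter> {a'<..b'} = {}" using True by auto
      moreover have "(\<integral>w. k w * D a \<beta> w * D' a' \<beta>' w \<partial>M) = 0"
        by (rule past(2)) (use o ab True in \<open>auto simp: \<beta>_def\<close>)
      ultimately show ?thesis unfolding LHS by simp
    next
      case b: False
      define \<mu> where "\<mu> = min \<beta> \<beta>'"
      have \<mu>: "a' \<le> \<mu>" "\<mu> \<le> \<beta>" "\<mu> \<le> \<beta>'" using b False o by (auto simp: \<mu>_def \<beta>_def)
      have set_eq: "{0..t} \<inter> {a<..b} \<inter> {a'<..b'} = {a'<..\<mu>}"
        using le(1) ab ab' by (auto simp: \<mu>_def \<beta>_def \<beta>'_def)
      have same: "(\<integral>w. k w * (D a' \<mu> w * D' a' \<mu> w) \<partial>M) = (\<mu> - a') * (C h \<bullet> h') * (\<integral>w. k w \<partial>M)"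
        unfolding D_def D'_def by (rule W_cov[OF ab'(1) \<mu>(1) k_F k_b]) simp
      have same_i: "integrable M (\<lambda>w. k w * D a' \<mu> w * D' a' \<mu> w)"
        using integrable_mult_L2[of "\<lambda>w. k w * D a' \<mu> w" "\<lambda>w. D' a' \<mu> w"]
          sqD(1)[OF ab'(1) \<mu>(1)] W_sq[OF ab'(1) \<mu>(1), of h'] W_inc_M[OF ab'(1) \<mu>(1)] k_M
        by (simp add: D_def D'_def)
      have split: "k w * D a \<beta> w * D' a' \<beta>' w = k w * D a a' w * D' a' \<beta>' w + k w * D a' \<mu> w * D' a' \<mu> w
        + k w * D a' \<mu> w * D' \<mu> \<beta>' w + k w * D' a' \<mu> w * D \<mu> \<beta> w" for w
      proof -
        have d: "D a \<beta> w = D a a' w + D a' \<mu> w + D \<mu> \<beta> w" "D' a' \<beta>' w = D' a' \<mu> w + D' \<mu> \<beta>' w"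
          by (simp_all add: D_def D'_def inner_diff_left)
        \<comment> \<open>\<open>\<mu>\<close> is one of the two right endpoints, so one of the two
          tails is trivial.\<close>
        have "D \<mu> \<beta> w * D' \<mu> \<beta>' w = 0" by (auto simp: \<mu>_def min_def D_def D'_def)
        then show ?thesis unfolding d by (simp add: algebra_simps)
      qed
      have "(\<integral>w. k w * D a \<beta> w * D' a' \<beta>' w \<partial>M) = (\<integral>w. k w * D a' \<mu> w * D' a' \<mu> w \<partial>M)"
        unfolding split
        using past[of a a' a' \<beta>'] past[of a' \<mu> \<mu> \<beta>'] past'[of a' \<mu> \<mu> \<beta>] same_i \<mu> o ab ab' le(1) by simp
      also have "\<dots> = (\<mu> - a') * (C h \<bullet> h') * (\<integral>w. k w \<partial>M)" using same by (simp add: mult.assoc)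
      finally show ?thesis unfolding LHS set_eq k_def using \<mu>(1) by (simp add: mult_ac)
    qed
  qed
qed

lemma elem_sq_integrable:
  assumes "elem \<psi> S" "0 \<le> t" shows "integrable M (\<lambda>w. (S t w)\<^sup>2)"
  using assms(1)
proof induction
  case (elem_step a b c K \<psi> S h)
  let ?X = "\<lambda>w. c w * ((W (min t b) w - W (min t a) w) \<bullet> h)"
  have m: "0 \<le> min t a" "min t a \<le> min t b" using elem_step(1,2) assms(2) by auto
  have i: "integrable M (\<lambda>w. (?X w)\<^sup>2)"
    by (rule bounded_mult_sq_integrable[OF measurable_F_M[OF elem_step(1,3)] W_inc_M[OF m] _ W_sq[OF m]])
       (use elem_step(4) in blast)
  have XM: "?X \<in> borel_measurable M"
    using measurable_F_M[OF elem_step(1,3)] W_inc_M[OF m] by (intro borel_measurable_times)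
  have SM: "S t \<in> borel_measurable M" by (rule cont_adapted_M[OF elem_cont_adapted[OF elem_step(5)] assms(2)])
  have "integrable M (\<lambda>w. (?X w)\<^sup>2 + (S t w)\<^sup>2 + 2 * (?X w * S t w))"
    using i elem_step(6) integrable_mult_L2[OF XM SM i elem_step(6)] by simp
  moreover have "(?X w + S t w)\<^sup>2 = (?X w)\<^sup>2 + (S t w)\<^sup>2 + 2 * (?X w * S t w)" for w
    by (simp add: power2_sum)
  ultimately show ?case by simp
qed simp

lemma elem_mean:
  assumes "elem \<psi> S" "0 \<le> t" shows "(\<integral>w. S t w \<partial>M) = 0"
  using assms(1)
proof induction
  case (elem_step a b c K \<psi> S h)
  let ?X = "\<lambda>w. c w * ((W (min t b) w - W (min t a) w) \<bullet> h)"
  have Si: "integrable M (S t)"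
    using elem_sq_integrable[OF elem_step(5) assms(2)] cont_adapted_M[OF elem_cont_adapted[OF elem_step(5)] assms(2)]
    by (rule square_integrable_imp_integrable[rotated])
  have X: "integrable M ?X \<and> (\<integral>w. ?X w \<partial>M) = 0"
  proof (cases "t \<le> a")
    case True
    then show ?thesis using elem_step(2) by (simp add: min_def)
  next
    case False
    then have m: "min t a = a" "a \<le> min t b" using elem_step(2) by auto
    have "integrable M (\<lambda>w. (c w)\<^sup>2)"
    proof (rule integrable_const_bound[where B = "K\<^sup>2"])
      show "AE w in M. norm ((c w)\<^sup>2) \<le> K\<^sup>2"
        using elem_step(4) by (intro AE_I2) (simp add: abs_le_square_iff[symmetric], smt (verit) abs_ge_zero)
    qed (use measurable_F_M[OF elem_step(1,3)] in measurable)
    then show ?thesis using W_orthogonal[OF elem_step(1) m(2) elem_step(3)] by (simp add: m)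
  qed
  show ?case using X Si elem_step(6) by simp
qed simp

text \<open>The bilinear form is what induction can prove, once in each argument; the quadratic one
  would leave cross terms. Integrability in time is carried along because additivity of the integral
  needs it.\<close>

lemma elem_isometry_bilinear:
  assumes "elem \<psi> S" and S': "elem \<psi>' S'" and t: "0 \<le> t"
  shows "set_integrable lborel {0..t} (\<lambda>s. \<integral>w. C (\<psi> s w) \<bullet> \<psi>' s w \<partial>M) \<and>
    (\<integral>w. S t w * S' t w \<partial>M) = (LINT s:{0..t}|lborel. \<integral>w. C (\<psi> s w) \<bullet> \<psi>' s w \<partial>M)"
  using assms(1)
proof induction
  case elem_0
  then show ?case by (simp add: linear_0[OF bounded_linear.linear[OF C_lin]] set_lebesgue_integral_def set_integrable_def)
next
  case (elem_step a b c K \<psi> S h)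
  note Cl = bounded_linear.linear[OF C_lin]
  let ?X = "\<lambda>w. c w * ((W (min t b) w - W (min t a) w) \<bullet> h)"
  let ?\<phi> = "\<lambda>s w. (if s \<in> {a<..b} then c w else 0) *\<^sub>R h"
  have cb: "\<bar>c w\<bar> \<le> K" for w using elem_step(4) by blast
  have eX: "elem ?\<phi> (\<lambda>t w. c w * ((W (min t b) w - W (min t a) w) \<bullet> h))"
    by (rule elem_single[OF elem_step(1-3) cb])
  have bint: "integrable M (\<lambda>w. C (\<theta> s w) \<bullet> \<theta>' s w)" if e: "elem \<theta> R" "elem \<theta>' R'" for \<theta> \<theta>' R R' s
  proof -
    obtain K1 where K1: "K1 \<ge> 0" "\<And>s w. norm (\<theta> s w) \<le> K1" using elem_bounded[OF e(1)] by blast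
    obtain K2 where K2: "K2 \<ge> 0" "\<And>s w. norm (\<theta>' s w) \<le> K2" using elem_bounded[OF e(2)] by blast
    obtain B where B: "B > 0" "\<And>x. norm (C x) \<le> norm x * B" using bounded_linear.pos_bounded[OF C_lin] by blast
    have [measurable]: "C \<in> borel_measurable borel"
      by (intro borel_measurable_continuous_onI linear_continuous_on C_lin)
    show ?thesis
    proof (rule integrable_const_bound[where B = "K1 * B * K2"])
      have "\<bar>C (\<theta> s w) \<bullet> \<theta>' s w\<bar> \<le> K1 * B * K2" for w
      proof -
        have "\<bar>C (\<theta> s w) \<bullet> \<theta>' s w\<bar> \<le> norm (C (\<theta> s w)) * norm (\<theta>' s w)" by (rule Cauchy_Schwarz_ineq2)
        also have "\<dots> \<le> (K1 * B) * K2"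
          using B K1 K2 by (intro mult_mono order_trans[OF B(2)]) (auto intro!: mult_right_mono)
        finally show ?thesis .
      qed
      then show "AE w in M. norm (C (\<theta> s w) \<bullet> \<theta>' s w) \<le> K1 * B * K2" by auto
      show "(\<lambda>w. C (\<theta> s w) \<bullet> \<theta>' s w) \<in> borel_measurable M"
        using elem_measurable[OF e(1), of s] elem_measurable[OF e(2), of s] by measurable
    qed
  qed
  have single: "set_integrable lborel {0..t} (\<lambda>s. \<integral>w. C (?\<phi> s w) \<bullet> \<psi>' s w \<partial>M) \<and>
    (\<integral>w. ?X w * S' t w \<partial>M) = (LINT s:{0..t}|lborel. \<integral>w. C (?\<phi> s w) \<bullet> \<psi>' s w \<partial>M)"
    using S'
  proof induction
    case elem_0
    then show ?case by (simp add: set_lebesgue_integral_def set_integrable_def)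
  next
    case (elem_step a' b' c' K' \<psi>' S' h')
    have cb': "\<bar>c' w\<bar> \<le> K'" for w using elem_step(4) by blast
    let ?X' = "\<lambda>w. c' w * ((W (min t b') w - W (min t a') w) \<bullet> h')"
    let ?\<phi>' = "\<lambda>s w. (if s \<in> {a'<..b'} then c' w else 0) *\<^sub>R h'"
    have eX': "elem ?\<phi>' (\<lambda>t w. c' w * ((W (min t b') w - W (min t a') w) \<bullet> h'))"
      by (rule elem_single[OF elem_step(1-3) cb'])
    have XL: "integrable M (\<lambda>w. R t w * R' t w)" if "elem \<theta> R" "elem \<theta>' R'" for \<theta> \<theta>' R R'
      by (rule integrable_mult_L2[OF cont_adapted_M[OF elem_cont_adapted[OF that(1)] t] cont_adapted_M[OF elem_cont_adapted[OF that(2)] t]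
            elem_sq_integrable[OF that(1) t] elem_sq_integrable[OF that(2) t]])
    have e: "(\<integral>w. C (?\<phi> s w) \<bullet> ?\<phi>' s w \<partial>M) = (C h \<bullet> h') * (\<integral>w. c w * c' w \<partial>M) * indicator ({a<..b} \<inter> {a'<..b'}) s" for s
    proof -
      have "(\<integral>w. C (?\<phi> s w) \<bullet> ?\<phi>' s w \<partial>M)
        = (\<integral>w. ((C h \<bullet> h') * indicator ({a<..b} \<inter> {a'<..b'}) s) * (c w * c' w) \<partial>M)"
        by (rule Bochner_Integration.integral_cong)
           (auto simp: linear_0[OF Cl] linear_scale[OF Cl] split: split_indicator)
      then show ?thesis by simp
    qed
    have fin: "emeasure lborel ({0..t} \<inter> ({a<..b} \<inter> {a'<..b'})) < \<infinity>"
    proof -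
      have "emeasure lborel ({0..t} \<inter> ({a<..b} \<inter> {a'<..b'})) \<le> emeasure lborel {0..t}" by (intro emeasure_mono) auto
      then show ?thesis using t by (auto intro: le_less_trans)
    qed
    have i1: "set_integrable lborel {0..t} (\<lambda>s. \<integral>w. C (?\<phi> s w) \<bullet> ?\<phi>' s w \<partial>M)"
    proof -
      have "integrable lborel (\<lambda>s. (C h \<bullet> h') * (\<integral>w. c w * c' w \<partial>M) * indicator ({0..t} \<inter> ({a<..b} \<inter> {a'<..b'})) s)"
        using fin by (intro integrable_mult_right) (auto simp: integrable_indicator_iff)
      then show ?thesis unfolding set_integrable_def e by (simp add: indicator_inter_arith mult_ac)
    qed
    have v1: "(LINT s:{0..t}|lborel. \<integral>w. C (?\<phi> s w) \<bullet> ?\<phi>' s w \<partial>M)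
      = (C h \<bullet> h') * (\<integral>w. c w * c' w \<partial>M) * measure lborel ({0..t} \<inter> ({a<..b} \<inter> {a'<..b'}))"
    proof -
      have "(LINT s:{0..t}|lborel. \<integral>w. C (?\<phi> s w) \<bullet> ?\<phi>' s w \<partial>M)
        = (LINT s|lborel. (C h \<bullet> h') * (\<integral>w. c w * c' w \<partial>M) * indicator ({0..t} \<inter> ({a<..b} \<inter> {a'<..b'})) s)"
        unfolding set_lebesgue_integral_def e by (simp add: indicator_inter_arith mult_ac)
      also have "\<dots> = (C h \<bullet> h') * (\<integral>w. c w * c' w \<partial>M) * measure lborel ({0..t} \<inter> ({a<..b} \<inter> {a'<..b'}))"
        by simp
      finally show ?thesis .
    qed
    have r1: "(\<integral>w. ?X w * ?X' w \<partial>M) = (LINT s:{0..t}|lborel. \<integral>w. C (?\<phi> s w) \<bullet> ?\<phi>' s w \<partial>M)"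
      unfolding v1 using interval_overlap_isometry[OF \<open>0 \<le> a\<close> \<open>a \<le> b\<close> elem_step(1,2) t \<open>c \<in> borel_measurable (F a)\<close> cb elem_step(3) cb', of h h']
      by (simp add: Int_assoc)
    have add: "(\<integral>w. C (?\<phi> s w) \<bullet> (?\<phi>' s w + \<psi>' s w) \<partial>M) = (\<integral>w. C (?\<phi> s w) \<bullet> ?\<phi>' s w \<partial>M) + (\<integral>w. C (?\<phi> s w) \<bullet> \<psi>' s w \<partial>M)" for s
      unfolding inner_add_right by (rule Bochner_Integration.integral_add[OF bint[OF eX eX'] bint[OF eX elem_step(5)]])
    have "(\<integral>w. ?X w * (?X' w + S' t w) \<partial>M) = (\<integral>w. ?X w * ?X' w \<partial>M) + (\<integral>w. ?X w * S' t w \<partial>M)"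
      unfolding distrib_left using XL[OF eX eX'] XL[OF eX elem_step(5)] by (rule Bochner_Integration.integral_add)
    then show ?case
      unfolding add using i1 r1 elem_step(6) by (simp add: set_integral_add)
  qed
  have Si: "integrable M (\<lambda>w. S t w * S' t w)" "integrable M (\<lambda>w. ?X w * S' t w)"
    by (rule integrable_mult_L2[OF cont_adapted_M[OF elem_cont_adapted[OF elem_step(5)] t] cont_adapted_M[OF elem_cont_adapted[OF S'] t]
            elem_sq_integrable[OF elem_step(5) t] elem_sq_integrable[OF S' t]],
        rule integrable_mult_L2[OF cont_adapted_M[OF elem_cont_adapted[OF eX] t] cont_adapted_M[OF elem_cont_adapted[OF S'] t]
            elem_sq_integrable[OF eX t] elem_sq_integrable[OF S' t]])
  have add: "(\<integral>w. C (?\<phi> s w + \<psi> s w) \<bullet> \<psi>' s w \<partial>M) = (\<integral>w. C (?\<phi> s w) \<bullet> \<psi>' s w \<partial>M) + (\<integral>w. C (\<psi> s w) \<bullet> \<psi>' s w \<partial>M)" for s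
    unfolding linear_add[OF Cl] inner_add_left by (rule Bochner_Integration.integral_add[OF bint[OF eX S'] bint[OF elem_step(5) S']])
  have "(\<integral>w. (?X w + S t w) * S' t w \<partial>M) = (\<integral>w. ?X w * S' t w \<partial>M) + (\<integral>w. S t w * S' t w \<partial>M)"
    unfolding distrib_right using Si(2,1) by (rule Bochner_Integration.integral_add)
  then show ?case
    unfolding add using single elem_step(6) by (simp add: set_integral_add)
qed

text \<open>The squared norm of C^(1/2) x, without constructing the square root.\<close>

definition qf :: "'k \<Rightarrow> ennreal" where
  "qf x = ennreal (C x \<bullet> x)"

lemma C_measurable [measurable]: "C \<in> borel_measurable borel"
  by (intro borel_measurable_continuous_onI linear_continuous_on C_lin)

lemma qf_measurable [measurable]: "qf \<in> borel_measurable borel"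
  unfolding qf_def by measurable

text \<open>Nonnegativity of the form at \<open>x - y\<close>, as in the parallelogram law.\<close>

lemma qf_add_le: "qf (x + y) \<le> 2 * qf x + 2 * qf y"
proof -
  note Cl = bounded_linear.linear[OF C_lin]
  have "0 \<le> C (x - y) \<bullet> (x - y)" by (rule C_psd)
  then have "C (x + y) \<bullet> (x + y) \<le> 2 * (C x \<bullet> x) + 2 * (C y \<bullet> y)"
    by (simp add: linear_add[OF Cl] linear_diff[OF Cl] inner_add_left inner_add_right inner_diff_left inner_diff_right)
  then have "qf (x + y) \<le> ennreal (2 * (C x \<bullet> x) + 2 * (C y \<bullet> y))" unfolding qf_def by (rule ennreal_leI)
  also have "\<dots> = 2 * qf x + 2 * qf y" using C_psd[of x] C_psd[of y] by (simp add: qf_def ennreal_mult)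
  finally show ?thesis .
qed

lemma qf_scale: "qf (r *\<^sub>R x) = ennreal (r\<^sup>2) * qf x"
  using C_psd[of x] by (simp add: qf_def linear_scale[OF bounded_linear.linear[OF C_lin]] power2_eq_square mult.assoc flip: ennreal_mult)

lemma qf_0 [simp]: "qf 0 = 0"
  by (simp add: qf_def)

text \<open>The diagonal case of the bilinear identity, moved to nonnegative integrals, where limits
  need no integrability side conditions.\<close>

lemma elem_isometry:
  assumes e: "elem \<psi> S" and t: "0 \<le> t"
  shows "(\<integral>\<^sup>+ w. ennreal ((S t w)\<^sup>2) \<partial>M) = EI t (\<lambda>s w. qf (\<psi> s w))"
proof -
  note [measurable] = elem_measurable_PT[OF e] elem_measurable[OF e]
  note b = elem_isometry_bilinear[OF e e t]
  obtain K where K: "K \<ge> 0" "\<And>s w. norm (\<psi> s w) \<le> K" using elem_bounded[OF e] by blast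
  obtain B where B: "B > 0" "\<And>x. norm (C x) \<le> norm x * B" using bounded_linear.pos_bounded[OF C_lin] by blast
  have bi: "integrable M (\<lambda>w. C (\<psi> s w) \<bullet> \<psi> s w)" for s
  proof (rule integrable_const_bound[where B = "K * B * K"])
    have "\<bar>C (\<psi> s w) \<bullet> \<psi> s w\<bar> \<le> K * B * K" for w
    proof -
      have "\<bar>C (\<psi> s w) \<bullet> \<psi> s w\<bar> \<le> norm (C (\<psi> s w)) * norm (\<psi> s w)" by (rule Cauchy_Schwarz_ineq2)
      also have "\<dots> \<le> (K * B) * K"
        using B K by (intro mult_mono order_trans[OF B(2)]) (auto intro!: mult_right_mono)
      finally show ?thesis .
    qed
    then show "AE w in M. norm (C (\<psi> s w) \<bullet> \<psi> s w) \<le> K * B * K" by auto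
  qed measurable
  have "(\<integral>\<^sup>+ w. ennreal ((S t w)\<^sup>2) \<partial>M) = ennreal (\<integral>w. (S t w)\<^sup>2 \<partial>M)"
    by (rule nn_integral_eq_integral[OF elem_sq_integrable[OF e t]]) auto
  also have "(\<integral>w. (S t w)\<^sup>2 \<partial>M) = (LINT s:{0..t}|lborel. \<integral>w. C (\<psi> s w) \<bullet> \<psi> s w \<partial>M)"
    using b by (simp add: power2_eq_square)
  also have "ennreal \<dots> = (\<integral>\<^sup>+ s. ennreal (indicator {0..t} s *\<^sub>R (\<integral>w. C (\<psi> s w) \<bullet> \<psi> s w \<partial>M)) \<partial>lborel)"
    unfolding set_lebesgue_integral_def
    by (rule nn_integral_eq_integral[symmetric]) (use b C_psd in \<open>auto simp: set_integrable_def intro!: integral_nonneg_AE\<close>)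
  also have "\<dots> = (\<integral>\<^sup>+ s\<in>{0..t}. (\<integral>\<^sup>+ w. qf (\<psi> s w) \<partial>M) \<partial>lborel)"
    unfolding qf_def
    by (intro nn_integral_cong) (use C_psd bi in \<open>auto simp: nn_integral_eq_integral split: split_indicator\<close>)
  also have "\<dots> = EI t (\<lambda>s w. qf (\<psi> s w))"
    by (rule EI_eq_space_time[symmetric]) measurable
  finally show ?thesis .
qed

end

subsection \<open>The Ito integral\<close>

context hilbert_noise
begin

lemma sq_diff_le: "((x::real) - y)\<^sup>2 \<le> 2 * x\<^sup>2 + 2 * y\<^sup>2"
  using power2_norm_add_le[of x "- y"] by simp

lemma ennreal_sq_add_le: "ennreal ((x + y)\<^sup>2) \<le> 2 * ennreal (x\<^sup>2) + 2 * ennreal (y\<^sup>2)"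
proof -
  have "ennreal ((x + y)\<^sup>2) \<le> ennreal (2 * x\<^sup>2 + 2 * y\<^sup>2)"
    using sq_diff_le[of x "- y"] by (intro ennreal_leI) simp
  then show ?thesis by (simp add: ennreal_mult)
qed

lemma nn_sq_add_le:
  fixes f g :: "'w \<Rightarrow> real"
  assumes [measurable]: "f \<in> borel_measurable M" "g \<in> borel_measurable M"
  shows "(\<integral>\<^sup>+ w. ennreal ((f w + g w)\<^sup>2) \<partial>M)
    \<le> 2 * (\<integral>\<^sup>+ w. ennreal ((f w)\<^sup>2) \<partial>M) + 2 * (\<integral>\<^sup>+ w. ennreal ((g w)\<^sup>2) \<partial>M)"
proof -
  have "(\<integral>\<^sup>+ w. ennreal ((f w + g w)\<^sup>2) \<partial>M) \<le> (\<integral>\<^sup>+ w. 2 * ennreal ((f w)\<^sup>2) + 2 * ennreal ((g w)\<^sup>2) \<partial>M)"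
    by (intro nn_integral_mono ennreal_sq_add_le)
  also have "\<dots> = 2 * (\<integral>\<^sup>+ w. ennreal ((f w)\<^sup>2) \<partial>M) + 2 * (\<integral>\<^sup>+ w. ennreal ((g w)\<^sup>2) \<partial>M)"
    by (subst nn_integral_add) (auto simp: nn_integral_cmult)
  finally show ?thesis .
qed

lemma ennreal_tendsto_add_0:
  assumes "f \<longlonglongrightarrow> (0::ennreal)" "g \<longlonglongrightarrow> 0" "a < \<infinity>" "b < \<infinity>" shows "(\<lambda>n. a * f n + b * g n) \<longlonglongrightarrow> 0"
proof -
  have "(\<lambda>n. a * f n + b * g n) \<longlonglongrightarrow> a * 0 + b * 0"
    using assms(3,4) by (intro tendsto_add ennreal_tendsto_cmult assms(1,2)) auto
  then show ?thesis by simp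
qed

lemma ennreal_tendsto_0_le:
  assumes "f \<longlonglongrightarrow> (0::ennreal)" "\<And>n. g n \<le> f n" shows "g \<longlonglongrightarrow> 0"
  by (rule tendsto_sandwich[OF always_eventually always_eventually tendsto_const assms(1)]) (use assms(2) in auto)

text \<open>The integrals are asked to converge at each time separately, so \<open>I\<close> need
  not be continuous here. For continuous versions, bounds uniform in time come back through Doob's
  inequality.\<close>

definition itoL :: "real \<Rightarrow> (real \<Rightarrow> 'w \<Rightarrow> 'k) \<Rightarrow> (real \<Rightarrow> 'w \<Rightarrow> real) \<Rightarrow> bool" where
  "itoL T g I \<longleftrightarrow> (\<exists>\<psi> S. (\<forall>n. elem (\<psi> n) (S n)) \<and>
     (\<lambda>n. EI T (\<lambda>s w. qf (\<psi> n s w - g s w))) \<longlonglongrightarrow> 0 \<and>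
     (\<forall>t\<in>{0..T}. (\<lambda>n. \<integral>\<^sup>+ w. ennreal ((S n t w - I t w)\<^sup>2) \<partial>M) \<longlonglongrightarrow> 0))"

text \<open>\<open>ito g I\<close>: \<open>I\<close> is a version of the real-valued integral \<open>\<integral> \<langle>g, dW\<rangle>\<close>.\<close>

definition ito :: "(real \<Rightarrow> 'w \<Rightarrow> 'k) \<Rightarrow> (real \<Rightarrow> 'w \<Rightarrow> real) \<Rightarrow> bool" where
  "ito g I \<longleftrightarrow> (\<forall>T. (\<lambda>x. g (fst x) (snd x)) \<in> borel_measurable (PT T)) \<and>
     (\<forall>t\<ge>0. I t \<in> borel_measurable (F t)) \<and> (\<forall>T>0. itoL T g I)"

lemma ito_PT: "ito g I \<Longrightarrow> (\<lambda>x. g (fst x) (snd x)) \<in> borel_measurable (PT T)"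
  by (simp add: ito_def)

lemma ito_F: "ito g I \<Longrightarrow> 0 \<le> t \<Longrightarrow> I t \<in> borel_measurable (F t)"
  by (simp add: ito_def)

lemma ito_M: "ito g I \<Longrightarrow> 0 \<le> t \<Longrightarrow> I t \<in> borel_measurable M"
  using ito_F measurable_F_M by blast

lemma itoE:
  assumes "ito g I" "0 < T"
  obtains \<psi> S where "\<And>n. elem (\<psi> n) (S n)" "(\<lambda>n. EI T (\<lambda>s w. qf (\<psi> n s w - g s w))) \<longlonglongrightarrow> 0"
    "\<And>t. t \<in> {0..T} \<Longrightarrow> (\<lambda>n. \<integral>\<^sup>+ w. ennreal ((S n t w - I t w)\<^sup>2) \<partial>M) \<longlonglongrightarrow> 0"
proof -
  have "itoL T g I" using assms by (simp add: ito_def)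
  then show thesis using that unfolding itoL_def by blast
qed

lemma elem_M: "elem \<psi> S \<Longrightarrow> 0 \<le> t \<Longrightarrow> S t \<in> borel_measurable M"
  by (rule cont_adapted_M[OF elem_cont_adapted])

lemma ito_elem: assumes e: "elem \<psi> S" shows "ito \<psi> S"
  unfolding ito_def itoL_def
proof (intro conjI allI impI)
  show "(\<lambda>x. \<psi> (fst x) (snd x)) \<in> borel_measurable (PT T)" for T by (rule elem_measurable_PT[OF e])
  show "S t \<in> borel_measurable (F t)" if "0 \<le> t" for t by (rule cont_adapted_F[OF elem_cont_adapted[OF e] that])
  fix T :: real
  show "\<exists>\<psi>' S'. (\<forall>n. elem (\<psi>' n) (S' n)) \<and> (\<lambda>n. EI T (\<lambda>s w. qf (\<psi>' n s w - \<psi> s w))) \<longlonglongrightarrow> 0 \<and>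
     (\<forall>t\<in>{0..T}. (\<lambda>n. \<integral>\<^sup>+ w. ennreal ((S' n t w - S t w)\<^sup>2) \<partial>M) \<longlonglongrightarrow> 0)"
    by (intro exI[of _ "\<lambda>_. \<psi>"] exI[of _ "\<lambda>_. S"]) (simp add: e EI_def)
qed

section \<open>Linearity of the Ito integral\<close>

lemma ito_add:
  assumes 1: "ito g I" and 2: "ito g' I'"
  shows "ito (\<lambda>s w. g s w + g' s w) (\<lambda>t w. I t w + I' t w)"
  unfolding ito_def
proof (intro conjI allI impI)
  note [measurable] = ito_PT[OF 1] ito_PT[OF 2]
  show "(\<lambda>x. g (fst x) (snd x) + g' (fst x) (snd x)) \<in> borel_measurable (PT T)" for T by measurable
  show "(\<lambda>w. I t w + I' t w) \<in> borel_measurable (F t)" if "0 \<le> t" for t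
    using ito_F[OF 1 that] ito_F[OF 2 that] by measurable
  fix T :: real assume T: "T > 0"
  obtain \<psi> S where e: "\<And>n. elem (\<psi> n) (S n)" and l: "(\<lambda>n. EI T (\<lambda>s w. qf (\<psi> n s w - g s w))) \<longlonglongrightarrow> 0"
    and c: "\<And>t. t \<in> {0..T} \<Longrightarrow> (\<lambda>n. \<integral>\<^sup>+ w. ennreal ((S n t w - I t w)\<^sup>2) \<partial>M) \<longlonglongrightarrow> 0"
    using 1 T unfolding ito_def itoL_def by blast
  obtain \<psi>' S' where e': "\<And>n. elem (\<psi>' n) (S' n)" and l': "(\<lambda>n. EI T (\<lambda>s w. qf (\<psi>' n s w - g' s w))) \<longlonglongrightarrow> 0"
    and c': "\<And>t. t \<in> {0..T} \<Longrightarrow> (\<lambda>n. \<integral>\<^sup>+ w. ennreal ((S' n t w - I' t w)\<^sup>2) \<partial>M) \<longlonglongrightarrow> 0"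
    using 2 T unfolding ito_def itoL_def by blast
  show "itoL T (\<lambda>s w. g s w + g' s w) (\<lambda>t w. I t w + I' t w)"
    unfolding itoL_def
  proof (intro exI conjI allI ballI)
    show "elem (\<lambda>s w. \<psi> n s w + \<psi>' n s w) (\<lambda>t w. S n t w + S' n t w)" for n by (rule elem_add[OF e e'])
    have "(\<lambda>n. 2 * EI T (\<lambda>s w. qf (\<psi> n s w - g s w)) + 2 * EI T (\<lambda>s w. qf (\<psi>' n s w - g' s w))) \<longlonglongrightarrow> 0"
      by (rule ennreal_tendsto_add_0[OF l l']) auto
    then show "(\<lambda>n. EI T (\<lambda>s w. qf (\<psi> n s w + \<psi>' n s w - (g s w + g' s w)))) \<longlonglongrightarrow> 0"
    proof (rule ennreal_tendsto_0_le)
      fix n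
      note [measurable] = elem_measurable_PT[OF e[of n]] elem_measurable_PT[OF e'[of n]]
      have "EI T (\<lambda>s w. qf (\<psi> n s w + \<psi>' n s w - (g s w + g' s w)))
        \<le> EI T (\<lambda>s w. 2 * qf (\<psi> n s w - g s w) + 2 * qf (\<psi>' n s w - g' s w))"
      proof (rule EI_mono)
        fix s w
        show "qf (\<psi> n s w + \<psi>' n s w - (g s w + g' s w)) \<le> 2 * qf (\<psi> n s w - g s w) + 2 * qf (\<psi>' n s w - g' s w)"
          using qf_add_le[of "\<psi> n s w - g s w" "\<psi>' n s w - g' s w"] by (simp add: algebra_simps)
      qed
      also have "\<dots> = 2 * EI T (\<lambda>s w. qf (\<psi> n s w - g s w)) + 2 * EI T (\<lambda>s w. qf (\<psi>' n s w - g' s w))"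
        by (subst EI_add, measurable) (subst EI_cmult, measurable)+
      finally show "EI T (\<lambda>s w. qf (\<psi> n s w + \<psi>' n s w - (g s w + g' s w)))
        \<le> 2 * EI T (\<lambda>s w. qf (\<psi> n s w - g s w)) + 2 * EI T (\<lambda>s w. qf (\<psi>' n s w - g' s w))" .
    qed
    fix t assume t: "t \<in> {0..T}"
    then have t0: "0 \<le> t" by simp
    have "(\<lambda>n. 2 * (\<integral>\<^sup>+ w. ennreal ((S n t w - I t w)\<^sup>2) \<partial>M) + 2 * (\<integral>\<^sup>+ w. ennreal ((S' n t w - I' t w)\<^sup>2) \<partial>M)) \<longlonglongrightarrow> 0"
      by (rule ennreal_tendsto_add_0[OF c[OF t] c'[OF t]]) auto
    then show "(\<lambda>n. \<integral>\<^sup>+ w. ennreal ((S n t w + S' n t w - (I t w + I' t w))\<^sup>2) \<partial>M) \<longlonglongrightarrow> 0"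
    proof (rule ennreal_tendsto_0_le)
      fix n
      have "(\<integral>\<^sup>+ w. ennreal (((S n t w - I t w) + (S' n t w - I' t w))\<^sup>2) \<partial>M)
        \<le> 2 * (\<integral>\<^sup>+ w. ennreal ((S n t w - I t w)\<^sup>2) \<partial>M) + 2 * (\<integral>\<^sup>+ w. ennreal ((S' n t w - I' t w)\<^sup>2) \<partial>M)"
        by (intro nn_sq_add_le borel_measurable_diff elem_M[OF e t0] elem_M[OF e' t0] ito_M[OF 1 t0] ito_M[OF 2 t0])
      then show "(\<integral>\<^sup>+ w. ennreal ((S n t w + S' n t w - (I t w + I' t w))\<^sup>2) \<partial>M)
        \<le> 2 * (\<integral>\<^sup>+ w. ennreal ((S n t w - I t w)\<^sup>2) \<partial>M) + 2 * (\<integral>\<^sup>+ w. ennreal ((S' n t w - I' t w)\<^sup>2) \<partial>M)"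
        by (simp add: algebra_simps)
    qed
  qed
qed

lemma ito_scale:
  assumes 1: "ito g I"
  shows "ito (\<lambda>s w. r *\<^sub>R g s w) (\<lambda>t w. r * I t w)"
  unfolding ito_def
proof (intro conjI allI impI)
  note [measurable] = ito_PT[OF 1]
  show "(\<lambda>x. r *\<^sub>R g (fst x) (snd x)) \<in> borel_measurable (PT T)" for T by measurable
  show "(\<lambda>w. r * I t w) \<in> borel_measurable (F t)" if "0 \<le> t" for t
    using ito_F[OF 1 that] by measurable
  fix T :: real assume T: "T > 0"
  obtain \<psi> S where e: "\<And>n. elem (\<psi> n) (S n)" and l: "(\<lambda>n. EI T (\<lambda>s w. qf (\<psi> n s w - g s w))) \<longlonglongrightarrow> 0"
    and c: "\<And>t. t \<in> {0..T} \<Longrightarrow> (\<lambda>n. \<integral>\<^sup>+ w. ennreal ((S n t w - I t w)\<^sup>2) \<partial>M) \<longlonglongrightarrow> 0"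
    using 1 T unfolding ito_def itoL_def by blast
  show "itoL T (\<lambda>s w. r *\<^sub>R g s w) (\<lambda>t w. r * I t w)"
    unfolding itoL_def
  proof (intro exI conjI allI ballI)
    show "elem (\<lambda>s w. r *\<^sub>R \<psi> n s w) (\<lambda>t w. r * S n t w)" for n by (rule elem_scale[OF e])
    have "(\<lambda>n. ennreal (r\<^sup>2) * EI T (\<lambda>s w. qf (\<psi> n s w - g s w)) + 0 * 0) \<longlonglongrightarrow> 0"
      by (rule ennreal_tendsto_add_0[OF l tendsto_const]) auto
    then show "(\<lambda>n. EI T (\<lambda>s w. qf (r *\<^sub>R \<psi> n s w - r *\<^sub>R g s w))) \<longlonglongrightarrow> 0"
    proof (rule ennreal_tendsto_0_le)
      fix n
      note [measurable] = elem_measurable_PT[OF e[of n]]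
      have "EI T (\<lambda>s w. qf (r *\<^sub>R \<psi> n s w - r *\<^sub>R g s w)) = EI T (\<lambda>s w. ennreal (r\<^sup>2) * qf (\<psi> n s w - g s w))"
        by (simp only: qf_scale flip: scaleR_diff_right)
      also have "\<dots> = ennreal (r\<^sup>2) * EI T (\<lambda>s w. qf (\<psi> n s w - g s w))"
        by (rule EI_cmult) measurable
      finally show "EI T (\<lambda>s w. qf (r *\<^sub>R \<psi> n s w - r *\<^sub>R g s w)) \<le> ennreal (r\<^sup>2) * EI T (\<lambda>s w. qf (\<psi> n s w - g s w)) + 0 * 0" by simp
    qed
    fix t assume t: "t \<in> {0..T}"
    then have t0: "0 \<le> t" by simp
    have "(\<lambda>n. ennreal (r\<^sup>2) * (\<integral>\<^sup>+ w. ennreal ((S n t w - I t w)\<^sup>2) \<partial>M) + 0 * 0) \<longlonglongrightarrow> 0"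
      by (rule ennreal_tendsto_add_0[OF c[OF t] tendsto_const]) auto
    then show "(\<lambda>n. \<integral>\<^sup>+ w. ennreal ((r * S n t w - r * I t w)\<^sup>2) \<partial>M) \<longlonglongrightarrow> 0"
    proof (rule ennreal_tendsto_0_le)
      fix n
      note [measurable] = elem_M[OF e[of n] t0] ito_M[OF 1 t0]
      have "(\<integral>\<^sup>+ w. ennreal ((r * S n t w - r * I t w)\<^sup>2) \<partial>M) = (\<integral>\<^sup>+ w. ennreal (r\<^sup>2) * ennreal ((S n t w - I t w)\<^sup>2) \<partial>M)"
        by (simp add: power_mult_distrib flip: right_diff_distrib ennreal_mult)
      also have "\<dots> = ennreal (r\<^sup>2) * (\<integral>\<^sup>+ w. ennreal ((S n t w - I t w)\<^sup>2) \<partial>M)"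
        by (rule nn_integral_cmult) measurable
      finally show "(\<integral>\<^sup>+ w. ennreal ((r * S n t w - r * I t w)\<^sup>2) \<partial>M) \<le> ennreal (r\<^sup>2) * (\<integral>\<^sup>+ w. ennreal ((S n t w - I t w)\<^sup>2) \<partial>M) + 0 * 0" by simp
    qed
  qed
qed

lemma ito_diff:
  assumes "ito g I" "ito g' I'"
  shows "ito (\<lambda>s w. g s w - g' s w) (\<lambda>t w. I t w - I' t w)"
  using ito_add[OF assms(1) ito_scale[OF assms(2), of "-1"]] by simp

lemma ito_sum:
  assumes "\<And>i. i \<in> J \<Longrightarrow> ito (g i) (I i)"
  shows "ito (\<lambda>s w. \<Sum>i\<in>J. g i s w) (\<lambda>t w. \<Sum>i\<in>J. I i t w)"
  using assms by (induction J rule: infinite_finite_induct) (auto intro: ito_add ito_elem[OF elem_0])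

text \<open>One elementary approximation at finite L^2 distance suffices.\<close>

lemma ito_sq_finite:
  assumes i: "ito g I" and t: "0 \<le> t"
  shows "integrable M (\<lambda>w. (I t w)\<^sup>2)"
proof (rule integrableI_bounded)
  note [measurable] = ito_M[OF i t]
  show "(\<lambda>w. (I t w)\<^sup>2) \<in> borel_measurable M" by measurable
  have T: "0 < t + 1" "t \<in> {0..t+1}" using t by auto
  obtain \<psi> S where e: "\<And>n. elem (\<psi> n) (S n)"
    and c: "(\<lambda>n. \<integral>\<^sup>+ w. ennreal ((S n t w - I t w)\<^sup>2) \<partial>M) \<longlonglongrightarrow> 0"
    by (rule itoE[OF i T(1)]) (use T(2) in blast)
  have "\<forall>\<^sub>F n in sequentially. (\<integral>\<^sup>+ w. ennreal ((S n t w - I t w)\<^sup>2) \<partial>M) < 1"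
    by (rule order_tendstoD(2)[OF c]) simp
  then obtain n where n: "(\<integral>\<^sup>+ w. ennreal ((S n t w - I t w)\<^sup>2) \<partial>M) < 1"
    using eventually_happens'[OF sequentially_bot] by blast
  note [measurable] = elem_M[OF e[of n] t]
  have S: "(\<integral>\<^sup>+ w. ennreal ((S n t w)\<^sup>2) \<partial>M) < \<infinity>"
    using elem_sq_integrable[OF e t] by (simp add: integrable_iff_bounded)
  have "(\<integral>\<^sup>+ w. ennreal ((S n t w + (- (S n t w - I t w)))\<^sup>2) \<partial>M)
    \<le> 2 * (\<integral>\<^sup>+ w. ennreal ((S n t w)\<^sup>2) \<partial>M) + 2 * (\<integral>\<^sup>+ w. ennreal ((- (S n t w - I t w))\<^sup>2) \<partial>M)"
    by (intro nn_sq_add_le) measurable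
  also have "\<dots> < \<infinity>"
    using S n by (simp only: power2_minus) (auto simp: ennreal_mult_less_top intro: less_trans)
  finally show "(\<integral>\<^sup>+ w. ennreal (norm ((I t w)\<^sup>2)) \<partial>M) < \<infinity>" by simp
qed

lemma expectation_sq_le:
  fixes f :: "'w \<Rightarrow> real"
  assumes f: "f \<in> borel_measurable M" "integrable M (\<lambda>w. (f w)\<^sup>2)"
  shows "ennreal ((\<integral>w. f w \<partial>M)\<^sup>2) \<le> (\<integral>\<^sup>+ w. ennreal ((f w)\<^sup>2) \<partial>M)"
proof -
  have i: "integrable M f" using f by (rule square_integrable_imp_integrable)
  have "(\<integral>w. f w \<partial>M)\<^sup>2 \<le> (\<integral>w. (f w)\<^sup>2 \<partial>M)"
    using variance_positive[of f] variance_eq[OF i f(2)] by simp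
  also have "ennreal (\<integral>w. (f w)\<^sup>2 \<partial>M) = (\<integral>\<^sup>+ w. ennreal ((f w)\<^sup>2) \<partial>M)"
    by (rule nn_integral_eq_integral[OF f(2), symmetric]) auto
  finally show ?thesis by (simp add: ennreal_leI)
qed

section \<open>Martingale property and moment bounds of the Ito integral\<close>

text \<open>For elementary integrals the orthogonality is the zero mean of the integral restricted
  to times after \<open>s\<close> and multiplied by \<open>c\<close>. The approximation error is
  controlled in L^2 at the two times \<open>s\<close> and \<open>t\<close>.\<close>

lemma ito_L2_martingale:
  assumes i: "ito g I"
  shows "L2_martingale I"
  unfolding L2_martingale_def
proof (intro conjI allI impI)
  show "I t \<in> borel_measurable (F t)" "integrable M (\<lambda>w. (I t w)\<^sup>2)" if "0 \<le> t" for t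
    using ito_F[OF i that] ito_sq_finite[OF i that] by auto
  fix s t :: real and c :: "'w \<Rightarrow> real" and K
  assume st: "0 \<le> s" "s \<le> t" and c: "c \<in> borel_measurable (F s)" "\<forall>w. \<bar>c w\<bar> \<le> K"
  have t: "0 \<le> t" using st by simp
  have T: "0 < t + 1" using t by simp
  obtain \<psi> S where e: "\<And>n. elem (\<psi> n) (S n)"
    and cv: "\<And>u. u \<in> {0..t+1} \<Longrightarrow> (\<lambda>n. \<integral>\<^sup>+ w. ennreal ((S n u w - I u w)\<^sup>2) \<partial>M) \<longlonglongrightarrow> 0"
    by (rule itoE[OF i T]) blast
  have cM[measurable]: "c \<in> borel_measurable M" by (rule measurable_F_M[OF st(1) c(1)])
  note [measurable] = ito_M[OF i t] ito_M[OF i st(1)]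
  have K: "0 \<le> K" using c(2) by (meson abs_ge_zero order_trans)
  have "ennreal ((\<integral>w. c w * (I t w - I s w) \<partial>M)\<^sup>2)
     \<le> ennreal (2 * K\<^sup>2) * (\<integral>\<^sup>+ w. ennreal ((S n t w - I t w)\<^sup>2) \<partial>M) + ennreal (2 * K\<^sup>2) * (\<integral>\<^sup>+ w. ennreal ((S n s w - I s w)\<^sup>2) \<partial>M)" for n
  proof -
    note [measurable] = elem_M[OF e[of n] t] elem_M[OF e[of n] st(1)]
    have sq: "integrable M (\<lambda>w. (f w - h w)\<^sup>2)" if "f \<in> borel_measurable M" "h \<in> borel_measurable M" "integrable M (\<lambda>w. (f w)\<^sup>2)" "integrable M (\<lambda>w. (h w)\<^sup>2)" for f h :: "'w \<Rightarrow> real"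
    proof (rule Bochner_Integration.integrable_bound)
      show "integrable M (\<lambda>w. 2 * (f w)\<^sup>2 + 2 * (h w)\<^sup>2)" using that by simp
    qed (use that sq_diff_le in auto)
    have i1: "integrable M (\<lambda>w. (I t w - I s w)\<^sup>2)" by (rule sq) (use ito_sq_finite[OF i] st t in auto)
    have i2: "integrable M (\<lambda>w. (S n t w - S n s w)\<^sup>2)" by (rule sq) (use elem_sq_integrable[OF e] st t in auto)
    have j1: "integrable M (\<lambda>w. c w * (I t w - I s w))"
      by (rule square_integrable_imp_integrable[OF _ bounded_mult_sq_integrable[OF cM _ _ i1]]) (use c(2) in \<open>auto\<close>)
    have j2: "integrable M (\<lambda>w. c w * (S n t w - S n s w))"
      by (rule square_integrable_imp_integrable[OF _ bounded_mult_sq_integrable[OF cM _ _ i2]]) (use c(2) in \<open>auto\<close>)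
    have "elem (\<lambda>r w. (if s < r then c w else 0) *\<^sub>R \<psi> n r w) (\<lambda>r w. c w * (S n (max r s) w - S n s w))"
      by (rule elem_restrict[OF e st(1) c(1)]) (use c(2) in blast)
    from elem_mean[OF this t] have z: "(\<integral>w. c w * (S n t w - S n s w) \<partial>M) = 0" using st by (simp add: max_absorb1)
    \<comment> \<open>The error, arranged as a sum of the deviations at the two times so that
      \<open>nn_sq_add_le\<close> applies.\<close>
    define R where "R w = c w * ((S n t w - I t w) + (- (S n s w - I s w)))" for w
    have RI: "integrable M (\<lambda>w. (R w)\<^sup>2)"
      unfolding R_def
    proof (rule bounded_mult_sq_integrable[OF cM])
      have "integrable M (\<lambda>w. ((S n t w - S n s w) - (I t w - I s w))\<^sup>2)" by (rule sq) (use i1 i2 in auto)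
      then show "integrable M (\<lambda>w. ((S n t w - I t w) + (- (S n s w - I s w)))\<^sup>2)" by (simp add: algebra_simps)
    qed (use c(2) in auto)
    have "(\<integral>w. R w \<partial>M) = (\<integral>w. c w * (S n t w - S n s w) - c w * (I t w - I s w) \<partial>M)"
      by (rule Bochner_Integration.integral_cong) (auto simp: R_def algebra_simps)
    also have "\<dots> = - (\<integral>w. c w * (I t w - I s w) \<partial>M)" using j1 j2 z by simp
    finally have "ennreal ((\<integral>w. c w * (I t w - I s w) \<partial>M)\<^sup>2) = ennreal ((\<integral>w. R w \<partial>M)\<^sup>2)" by simp
    also have "\<dots> \<le> (\<integral>\<^sup>+ w. ennreal ((R w)\<^sup>2) \<partial>M)" by (rule expectation_sq_le[OF _ RI]) (simp add: R_def[abs_def])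
    also have "\<dots> \<le> (\<integral>\<^sup>+ w. ennreal (K\<^sup>2) * ennreal (((S n t w - I t w) + (- (S n s w - I s w)))\<^sup>2) \<partial>M)"
    proof (rule nn_integral_mono)
      fix w
      have "(c w)\<^sup>2 \<le> K\<^sup>2" using c(2) K by (simp add: abs_le_square_iff[symmetric])
      then have "(R w)\<^sup>2 \<le> K\<^sup>2 * ((S n t w - I t w) + (- (S n s w - I s w)))\<^sup>2"
        unfolding R_def power_mult_distrib by (intro mult_right_mono) auto
      then show "ennreal ((R w)\<^sup>2) \<le> ennreal (K\<^sup>2) * ennreal (((S n t w - I t w) + (- (S n s w - I s w)))\<^sup>2)"
        by (simp add: ennreal_leI flip: ennreal_mult)
    qed
    also have "\<dots> = ennreal (K\<^sup>2) * (\<integral>\<^sup>+ w. ennreal (((S n t w - I t w) + (- (S n s w - I s w)))\<^sup>2) \<partial>M)"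
      by (rule nn_integral_cmult) measurable
    also have "\<dots> \<le> ennreal (K\<^sup>2) * (2 * (\<integral>\<^sup>+ w. ennreal ((S n t w - I t w)\<^sup>2) \<partial>M) + 2 * (\<integral>\<^sup>+ w. ennreal ((- (S n s w - I s w))\<^sup>2) \<partial>M))"
      by (intro mult_left_mono nn_sq_add_le; (measurable | simp))
    also have "\<dots> = ennreal (2 * K\<^sup>2) * (\<integral>\<^sup>+ w. ennreal ((S n t w - I t w)\<^sup>2) \<partial>M) + ennreal (2 * K\<^sup>2) * (\<integral>\<^sup>+ w. ennreal ((S n s w - I s w)\<^sup>2) \<partial>M)"
      by (simp only: power2_minus ennreal_mult zero_le_power2 zero_le_numeral ennreal_numeral distrib_left mult_ac)
    finally show ?thesis .
  qed
  moreover have "(\<lambda>n. ennreal (2 * K\<^sup>2) * (\<integral>\<^sup>+ w. ennreal ((S n t w - I t w)\<^sup>2) \<partial>M) + ennreal (2 * K\<^sup>2) * (\<integral>\<^sup>+ w. ennreal ((S n s w - I s w)\<^sup>2) \<partial>M)) \<longlonglongrightarrow> 0"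
    by (rule ennreal_tendsto_add_0[OF cv cv]) (use st in auto)
  ultimately have "ennreal ((\<integral>w. c w * (I t w - I s w) \<partial>M)\<^sup>2) \<le> 0"
    by (intro LIMSEQ_le_const[where X = "\<lambda>n. ennreal (2 * K\<^sup>2) * (\<integral>\<^sup>+ w. ennreal ((S n t w - I t w)\<^sup>2) \<partial>M) + ennreal (2 * K\<^sup>2) * (\<integral>\<^sup>+ w. ennreal ((S n s w - I s w)\<^sup>2) \<partial>M)"]) auto
  then show "(\<integral>w. c w * (I t w - I s w) \<partial>M) = 0" by (simp add: ennreal_eq_0_iff)
qed

lemma ito_at_0:
  assumes i: "ito g I" shows "AE w in M. I 0 w = 0"
proof -
  note [measurable] = ito_M[OF i order_refl]
  obtain \<psi> S where e: "\<And>n. elem (\<psi> n) (S n)"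
    and cv: "\<And>u. u \<in> {0..1} \<Longrightarrow> (\<lambda>n. \<integral>\<^sup>+ w. ennreal ((S n u w - I u w)\<^sup>2) \<partial>M) \<longlonglongrightarrow> 0"
    by (rule itoE[OF i zero_less_one]) blast
  have "(\<lambda>n::nat. \<integral>\<^sup>+ w. ennreal ((I 0 w)\<^sup>2) \<partial>M) \<longlonglongrightarrow> 0"
    using cv[of 0] elem_at_0[OF e] by simp
  then have "(\<integral>\<^sup>+ w. ennreal ((I 0 w)\<^sup>2) \<partial>M) = 0" by (simp add: LIMSEQ_const_iff)
  then show ?thesis by (subst (asm) nn_integral_0_iff_AE) (auto simp: ennreal_eq_0_iff)
qed

text \<open>Writes an integral over an event and a subinterval as an \<open>EI\<close>, so that
  linearity and approximation on the product space apply.\<close>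

lemma EI_window:
  fixes q :: "real \<Rightarrow> 'w \<Rightarrow> ennreal"
  assumes q: "(\<lambda>x. q (fst x) (snd x)) \<in> borel_measurable (PT u)" and s: "0 \<le> s" and A: "A \<in> sets M"
  shows "(\<lambda>x. if s < fst x \<and> snd x \<in> A then q (fst x) (snd x) else 0) \<in> borel_measurable (PT u)"
    "EI u (\<lambda>r w. if s < r \<and> w \<in> A then q r w else 0) = (\<integral>\<^sup>+ w\<in>A. (\<integral>\<^sup>+ r\<in>{s<..u}. q r w \<partial>lborel) \<partial>M)"
proof -
  have "Measurable.pred (restrict_space lborel {0..u}) (\<lambda>r. s < r)"
    by (intro measurable_restrict_space1) simp
  then have 1: "Measurable.pred (PT u) (\<lambda>x. s < fst x)"
    unfolding PT_def by (rule measurable_compose[OF measurable_fst])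
  have "Measurable.pred M (\<lambda>w. w \<in> A)" using A by simp
  then have 2: "Measurable.pred (PT u) (\<lambda>x. snd x \<in> A)"
    unfolding PT_def by (rule measurable_compose[OF measurable_snd])
  show m: "(\<lambda>x. if s < fst x \<and> snd x \<in> A then q (fst x) (snd x) else 0) \<in> borel_measurable (PT u)"
    using 1 2 q by measurable
  show "EI u (\<lambda>r w. if s < r \<and> w \<in> A then q r w else 0) = (\<integral>\<^sup>+ w\<in>A. (\<integral>\<^sup>+ r\<in>{s<..u}. q r w \<partial>lborel) \<partial>M)"
    unfolding EI_eq_time_space[OF m]
  proof (rule nn_integral_cong)
    fix w
    show "(\<integral>\<^sup>+ r\<in>{0..u}. (if s < r \<and> w \<in> A then q r w else 0) \<partial>lborel) = (\<integral>\<^sup>+ r\<in>{s<..u}. q r w \<partial>lborel) * indicator A w"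
      using s by (cases "w \<in> A") (auto intro!: nn_integral_cong split: split_indicator)
  qed
qed

lemma EI_mono_time:
  assumes "\<And>T. (\<lambda>x. f (fst x) (snd x)) \<in> borel_measurable (PT T)" "u \<le> T"
  shows "EI u f \<le> EI T f"
  unfolding EI_eq_time_space[OF assms(1)]
  by (intro nn_integral_mono) (use assms(2) in \<open>auto split: split_indicator\<close>)

text \<open>The factor 4 is 2 * 2: one splitting separates the elementary integral from the error of
  the integrals, the other separates \<open>g\<close> from the error of the integrands.\<close>

lemma ito_increment:
  assumes i: "ito g I" and su: "0 \<le> s" "s \<le> u" and A: "A \<in> sets (F s)"
  shows "(\<integral>\<^sup>+ w\<in>A. ennreal ((I u w - I s w)\<^sup>2) \<partial>M) \<le> (\<integral>\<^sup>+ w\<in>A. (\<integral>\<^sup>+ r\<in>{s<..u}. 4 * qf (g r w) \<partial>lborel) \<partial>M)"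
proof -
  have u: "0 \<le> u" using su by simp
  note [measurable] = ito_PT[OF i] ito_M[OF i u] ito_M[OF i su(1)]
  have AM[measurable]: "A \<in> sets M" by (rule sets_F_M[OF su(1) A])
  have T: "0 < u + 1" using u by simp
  obtain \<psi> S where e: "\<And>n. elem (\<psi> n) (S n)" and l: "(\<lambda>n. EI (u+1) (\<lambda>s w. qf (\<psi> n s w - g s w))) \<longlonglongrightarrow> 0"
    and cv: "\<And>v. v \<in> {0..u+1} \<Longrightarrow> (\<lambda>n. \<integral>\<^sup>+ w. ennreal ((S n v w - I v w)\<^sup>2) \<partial>M) \<longlonglongrightarrow> 0"
    by (rule itoE[OF i T]) blast
  let ?R = "EI u (\<lambda>r w. if s < r \<and> w \<in> A then 4 * qf (g r w) else 0)"
  have "(\<integral>\<^sup>+ w\<in>A. ennreal ((I u w - I s w)\<^sup>2) \<partial>M) \<le> ?R + (4 * EI (u+1) (\<lambda>s w. qf (\<psi> n s w - g s w))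
     + 1 * (4 * (\<integral>\<^sup>+ w. ennreal ((S n u w - I u w)\<^sup>2) \<partial>M) + 4 * (\<integral>\<^sup>+ w. ennreal ((S n s w - I s w)\<^sup>2) \<partial>M)))" for n
  proof -
    note [measurable] = elem_M[OF e[of n] u] elem_M[OF e[of n] su(1)] elem_measurable_PT[OF e[of n]]
    define d where "d w = (indicator A w :: real)" for w
    have dF: "d \<in> borel_measurable (F s)" unfolding d_def using A by measurable
    have [measurable]: "d \<in> borel_measurable M" by (rule measurable_F_M[OF su(1) dF])
    have eR: "elem (\<lambda>r w. (if s < r then d w else 0) *\<^sub>R \<psi> n r w) (\<lambda>r w. d w * (S n (max r s) w - S n s w))"
      by (rule elem_restrict[OF e su(1) dF, of 1]) (auto simp: d_def split: split_indicator)
    have "(\<integral>\<^sup>+ w\<in>A. ennreal ((I u w - I s w)\<^sup>2) \<partial>M)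
       = (\<integral>\<^sup>+ w. ennreal ((d w * (S n u w - S n s w) + d w * ((I u w - S n u w) - (I s w - S n s w)))\<^sup>2) \<partial>M)"
      by (rule nn_integral_cong) (auto simp: d_def split: split_indicator)
    also have "\<dots> \<le> 2 * (\<integral>\<^sup>+ w. ennreal ((d w * (S n u w - S n s w))\<^sup>2) \<partial>M)
       + 2 * (\<integral>\<^sup>+ w. ennreal ((d w * ((I u w - S n u w) - (I s w - S n s w)))\<^sup>2) \<partial>M)"
      by (rule nn_sq_add_le) measurable
    also have "2 * (\<integral>\<^sup>+ w. ennreal ((d w * (S n u w - S n s w))\<^sup>2) \<partial>M) \<le> ?R + 4 * EI (u+1) (\<lambda>s w. qf (\<psi> n s w - g s w))"
    proof -
      have "2 * (\<integral>\<^sup>+ w. ennreal ((d w * (S n u w - S n s w))\<^sup>2) \<partial>M) = 2 * EI u (\<lambda>r w. qf ((if s < r then d w else 0) *\<^sub>R \<psi> n r w))"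
        using elem_isometry[OF eR u] su by (simp add: max_absorb1)
      also have "\<dots> = EI u (\<lambda>r w. 2 * qf ((if s < r then d w else 0) *\<^sub>R \<psi> n r w))"
        by (rule EI_cmult[symmetric]) (use elem_measurable_PT[OF eR] in measurable)
      also have "\<dots> \<le> EI u (\<lambda>r w. (if s < r \<and> w \<in> A then 4 * qf (g r w) else 0) + 4 * qf (\<psi> n r w - g r w))"
      proof (rule EI_mono)
        fix r w
        have "2 * qf (\<psi> n r w) \<le> 2 * (2 * qf (g r w) + 2 * qf (\<psi> n r w - g r w))"
          using qf_add_le[of "g r w" "\<psi> n r w - g r w"] by (intro mult_left_mono) auto
        also have "\<dots> = 4 * qf (g r w) + 4 * qf (\<psi> n r w - g r w)"
          by (simp add: distrib_left mult.assoc[symmetric])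
        finally show "2 * qf ((if s < r then d w else 0) *\<^sub>R \<psi> n r w) \<le> (if s < r \<and> w \<in> A then 4 * qf (g r w) else 0) + 4 * qf (\<psi> n r w - g r w)"
          by (auto simp: d_def split: split_indicator)
      qed
      also have "\<dots> = ?R + EI u (\<lambda>r w. 4 * qf (\<psi> n r w - g r w))"
        by (rule EI_add, rule EI_window(1)[OF _ su(1) AM]) measurable
      also have "EI u (\<lambda>r w. 4 * qf (\<psi> n r w - g r w)) = 4 * EI u (\<lambda>r w. qf (\<psi> n r w - g r w))"
        by (rule EI_cmult) measurable
      also have "EI u (\<lambda>r w. qf (\<psi> n r w - g r w)) \<le> EI (u+1) (\<lambda>r w. qf (\<psi> n r w - g r w))"
        proof (rule EI_mono_time)
          show "(\<lambda>x. qf (\<psi> n (fst x) (snd x) - g (fst x) (snd x))) \<in> borel_measurable (PT T)" for T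
            by (intro measurable_compose[OF _ qf_measurable] borel_measurable_diff elem_measurable_PT[OF e] ito_PT[OF i])
        qed simp
      finally show ?thesis by (simp add: add_left_mono mult_left_mono)
    qed
    also have "2 * (\<integral>\<^sup>+ w. ennreal ((d w * ((I u w - S n u w) - (I s w - S n s w)))\<^sup>2) \<partial>M)
      \<le> 1 * (4 * (\<integral>\<^sup>+ w. ennreal ((S n u w - I u w)\<^sup>2) \<partial>M) + 4 * (\<integral>\<^sup>+ w. ennreal ((S n s w - I s w)\<^sup>2) \<partial>M))"
    proof -
      have "(\<integral>\<^sup>+ w. ennreal ((d w * ((I u w - S n u w) - (I s w - S n s w)))\<^sup>2) \<partial>M)
        \<le> (\<integral>\<^sup>+ w. ennreal (((S n s w - I s w) + (- (S n u w - I u w)))\<^sup>2) \<partial>M)"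
        by (intro nn_integral_mono ennreal_leI) (auto simp: d_def algebra_simps split: split_indicator)
      also have "\<dots> \<le> 2 * (\<integral>\<^sup>+ w. ennreal ((S n s w - I s w)\<^sup>2) \<partial>M) + 2 * (\<integral>\<^sup>+ w. ennreal ((- (S n u w - I u w))\<^sup>2) \<partial>M)"
        by (rule nn_sq_add_le) measurable
      finally have "2 * (\<integral>\<^sup>+ w. ennreal ((d w * ((I u w - S n u w) - (I s w - S n s w)))\<^sup>2) \<partial>M)
        \<le> 2 * (2 * (\<integral>\<^sup>+ w. ennreal ((S n s w - I s w)\<^sup>2) \<partial>M) + 2 * (\<integral>\<^sup>+ w. ennreal ((- (S n u w - I u w))\<^sup>2) \<partial>M))"
        by (intro mult_left_mono) auto
      then show ?thesis by (simp only: power2_minus) (simp add: distrib_left mult.assoc[symmetric] add.commute)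
    qed
    finally show ?thesis by (simp add: add.assoc add_mono)
  qed
  moreover have "(\<lambda>n. ?R + (4 * EI (u+1) (\<lambda>s w. qf (\<psi> n s w - g s w))
     + 1 * (4 * (\<integral>\<^sup>+ w. ennreal ((S n u w - I u w)\<^sup>2) \<partial>M) + 4 * (\<integral>\<^sup>+ w. ennreal ((S n s w - I s w)\<^sup>2) \<partial>M)))) \<longlonglongrightarrow> ?R + 0"
    by (intro tendsto_add tendsto_const ennreal_tendsto_add_0 l cv) (use su in auto)
  ultimately have "(\<integral>\<^sup>+ w\<in>A. ennreal ((I u w - I s w)\<^sup>2) \<partial>M) \<le> ?R + 0"
    by (intro LIMSEQ_le_const[where X = "\<lambda>n. ?R + (4 * EI (u+1) (\<lambda>s w. qf (\<psi> n s w - g s w))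
     + 1 * (4 * (\<integral>\<^sup>+ w. ennreal ((S n u w - I u w)\<^sup>2) \<partial>M) + 4 * (\<integral>\<^sup>+ w. ennreal ((S n s w - I s w)\<^sup>2) \<partial>M)))"]) auto
  also have "?R + 0 = (\<integral>\<^sup>+ w\<in>A. (\<integral>\<^sup>+ r\<in>{s<..u}. 4 * qf (g r w) \<partial>lborel) \<partial>M)"
    using EI_window(2)[of "\<lambda>r w. 4 * qf (g r w)", OF _ su(1) AM] by simp
  finally show ?thesis .
qed

lemma ito_killed:
  assumes i: "ito g I" and P: "killing P" and t: "0 \<le> t" and fin: "EI t (\<lambda>s w. 4 * qf (g s w)) < \<infinity>"
  shows "(\<integral>\<^sup>+ w. (if P t w then ennreal ((I t w)\<^sup>2) else 0) \<partial>M) \<le> EI t (\<lambda>s w. if P s w then 4 * qf (g s w) else 0)"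
proof (rule killing_isometry[OF P ito_L2_martingale[OF i] ito_at_0[OF i] t _ fin ito_increment[OF i]])
  note [measurable] = ito_PT[OF i]
  show "(\<lambda>x. 4 * qf (g (fst x) (snd x))) \<in> borel_measurable (PT t)" by measurable
qed

lemma ito_L2:
  assumes i: "ito g I" and t: "0 \<le> t"
  shows "(\<integral>\<^sup>+ w. ennreal ((I t w)\<^sup>2) \<partial>M) \<le> 4 * EI t (\<lambda>s w. qf (g s w))"
proof -
  note [measurable] = ito_PT[OF i]
  have "(\<integral>\<^sup>+ w. ennreal ((I t w)\<^sup>2) \<partial>M) = (\<integral>\<^sup>+ w\<in>space M. ennreal ((I t w - I 0 w)\<^sup>2) \<partial>M)"
  proof (rule nn_integral_cong_AE)
    show "AE w in M. ennreal ((I t w)\<^sup>2) = ennreal ((I t w - I 0 w)\<^sup>2) * indicator (space M) w"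
      using ito_at_0[OF i] AE_space by eventually_elim simp
  qed
  also have "\<dots> \<le> (\<integral>\<^sup>+ w\<in>space M. (\<integral>\<^sup>+ r\<in>{0<..t}. 4 * qf (g r w) \<partial>lborel) \<partial>M)"
    using sets.top[of "F 0"] space_F[of 0] by (intro ito_increment[OF i order_refl t]) auto
  also have "\<dots> \<le> (\<integral>\<^sup>+ w. (\<integral>\<^sup>+ r\<in>{0..t}. 4 * qf (g r w) \<partial>lborel) \<partial>M)"
    by (intro nn_integral_mono) (auto split: split_indicator intro!: nn_integral_mono)
  also have "\<dots> = EI t (\<lambda>s w. 4 * qf (g s w))" by (rule EI_eq_time_space[symmetric]) measurable
  also have "\<dots> = 4 * EI t (\<lambda>s w. qf (g s w))" by (rule EI_cmult) measurable
  finally show ?thesis .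
qed

text \<open>Doob's factor 4 times the factor 4 of \<open>ito_L2\<close>.\<close>

lemma ito_doob:
  assumes i: "ito g I" and c: "cont_adapted I" and T: "0 \<le> T"
  shows "ES I T \<le> 16 * EI T (\<lambda>s w. qf (g s w))"
proof -
  have "ES I T \<le> 4 * (\<integral>\<^sup>+ w. ennreal ((I T w)\<^sup>2) \<partial>M)"
    by (rule doob_continuous[OF ito_L2_martingale[OF i] c T])
  also have "\<dots> \<le> 4 * (4 * EI T (\<lambda>s w. qf (g s w)))" by (intro mult_left_mono ito_L2[OF i T]) auto
  finally show ?thesis by (simp add: mult.assoc[symmetric])
qed

lemma S2_elem: 
  assumes e: "elem \<psi> S" shows "S2_process S"
  unfolding S2_process_def
proof (intro conjI elem_cont_adapted[OF e] allI impI)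
  fix T :: real assume T: "0 \<le> T"
  have "ES S T \<le> 4 * (\<integral>\<^sup>+ w. ennreal ((S T w)\<^sup>2) \<partial>M)"
    by (rule doob_continuous[OF ito_L2_martingale[OF ito_elem[OF e]] elem_cont_adapted[OF e] T])
  also have "\<dots> < \<infinity>"
    using elem_sq_integrable[OF e T] by (simp add: integrable_iff_bounded ennreal_mult_less_top)
  finally show "ES S T < \<infinity>" .
qed

end

subsection \<open>Discretisation of integrands\<close>

text \<open>Rounding down after clipping makes the range finite, so that rounded variables are
  simple functions, as elementary data require. Both the mesh and the clipping level improve with
  \<open>n\<close>.\<close>

definition rnd :: "nat \<Rightarrow> real \<Rightarrow> real" where
  "rnd n x = real_of_int \<lfloor>real (Suc n) * max (- real (Suc n)) (min (real (Suc n)) x)\<rfloor> / real (Suc n)"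

lemma rnd_measurable [measurable]: "rnd n \<in> borel_measurable borel"
  unfolding rnd_def by measurable

lemma rnd_close:
  defines "c \<equiv> \<lambda>n x. max (- real (Suc n)) (min (real (Suc n)) x)"
  shows "\<bar>rnd n x - c n x\<bar> \<le> inverse (real (Suc n))"
proof -
  let ?n = "real (Suc n)"
  have 1: "real_of_int \<lfloor>?n * c n x\<rfloor> \<le> ?n * c n x" "?n * c n x < real_of_int \<lfloor>?n * c n x\<rfloor> + 1" by linarith+
  have r: "rnd n x = real_of_int \<lfloor>?n * c n x\<rfloor> / ?n" by (simp only: rnd_def c_def)
  have c0: "(?n * c n x) / ?n = c n x" by simp
  have "rnd n x \<le> (?n * c n x) / ?n" unfolding r using 1 by (intro divide_right_mono) auto
  then have A: "rnd n x \<le> c n x" unfolding c0 .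
  have "(?n * c n x) / ?n \<le> (real_of_int \<lfloor>?n * c n x\<rfloor> + 1) / ?n" using 1 by (intro divide_right_mono) auto
  also have "\<dots> = rnd n x + inverse ?n"
    unfolding r by (simp add: add_divide_distrib inverse_eq_divide)
  finally have "c n x \<le> rnd n x + inverse ?n" unfolding c0 .
  with A show ?thesis by linarith
qed

lemma rnd_abs_le: "\<bar>rnd n x\<bar> \<le> \<bar>x\<bar> + 1"
proof -
  have "inverse (real (Suc n)) \<le> 1" by (simp add: field_simps)
  moreover have "\<bar>max (- real (Suc n)) (min (real (Suc n)) x)\<bar> \<le> \<bar>x\<bar>" by (auto simp: max_def min_def)
  ultimately show ?thesis using rnd_close[of n x] by linarith
qed

lemma rnd_bounded: "\<bar>rnd n x\<bar> \<le> real (Suc n) + 1"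
proof -
  have "inverse (real (Suc n)) \<le> 1" by (simp add: field_simps)
  moreover have "\<bar>max (- real (Suc n)) (min (real (Suc n)) x)\<bar> \<le> real (Suc n)" by (auto simp: max_def min_def)
  ultimately show ?thesis using rnd_close[of n x] by linarith
qed

lemma rnd_finite_range: "finite (range (rnd n))"
proof (rule finite_subset)
  let ?N = "int (Suc n) * int (Suc n)"
  show "range (rnd n) \<subseteq> (\<lambda>i. real_of_int i / real (Suc n)) ` {- ?N..?N}"
  proof
    fix y assume "y \<in> range (rnd n)"
    then obtain x where x: "y = rnd n x" by auto
    define z where "z = max (- real (Suc n)) (min (real (Suc n)) x)"
    have z: "- real (Suc n) \<le> z" "z \<le> real (Suc n)" by (auto simp: z_def)
    have "real (Suc n) * - real (Suc n) \<le> real (Suc n) * z" "real (Suc n) * z \<le> real (Suc n) * real (Suc n)"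
      by (rule mult_left_mono[OF z(1)], simp, rule mult_left_mono[OF z(2)], simp)
    moreover have "real_of_int ?N = real (Suc n) * real (Suc n)" by (simp only: of_int_mult of_int_of_nat_eq)
    ultimately have "real_of_int (- ?N) \<le> real (Suc n) * z" "real (Suc n) * z \<le> real_of_int ?N"
      by (simp_all only: of_int_minus mult_minus_right)
    then have "- ?N \<le> \<lfloor>real (Suc n) * z\<rfloor>" "\<lfloor>real (Suc n) * z\<rfloor> \<le> ?N"
      by (simp_all only: le_floor_iff floor_le_iff)
    then show "y \<in> (\<lambda>i. real_of_int i / real (Suc n)) ` {- ?N..?N}"
      unfolding x rnd_def z_def[symmetric] by auto
  qed
qed simp

text \<open>A convergent sequence is bounded, so eventually the clipping is inactive and only the
  rounding error remains.\<close>

lemma rnd_tendsto: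
  assumes y: "y \<longlonglongrightarrow> x"
  shows "(\<lambda>n. rnd n (y n)) \<longlonglongrightarrow> x"
proof -
  obtain K where K: "\<And>n. \<bar>y n\<bar> \<le> K" using convergent_imp_Bseq[OF convergentI[OF y]] unfolding Bseq_def by auto
  obtain N :: nat where N: "K \<le> real N" using real_arch_simple by blast
  have "(\<lambda>n. rnd n (y n) - y n) \<longlonglongrightarrow> 0"
  proof (rule Lim_null_comparison[OF _ LIMSEQ_inverse_real_of_nat])
    show "\<forall>\<^sub>F n in sequentially. norm (rnd n (y n) - y n) \<le> inverse (real (Suc n))"
    proof (rule eventually_sequentiallyI)
      fix n assume "N \<le> n"
      then have "\<bar>y n\<bar> \<le> real (Suc n)" using K[of n] N by linarith
      then have "max (- real (Suc n)) (min (real (Suc n)) (y n)) = y n" by (auto simp: max_def min_def)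
      then show "norm (rnd n (y n) - y n) \<le> inverse (real (Suc n))" using rnd_close[of n "y n"] by simp
    qed
  qed
  from tendsto_add[OF this y] show ?thesis by simp
qed

context stochastic_basis
begin

definition grid :: "nat \<Rightarrow> nat \<Rightarrow> real" where
  "grid n k = real k / real (Suc n)"

text \<open>With mesh 1/(n+1) the intervals cover the times in (0, n+1], so a single sequence of
  discretisations serves all horizons.\<close>

definition step :: "(real \<Rightarrow> 'w \<Rightarrow> real) \<Rightarrow> nat \<Rightarrow> real \<Rightarrow> 'w \<Rightarrow> real" where
  "step g n s w = (\<Sum>k<Suc n * Suc n. if s \<in> {grid n k<..grid n (Suc k)} then rnd n (g (grid n k) w) else 0)"

lemma grid_mono: "0 \<le> grid n k" "grid n k < grid n (Suc k)"
  by (auto simp: grid_def divide_strict_right_mono)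

lemma step_eq:
  assumes "0 < s" "s \<le> real (Suc n)"
  shows "step g n s w = rnd n (g (left_grid 1 n s) w)"
proof -
  define k where "k = nat (\<lceil>real (Suc n) * s\<rceil> - 1)"
  have c: "\<lceil>real (Suc n) * s\<rceil> \<ge> 1" using assms by (simp add: one_le_ceiling)
  then have k: "real k = real_of_int \<lceil>real (Suc n) * s\<rceil> - 1" by (simp add: k_def)
  have 1: "real k < real (Suc n) * s" "real (Suc n) * s \<le> real (Suc k)" using k by linarith+
  have "real (Suc n) * s \<le> real (Suc n) * real (Suc n)" using assms by (intro mult_left_mono) auto
  then have "real k < real (Suc n * Suc n)" unfolding of_nat_mult using 1 by linarith
  then have kn: "k < Suc n * Suc n" by (simp only: of_nat_less_iff)
  have s: "grid n k < s" "s \<le> grid n (Suc k)" using 1 unfolding grid_def by (simp_all add: field_simps del: of_nat_Suc)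
  have uniq: "s \<in> {grid n j<..grid n (Suc j)} \<longleftrightarrow> j = k" for j
  proof
    assume "s \<in> {grid n j<..grid n (Suc j)}"
    then have "real j < real (Suc n) * s" "real (Suc n) * s \<le> real (Suc j)"
      unfolding grid_def by (simp_all add: field_simps del: of_nat_Suc)
    then have "real j < real (Suc k)" "real k < real (Suc j)" using 1 by linarith+
    then show "j = k" by simp
  qed (use s in auto)
  have "step g n s w = (\<Sum>j<Suc n * Suc n. if j = k then rnd n (g (grid n k) w) else 0)"
    unfolding step_def by (rule sum.cong[OF refl]) (simp only: uniq, simp)
  also have "\<dots> = rnd n (g (grid n k) w)" using kn by (simp add: sum.delta del: mult_Suc mult_Suc_right)
  also have "grid n k = left_grid 1 n s"
    using left_grid_on_interval[of 1 k n s] s by (simp add: grid_def)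
  finally show ?thesis .
qed

lemma window_measurable:
  assumes "c \<in> borel_measurable M"
  shows "(\<lambda>x. if fst x \<in> {a<..b} then c (snd x) else (0::real)) \<in> borel_measurable (PT T)"
proof -
  have c: "(\<lambda>x. c (snd x)) \<in> borel_measurable (PT T)"
    unfolding PT_def by (rule measurable_compose[OF measurable_snd assms])
  have "Measurable.pred (restrict_space lborel {0..T}) (\<lambda>s. s \<in> {a<..b})"
    by (intro measurable_restrict_space1) simp
  then have i: "Measurable.pred (PT T) (\<lambda>x. fst x \<in> {a<..b})"
    unfolding PT_def by (rule measurable_compose[OF measurable_fst])
  show ?thesis using c i by measurable
qed

lemma step_measurable_PT:
  assumes g: "cont_adapted g"
  shows "(\<lambda>x. step g n (fst x) (snd x)) \<in> borel_measurable (PT T)"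
  unfolding step_def
  by (intro borel_measurable_sum window_measurable measurable_compose[OF cont_adapted_M[OF g grid_mono(1)] rnd_measurable])

text \<open>The step process vanishes at time zero, so it can be compared with its integrand only at
  positive times.\<close>

lemma AE_PT_pos: "AE x in PT T. 0 < fst x"
proof -
  have m: "(\<lambda>x. indicator {0} (fst x) :: ennreal) \<in> borel_measurable (PT T)"
  proof -
    have "(\<lambda>s. indicator {0} s :: ennreal) \<in> borel_measurable (restrict_space lborel {0..T})"
      by (intro measurable_restrict_space1) simp
    then show ?thesis unfolding PT_def by (rule measurable_compose[OF measurable_fst])
  qed
  have "(\<integral>\<^sup>+ x. indicator {0} (fst x) \<partial>PT T) = EI T (\<lambda>s w. indicator {0} s)" by (simp add: EI_def)
  also have "\<dots> = (\<integral>\<^sup>+ s\<in>{0..T}. (\<integral>\<^sup>+ w. indicator {0} s \<partial>M) \<partial>lborel)"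
    by (rule EI_eq_space_time) (rule m)
  also have "\<dots> \<le> (\<integral>\<^sup>+ s. indicator {0} (s::real) \<partial>lborel)"
    by (intro nn_integral_mono) (auto simp: emeasure_space_1 split: split_indicator)
  also have "\<dots> = 0" by simp
  finally have "AE x in PT T. indicator {0} (fst x) = (0::ennreal)"
    by (subst (asm) le_zero_eq, subst (asm) nn_integral_0_iff_AE[OF m])
  moreover have "AE x in PT T. x \<in> space (PT T)" by (rule AE_space)
  ultimately show ?thesis
    by eventually_elim (auto simp: space_PT split: split_indicator_asm)
qed

lemma step_tendsto:
  assumes g: "S2_process g" and T: "0 \<le> T"
  shows "(\<lambda>n. EI T (\<lambda>s w. ennreal ((step g n s w - g s w)\<^sup>2))) \<longlonglongrightarrow> 0"
proof -
  note ca = S2_cont_adapted[OF g]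
  define G where "G w = (SUP t\<in>{0..T}. ennreal ((norm (g t w))\<^sup>2))" for w
  have Gm: "G \<in> borel_measurable M" unfolding G_def by (rule sup_sq_measurable[OF ca T])
  have G2: "(\<lambda>x. 6 * G (snd x) + 4) \<in> borel_measurable (PT T)"
    using measurable_compose[OF measurable_snd Gm, of "restrict_space lborel {0..T}"] unfolding PT_def by measurable
  note [measurable] = step_measurable_PT[OF ca] measurable_PT_cont[OF ca]
  have "(\<lambda>n. \<integral>\<^sup>+ x. ennreal ((step g n (fst x) (snd x) - g (fst x) (snd x))\<^sup>2) \<partial>PT T) \<longlonglongrightarrow> (\<integral>\<^sup>+ x. 0 \<partial>PT T)"
  \<comment> \<open>The squared step process is at most \<open>2 * G + 2\<close>, hence the squared
    difference at most \<open>2 * (2 * G + 2) + 2 * G\<close>.\<close>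
  proof (rule nn_integral_dominated_convergence[where w = "\<lambda>x. 6 * G (snd x) + 4"])
    show "(\<integral>\<^sup>+ x. 6 * G (snd x) + 4 \<partial>PT T) < \<infinity>"
    proof -
      have "(\<integral>\<^sup>+ x. 6 * G (snd x) + 4 \<partial>PT T) = EI T (\<lambda>s w. 6 * G w + 4)" by (simp add: EI_def)
      also have "\<dots> = (\<integral>\<^sup>+ s\<in>{0..T}. (\<integral>\<^sup>+ w. 6 * G w + 4 \<partial>M) \<partial>lborel)"
        by (rule EI_eq_space_time) (rule G2)
      also have "\<dots> = (6 * (\<integral>\<^sup>+ w. G w \<partial>M) + 4) * ennreal T"
        using Gm T by (simp add: nn_integral_add nn_integral_cmult emeasure_space_1 nn_integral_cmult_indicator)
      also have "\<dots> < \<infinity>" using S2_ES[OF g T, folded G_def] by (auto simp: ennreal_mult_less_top)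
      finally show ?thesis .
    qed
    show "AE x in PT T. ennreal ((step g n (fst x) (snd x) - g (fst x) (snd x))\<^sup>2) \<le> 6 * G (snd x) + 4" for n
    proof (rule AE_mp[OF AE_PT_pos], rule AE_I2, rule impI)
      fix x assume "x \<in> space (PT T)" and pos: "0 < fst x"
      then have s: "fst x \<in> {0..T}" and w: "snd x \<in> space M" by (auto simp: space_PT)
      have bd: "ennreal ((g t (snd x))\<^sup>2) \<le> G (snd x)" if "t \<in> {0..T}" for t
        unfolding G_def using that by (intro SUP_upper2[of t]) auto
      have "ennreal ((step g n (fst x) (snd x))\<^sup>2) \<le> 2 * G (snd x) + 2"
      proof (cases "fst x \<le> real (Suc n)")
        case True
        let ?y = "g (left_grid 1 n (fst x)) (snd x)"
        have lg: "left_grid 1 n (fst x) \<in> {0..T}" using left_grid[OF pos, of 1 n] s by auto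
        have "(rnd n ?y)\<^sup>2 \<le> (\<bar>?y\<bar> + 1)\<^sup>2" using rnd_abs_le[of n ?y] by (simp add: abs_le_square_iff[symmetric])
        also have "\<dots> \<le> 2 * ?y\<^sup>2 + 2" using power2_norm_add_le[of "\<bar>?y\<bar>" 1] by simp
        finally have "ennreal ((rnd n ?y)\<^sup>2) \<le> ennreal (2 * ?y\<^sup>2 + 2)" by (rule ennreal_leI)
        also have "\<dots> = 2 * ennreal (?y\<^sup>2) + 2" by (simp add: ennreal_mult)
        also have "\<dots> \<le> 2 * G (snd x) + 2" by (intro add_mono mult_left_mono bd lg) auto
        finally show ?thesis unfolding step_eq[OF pos True] .
      next
        case False
        \<comment> \<open>The last grid point is \<open>n + 1\<close>, because there are
          \<open>Suc n * Suc n\<close> intervals of mesh 1/(n+1).\<close>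
        have "step g n (fst x) (snd x) = 0"
        proof -
          have "grid n (Suc k) \<le> real (Suc n)" if "k < Suc n * Suc n" for k
          proof -
            have "real (Suc k) \<le> real (Suc n * Suc n)" using that by (simp only: of_nat_le_iff Suc_le_eq)
            then have "real (Suc k) \<le> real (Suc n) * real (Suc n)" unfolding of_nat_mult .
            then have "real (Suc k) / real (Suc n) \<le> (real (Suc n) * real (Suc n)) / real (Suc n)"
              by (rule divide_right_mono) simp
            then show ?thesis unfolding grid_def by simp
          qed
          then show ?thesis unfolding step_def using False by (intro sum.neutral) (force simp del: of_nat_Suc)
        qed
        then show ?thesis by simp
      qed
      moreover have "(step g n (fst x) (snd x) - g (fst x) (snd x))\<^sup>2 \<le> 2 * (step g n (fst x) (snd x))\<^sup>2 + 2 * (g (fst x) (snd x))\<^sup>2"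
        using power2_norm_add_le[of "step g n (fst x) (snd x)" "- g (fst x) (snd x)"] by simp
      then have "ennreal ((step g n (fst x) (snd x) - g (fst x) (snd x))\<^sup>2) \<le> 2 * ennreal ((step g n (fst x) (snd x))\<^sup>2) + 2 * ennreal ((g (fst x) (snd x))\<^sup>2)"
        by (subst ennreal_numeral[symmetric], subst ennreal_mult[symmetric], simp, simp)+
           (subst ennreal_plus[symmetric], simp, simp, rule ennreal_leI)
      ultimately have "ennreal ((step g n (fst x) (snd x) - g (fst x) (snd x))\<^sup>2) \<le> 2 * (2 * G (snd x) + 2) + 2 * G (snd x)"
        using bd[OF s] by (meson add_mono mult_left_mono order_trans zero_le)
      also have "\<dots> = 6 * G (snd x) + 4"
      proof -
        have "2 * (2 * G (snd x) + 2) + 2 * G (snd x) = (4 * G (snd x) + 2 * G (snd x)) + 4"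
          by (simp add: distrib_left mult.assoc[symmetric] add_ac)
        also have "4 * G (snd x) + 2 * G (snd x) = 6 * G (snd x)" by (simp flip: distrib_right)
        finally show ?thesis .
      qed
      finally show "ennreal ((step g n (fst x) (snd x) - g (fst x) (snd x))\<^sup>2) \<le> 6 * G (snd x) + 4" .
    qed
    show "AE x in PT T. (\<lambda>n. ennreal ((step g n (fst x) (snd x) - g (fst x) (snd x))\<^sup>2)) \<longlonglongrightarrow> 0"
    proof (rule AE_mp[OF AE_PT_pos], rule AE_I2, rule impI)
      fix x assume "x \<in> space (PT T)" and pos: "0 < fst x"
      then have w: "snd x \<in> space M" by (auto simp: space_PT)
      have "(\<lambda>n. g (left_grid 1 n (fst x)) (snd x)) \<longlonglongrightarrow> g (fst x) (snd x)"
        by (rule continuous_on_tendsto_compose[OF cont_adapted_cont[OF ca w] left_grid_tendsto[OF pos]])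
           (use pos left_grid[OF pos, of 1] in auto)
      then have "(\<lambda>n. rnd n (g (left_grid 1 n (fst x)) (snd x))) \<longlonglongrightarrow> g (fst x) (snd x)" by (rule rnd_tendsto)
      moreover have "\<forall>\<^sub>F n in sequentially. rnd n (g (left_grid 1 n (fst x)) (snd x)) = step g n (fst x) (snd x)"
      proof -
        obtain N :: nat where "fst x \<le> real N" using real_arch_simple by blast
        then show ?thesis by (intro eventually_sequentiallyI[of N]) (auto intro!: step_eq[symmetric] pos)
      qed
      ultimately have "(\<lambda>n. step g n (fst x) (snd x)) \<longlonglongrightarrow> g (fst x) (snd x)" by (rule Lim_transform_eventually)
      then have "(\<lambda>n. ennreal ((step g n (fst x) (snd x) - g (fst x) (snd x))\<^sup>2)) \<longlonglongrightarrow> ennreal ((g (fst x) (snd x) - g (fst x) (snd x))\<^sup>2)"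
        by (intro tendsto_ennrealI tendsto_intros)
      then show "(\<lambda>n. ennreal ((step g n (fst x) (snd x) - g (fst x) (snd x))\<^sup>2)) \<longlonglongrightarrow> 0" by simp
    qed
  qed (use G2 in measurable)
  then show ?thesis by (simp add: EI_def)
qed

end

subsection \<open>Existence of the Ito integral\<close>

context hilbert_noise
begin

definition step_int :: "(real \<Rightarrow> 'w \<Rightarrow> real) \<Rightarrow> 'k \<Rightarrow> nat \<Rightarrow> real \<Rightarrow> 'w \<Rightarrow> real" where
  "step_int g h n t w = (\<Sum>k<Suc n * Suc n. rnd n (g (grid n k) w) * ((W (min t (grid n (Suc k))) w - W (min t (grid n k)) w) \<bullet> h))"

lemma elem_step_int:
  assumes g: "cont_adapted g"
  shows "elem (\<lambda>s w. step g n s w *\<^sub>R h) (step_int g h n)"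
proof -
  have "elem (\<lambda>s w. (if s \<in> {grid n k<..grid n (Suc k)} then rnd n (g (grid n k) w) else 0) *\<^sub>R h)
     (\<lambda>t w. rnd n (g (grid n k) w) * ((W (min t (grid n (Suc k))) w - W (min t (grid n k)) w) \<bullet> h))" for k
    by (rule elem_single[OF grid_mono(1) less_imp_le[OF grid_mono(2)] measurable_compose[OF cont_adapted_F[OF g grid_mono(1)] rnd_measurable] rnd_bounded])
  from elem_sum[of "{..<Suc n * Suc n}", OF this] show ?thesis
    unfolding step_def step_int_def scaleR_sum_left by (simp only: step_int_def[abs_def])
qed

lemma EI_sq_diff_step:
  assumes g: "cont_adapted g"
  shows "EI T (\<lambda>s w. ennreal ((step g m s w - step g n s w)\<^sup>2))
    \<le> 2 * EI T (\<lambda>s w. ennreal ((step g m s w - g s w)\<^sup>2)) + 2 * EI T (\<lambda>s w. ennreal ((step g n s w - g s w)\<^sup>2))"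
proof -
  note [measurable] = step_measurable_PT[OF g] measurable_PT_cont[OF g]
  have "EI T (\<lambda>s w. ennreal ((step g m s w - step g n s w)\<^sup>2))
    \<le> EI T (\<lambda>s w. 2 * ennreal ((step g m s w - g s w)\<^sup>2) + 2 * ennreal ((step g n s w - g s w)\<^sup>2))"
  proof (rule EI_mono)
    fix s w
    show "ennreal ((step g m s w - step g n s w)\<^sup>2) \<le> 2 * ennreal ((step g m s w - g s w)\<^sup>2) + 2 * ennreal ((step g n s w - g s w)\<^sup>2)"
      using ennreal_sq_add_le[of "step g m s w - g s w" "- (step g n s w - g s w)"]
      unfolding power2_minus by simp
  qed
  also have "\<dots> = 2 * EI T (\<lambda>s w. ennreal ((step g m s w - g s w)\<^sup>2)) + 2 * EI T (\<lambda>s w. ennreal ((step g n s w - g s w)\<^sup>2))"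
    by (subst EI_add, measurable) (subst EI_cmult, measurable)+
  finally show ?thesis .
qed

lemma qf_real_scale: "qf (x *\<^sub>R h) = qf h * ennreal (x\<^sup>2)"
  by (simp add: qf_scale mult.commute)

text \<open>Doob's inequality reduces convergence of the step integrals to that of the step
  processes. A subsequence that is accurate on the horizon \<open>j\<close> at stage
  \<open>j\<close> is fast on every fixed horizon from some index on, and \<open>S2_complete\<close>
  applies.\<close>

lemma ito_exists:
  assumes g: "S2_process (g :: real \<Rightarrow> 'w \<Rightarrow> real)"
  shows "\<exists>I. S2_process I \<and> ito (\<lambda>s w. g s w *\<^sub>R h) I"
proof -
  note ca = S2_cont_adapted[OF g]
  note [measurable] = step_measurable_PT[OF ca] measurable_PT_cont[OF ca]
  define e where "e T n = EI T (\<lambda>s w. ennreal ((step g n s w - g s w)\<^sup>2))" for T n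
  have e0: "e T \<longlonglongrightarrow> 0" if "0 \<le> T" for T unfolding e_def by (rule step_tendsto[OF g that])
  have "\<exists>n. e (real j) n \<le> ennreal (1 / 64^j)" for j
  proof -
    have "\<forall>\<^sub>F n in sequentially. e (real j) n < ennreal (1 / 64^j)"
      by (rule order_tendstoD(2)[OF e0]) auto
    then show ?thesis using eventually_happens'[OF sequentially_bot] by (blast intro: less_imp_le)
  qed
  then obtain \<phi> where \<phi>: "\<And>j. e (real j) (\<phi> j) \<le> ennreal (1 / 64^j)" by metis
  have e_mono: "e T n \<le> e T' n" if "T \<le> T'" for T T' n
    unfolding e_def
  proof (rule EI_mono_time[OF _ that])
    show "(\<lambda>x. ennreal ((step g n (fst x) (snd x) - g (fst x) (snd x))\<^sup>2)) \<in> borel_measurable (PT T)" for T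
      by measurable
  qed
  define X where "X j = step_int g h (\<phi> j)" for j
  have XS: "S2_process (X j)" for j unfolding X_def by (rule S2_elem[OF elem_step_int[OF ca]])
  define q where "q = C h \<bullet> h"
  have q: "0 \<le> q" "qf h = ennreal q" using C_psd by (auto simp: q_def qf_def)
  \<comment> \<open>The numerator 64 is 16 * (2 + 2): the factor of \<open>ito_doob\<close>, and two
    step processes compared through \<open>g\<close>. The base 64 is the rate asked for by
    \<open>S2_complete\<close>.\<close>
  have D: "ES (\<lambda>t w. X (Suc j) t w - X j t w) T \<le> ennreal (64 * q / 64^j)" if T: "0 \<le> T" "T \<le> real j" for j T
  proof -
    have el: "elem (\<lambda>s w. step g (\<phi> (Suc j)) s w *\<^sub>R h - step g (\<phi> j) s w *\<^sub>R h) (\<lambda>t w. X (Suc j) t w - X j t w)"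
      unfolding X_def by (rule elem_diff[OF elem_step_int[OF ca] elem_step_int[OF ca]])
    have "ES (\<lambda>t w. X (Suc j) t w - X j t w) T \<le> 16 * EI T (\<lambda>s w. qf (step g (\<phi> (Suc j)) s w *\<^sub>R h - step g (\<phi> j) s w *\<^sub>R h))"
      by (rule ito_doob[OF ito_elem[OF el] elem_cont_adapted[OF el] T(1)])
    also have "EI T (\<lambda>s w. qf (step g (\<phi> (Suc j)) s w *\<^sub>R h - step g (\<phi> j) s w *\<^sub>R h))
       = EI T (\<lambda>s w. qf h * ennreal ((step g (\<phi> (Suc j)) s w - step g (\<phi> j) s w)\<^sup>2))"
      by (simp only: qf_real_scale flip: scaleR_diff_left)
    also have "\<dots> = qf h * EI T (\<lambda>s w. ennreal ((step g (\<phi> (Suc j)) s w - step g (\<phi> j) s w)\<^sup>2))"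
      by (rule EI_cmult) measurable
    also have "EI T (\<lambda>s w. ennreal ((step g (\<phi> (Suc j)) s w - step g (\<phi> j) s w)\<^sup>2)) \<le> 2 * e T (\<phi> (Suc j)) + 2 * e T (\<phi> j)"
      unfolding e_def by (rule EI_sq_diff_step[OF ca])
    also have "\<dots> \<le> 2 * ennreal (1 / 64^j) + 2 * ennreal (1 / 64^j)"
    proof (intro add_mono mult_left_mono)
      have "e T (\<phi> (Suc j)) \<le> ennreal (1 / 64^Suc j)"
        by (rule order_trans[OF e_mono \<phi>]) (use T in auto)
      also have "\<dots> \<le> ennreal (1 / 64^j)" by (intro ennreal_leI) (simp add: field_simps)
      finally show "e T (\<phi> (Suc j)) \<le> ennreal (1 / 64^j)" .
      show "e T (\<phi> j) \<le> ennreal (1 / 64^j)" by (rule order_trans[OF e_mono \<phi>]) (use T in auto)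
    qed auto
    also have "16 * (qf h * (2 * ennreal (1 / 64^j) + 2 * ennreal (1 / 64^j))) = ennreal (64 * q / 64^j)"
    proof -
      have "2 * ennreal (1 / 64^j) + 2 * ennreal (1 / 64^j) = ennreal (4 * (1 / 64^j))"
        by (subst ennreal_mult) (simp_all flip: distrib_right)
      then have "16 * (qf h * (2 * ennreal (1 / 64^j) + 2 * ennreal (1 / 64^j))) = ennreal 16 * (ennreal q * ennreal (4 * (1 / 64^j)))"
        by (simp add: q)
      also have "\<dots> = ennreal 16 * ennreal (q * (4 * (1 / 64^j)))"
        using q(1) by (subst ennreal_mult[of q]) auto
      also have "\<dots> = ennreal (16 * (q * (4 * (1 / 64^j))))"
        using q(1) by (intro ennreal_mult[symmetric]) auto
      also have "16 * (q * (4 * (1 / 64^j))) = 64 * q / 64^j" by simp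
      finally show ?thesis .
    qed
    finally show ?thesis by (simp add: mult_left_mono)
  qed
  have fast: "\<exists>A\<ge>0. \<forall>n. ES (\<lambda>t w. X (Suc n) t w - X n t w) T \<le> ennreal (A / 64^n)" if T: "0 \<le> T" for T
  proof -
    obtain N :: nat where N: "T \<le> real N" using real_arch_simple by blast
    define f where "f n = enn2real (ES (\<lambda>t w. X (Suc n) t w - X n t w) T)" for n
    have f: "ES (\<lambda>t w. X (Suc n) t w - X n t w) T = ennreal (f n)" "0 \<le> f n" for n
      using S2_ES[OF S2_diff[OF XS XS] T, of "Suc n" n] unfolding f_def by auto
    \<comment> \<open>The finitely many stages before the horizon is reached are absorbed into the
      constant.\<close>
    define A where "A = 64 * q + (\<Sum>n<N. f n * 64^n)"
    have s0: "0 \<le> (\<Sum>n<N. f n * 64^n)" using f by (intro sum_nonneg) auto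
    have "f n \<le> A / 64^n" for n
    proof (cases "N \<le> n")
      case True
      then have "f n \<le> 64 * q / 64^n" using D[OF T, of n] N q f by simp
      also have "\<dots> \<le> A / 64^n" unfolding A_def using s0 by (intro divide_right_mono) auto
      finally show ?thesis .
    next
      case False
      then have "f n * 64^n \<le> (\<Sum>n<N. f n * 64^n)" using f by (intro member_le_sum) auto
      also have "\<dots> \<le> A" unfolding A_def using q by simp
      finally show ?thesis by (simp add: field_simps)
    qed
    then show ?thesis unfolding f(1) using q s0 by (intro exI[of _ A]) (auto simp: A_def intro!: ennreal_leI)
  qed
  obtain Y where Y: "S2_process Y" "\<And>T. 0 \<le> T \<Longrightarrow> (\<lambda>n. ES (\<lambda>t w. X n t w - Y t w) T) \<longlonglongrightarrow> 0"
    using S2_complete[OF XS fast] by blast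
  have "ito (\<lambda>s w. g s w *\<^sub>R h) Y"
    unfolding ito_def
  proof (intro conjI allI impI)
    show "(\<lambda>x. g (fst x) (snd x) *\<^sub>R h) \<in> borel_measurable (PT T)" for T by measurable
    show "Y t \<in> borel_measurable (F t)" if "0 \<le> t" for t by (rule cont_adapted_F[OF S2_cont_adapted[OF Y(1)] that])
    fix T :: real assume T: "0 < T"
    show "itoL T (\<lambda>s w. g s w *\<^sub>R h) Y"
      unfolding itoL_def
    proof (intro exI conjI allI ballI)
      show "elem (\<lambda>s w. step g (\<phi> n) s w *\<^sub>R h) (X n)" for n unfolding X_def by (rule elem_step_int[OF ca])
      have "(\<lambda>n. e T (\<phi> n)) \<longlonglongrightarrow> 0"
      proof -
        obtain N :: nat where N: "T \<le> real N" using real_arch_simple by blast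
        have "(\<lambda>n. ennreal ((1/64)^n)) \<longlonglongrightarrow> ennreal 0" by (intro tendsto_ennrealI LIMSEQ_power_zero) auto
        then have z: "(\<lambda>n. ennreal (1 / 64^n)) \<longlonglongrightarrow> 0" by (simp add: power_one_over)
        show ?thesis
        proof (rule tendsto_sandwich[OF _ _ tendsto_const z])
          show "\<forall>\<^sub>F n in sequentially. e T (\<phi> n) \<le> ennreal (1 / 64^n)"
            by (rule eventually_sequentiallyI[of N], rule order_trans[OF e_mono \<phi>]) (use N in auto)
        qed simp
      qed
      then have "(\<lambda>n. qf h * e T (\<phi> n) + 0 * 0) \<longlonglongrightarrow> 0"
        by (rule ennreal_tendsto_add_0[OF _ tendsto_const]) (auto simp: q)
      then show "(\<lambda>n. EI T (\<lambda>s w. qf (step g (\<phi> n) s w *\<^sub>R h - g s w *\<^sub>R h))) \<longlonglongrightarrow> 0"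
      proof (rule ennreal_tendsto_0_le)
        fix n
        have "EI T (\<lambda>s w. qf (step g (\<phi> n) s w *\<^sub>R h - g s w *\<^sub>R h)) = EI T (\<lambda>s w. qf h * ennreal ((step g (\<phi> n) s w - g s w)\<^sup>2))"
          by (simp only: qf_real_scale flip: scaleR_diff_left)
        also have "\<dots> = qf h * e T (\<phi> n)" unfolding e_def by (rule EI_cmult) measurable
        finally show "EI T (\<lambda>s w. qf (step g (\<phi> n) s w *\<^sub>R h - g s w *\<^sub>R h)) \<le> qf h * e T (\<phi> n) + 0 * 0" by simp
      qed
      fix t assume t: "t \<in> {0..T}"
      show "(\<lambda>n. \<integral>\<^sup>+ w. ennreal ((X n t w - Y t w)\<^sup>2) \<partial>M) \<longlonglongrightarrow> 0"
        using ennreal_tendsto_0_le[OF Y(2)[of T], of "\<lambda>n. \<integral>\<^sup>+ w. ennreal ((X n t w - Y t w)\<^sup>2) \<partial>M"]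
          E_le_ES[of t T "\<lambda>t w. X n t w - Y t w" for n] t T by simp
    qed
  qed
  then show ?thesis using Y(1) by blast
qed

text \<open>A fixed version with continuous paths and finite second moments of the supremum; it is
  determined only up to a null set.\<close>

definition Ito :: "(real \<Rightarrow> 'w \<Rightarrow> real) \<Rightarrow> 'k \<Rightarrow> real \<Rightarrow> 'w \<Rightarrow> real" where
  "Ito g h = (SOME I. S2_process I \<and> ito (\<lambda>s w. g s w *\<^sub>R h) I)"

lemma Ito:
  assumes "S2_process g"
  shows "S2_process (Ito g h)" "ito (\<lambda>s w. g s w *\<^sub>R h) (Ito g h)"
  using someI_ex[OF ito_exists[OF assms, of h]] unfolding Ito_def by blast+

text \<open>The whole sequence converges, not merely the subsequence used for existence, so
  integrands for several directions can be discretised on a common grid.\<close>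

lemma step_int_tendsto_Ito:
  assumes g: "S2_process g" and T: "0 \<le> T"
  shows "(\<lambda>n. ES (\<lambda>t w. step_int g h n t w - Ito g h t w) T) \<longlonglongrightarrow> 0"
proof -
  note ca = S2_cont_adapted[OF g]
  note [measurable] = step_measurable_PT[OF ca] measurable_PT_cont[OF ca]
  have "(\<lambda>n. (16 * qf h) * EI T (\<lambda>s w. ennreal ((step g n s w - g s w)\<^sup>2)) + 0 * 0) \<longlonglongrightarrow> 0"
    by (rule ennreal_tendsto_add_0[OF step_tendsto[OF g T] tendsto_const]) (auto simp: qf_def ennreal_mult_less_top)
  then show ?thesis
  proof (rule ennreal_tendsto_0_le)
    fix n
    note el = elem_step_int[OF ca, of n h]
    have "ES (\<lambda>t w. step_int g h n t w - Ito g h t w) T \<le> 16 * EI T (\<lambda>s w. qf (step g n s w *\<^sub>R h - g s w *\<^sub>R h))"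
      by (rule ito_doob[OF ito_diff[OF ito_elem[OF el] Ito(2)[OF g]] cont_adapted_diff[OF elem_cont_adapted[OF el] S2_cont_adapted[OF Ito(1)[OF g]]] T])
    also have "EI T (\<lambda>s w. qf (step g n s w *\<^sub>R h - g s w *\<^sub>R h)) = EI T (\<lambda>s w. qf h * ennreal ((step g n s w - g s w)\<^sup>2))"
      by (simp only: qf_real_scale flip: scaleR_diff_left)
    also have "\<dots> = qf h * EI T (\<lambda>s w. ennreal ((step g n s w - g s w)\<^sup>2))" by (rule EI_cmult) measurable
    finally show "ES (\<lambda>t w. step_int g h n t w - Ito g h t w) T \<le> (16 * qf h) * EI T (\<lambda>s w. ennreal ((step g n s w - g s w)\<^sup>2)) + 0 * 0"
      by (simp add: mult.assoc)
  qed
qed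

end

subsection \<open>Stochastic differential equations\<close>

text \<open>The equation \<open>X\<^sub>t = x0 + \<integral> b(X) ds + \<Sum>i\<in>J. (\<integral> g\<^sub>i(X) \<langle>h\<^sub>i, dW\<rangle>) u\<^sub>i\<close>, driven by finitely many real noises.\<close>

locale sde = hilbert_noise M F W C
  for M :: "'w measure" and F and W :: "real \<Rightarrow> 'w \<Rightarrow> 'k::{real_inner, banach, second_countable_topology}" and C +
  fixes J :: "'i set" and h :: "'i \<Rightarrow> 'k" and u :: "'i \<Rightarrow> 'a::{real_inner, banach, second_countable_topology}"
  assumes J: "finite J" and u: "\<And>i. i \<in> J \<Longrightarrow> norm (u i) \<le> 1"
begin

text \<open>The drift integrand and the real integrals are separate arguments rather than functions
  of one path, so that a difference of two solutions has this form again.\<close>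

definition evo :: "(real \<Rightarrow> 'w \<Rightarrow> 'a) \<Rightarrow> ('i \<Rightarrow> real \<Rightarrow> 'w \<Rightarrow> real) \<Rightarrow> real \<Rightarrow> 'w \<Rightarrow> 'a" where
  "evo \<beta> I t w = (LINT s:{0..t}|lborel. \<beta> s w) + (\<Sum>i\<in>J. I i t w *\<^sub>R u i)"

definition cf :: "(real \<Rightarrow> 'w \<Rightarrow> 'a) \<Rightarrow> ('i \<Rightarrow> real \<Rightarrow> 'w \<Rightarrow> real) \<Rightarrow> real \<Rightarrow> 'w \<Rightarrow> real" where
  "cf \<beta> \<gamma> s w = (norm (\<beta> s w))\<^sup>2 + (\<Sum>i\<in>J. (\<gamma> i s w)\<^sup>2)"

text \<open>The 2 separates drift from noise; 32 is 2 * 16, with 16 from \<open>ito_doob\<close>;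
  \<open>card J\<close> comes from squaring a sum over \<open>J\<close>.\<close>

definition KC :: real where
  "KC = 2 + 32 * real (card J) * (\<Sum>i\<in>J. C (h i) \<bullet> h i)"

lemma KC_ge: "2 \<le> KC"
  unfolding KC_def using C_psd by (simp add: sum_nonneg)

lemma qf_le: "i \<in> J \<Longrightarrow> 32 * ennreal (real (card J)) * qf (h i) \<le> ennreal KC"
proof -
  assume i: "i \<in> J"
  have "C (h i) \<bullet> h i \<le> (\<Sum>i\<in>J. C (h i) \<bullet> h i)" by (rule member_le_sum[OF i _ J]) (simp add: C_psd)
  then have "32 * real (card J) * (C (h i) \<bullet> h i) \<le> 32 * real (card J) * (\<Sum>i\<in>J. C (h i) \<bullet> h i)"
    by (intro mult_left_mono) auto
  then have le: "32 * real (card J) * (C (h i) \<bullet> h i) \<le> KC" unfolding KC_def by linarith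
  have "32 * ennreal (real (card J)) * qf (h i) = ennreal 32 * ennreal (real (card J)) * ennreal (C (h i) \<bullet> h i)"
    by (simp add: qf_def)
  also have "\<dots> = ennreal (32 * real (card J) * (C (h i) \<bullet> h i))"
    using ennreal_mult[of "32 * real (card J)" "C (h i) \<bullet> h i"] ennreal_mult[of 32 "real (card J)"] C_psd[of "h i"]
    by (simp only: mult_nonneg_nonneg zero_le_numeral of_nat_0_le_iff)
  also have "\<dots> \<le> ennreal KC" using le by (rule ennreal_leI)
  finally show ?thesis .
qed

lemma evo_sq_le:
  "ennreal ((norm (evo \<beta> I t w))\<^sup>2) \<le> 2 * ennreal ((norm (LINT s:{0..t}|lborel. \<beta> s w))\<^sup>2)
    + (\<Sum>i\<in>J. 2 * ennreal (real (card J)) * ennreal ((I i t w)\<^sup>2))"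
proof -
  have "(norm (\<Sum>i\<in>J. I i t w *\<^sub>R u i))\<^sup>2 \<le> real (card J) * (\<Sum>i\<in>J. (norm (I i t w *\<^sub>R u i))\<^sup>2)"
    by (rule power2_norm_sum_le[OF J])
  also have "\<dots> \<le> real (card J) * (\<Sum>i\<in>J. (I i t w)\<^sup>2)"
  proof (intro mult_left_mono sum_mono)
    fix i assume "i \<in> J"
    then have "norm (I i t w *\<^sub>R u i) \<le> \<bar>I i t w\<bar>" using u[of i] by (simp add: mult_left_le)
    then have "(norm (I i t w *\<^sub>R u i))\<^sup>2 \<le> \<bar>I i t w\<bar>\<^sup>2" by (intro power_mono) auto
    then show "(norm (I i t w *\<^sub>R u i))\<^sup>2 \<le> (I i t w)\<^sup>2" by simp
  qed auto
  finally have 1: "(norm (\<Sum>i\<in>J. I i t w *\<^sub>R u i))\<^sup>2 \<le> real (card J) * (\<Sum>i\<in>J. (I i t w)\<^sup>2)" .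
  have "(norm (evo \<beta> I t w))\<^sup>2 \<le> 2 * (norm (LINT s:{0..t}|lborel. \<beta> s w))\<^sup>2 + 2 * (norm (\<Sum>i\<in>J. I i t w *\<^sub>R u i))\<^sup>2"
    unfolding evo_def by (rule power2_norm_add_le)
  also have "\<dots> \<le> 2 * (norm (LINT s:{0..t}|lborel. \<beta> s w))\<^sup>2 + (\<Sum>i\<in>J. 2 * real (card J) * (I i t w)\<^sup>2)"
    using 1 by (simp add: mult.assoc flip: sum_distrib_left)
  finally have "ennreal ((norm (evo \<beta> I t w))\<^sup>2) \<le> ennreal (2 * (norm (LINT s:{0..t}|lborel. \<beta> s w))\<^sup>2 + (\<Sum>i\<in>J. 2 * real (card J) * (I i t w)\<^sup>2))"
    by (rule ennreal_leI)
  also have "\<dots> = ennreal (2 * (norm (LINT s:{0..t}|lborel. \<beta> s w))\<^sup>2) + (\<Sum>i\<in>J. ennreal (2 * real (card J) * (I i t w)\<^sup>2))"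
    by (subst ennreal_plus) (auto simp: sum_nonneg)
  also have "\<dots> = 2 * ennreal ((norm (LINT s:{0..t}|lborel. \<beta> s w))\<^sup>2) + (\<Sum>i\<in>J. 2 * ennreal (real (card J)) * ennreal ((I i t w)\<^sup>2))"
    by (simp add: ennreal_mult)
  finally show ?thesis .
qed

text \<open>The arithmetic shared by the bounds for the killed moment and for the supremum. The
  former would allow 4 in place of 16 and is weakened so that one lemma serves both.\<close>

lemma combine_bound:
  assumes t: "0 \<le> t" and b: "a \<le> ennreal t * x" and c: "\<And>i. i \<in> J \<Longrightarrow> c i \<le> 16 * (qf (h i) * y i)"
  shows "2 * a + (\<Sum>i\<in>J. 2 * ennreal (real (card J)) * c i) \<le> ennreal (KC * (1 + t)) * (x + (\<Sum>i\<in>J. y i))"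
proof -
  have K: "ennreal KC \<le> ennreal (KC * (1 + t))" using t KC_ge by (intro ennreal_leI) (simp add: mult_le_cancel_left1)
  have "2 * a \<le> 2 * (ennreal t * x)" by (intro mult_left_mono b) auto
  also have "\<dots> = ennreal (2 * t) * x" using t by (simp add: ennreal_mult mult.assoc)
  also have "\<dots> \<le> ennreal (KC * (1 + t)) * x"
  proof (intro mult_right_mono ennreal_leI)
    have "2 * t \<le> KC * t" using KC_ge t by (intro mult_right_mono) auto
    then show "2 * t \<le> KC * (1 + t)" using KC_ge by (simp add: distrib_left)
  qed auto
  finally have 1: "2 * a \<le> ennreal (KC * (1 + t)) * x" .
  have 2: "2 * ennreal (real (card J)) * c i \<le> ennreal (KC * (1 + t)) * y i" if "i \<in> J" for i
  proof -
    have "2 * ennreal (real (card J)) * c i \<le> 2 * ennreal (real (card J)) * (16 * (qf (h i) * y i))"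
      by (intro mult_left_mono c[OF that]) auto
    also have "\<dots> = (2 * 16) * ennreal (real (card J)) * qf (h i) * y i" by (simp only: mult_ac)
    also have "\<dots> = 32 * ennreal (real (card J)) * qf (h i) * y i" by simp
    also have "\<dots> \<le> ennreal (KC * (1 + t)) * y i"
      using order_trans[OF qf_le[OF that] K] by (intro mult_right_mono) auto
    finally show ?thesis .
  qed
  have "2 * a + (\<Sum>i\<in>J. 2 * ennreal (real (card J)) * c i) \<le> ennreal (KC * (1 + t)) * x + (\<Sum>i\<in>J. ennreal (KC * (1 + t)) * y i)"
    by (intro add_mono sum_mono 1 2)
  also have "\<dots> = ennreal (KC * (1 + t)) * (x + (\<Sum>i\<in>J. y i))" by (simp add: distrib_left sum_distrib_left)
  finally show ?thesis .
qed

lemma EI_cf: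
  assumes \<beta>: "S2_process \<beta>" and \<gamma>: "\<And>i. i \<in> J \<Longrightarrow> S2_process (\<gamma> i)" and P: "Measurable.pred (PT T) (\<lambda>x. P (fst x) (snd x))"
  shows "EI T (\<lambda>s w. if P s w then ennreal (cf \<beta> \<gamma> s w) else 0)
    = EI T (\<lambda>s w. if P s w then ennreal ((norm (\<beta> s w))\<^sup>2) else 0) + (\<Sum>i\<in>J. EI T (\<lambda>s w. if P s w then ennreal ((\<gamma> i s w)\<^sup>2) else 0))"
proof -
  note [measurable] = P measurable_PT_cont[OF S2_cont_adapted[OF \<beta>]]
  have gm: "(\<lambda>x. if P (fst x) (snd x) then ennreal ((\<gamma> i (fst x) (snd x))\<^sup>2) else 0) \<in> borel_measurable (PT T)" if "i \<in> J" for i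
    using measurable_PT_cont[OF S2_cont_adapted[OF \<gamma>[OF that]], of T] by measurable
  have "EI T (\<lambda>s w. if P s w then ennreal (cf \<beta> \<gamma> s w) else 0)
    = EI T (\<lambda>s w. (if P s w then ennreal ((norm (\<beta> s w))\<^sup>2) else 0) + (\<Sum>i\<in>J. if P s w then ennreal ((\<gamma> i s w)\<^sup>2) else 0))"
  proof (rule EI_cong)
    fix s w
    have "ennreal (cf \<beta> \<gamma> s w) = ennreal ((norm (\<beta> s w))\<^sup>2) + (\<Sum>i\<in>J. ennreal ((\<gamma> i s w)\<^sup>2))"
      unfolding cf_def by (subst ennreal_plus) (auto simp: sum_nonneg)
    then show "(if P s w then ennreal (cf \<beta> \<gamma> s w) else 0)
       = (if P s w then ennreal ((norm (\<beta> s w))\<^sup>2) else 0) + (\<Sum>i\<in>J. if P s w then ennreal ((\<gamma> i s w)\<^sup>2) else 0)" by simp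
  qed
  also have "\<dots> = EI T (\<lambda>s w. if P s w then ennreal ((norm (\<beta> s w))\<^sup>2) else 0) + EI T (\<lambda>s w. \<Sum>i\<in>J. if P s w then ennreal ((\<gamma> i s w)\<^sup>2) else 0)"
  proof (rule EI_add)
    show "(\<lambda>x. if P (fst x) (snd x) then ennreal ((norm (\<beta> (fst x) (snd x)))\<^sup>2) else 0) \<in> borel_measurable (PT T)"
      by measurable
    show "(\<lambda>x. \<Sum>i\<in>J. if P (fst x) (snd x) then ennreal ((\<gamma> i (fst x) (snd x))\<^sup>2) else 0) \<in> borel_measurable (PT T)"
      by (rule borel_measurable_sum) (rule gm)
  qed
  also have "EI T (\<lambda>s w. \<Sum>i\<in>J. if P s w then ennreal ((\<gamma> i s w)\<^sup>2) else 0) = (\<Sum>i\<in>J. EI T (\<lambda>s w. if P s w then ennreal ((\<gamma> i s w)\<^sup>2) else 0))"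
    by (rule EI_sum[OF gm])
  finally show ?thesis .
qed

text \<open>For the drift, survival at \<open>t\<close> implies survival at all earlier times, so
  its integrand may be cut off by the predicate path by path. For the stochastic integral this is
  impossible pathwise, and \<open>ito_killed\<close> is used.\<close>

lemma evo_killed:
  assumes \<beta>: "S2_process \<beta>" and \<gamma>: "\<And>i. i \<in> J \<Longrightarrow> S2_process (\<gamma> i)"
    and I: "\<And>i. i \<in> J \<Longrightarrow> ito (\<lambda>s w. \<gamma> i s w *\<^sub>R h i) (I i)"
    and P: "killing P" and t: "0 \<le> t"
  shows "(\<integral>\<^sup>+ w. (if P t w then ennreal ((norm (evo \<beta> I t w))\<^sup>2) else 0) \<partial>M)
    \<le> ennreal (KC * (1 + t)) * EI t (\<lambda>s w. if P s w then ennreal (cf \<beta> \<gamma> s w) else 0)"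
proof -
  note ca = S2_cont_adapted[OF \<beta>]
  note [measurable] = measurable_PT_cont[OF ca] killing_measurable_PT[OF P] cont_adapted_M[OF S2_cont_adapted[OF S2_Icc_integral(1)[OF \<beta>]] t]
  have [measurable]: "Measurable.pred M (P t)" using killing_M[OF P t] by (simp add: pred_def)
  let ?D = "\<lambda>w. LINT s:{0..t}|lborel. \<beta> s w"
  have IM: "(\<lambda>w. if P t w then ennreal ((I i t w)\<^sup>2) else 0) \<in> borel_measurable M" if "i \<in> J" for i
    using ito_M[OF I[OF that] t] by measurable
  have "(\<integral>\<^sup>+ w. (if P t w then ennreal ((norm (evo \<beta> I t w))\<^sup>2) else 0) \<partial>M)
    \<le> (\<integral>\<^sup>+ w. 2 * (if P t w then ennreal ((norm (?D w))\<^sup>2) else 0)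
        + (\<Sum>i\<in>J. 2 * ennreal (real (card J)) * (if P t w then ennreal ((I i t w)\<^sup>2) else 0)) \<partial>M)"
    by (intro nn_integral_mono) (use evo_sq_le in \<open>auto\<close>)
  also have "\<dots> = 2 * (\<integral>\<^sup>+ w. (if P t w then ennreal ((norm (?D w))\<^sup>2) else 0) \<partial>M)
        + (\<Sum>i\<in>J. 2 * ennreal (real (card J)) * (\<integral>\<^sup>+ w. (if P t w then ennreal ((I i t w)\<^sup>2) else 0) \<partial>M))"
    using IM by (subst nn_integral_add) (auto simp: nn_integral_cmult nn_integral_sum)
  also have "\<dots> \<le> ennreal (KC * (1 + t)) * (EI t (\<lambda>s w. if P s w then ennreal ((norm (\<beta> s w))\<^sup>2) else 0)
       + (\<Sum>i\<in>J. EI t (\<lambda>s w. if P s w then ennreal ((\<gamma> i s w)\<^sup>2) else 0)))"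
  proof (rule combine_bound[OF t])
    have m: "(\<lambda>x. if P (fst x) (snd x) then ennreal ((norm (\<beta> (fst x) (snd x)))\<^sup>2) else 0) \<in> borel_measurable (PT t)" by measurable
    have "(\<integral>\<^sup>+ w. (if P t w then ennreal ((norm (?D w))\<^sup>2) else 0) \<partial>M)
      \<le> (\<integral>\<^sup>+ w. ennreal t * (\<integral>\<^sup>+ s\<in>{0..t}. (if P s w then ennreal ((norm (\<beta> s w))\<^sup>2) else 0) \<partial>lborel) \<partial>M)"
    proof (rule nn_integral_mono)
      fix w assume w: "w \<in> space M"
      show "(if P t w then ennreal ((norm (?D w))\<^sup>2) else 0) \<le> ennreal t * (\<integral>\<^sup>+ s\<in>{0..t}. (if P s w then ennreal ((norm (\<beta> s w))\<^sup>2) else 0) \<partial>lborel)"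
      proof (cases "P t w")
        case True
        have "ennreal ((norm (?D w))\<^sup>2) \<le> ennreal t * (\<integral>\<^sup>+ s\<in>{0..t}. ennreal ((norm (\<beta> s w))\<^sup>2) \<partial>lborel)"
          by (rule Icc_integral_Cauchy_Schwarz[OF cont_adapted_cont_Icc[OF ca w order_refl] t])
        also have "(\<integral>\<^sup>+ s\<in>{0..t}. ennreal ((norm (\<beta> s w))\<^sup>2) \<partial>lborel) = (\<integral>\<^sup>+ s\<in>{0..t}. (if P s w then ennreal ((norm (\<beta> s w))\<^sup>2) else 0) \<partial>lborel)"
          using killing_mono[OF P _ _ True] by (intro nn_integral_cong) (auto split: split_indicator)
        finally show ?thesis using True by simp
      qed simp
    qed
    also have "\<dots> = ennreal t * EI t (\<lambda>s w. if P s w then ennreal ((norm (\<beta> s w))\<^sup>2) else 0)"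
      unfolding EI_eq_time_space[OF m] by (rule nn_integral_cmult[OF measurable_time_integral[OF m]])
    finally show "(\<integral>\<^sup>+ w. (if P t w then ennreal ((norm (?D w))\<^sup>2) else 0) \<partial>M)
      \<le> ennreal t * EI t (\<lambda>s w. if P s w then ennreal ((norm (\<beta> s w))\<^sup>2) else 0)" .
  next
    fix i assume i: "i \<in> J"
    note [measurable] = measurable_PT_cont[OF S2_cont_adapted[OF \<gamma>[OF i]]]
    \<comment> \<open>\<open>ito_killed\<close> uses the integrand without the predicate as
      dominating function, which must therefore be integrable.\<close>
    have fin: "EI t (\<lambda>s w. 4 * qf (\<gamma> i s w *\<^sub>R h i)) < \<infinity>"
    proof -
      have "EI t (\<lambda>s w. 4 * qf (\<gamma> i s w *\<^sub>R h i)) = EI t (\<lambda>s w. (4 * qf (h i)) * ennreal ((norm (\<gamma> i s w))\<^sup>2))"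
        by (rule EI_cong) (simp add: qf_real_scale mult.assoc)
      also have "\<dots> = (4 * qf (h i)) * EI t (\<lambda>s w. ennreal ((norm (\<gamma> i s w))\<^sup>2))" by (rule EI_cmult) measurable
      also have "\<dots> < \<infinity>" using EI_S2_finite[OF \<gamma>[OF i] t] by (auto simp: qf_def ennreal_mult_less_top)
      finally show ?thesis .
    qed
    have "(\<integral>\<^sup>+ w. (if P t w then ennreal ((I i t w)\<^sup>2) else 0) \<partial>M) \<le> EI t (\<lambda>s w. if P s w then 4 * qf (\<gamma> i s w *\<^sub>R h i) else 0)"
      by (rule ito_killed[OF I[OF i] P t fin])
    also have "\<dots> = EI t (\<lambda>s w. (4 * qf (h i)) * (if P s w then ennreal ((\<gamma> i s w)\<^sup>2) else 0))"
      by (rule EI_cong) (simp add: qf_real_scale mult.assoc)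
    also have "\<dots> = (4 * qf (h i)) * EI t (\<lambda>s w. if P s w then ennreal ((\<gamma> i s w)\<^sup>2) else 0)" by (rule EI_cmult) measurable
    also have "\<dots> \<le> (16 * qf (h i)) * EI t (\<lambda>s w. if P s w then ennreal ((\<gamma> i s w)\<^sup>2) else 0)"
      by (intro mult_right_mono) auto
    finally show "(\<integral>\<^sup>+ w. (if P t w then ennreal ((I i t w)\<^sup>2) else 0) \<partial>M)
      \<le> 16 * (qf (h i) * EI t (\<lambda>s w. if P s w then ennreal ((\<gamma> i s w)\<^sup>2) else 0))" by (simp only: mult.assoc)
  qed
  also have "\<dots> = ennreal (KC * (1 + t)) * EI t (\<lambda>s w. if P s w then ennreal (cf \<beta> \<gamma> s w) else 0)"
    by (subst EI_cf[OF \<beta> \<gamma> killing_measurable_PT[OF P]]) auto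
  finally show ?thesis .
qed

lemma evo_ES:
  assumes \<beta>: "S2_process \<beta>" and \<gamma>: "\<And>i. i \<in> J \<Longrightarrow> S2_process (\<gamma> i)"
    and I: "\<And>i. i \<in> J \<Longrightarrow> ito (\<lambda>s w. \<gamma> i s w *\<^sub>R h i) (I i)" and Ic: "\<And>i. i \<in> J \<Longrightarrow> cont_adapted (I i)"
    and T: "0 \<le> T"
  shows "ES (evo \<beta> I) T \<le> ennreal (KC * (1 + T)) * EI T (\<lambda>s w. ennreal (cf \<beta> \<gamma> s w))"
proof -
  let ?D = "\<lambda>t w. LINT s:{0..t}|lborel. \<beta> s w"
  note Dm = sup_sq_measurable[OF S2_cont_adapted[OF S2_Icc_integral(1)[OF \<beta>]] T]
  have Im: "(\<lambda>w. SUP t\<in>{0..T}. ennreal ((I i t w)\<^sup>2)) \<in> borel_measurable M" if "i \<in> J" for i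
    using sup_sq_measurable[OF Ic[OF that] T] by simp
  have "ES (evo \<beta> I) T \<le> (\<integral>\<^sup>+ w. 2 * (SUP t\<in>{0..T}. ennreal ((norm (?D t w))\<^sup>2))
        + (\<Sum>i\<in>J. 2 * ennreal (real (card J)) * (SUP t\<in>{0..T}. ennreal ((I i t w)\<^sup>2))) \<partial>M)"
  proof (intro nn_integral_mono SUP_least)
    fix w t assume t: "t \<in> {0..T}"
    show "ennreal ((norm (evo \<beta> I t w))\<^sup>2) \<le> 2 * (SUP t\<in>{0..T}. ennreal ((norm (?D t w))\<^sup>2))
        + (\<Sum>i\<in>J. 2 * ennreal (real (card J)) * (SUP t\<in>{0..T}. ennreal ((I i t w)\<^sup>2)))"
      by (rule order_trans[OF evo_sq_le]) (intro add_mono mult_left_mono sum_mono SUP_upper t; simp)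
  qed
  also have "\<dots> = 2 * ES ?D T + (\<Sum>i\<in>J. 2 * ennreal (real (card J)) * ES (I i) T)"
    using Dm Im by (subst nn_integral_add) (auto simp: nn_integral_cmult nn_integral_sum)
  also have "\<dots> \<le> ennreal (KC * (1 + T)) * (EI T (\<lambda>s w. ennreal ((norm (\<beta> s w))\<^sup>2)) + (\<Sum>i\<in>J. EI T (\<lambda>s w. ennreal ((\<gamma> i s w)\<^sup>2))))"
  proof (rule combine_bound[OF T S2_Icc_integral(2)[OF \<beta> T]])
    fix i assume i: "i \<in> J"
    note [measurable] = measurable_PT_cont[OF S2_cont_adapted[OF \<gamma>[OF i]]]
    have "ES (I i) T \<le> 16 * EI T (\<lambda>s w. qf (\<gamma> i s w *\<^sub>R h i))" by (rule ito_doob[OF I[OF i] Ic[OF i] T])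
    also have "EI T (\<lambda>s w. qf (\<gamma> i s w *\<^sub>R h i)) = EI T (\<lambda>s w. qf (h i) * ennreal ((\<gamma> i s w)\<^sup>2))"
      by (simp only: qf_real_scale)
    also have "\<dots> = qf (h i) * EI T (\<lambda>s w. ennreal ((\<gamma> i s w)\<^sup>2))" by (rule EI_cmult) measurable
    finally show "ES (I i) T \<le> 16 * (qf (h i) * EI T (\<lambda>s w. ennreal ((\<gamma> i s w)\<^sup>2)))" .
  qed
  also have "\<dots> = ennreal (KC * (1 + T)) * EI T (\<lambda>s w. ennreal (cf \<beta> \<gamma> s w))"
    using EI_cf[OF \<beta> \<gamma>, where P = "\<lambda>_ _. True" and T = T] by simp
  finally show ?thesis .
qed

lemma evo_S2:
  assumes \<beta>: "S2_process \<beta>" and I: "\<And>i. i \<in> J \<Longrightarrow> S2_process (I i)"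
  shows "S2_process (evo \<beta> I)"
  unfolding evo_def[abs_def] by (intro S2_add S2_Icc_integral(1)[OF \<beta>] S2_sum S2_scaleR_left I)

lemma evo_diff:
  assumes \<beta>: "S2_process \<beta>" "S2_process \<beta>'" and w: "w \<in> space M"
  shows "evo \<beta> I t w - evo \<beta>' I' t w = evo (\<lambda>s w. \<beta> s w - \<beta>' s w) (\<lambda>i t w. I i t w - I' i t w) t w"
proof -
  have "set_integrable lborel {0..t} (\<lambda>s. \<beta> s w)" "set_integrable lborel {0..t} (\<lambda>s. \<beta>' s w)"
    by (intro borel_integrable_atLeastAtMost' cont_adapted_cont_Icc[OF S2_cont_adapted w] \<beta>; simp)+
  then show ?thesis
    by (simp add: evo_def set_integral_diff scaleR_diff_left sum_subtractf)
qed

lemma ito_diff_dir: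
  assumes "ito (\<lambda>s w. \<gamma> s w *\<^sub>R k) I" "ito (\<lambda>s w. \<gamma>' s w *\<^sub>R k) I'"
  shows "ito (\<lambda>s w. (\<gamma> s w - \<gamma>' s w) *\<^sub>R k) (\<lambda>t w. I t w - I' t w)"
  using ito_diff[OF assms] by (simp add: scaleR_diff_left)

lemma ES_zero_AE:
  assumes X: "cont_adapted X" and 0: "\<And>T. 0 \<le> T \<Longrightarrow> ES X T = 0"
  shows "AE w in M. \<forall>t\<ge>0. X t w = 0"
proof -
  have "AE w in M. (SUP t\<in>{0..real n}. ennreal ((norm (X t w))\<^sup>2)) = 0" for n
    using 0[of "real n"] by (subst nn_integral_0_iff_AE[OF sup_sq_measurable[OF X], symmetric]) auto
  then have "AE w in M. \<forall>n::nat. (SUP t\<in>{0..real n}. ennreal ((norm (X t w))\<^sup>2)) = 0" by (simp add: AE_all_countable)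
  then show ?thesis
  proof eventually_elim
    fix w assume *: "\<forall>n::nat. (SUP t\<in>{0..real n}. ennreal ((norm (X t w))\<^sup>2)) = 0"
    show "\<forall>t\<ge>0. X t w = 0"
    proof (intro allI impI)
      fix t :: real assume "0 \<le> t"
      obtain n :: nat where "t \<le> real n" using real_arch_simple by blast
      then have "ennreal ((norm (X t w))\<^sup>2) \<le> (SUP t\<in>{0..real n}. ennreal ((norm (X t w))\<^sup>2))"
        using \<open>0 \<le> t\<close> by (intro SUP_upper) auto
      then show "X t w = 0" using * by simp
    qed
  qed
qed

text \<open>Approximation from below, so that a path alive at \<open>t\<close> is alive at the
  approximating times.\<close>

lemma rational_approx:
  fixes t :: real assumes "0 \<le> t"
  obtains r :: "nat \<Rightarrow> nat" where "\<And>n. real (r n) / real (Suc n) \<le> t" "(\<lambda>n. real (r n) / real (Suc n)) \<longlonglongrightarrow> t"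
proof
  let ?r = "\<lambda>n. nat \<lfloor>real (Suc n) * t\<rfloor>"
  have r: "real (?r n) = real_of_int \<lfloor>real (Suc n) * t\<rfloor>" for n using assms by (intro of_nat_nat) auto
  have 1: "real (?r n) \<le> real (Suc n) * t" "real (Suc n) * t \<le> real (?r n) + 1" for n unfolding r by linarith+
  have "real (?r n) / real (Suc n) \<le> (real (Suc n) * t) / real (Suc n)" for n by (intro divide_right_mono 1) auto
  then show le: "real (?r n) / real (Suc n) \<le> t" for n by simp
  have "(real (Suc n) * t) / real (Suc n) \<le> (real (?r n) + 1) / real (Suc n)" for n by (intro divide_right_mono 1) auto
  then have ge: "t \<le> real (?r n) / real (Suc n) + inverse (real (Suc n))" for n by (simp add: add_divide_distrib inverse_eq_divide)
  show "(\<lambda>n. real (?r n) / real (Suc n)) \<longlonglongrightarrow> t"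
  proof (rule LIM_zero_cancel, rule Lim_null_comparison[OF _ LIMSEQ_inverse_real_of_nat])
    have "norm (real (?r n) / real (Suc n) - t) \<le> inverse (real (Suc n))" for n
      using le[of n] ge[of n] unfolding real_norm_def by linarith
    then show "\<forall>\<^sub>F n in sequentially. norm (real (?r n) / real (Suc n) - t) \<le> inverse (real (Suc n))" by simp
  qed
qed

text \<open>Gronwall's inequality for the second moment of the difference on the surviving event.
  The coefficients are arbitrary processes compared only while \<open>P\<close> holds; this makes it
  possible to compare solutions of different equations that coincide on a ball, and with
  \<open>L = 0\<close> to identify a process with the right-hand side of its equation.\<close>

lemma evo_unique:
  assumes X: "S2_process X" "S2_process X'" and \<beta>: "S2_process \<beta>" "S2_process \<beta>'"
    and \<gamma>: "\<And>i. i \<in> J \<Longrightarrow> S2_process (\<gamma> i)" "\<And>i. i \<in> J \<Longrightarrow> S2_process (\<gamma>' i)"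
    and I: "\<And>i. i \<in> J \<Longrightarrow> ito (\<lambda>s w. \<gamma> i s w *\<^sub>R h i) (I i)" "\<And>i. i \<in> J \<Longrightarrow> ito (\<lambda>s w. \<gamma>' i s w *\<^sub>R h i) (I' i)"
    and eq: "AE w in M. \<forall>t\<ge>0. X t w = x0 + evo \<beta> I t w" "AE w in M. \<forall>t\<ge>0. X' t w = x0 + evo \<beta>' I' t w"
    and P: "killing P" and L: "0 \<le> L"
    and lip: "\<And>s w. 0 \<le> s \<Longrightarrow> w \<in> space M \<Longrightarrow> P s w \<Longrightarrow>
       cf (\<lambda>s w. \<beta> s w - \<beta>' s w) (\<lambda>i s w. \<gamma> i s w - \<gamma>' i s w) s w \<le> L * (norm (X s w - X' s w))\<^sup>2"
  shows "AE w in M. \<forall>t\<ge>0. P t w \<longrightarrow> X t w = X' t w"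
proof -
  define Y where "Y t w = X t w - X' t w" for t w
  have Y: "S2_process Y" unfolding Y_def by (rule S2_diff[OF X])
  note Yc = S2_cont_adapted[OF Y]
  note [measurable] = killing_measurable_PT[OF P] measurable_PT_cont[OF Yc]
  have YE: "AE w in M. \<forall>t\<ge>0. Y t w = evo (\<lambda>s w. \<beta> s w - \<beta>' s w) (\<lambda>i t w. I i t w - I' i t w) t w"
    using eq AE_space by eventually_elim (simp add: Y_def flip: evo_diff[OF \<beta>])
  define v where "v t = (\<integral>\<^sup>+ w. (if P t w then ennreal ((norm (Y t w))\<^sup>2) else 0) \<partial>M)" for t
  \<comment> \<open>\<open>L + 1\<close> keeps the Gronwall constant positive when
    \<open>L = 0\<close>.\<close>
  have est: "v t \<le> ennreal (KC * (1 + T) * (L + 1)) * (\<integral>\<^sup>+ s\<in>{0..t}. v s \<partial>lborel)" if t: "t \<in> {0..T}" for t T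
  proof -
    have t0: "0 \<le> t" using t by simp
    have "v t = (\<integral>\<^sup>+ w. (if P t w then ennreal ((norm (evo (\<lambda>s w. \<beta> s w - \<beta>' s w) (\<lambda>i t w. I i t w - I' i t w) t w))\<^sup>2) else 0) \<partial>M)"
      unfolding v_def using YE by (intro nn_integral_cong_AE) (auto elim!: eventually_mono simp: t0)
    also have "\<dots> \<le> ennreal (KC * (1 + t)) * EI t (\<lambda>s w. if P s w then ennreal (cf (\<lambda>s w. \<beta> s w - \<beta>' s w) (\<lambda>i s w. \<gamma> i s w - \<gamma>' i s w) s w) else 0)"
      by (rule evo_killed[OF S2_diff[OF \<beta>] S2_diff[OF \<gamma>] ito_diff_dir[OF I] P t0])
    also have "EI t (\<lambda>s w. if P s w then ennreal (cf (\<lambda>s w. \<beta> s w - \<beta>' s w) (\<lambda>i s w. \<gamma> i s w - \<gamma>' i s w) s w) else 0)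
      \<le> EI t (\<lambda>s w. ennreal (L + 1) * (if P s w then ennreal ((norm (Y s w))\<^sup>2) else 0))"
    proof (rule EI_mono)
      fix s w assume "s \<in> {0..t}" "w \<in> space M"
      then have "ennreal (cf (\<lambda>s w. \<beta> s w - \<beta>' s w) (\<lambda>i s w. \<gamma> i s w - \<gamma>' i s w) s w) \<le> ennreal ((L + 1) * (norm (Y s w))\<^sup>2)" if "P s w"
        using lip[of s w] that by (intro ennreal_leI) (auto simp: Y_def distrib_right intro: order_trans)
      then show "(if P s w then ennreal (cf (\<lambda>s w. \<beta> s w - \<beta>' s w) (\<lambda>i s w. \<gamma> i s w - \<gamma>' i s w) s w) else 0)
        \<le> ennreal (L + 1) * (if P s w then ennreal ((norm (Y s w))\<^sup>2) else 0)"
        using L by (auto simp: ennreal_mult)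
    qed
    also have "\<dots> = ennreal (L + 1) * EI t (\<lambda>s w. if P s w then ennreal ((norm (Y s w))\<^sup>2) else 0)"
      by (rule EI_cmult) measurable
    also have "EI t (\<lambda>s w. if P s w then ennreal ((norm (Y s w))\<^sup>2) else 0) = (\<integral>\<^sup>+ s\<in>{0..t}. v s \<partial>lborel)"
      unfolding v_def by (rule EI_eq_space_time) measurable
    also have "ennreal (KC * (1 + t)) * (ennreal (L + 1) * (\<integral>\<^sup>+ s\<in>{0..t}. v s \<partial>lborel)) = ennreal (KC * (1 + t) * (L + 1)) * (\<integral>\<^sup>+ s\<in>{0..t}. v s \<partial>lborel)"
      using KC_ge t L by (simp add: ennreal_mult mult.assoc)
    also have "\<dots> \<le> ennreal (KC * (1 + T) * (L + 1)) * (\<integral>\<^sup>+ s\<in>{0..t}. v s \<partial>lborel)"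
      using KC_ge t L by (intro mult_right_mono ennreal_leI) auto
    finally show ?thesis by (simp add: mult_left_mono)
  qed
  have v0: "v t = 0" if t: "0 \<le> t" for t
  proof -
    have vb: "v s \<le> ES Y t" if "s \<in> {0..t}" for s
    proof -
      have "v s \<le> (\<integral>\<^sup>+ w. ennreal ((norm (Y s w))\<^sup>2) \<partial>M)" unfolding v_def by (intro nn_integral_mono) auto
      also have "\<dots> \<le> ES Y t" using that by (intro E_le_ES) auto
      finally show ?thesis .
    qed
    have B: "ES Y t = ennreal (enn2real (ES Y t))" using S2_ES[OF Y t] by auto
    have "v t \<le> ennreal (2 * 0 * exp (2 * (KC * (1 + t) * (L + 1)) * t))"
    proof (rule gronwall_ennreal[where T = t and B = "enn2real (ES Y t)"])
      show "v s \<le> ennreal 0 + ennreal (KC * (1 + t) * (L + 1)) * (\<integral>\<^sup>+ r\<in>{0..s}. v r \<partial>lborel)" if "s \<in> {0..t}" for s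
        using est[OF that] by simp
      show "v s \<le> ennreal (enn2real (ES Y t))" if "s \<in> {0..t}" for s
        using vb[OF that] B by simp
      show "0 < KC * (1 + t) * (L + 1)" using KC_ge t L by (intro mult_pos_pos) auto
    qed (use t in auto)
    then show ?thesis by simp
  qed
  have pt: "AE w in M. P t w \<longrightarrow> Y t w = 0" if t: "0 \<le> t" for t
  proof -
    have [measurable]: "Measurable.pred M (P t)" using killing_M[OF P t] by (simp add: pred_def)
    note [measurable] = cont_adapted_M[OF Yc t]
    have "AE w in M. (if P t w then ennreal ((norm (Y t w))\<^sup>2) else 0) = 0"
      using v0[OF t] unfolding v_def by (subst (asm) nn_integral_0_iff_AE) measurable
    then show ?thesis by eventually_elim (auto split: if_splits)
  qed
  \<comment> \<open>The null set may depend on the time, so countably many times come first;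
    continuity then gives all of them.\<close>
  have "AE w in M. \<forall>a b. P (real a / real (Suc b)) w \<longrightarrow> Y (real a / real (Suc b)) w = 0"
    unfolding AE_all_countable by (intro allI pt) auto
  then show ?thesis
    using AE_space
  proof eventually_elim
    fix w assume *: "\<forall>a b. P (real a / real (Suc b)) w \<longrightarrow> Y (real a / real (Suc b)) w = 0" and w: "w \<in> space M"
    show "\<forall>t\<ge>0. P t w \<longrightarrow> X t w = X' t w"
    proof (intro allI impI)
      fix t :: real assume t: "0 \<le> t" and Pt: "P t w"
      obtain r :: "nat \<Rightarrow> nat" where r: "\<And>n. real (r n) / real (Suc n) \<le> t" "(\<lambda>n. real (r n) / real (Suc n)) \<longlonglongrightarrow> t"
        using rational_approx[OF t] by blast
      have "(\<lambda>n. Y (real (r n) / real (Suc n)) w) \<longlonglongrightarrow> Y t w"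
        by (rule continuous_on_tendsto_compose[OF cont_adapted_cont[OF Yc w] r(2)]) (use t in auto)
      moreover have "Y (real (r n) / real (Suc n)) w = 0" for n
        using * killing_mono[OF P _ r(1) Pt] by simp
      ultimately have "Y t w = 0" by (simp add: LIMSEQ_const_iff)
      then show "X t w = X' t w" by (simp add: Y_def)
    qed
  qed
qed


section \<open>Picard iteration for Lipschitz coefficients\<close>

definition coeff_I :: "('i \<Rightarrow> 'a \<Rightarrow> real) \<Rightarrow> (real \<Rightarrow> 'w \<Rightarrow> 'a) \<Rightarrow> 'i \<Rightarrow> real \<Rightarrow> 'w \<Rightarrow> real" where
  "coeff_I g X i = Ito (\<lambda>s w. g i (X s w)) (h i)"

text \<open>The integrals are the fixed versions \<open>coeff_I\<close>, so the equation involves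
  real integrals only. Strong solutions, which bring their own integral process, are related to it
  later.\<close>

definition solves :: "('a \<Rightarrow> 'a) \<Rightarrow> ('i \<Rightarrow> 'a \<Rightarrow> real) \<Rightarrow> 'a \<Rightarrow> (real \<Rightarrow> 'w \<Rightarrow> 'a) \<Rightarrow> bool" where
  "solves b g x0 X \<longleftrightarrow> S2_process X \<and> (AE w in M. \<forall>t\<ge>0. X t w = x0 + evo (\<lambda>s w. b (X s w)) (coeff_I g X) t w)"

definition Lip :: "real \<Rightarrow> ('a \<Rightarrow> 'a) \<Rightarrow> ('i \<Rightarrow> 'a \<Rightarrow> real) \<Rightarrow> bool" where
  "Lip L b g \<longleftrightarrow> (\<forall>x y. norm (b x - b y) \<le> L * norm (x - y)) \<and> (\<forall>i\<in>J. \<forall>x y. \<bar>g i x - g i y\<bar> \<le> L * norm (x - y))"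

text \<open>Just enough for the coefficients along a path to be integrands again. It holds for the
  truncated coefficients and also for the original ones, which need not be globally
  Lipschitz.\<close>

definition regular :: "('a \<Rightarrow> 'a) \<Rightarrow> ('i \<Rightarrow> 'a \<Rightarrow> real) \<Rightarrow> bool" where
  "regular b g \<longleftrightarrow> continuous_on UNIV b \<and> (\<forall>i\<in>J. continuous_on UNIV (g i)) \<and>
     (\<exists>G\<ge>0. \<forall>x. norm (b x) \<le> G * (1 + norm x) \<and> (\<forall>i\<in>J. \<bar>g i x\<bar> \<le> G * (1 + norm x)))"

lemma regular_S2:
  assumes "regular b g" and X: "S2_process X"
  shows "S2_process (\<lambda>s w. b (X s w))" "i \<in> J \<Longrightarrow> S2_process (\<lambda>s w. g i (X s w))"
proof -
  obtain G where G: "0 \<le> G" "\<And>x. norm (b x) \<le> G * (1 + norm x)" "\<And>x i. i \<in> J \<Longrightarrow> \<bar>g i x\<bar> \<le> G * (1 + norm x)"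
    using assms(1) unfolding regular_def by blast
  show "S2_process (\<lambda>s w. b (X s w))"
    by (rule S2_compose[OF X _ G(1,2)]) (use assms(1) in \<open>simp add: regular_def\<close>)
  show "S2_process (\<lambda>s w. g i (X s w))" if "i \<in> J"
    by (rule S2_compose[OF X _ G(1)]) (use assms(1) G(3) that in \<open>auto simp: regular_def\<close>)
qed

lemma Lip_regular:
  assumes L: "0 \<le> L" "Lip L b g"
  shows "regular b g"
proof -
  have c: "continuous_on UNIV b" "\<And>i. i \<in> J \<Longrightarrow> continuous_on UNIV (g i)"
    using L by (auto intro!: lipschitz_on_continuous_on[of L] lipschitz_onI simp: Lip_def dist_norm)
  define G where "G = L + norm (b 0) + (\<Sum>i\<in>J. \<bar>g i 0\<bar>)"
  have s0: "0 \<le> (\<Sum>i\<in>J. \<bar>g i 0\<bar>)" by (simp add: sum_nonneg)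
  have G: "0 \<le> G" using L s0 by (simp add: G_def)
  have le: "y \<le> G * (1 + norm x)" if "y \<le> z + L * norm x" "z \<le> norm (b 0) + (\<Sum>i\<in>J. \<bar>g i 0\<bar>)" for y z and x :: 'a
  proof -
    have "y \<le> (norm (b 0) + (\<Sum>i\<in>J. \<bar>g i 0\<bar>)) + L * norm x" using that by linarith
    also have "\<dots> \<le> G * 1 + G * norm x"
      using L s0 by (intro add_mono mult_right_mono) (auto simp: G_def)
    finally show ?thesis by (simp add: distrib_left)
  qed
  have "norm (b x) \<le> G * (1 + norm x)" for x
  proof (rule le)
    show "norm (b x) \<le> norm (b 0) + L * norm x"
      using L(2) norm_triangle_sub[of "b x" "b 0"] unfolding Lip_def by (smt (verit) diff_zero)
  qed (use s0 in simp)
  moreover have "\<bar>g i x\<bar> \<le> G * (1 + norm x)" if i: "i \<in> J" for i x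
  proof (rule le)
    have "\<bar>g i x - g i 0\<bar> \<le> L * norm x" using L(2) i unfolding Lip_def by (metis diff_zero)
    then show "\<bar>g i x\<bar> \<le> \<bar>g i 0\<bar> + L * norm x" by linarith
    have "\<bar>g i 0\<bar> \<le> (\<Sum>i\<in>J. \<bar>g i 0\<bar>)" by (rule member_le_sum[OF i _ J]) auto
    then show "\<bar>g i 0\<bar> \<le> norm (b 0) + (\<Sum>i\<in>J. \<bar>g i 0\<bar>)" by (simp add: add_increasing)
  qed
  ultimately show ?thesis unfolding regular_def using c G by blast
qed

lemma coeff_I:
  assumes "regular b g" "S2_process X" "i \<in> J"
  shows "S2_process (coeff_I g X i)" "ito (\<lambda>s w. g i (X s w) *\<^sub>R h i) (coeff_I g X i)"
  unfolding coeff_I_def using Ito[OF regular_S2(2)[OF assms]] by auto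

lemma evo_coeff_S2:
  assumes "regular b g" "S2_process X"
  shows "S2_process (\<lambda>t w. x0 + evo (\<lambda>s w. b (X s w)) (coeff_I g X) t w)"
  by (intro S2_add S2_const evo_S2 regular_S2(1)[OF assms] coeff_I(1)[OF assms])

lemma cf_le:
  assumes L: "0 \<le> L" "norm x \<le> L * z" "\<And>i. i \<in> J \<Longrightarrow> \<bar>y i\<bar> \<le> L * z"
  shows "(norm x)\<^sup>2 + (\<Sum>i\<in>J. (y i)\<^sup>2) \<le> L\<^sup>2 * (1 + real (card J)) * z\<^sup>2"
proof -
  have 1: "(norm x)\<^sup>2 \<le> (L * z)\<^sup>2" by (intro power_mono L) auto
  have "(y i)\<^sup>2 \<le> (L * z)\<^sup>2" if "i \<in> J" for i
    using L(3)[OF that] by (simp add: abs_le_square_iff[symmetric])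
  then have "(\<Sum>i\<in>J. (y i)\<^sup>2) \<le> (\<Sum>i\<in>J. (L * z)\<^sup>2)" by (rule sum_mono)
  with 1 have "(norm x)\<^sup>2 + (\<Sum>i\<in>J. (y i)\<^sup>2) \<le> (L * z)\<^sup>2 + real (card J) * (L * z)\<^sup>2" by simp
  also have "\<dots> = L\<^sup>2 * (1 + real (card J)) * z\<^sup>2" by (simp add: power_mult_distrib algebra_simps)
  finally show ?thesis .
qed

lemma picard_estimate:
  assumes L: "0 \<le> L" "Lip L b g" and X: "S2_process X" "S2_process Y" and T: "0 \<le> T"
  shows "ES (\<lambda>t w. (x0 + evo (\<lambda>s w. b (X s w)) (coeff_I g X) t w) - (x0 + evo (\<lambda>s w. b (Y s w)) (coeff_I g Y) t w)) T
    \<le> ennreal (KC * (1 + T) * (L\<^sup>2 * (1 + real (card J)) + 1)) * EI T (\<lambda>s w. ennreal ((norm (X s w - Y s w))\<^sup>2))"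
proof -
  note r = Lip_regular[OF L]
  define A where "A = L\<^sup>2 * (1 + real (card J)) + 1"
  have A: "0 \<le> A" by (simp add: A_def)
  let ?\<beta> = "\<lambda>s w. b (X s w) - b (Y s w)"
  let ?\<gamma> = "\<lambda>i s w. g i (X s w) - g i (Y s w)"
  let ?I = "\<lambda>i t w. coeff_I g X i t w - coeff_I g Y i t w"
  note [measurable] = measurable_PT_cont[OF S2_cont_adapted[OF X(1)]] measurable_PT_cont[OF S2_cont_adapted[OF X(2)]]
  have "ES (\<lambda>t w. (x0 + evo (\<lambda>s w. b (X s w)) (coeff_I g X) t w) - (x0 + evo (\<lambda>s w. b (Y s w)) (coeff_I g Y) t w)) T
     = ES (evo ?\<beta> ?I) T"
    using evo_diff[OF regular_S2(1)[OF r X(1)] regular_S2(1)[OF r X(2)]] by (intro nn_integral_cong) simp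
  also have "\<dots> \<le> ennreal (KC * (1 + T)) * EI T (\<lambda>s w. ennreal (cf ?\<beta> ?\<gamma> s w))"
    by (rule evo_ES[OF S2_diff S2_diff ito_diff_dir cont_adapted_diff T])
       (auto intro!: regular_S2[OF r] X coeff_I[OF r] S2_cont_adapted)
  also have "EI T (\<lambda>s w. ennreal (cf ?\<beta> ?\<gamma> s w)) \<le> EI T (\<lambda>s w. ennreal A * ennreal ((norm (X s w - Y s w))\<^sup>2))"
  proof (rule EI_mono)
    fix s w
    have "cf ?\<beta> ?\<gamma> s w \<le> L\<^sup>2 * (1 + real (card J)) * (norm (X s w - Y s w))\<^sup>2"
      unfolding cf_def by (rule cf_le[OF L(1)]) (use L(2) in \<open>auto simp: Lip_def\<close>)
    also have "\<dots> \<le> A * (norm (X s w - Y s w))\<^sup>2" unfolding A_def by (intro mult_right_mono) auto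
    finally have "ennreal (cf ?\<beta> ?\<gamma> s w) \<le> ennreal (A * (norm (X s w - Y s w))\<^sup>2)" by (rule ennreal_leI)
    then show "ennreal (cf ?\<beta> ?\<gamma> s w) \<le> ennreal A * ennreal ((norm (X s w - Y s w))\<^sup>2)"
      using A by (simp add: ennreal_mult)
  qed
  also have "\<dots> = ennreal A * EI T (\<lambda>s w. ennreal ((norm (X s w - Y s w))\<^sup>2))" by (rule EI_cmult) measurable
  finally show ?thesis
    using A KC_ge T unfolding A_def[symmetric] by (simp add: ennreal_mult mult_left_mono mult.assoc)
qed

text \<open>Measured against \<open>exp (\<beta> * t)\<close>, one Picard step gains the factor
  \<open>Kp T / \<beta>\<close>. The choice \<open>\<beta> = 64 * Kp T\<close> yields exactly the
  rate required by \<open>S2_complete\<close>.\<close>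

lemma lipschitz_solution:
  assumes L: "0 \<le> L" "Lip L b g"
  shows "\<exists>X. solves b g x0 X"
proof -
  note r = Lip_regular[OF L]
  define \<Phi> where "\<Phi> X t w = x0 + evo (\<lambda>s w. b (X s w)) (coeff_I g X) t w" for X t w
  have \<Phi>: "S2_process (\<Phi> X)" if "S2_process X" for X unfolding \<Phi>_def[abs_def] by (rule evo_coeff_S2[OF r that])
  define X where "X n = (\<Phi> ^^ n) (\<lambda>t w. x0)" for n
  have XS: "S2_process (X n)" for n unfolding X_def by (induction n) (auto intro: \<Phi>)
  have Xn: "X (Suc n) = \<Phi> (X n)" for n by (simp add: X_def)
  define Kp where "Kp T = KC * (1 + T) * (L\<^sup>2 * (1 + real (card J)) + 1)" for T
  have Kp: "Kp T > 0" if "0 \<le> T" for T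
    unfolding Kp_def using KC_ge that by (intro mult_pos_pos add_pos_nonneg[of 1] add_nonneg_pos[of _ 1]) auto
  have Kp_mono: "Kp t \<le> Kp T" if "0 \<le> t" "t \<le> T" for t T
    unfolding Kp_def using KC_ge that by (intro mult_right_mono mult_left_mono) auto
  have est: "ES (\<lambda>t w. \<Phi> X t w - \<Phi> Y t w) T \<le> ennreal (Kp T) * EI T (\<lambda>s w. ennreal ((norm (X s w - Y s w))\<^sup>2))"
    if "S2_process X" "S2_process Y" "0 \<le> T" for X Y T
    unfolding \<Phi>_def Kp_def by (rule picard_estimate[OF L that])
  have fast: "\<exists>A\<ge>0. \<forall>n. ES (\<lambda>t w. X (Suc n) t w - X n t w) T \<le> ennreal (A / 64^n)" if T: "0 \<le> T" for T
  proof -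
    define \<beta> where "\<beta> = 64 * Kp T"
    have \<beta>: "\<beta> > 0" using Kp[OF T] by (simp add: \<beta>_def)
    define B where "B = enn2real (ES (\<lambda>t w. X (Suc 0) t w - X 0 t w) T)"
    have B: "ES (\<lambda>t w. X (Suc 0) t w - X 0 t w) T = ennreal B" "0 \<le> B"
      using S2_ES[OF S2_diff[OF XS XS] T, of "Suc 0" 0] unfolding B_def by auto
    have it: "ES (\<lambda>t w. X (Suc n) t w - X n t w) t \<le> ennreal (B / 64^n * exp (\<beta> * t))" if "t \<in> {0..T}" for n t
      using that
    proof (induction n arbitrary: t)
      case 0
      have "ES (\<lambda>t w. X (Suc 0) t w - X 0 t w) t \<le> ES (\<lambda>t w. X (Suc 0) t w - X 0 t w) T"
        using 0 by (intro nn_integral_mono SUP_subset_mono) auto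
      also have "\<dots> \<le> ennreal (B * exp (\<beta> * t))"
        unfolding B(1) using B(2) \<beta> 0 by (intro ennreal_leI) (simp add: mult_le_cancel_left1)
      finally show ?case by simp
    next
      case (Suc n)
      have t: "0 \<le> t" using Suc.prems by simp
      note [measurable] = measurable_PT_cont[OF S2_cont_adapted[OF XS]]
      have "ES (\<lambda>t w. X (Suc (Suc n)) t w - X (Suc n) t w) t \<le> ennreal (Kp t) * EI t (\<lambda>s w. ennreal ((norm (X (Suc n) s w - X n s w))\<^sup>2))"
        using est[OF XS XS t, of "Suc n" n] by (simp only: Xn)
      also have "EI t (\<lambda>s w. ennreal ((norm (X (Suc n) s w - X n s w))\<^sup>2))
        = (\<integral>\<^sup>+ s\<in>{0..t}. (\<integral>\<^sup>+ w. ennreal ((norm (X (Suc n) s w - X n s w))\<^sup>2) \<partial>M) \<partial>lborel)"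
        by (rule EI_eq_space_time) measurable
      also have "\<dots> \<le> (\<integral>\<^sup>+ s\<in>{0..t}. ennreal (B / 64^n) * ennreal (exp (\<beta> * s)) \<partial>lborel)"
      proof (rule nn_integral_mono)
        fix s
        have "(\<integral>\<^sup>+ w. ennreal ((norm (X (Suc n) s w - X n s w))\<^sup>2) \<partial>M) \<le> ennreal (B / 64^n) * ennreal (exp (\<beta> * s))" if s: "s \<in> {0..t}"
        proof -
          have "(\<integral>\<^sup>+ w. ennreal ((norm (X (Suc n) s w - X n s w))\<^sup>2) \<partial>M) \<le> ES (\<lambda>t w. X (Suc n) t w - X n t w) s"
            using s by (intro E_le_ES[of s s "\<lambda>t w. X (Suc n) t w - X n t w"]) auto
          also have "\<dots> \<le> ennreal (B / 64^n * exp (\<beta> * s))" by (rule Suc.IH) (use s Suc.prems in auto)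
          also have "\<dots> = ennreal (B / 64^n) * ennreal (exp (\<beta> * s))" using B(2) by (intro ennreal_mult) auto
          finally show ?thesis .
        qed
        then show "(\<integral>\<^sup>+ w. ennreal ((norm (X (Suc n) s w - X n s w))\<^sup>2) \<partial>M) * indicator {0..t} s \<le> ennreal (B / 64^n) * ennreal (exp (\<beta> * s)) * indicator {0..t} s"
          by (auto split: split_indicator)
      qed
      also have "\<dots> = ennreal (B / 64^n) * (\<integral>\<^sup>+ s\<in>{0..t}. ennreal (exp (\<beta> * s)) \<partial>lborel)"
        by (simp add: mult.assoc nn_integral_cmult)
      also have "\<dots> \<le> ennreal (B / 64^n) * ennreal (exp (\<beta> * t) / \<beta>)"
        by (intro mult_left_mono nn_integral_exp_le[OF \<beta> t]) auto
      finally have "ES (\<lambda>t w. X (Suc (Suc n)) t w - X (Suc n) t w) t \<le> ennreal (Kp t) * (ennreal (B / 64^n) * ennreal (exp (\<beta> * t) / \<beta>))"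
        by (simp add: mult_left_mono)
      also have "\<dots> \<le> ennreal (Kp T) * (ennreal (B / 64^n) * ennreal (exp (\<beta> * t) / \<beta>))"
        using Suc.prems by (intro mult_right_mono ennreal_leI Kp_mono) auto
      also have "\<dots> = ennreal (Kp T * (B / 64^n * (exp (\<beta> * t) / \<beta>)))"
      proof -
        have "0 \<le> B / 64^n * (exp (\<beta> * t) / \<beta>)" using B \<beta> by (intro mult_nonneg_nonneg) auto
        then show ?thesis
          using ennreal_mult[of "Kp T" "B / 64^n * (exp (\<beta> * t) / \<beta>)"] ennreal_mult[of "B / 64^n" "exp (\<beta> * t) / \<beta>"] B \<beta> Kp[OF T] by simp
      qed
      also have "Kp T * (B / 64^n * (exp (\<beta> * t) / \<beta>)) = B / 64^Suc n * exp (\<beta> * t)"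
        using Kp[OF T] by (simp add: \<beta>_def field_simps)
      finally show ?case .
    qed
    show ?thesis
    proof (intro exI[of _ "B * exp (\<beta> * T)"] conjI allI)
      fix n
      show "ES (\<lambda>t w. X (Suc n) t w - X n t w) T \<le> ennreal (B * exp (\<beta> * T) / 64^n)"
        using it[of T n] T by simp
    qed (use B in simp)
  qed
  obtain Y where Y: "S2_process Y" "\<And>T. 0 \<le> T \<Longrightarrow> (\<lambda>n. ES (\<lambda>t w. X n t w - Y t w) T) \<longlonglongrightarrow> 0"
    using S2_complete[OF XS fast] by blast
  \<comment> \<open>Insert \<open>X (Suc n) = \<Phi> (X n)\<close> between the limit and its image;
    both distances tend to zero.\<close>
  have "ES (\<lambda>t w. Y t w - \<Phi> Y t w) T = 0" if T: "0 \<le> T" for T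
  proof -
    have lim: "(\<lambda>n. 2 * ES (\<lambda>t w. X (Suc n) t w - Y t w) T + ennreal (2 * Kp T * T) * ES (\<lambda>t w. X n t w - Y t w) T) \<longlonglongrightarrow> 0"
      by (rule ennreal_tendsto_add_0[OF LIMSEQ_Suc[OF Y(2)[OF T]] Y(2)[OF T]]) auto
    have "ES (\<lambda>t w. Y t w - \<Phi> Y t w) T \<le> 2 * ES (\<lambda>t w. X (Suc n) t w - Y t w) T + ennreal (2 * Kp T * T) * ES (\<lambda>t w. X n t w - Y t w) T" for n
    proof -
      have "ES (\<lambda>t w. Y t w - \<Phi> Y t w) T \<le> ennreal 0 + ennreal 2 * ES (\<lambda>t w. X (Suc n) t w - Y t w) T + ennreal 2 * ES (\<lambda>t w. X (Suc n) t w - \<Phi> Y t w) T"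
      proof (rule ES_mono_le[OF _ _ T])
        have "(norm (Y t w - \<Phi> Y t w))\<^sup>2 \<le> 2 * (norm (X (Suc n) t w - Y t w))\<^sup>2 + 2 * (norm (X (Suc n) t w - \<Phi> Y t w))\<^sup>2" for t w
          using power2_norm_add_le[of "- (X (Suc n) t w - Y t w)" "X (Suc n) t w - \<Phi> Y t w"] unfolding norm_minus_cancel by simp
        then show "AE w in M. \<forall>t\<in>{0..T}. (norm (Y t w - \<Phi> Y t w))\<^sup>2 \<le> 0 + 2 * (norm (X (Suc n) t w - Y t w))\<^sup>2 + 2 * (norm (X (Suc n) t w - \<Phi> Y t w))\<^sup>2"
          by simp
      qed (auto intro!: S2_cont_adapted S2_diff XS Y(1) \<Phi>)
      also have "ES (\<lambda>t w. X (Suc n) t w - \<Phi> Y t w) T \<le> ennreal (Kp T) * EI T (\<lambda>s w. ennreal ((norm (X n s w - Y s w))\<^sup>2))"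
        unfolding Xn by (rule est[OF XS Y(1) T])
      also have "EI T (\<lambda>s w. ennreal ((norm (X n s w - Y s w))\<^sup>2)) \<le> ennreal T * ES (\<lambda>t w. X n t w - Y t w) T"
        by (rule EI_le_ES[OF S2_cont_adapted[OF S2_diff[OF XS Y(1)]] T])
      also have "ennreal 0 + ennreal 2 * ES (\<lambda>t w. X (Suc n) t w - Y t w) T + ennreal 2 * (ennreal (Kp T) * (ennreal T * ES (\<lambda>t w. X n t w - Y t w) T))
        = 2 * ES (\<lambda>t w. X (Suc n) t w - Y t w) T + ennreal (2 * Kp T * T) * ES (\<lambda>t w. X n t w - Y t w) T"
        using Kp[OF T] T by (simp add: ennreal_mult mult.assoc)
      finally show ?thesis by (simp add: add_left_mono mult_left_mono)
    qed
    then have "ES (\<lambda>t w. Y t w - \<Phi> Y t w) T \<le> 0" by (intro LIMSEQ_le_const[OF lim]) auto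
    then show ?thesis by simp
  qed
  then have "AE w in M. \<forall>t\<ge>0. Y t w - \<Phi> Y t w = 0"
    by (intro ES_zero_AE S2_cont_adapted S2_diff Y(1) \<Phi>)
  then have "solves b g x0 Y" unfolding solves_def using Y(1) by (auto simp: \<Phi>_def)
  then show ?thesis by blast
qed

section \<open>Locally Lipschitz coefficients: uniqueness, moments and global existence\<close>

definition loc_Lip :: "('a \<Rightarrow> 'a) \<Rightarrow> ('i \<Rightarrow> 'a \<Rightarrow> real) \<Rightarrow> bool" where
  "loc_Lip b g \<longleftrightarrow> (\<forall>R>0. \<exists>L\<ge>0. \<forall>x y. norm x \<le> R \<longrightarrow> norm y \<le> R \<longrightarrow>
     norm (b x - b y) \<le> L * norm (x - y) \<and> (\<forall>i\<in>J. \<bar>g i x - g i y\<bar> \<le> L * norm (x - y)))"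

lemma loc_Lip_trunc:
  assumes "loc_Lip b g" "R > 0"
  shows "\<exists>L\<ge>0. Lip L (\<lambda>x. b (trunc R x)) (\<lambda>i x. g i (trunc R x))"
proof -
  obtain L where L: "L \<ge> 0" "\<And>x y. norm x \<le> R \<Longrightarrow> norm y \<le> R \<Longrightarrow>
     norm (b x - b y) \<le> L * norm (x - y) \<and> (\<forall>i\<in>J. \<bar>g i x - g i y\<bar> \<le> L * norm (x - y))"
    using assms unfolding loc_Lip_def by meson
  have le: "L * norm (trunc R x - trunc R y) \<le> (2 * L) * norm (x - y)" for x y
    using mult_left_mono[OF trunc_Lipschitz[OF assms(2), of x y] L(1)] by simp
  have "Lip (2 * L) (\<lambda>x. b (trunc R x)) (\<lambda>i x. g i (trunc R x))"
    unfolding Lip_def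
  proof (intro conjI ballI allI)
    fix x y
    note * = L(2)[OF norm_trunc_le(1)[OF assms(2), of x] norm_trunc_le(1)[OF assms(2), of y]]
    show "norm (b (trunc R x) - b (trunc R y)) \<le> 2 * L * norm (x - y)" using order_trans[OF conjunct1[OF *] le] .
    show "\<bar>g i (trunc R x) - g i (trunc R y)\<bar> \<le> 2 * L * norm (x - y)" if "i \<in> J" for i
      using order_trans[OF bspec[OF conjunct2[OF *] that] le] .
  qed
  then show ?thesis using L(1) by (intro exI[of _ "2 * L"]) auto
qed

lemma loc_Lip_continuous:
  assumes "loc_Lip b g"
  shows "continuous_on UNIV b" "i \<in> J \<Longrightarrow> continuous_on UNIV (g i)"
proof -
  have ball: "\<exists>L. L-lipschitz_on (ball 0 R) b \<and> (\<forall>i\<in>J. L-lipschitz_on (ball 0 R) (g i))" if R: "R > 0" for R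
  proof -
    obtain L where L: "L \<ge> 0" "\<And>x y. norm x \<le> R \<Longrightarrow> norm y \<le> R \<Longrightarrow>
       norm (b x - b y) \<le> L * norm (x - y) \<and> (\<forall>i\<in>J. \<bar>g i x - g i y\<bar> \<le> L * norm (x - y))"
      using assms R unfolding loc_Lip_def by meson
    then show ?thesis by (intro exI[of _ L]) (auto intro!: lipschitz_onI simp: dist_norm)
  qed
  have at: "continuous (at x) b" "i \<in> J \<Longrightarrow> continuous (at x) (g i)" for x i
  proof -
    have R: "norm x + 1 > 0" by (simp add: add_nonneg_pos)
    obtain L where L: "L-lipschitz_on (ball 0 (norm x + 1)) b" "\<And>i. i \<in> J \<Longrightarrow> L-lipschitz_on (ball 0 (norm x + 1)) (g i)"
      using ball[OF R] by blast
    have x: "x \<in> ball 0 (norm x + 1)" by simp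
    show "continuous (at x) b"
      using lipschitz_on_continuous_on[OF L(1)] x by (simp add: continuous_on_eq_continuous_at)
    show "continuous (at x) (g i)" if "i \<in> J"
      using lipschitz_on_continuous_on[OF L(2)[OF that]] x by (simp add: continuous_on_eq_continuous_at)
  qed
  show "continuous_on UNIV b" "i \<in> J \<Longrightarrow> continuous_on UNIV (g i)"
    using at by (simp_all add: continuous_on_eq_continuous_at)
qed

text \<open>Killing both paths when either leaves the ball of radius \<open>n + 1\<close> makes one
  Lipschitz constant valid throughout. Continuous paths are bounded on compact intervals, so these
  balls exhaust almost every pair of paths.\<close>

lemma loc_Lip_unique:
  assumes l: "loc_Lip b g" and r: "regular b g" and X: "solves b g x0 X" "solves b g x0 Y"
  shows "AE w in M. \<forall>t\<ge>0. X t w = Y t w"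
proof -
  have XS: "S2_process X" "S2_process Y" using X by (auto simp: solves_def)
  have "AE w in M. \<forall>t\<ge>0. stay X (real (Suc n)) t w \<and> stay Y (real (Suc n)) t w \<longrightarrow> X t w = Y t w" for n
  proof -
    obtain L where L: "L \<ge> 0" "\<And>x y. norm x \<le> real (Suc n) \<Longrightarrow> norm y \<le> real (Suc n) \<Longrightarrow>
       norm (b x - b y) \<le> L * norm (x - y) \<and> (\<forall>i\<in>J. \<bar>g i x - g i y\<bar> \<le> L * norm (x - y))"
      using l unfolding loc_Lip_def by (meson of_nat_0_less_iff zero_less_Suc)
    show ?thesis
    proof (rule evo_unique[OF XS regular_S2(1)[OF r XS(1)] regular_S2(1)[OF r XS(2)] regular_S2(2)[OF r XS(1)] regular_S2(2)[OF r XS(2)]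
          coeff_I(2)[OF r XS(1)] coeff_I(2)[OF r XS(2)]])
      show "AE w in M. \<forall>t\<ge>0. X t w = x0 + evo (\<lambda>s w. b (X s w)) (coeff_I g X) t w"
        "AE w in M. \<forall>t\<ge>0. Y t w = x0 + evo (\<lambda>s w. b (Y s w)) (coeff_I g Y) t w"
        using X by (auto simp: solves_def)
      show "killing (\<lambda>t w. stay X (real (Suc n)) t w \<and> stay Y (real (Suc n)) t w)"
        by (intro killing_conj killing_stay S2_cont_adapted XS) auto
      show "0 \<le> L\<^sup>2 * (1 + real (card J))" by simp
      fix s w assume s: "0 \<le> s" "stay X (real (Suc n)) s w \<and> stay Y (real (Suc n)) s w"
      then have "norm (X s w) \<le> real (Suc n)" "norm (Y s w) \<le> real (Suc n)" by (auto simp: stay_def)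
      then show "cf (\<lambda>s w. b (X s w) - b (Y s w)) (\<lambda>i s w. g i (X s w) - g i (Y s w)) s w \<le> L\<^sup>2 * (1 + real (card J)) * (norm (X s w - Y s w))\<^sup>2"
        unfolding cf_def using L(2) by (intro cf_le[OF L(1)]) blast+
    qed
  qed
  then have "AE w in M. \<forall>n. \<forall>t\<ge>0. stay X (real (Suc n)) t w \<and> stay Y (real (Suc n)) t w \<longrightarrow> X t w = Y t w"
    by (simp add: AE_all_countable)
  then show ?thesis using AE_space
  proof eventually_elim
    fix w assume *: "\<forall>n. \<forall>t\<ge>0. stay X (real (Suc n)) t w \<and> stay Y (real (Suc n)) t w \<longrightarrow> X t w = Y t w" and w: "w \<in> space M"
    show "\<forall>t\<ge>0. X t w = Y t w"
    proof (intro allI impI)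
      fix t :: real assume t: "0 \<le> t"
      have bd: "\<exists>K. \<forall>s\<in>{0..t}. norm (Z s w) \<le> K" if "S2_process Z" for Z :: "real \<Rightarrow> 'w \<Rightarrow> 'a"
      proof -
        have "compact ((\<lambda>s. Z s w) ` {0..t})"
          by (intro compact_continuous_image cont_adapted_cont_Icc[OF S2_cont_adapted[OF that] w] compact_Icc) auto
        then show ?thesis by (metis bounded_iff compact_imp_bounded imageI)
      qed
      obtain K1 K2 where K: "\<And>s. s \<in> {0..t} \<Longrightarrow> norm (X s w) \<le> K1" "\<And>s. s \<in> {0..t} \<Longrightarrow> norm (Y s w) \<le> K2"
        using bd[OF XS(1)] bd[OF XS(2)] by blast
      obtain n :: nat where n: "max K1 K2 \<le> real n" using real_arch_simple by blast
      have "norm (X s w) \<le> real (Suc n)" "norm (Y s w) \<le> real (Suc n)" if "s \<in> {0..t}" for s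
        using K[OF that] n by simp_all
      then have "stay X (real (Suc n)) t w" "stay Y (real (Suc n)) t w" unfolding stay_def by blast+
      then show "X t w = Y t w" using * t by blast
    qed
  qed
qed


text \<open>The bound involves \<open>G\<close> but no Lipschitz constant, so it is the same for all
  truncation radii. Gronwall's inequality is applied to the second moment at fixed times, and the
  result is fed back into the estimate for the supremum.\<close>

lemma moment_bound:
  assumes r: "regular b g" and X: "solves b g x0 X" and G: "0 \<le> G"
    and gr: "\<And>x. norm (b x) \<le> G * norm x" "\<And>x i. i \<in> J \<Longrightarrow> \<bar>g i x\<bar> \<le> G * norm x" and T: "0 \<le> T"
  defines "K \<equiv> 2 * (KC * (1 + T) * (G\<^sup>2 * (1 + real (card J)) + 1))"
  shows "ES X T \<le> ennreal (2 * (norm x0)\<^sup>2 + 2 * (norm x0)\<^sup>2 * exp (2 * K * T))"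
proof -
  have XS: "S2_process X" and XE: "AE w in M. \<forall>t\<ge>0. X t w = x0 + evo (\<lambda>s w. b (X s w)) (coeff_I g X) t w"
    using X by (auto simp: solves_def)
  note [measurable] = measurable_PT_cont[OF S2_cont_adapted[OF XS]]
  define H where "H = G\<^sup>2 * (1 + real (card J)) + 1"
  have H: "H > 0" unfolding H_def by (intro add_nonneg_pos) auto
  have K: "K > 0" unfolding K_def H_def[symmetric] using KC_ge T H by (intro mult_pos_pos) auto
  define A where "A = 2 * (norm x0)\<^sup>2"
  have A: "0 \<le> A" by (simp add: A_def)
  define a where "a t = (\<integral>\<^sup>+ w. ennreal ((norm (X t w))\<^sup>2) \<partial>M)" for t
  let ?Z = "evo (\<lambda>s w. b (X s w)) (coeff_I g X)"
  have est: "ES X t \<le> ennreal A + ennreal K * (\<integral>\<^sup>+ s\<in>{0..t}. a s \<partial>lborel)" if t: "t \<in> {0..T}" for t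
  proof -
    have t0: "0 \<le> t" using t by simp
    have ZS: "S2_process ?Z" by (intro evo_S2 regular_S2(1)[OF r XS] coeff_I(1)[OF r XS])
    have "ES X t \<le> ennreal A + ennreal 2 * ES ?Z t + ennreal 0 * ES ?Z t"
    proof (rule ES_mono_le[OF S2_cont_adapted[OF ZS] S2_cont_adapted[OF ZS] t0 A])
      show "AE w in M. \<forall>t\<in>{0..t}. (norm (X t w))\<^sup>2 \<le> A + 2 * (norm (?Z t w))\<^sup>2 + 0 * (norm (?Z t w))\<^sup>2"
        using XE by eventually_elim (simp add: A_def power2_norm_add_le)
    qed auto
    also have "ES ?Z t \<le> ennreal (KC * (1 + t)) * EI t (\<lambda>s w. ennreal (cf (\<lambda>s w. b (X s w)) (\<lambda>i s w. g i (X s w)) s w))"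
      by (rule evo_ES[OF regular_S2(1)[OF r XS] regular_S2(2)[OF r XS] coeff_I(2)[OF r XS] S2_cont_adapted[OF coeff_I(1)[OF r XS]] t0])
    also have "EI t (\<lambda>s w. ennreal (cf (\<lambda>s w. b (X s w)) (\<lambda>i s w. g i (X s w)) s w))
      \<le> EI t (\<lambda>s w. ennreal H * ennreal ((norm (X s w))\<^sup>2))"
    proof (rule EI_mono)
      fix s w
      have "cf (\<lambda>s w. b (X s w)) (\<lambda>i s w. g i (X s w)) s w \<le> G\<^sup>2 * (1 + real (card J)) * (norm (X s w))\<^sup>2"
        unfolding cf_def by (rule cf_le[OF G]) (use gr in auto)
      also have "\<dots> \<le> H * (norm (X s w))\<^sup>2" unfolding H_def by (intro mult_right_mono) auto
      finally have "ennreal (cf (\<lambda>s w. b (X s w)) (\<lambda>i s w. g i (X s w)) s w) \<le> ennreal (H * (norm (X s w))\<^sup>2)" by (rule ennreal_leI)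
      then show "ennreal (cf (\<lambda>s w. b (X s w)) (\<lambda>i s w. g i (X s w)) s w) \<le> ennreal H * ennreal ((norm (X s w))\<^sup>2)"
        using H by (simp add: ennreal_mult)
    qed
    also have "\<dots> = ennreal H * EI t (\<lambda>s w. ennreal ((norm (X s w))\<^sup>2))" by (rule EI_cmult) measurable
    also have "EI t (\<lambda>s w. ennreal ((norm (X s w))\<^sup>2)) = (\<integral>\<^sup>+ s\<in>{0..t}. a s \<partial>lborel)"
      unfolding a_def by (rule EI_eq_space_time) measurable
    finally have "ES X t \<le> ennreal A + ennreal 2 * (ennreal (KC * (1 + t)) * (ennreal H * (\<integral>\<^sup>+ s\<in>{0..t}. a s \<partial>lborel))) + ennreal 0 * ES ?Z t"
      by (simp add: add_left_mono mult_left_mono)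
    also have "\<dots> = ennreal A + ennreal (2 * (KC * (1 + t) * H)) * (\<integral>\<^sup>+ s\<in>{0..t}. a s \<partial>lborel)"
      using KC_ge t0 H by (simp add: ennreal_mult mult.assoc)
    also have "\<dots> \<le> ennreal A + ennreal K * (\<integral>\<^sup>+ s\<in>{0..t}. a s \<partial>lborel)"
      unfolding K_def H_def[symmetric] using KC_ge t H
      by (intro add_left_mono mult_right_mono ennreal_leI mult_left_mono) auto
    finally show ?thesis .
  qed
  have B: "ES X T = ennreal (enn2real (ES X T))" using S2_ES[OF XS T] by auto
  have aES: "a t \<le> ES X t" if "0 \<le> t" for t unfolding a_def by (rule E_le_ES[OF that order_refl])
  have gw: "a t \<le> ennreal (2 * A * exp (2 * K * t))" if t: "t \<in> {0..T}" for t
  proof (rule gronwall_ennreal[where T = T and B = "enn2real (ES X T)", OF K A _ _ t])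
    show "a s \<le> ennreal A + ennreal K * (\<integral>\<^sup>+ r\<in>{0..s}. a r \<partial>lborel)" if "s \<in> {0..T}" for s
      by (rule order_trans[OF aES est]) (use that in auto)
    show "a s \<le> ennreal (enn2real (ES X T))" if "s \<in> {0..T}" for s
      unfolding B[symmetric] a_def by (rule E_le_ES) (use that in auto)
  qed
  have "ES X T \<le> ennreal A + ennreal K * (\<integral>\<^sup>+ s\<in>{0..T}. a s \<partial>lborel)" by (rule est) (use T in auto)
  also have "(\<integral>\<^sup>+ s\<in>{0..T}. a s \<partial>lborel) \<le> (\<integral>\<^sup>+ s\<in>{0..T}. ennreal (2 * A) * ennreal (exp (2 * K * s)) \<partial>lborel)"
    using gw A by (intro nn_integral_mono) (auto split: split_indicator simp flip: ennreal_mult)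
  also have "\<dots> = ennreal (2 * A) * (\<integral>\<^sup>+ s\<in>{0..T}. ennreal (exp (2 * K * s)) \<partial>lborel)"
    by (simp add: mult.assoc nn_integral_cmult)
  also have "(\<integral>\<^sup>+ s\<in>{0..T}. ennreal (exp (2 * K * s)) \<partial>lborel) \<le> ennreal (exp (2 * K * T) / (2 * K))"
    by (rule nn_integral_exp_le) (use K T in auto)
  finally have "ES X T \<le> ennreal A + ennreal K * (ennreal (2 * A) * ennreal (exp (2 * K * T) / (2 * K)))"
    by (simp add: add_left_mono mult_left_mono)
  also have "\<dots> = ennreal (A + K * (2 * A * (exp (2 * K * T) / (2 * K))))"
    using A K ennreal_mult[of "2 * A" "exp (2 * K * T) / (2 * K)"] ennreal_mult[of K "2 * A * (exp (2 * K * T) / (2 * K))"]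
    by (simp add: ennreal_plus)
  also have "A + K * (2 * A * (exp (2 * K * T) / (2 * K))) = A + A * exp (2 * K * T)"
    using K by simp
  finally show ?thesis by (simp add: A_def)
qed

text \<open>Truncated solutions are consistent by uniqueness up to the exit from a ball, and the
  uniform moment bound prevents the exit times from accumulating at a finite time.\<close>

theorem loc_Lip_solution:
  assumes l: "loc_Lip b g" and G: "0 \<le> G"
    and gr: "\<And>x. norm (b x) \<le> G * norm x" "\<And>x i. i \<in> J \<Longrightarrow> \<bar>g i x\<bar> \<le> G * norm x"
  shows "regular b g" "\<exists>X. solves b g x0 X"
proof -
  show r: "regular b g"
    unfolding regular_def
  proof (intro conjI ballI loc_Lip_continuous[OF l] exI[of _ G] allI G)
    have "G * norm x \<le> G * (1 + norm x)" for x :: 'a using G by (intro mult_left_mono) auto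
    then show "norm (b x) \<le> G * (1 + norm x)" "i \<in> J \<Longrightarrow> \<bar>g i x\<bar> \<le> G * (1 + norm x)" for x i
      using gr order_trans by blast+
  qed
  define R where "R n = real (Suc n)" for n
  have R: "R n > 0" for n by (simp add: R_def)
  define bn where "bn n x = b (trunc (R n) x)" for n x
  define gn where "gn n i x = g i (trunc (R n) x)" for n i x
  have "\<exists>L\<ge>0. Lip L (bn n) (gn n)" for n unfolding bn_def[abs_def] gn_def[abs_def] by (rule loc_Lip_trunc[OF l R])
  then obtain L where L: "\<And>n. L n \<ge> 0" "\<And>n. Lip (L n) (bn n) (gn n)" by metis
  have rn: "regular (bn n) (gn n)" for n by (rule Lip_regular[OF L])
  have "\<exists>X. solves (bn n) (gn n) x0 X" for n by (rule lipschitz_solution[OF L])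
  then obtain X where X: "\<And>n. solves (bn n) (gn n) x0 (X n)" by metis
  have XS: "S2_process (X n)" for n using X by (simp add: solves_def)
  have Xc: "cont_adapted (X n)" for n by (rule S2_cont_adapted[OF XS])
  have XE: "AE w in M. \<forall>t\<ge>0. X n t w = x0 + evo (\<lambda>s w. bn n (X n s w)) (coeff_I (gn n) (X n)) t w" for n
    using X by (simp add: solves_def)
  have ident: "trunc (R m) x = x" if "norm x \<le> R n" "n \<le> m" for n m and x :: 'a
    using that R[of m] by (intro trunc_ident) (auto simp: R_def)
  have mom: "\<exists>B\<ge>0. \<forall>n. ES (X n) T \<le> ennreal B" if T: "0 \<le> T" for T
  proof -
    \<comment> \<open>Truncation does not increase the norm, so the growth constant is
      preserved.\<close>
    have le: "G * norm (trunc (R n) x) \<le> G * norm x" for n and x :: 'a by (intro mult_left_mono norm_trunc_le(2) R G)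
    have "ES (X n) T \<le> ennreal (2 * (norm x0)\<^sup>2 + 2 * (norm x0)\<^sup>2 * exp (2 * (2 * (KC * (1 + T) * (G\<^sup>2 * (1 + real (card J)) + 1))) * T))" for n
      by (rule moment_bound[OF rn X G _ _ T]) (use order_trans[OF gr(1) le] order_trans[OF gr(2) le] in \<open>auto simp: bn_def gn_def\<close>)
    then show ?thesis by (intro exI[of _ "2 * (norm x0)\<^sup>2 + 2 * (norm x0)\<^sup>2 * exp (2 * (2 * (KC * (1 + T) * (G\<^sup>2 * (1 + real (card J)) + 1))) * T)"]) auto
  qed
  have consist: "AE w in M. \<forall>t\<ge>0. stay (X n) (R n) t w \<longrightarrow> X n t w = X m t w" if nm: "n \<le> m" for n m
  proof (rule evo_unique[OF XS XS regular_S2(1)[OF rn XS] regular_S2(1)[OF rn XS] regular_S2(2)[OF rn XS] regular_S2(2)[OF rn XS]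
        coeff_I(2)[OF rn XS] coeff_I(2)[OF rn XS] XE XE])
    show "killing (stay (X n) (R n))" by (rule killing_stay[OF Xc less_imp_le[OF R]])
    show "0 \<le> (L m)\<^sup>2 * (1 + real (card J))" by simp
    fix s w assume s: "0 \<le> s" "stay (X n) (R n) s w"
    then have "norm (X n s w) \<le> R n" by (simp add: stay_def)
    \<comment> \<open>Inside the ball of radius \<open>R n\<close> both truncations are the
      identity, so only the Lipschitz constant of the \<open>m\<close>-th coefficients
      enters.\<close>
    then have e: "bn n (X n s w) = bn m (X n s w)" "gn n i (X n s w) = gn m i (X n s w)" for i
      using ident[of "X n s w" n n] ident[of "X n s w" n m] nm by (simp_all add: bn_def gn_def)
    show "cf (\<lambda>s w. bn n (X n s w) - bn m (X m s w)) (\<lambda>i s w. gn n i (X n s w) - gn m i (X m s w)) s w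
      \<le> (L m)\<^sup>2 * (1 + real (card J)) * (norm (X n s w - X m s w))\<^sup>2"
      unfolding cf_def e by (rule cf_le[OF L(1)]) (use L(2)[of m] in \<open>auto simp: Lip_def\<close>)
  qed
  then have consist': "AE w in M. \<forall>n m. n \<le> m \<longrightarrow> (\<forall>t\<ge>0. stay (X n) (R n) t w \<longrightarrow> X n t w = X m t w)"
    by (simp add: AE_all_countable)
  have reach: "AE w in M. \<exists>n. stay (X n) (R n) T w" if T: "0 \<le> T" for T
  proof -
    obtain B where B: "B \<ge> 0" "\<And>n. ES (X n) T \<le> ennreal B" using mom[OF T] by blast
    define N where "N n = {w\<in>space M. \<not> stay (X n) (R n) T w}" for n
    have Nn: "N n \<in> sets M" for n
    proof -
      have "N n = space M - {w\<in>space M. stay (X n) (R n) T w}" by (auto simp: N_def)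
      then show ?thesis using killing_M[OF killing_stay[OF Xc less_imp_le[OF R]] T] by auto
    qed
    \<comment> \<open>Chebyshev's inequality for the supremum.\<close>
    have bd: "emeasure M (\<Inter>n. N n) \<le> ennreal (B * inverse (real (Suc n)))" for n
    proof -
      have "ennreal ((R n)\<^sup>2) * emeasure M (N n) = (\<integral>\<^sup>+ w. ennreal ((R n)\<^sup>2) * indicator (N n) w \<partial>M)"
        using Nn by (simp add: nn_integral_cmult_indicator)
      also have "\<dots> \<le> ES (X n) T"
      proof (rule nn_integral_mono)
        fix w
        show "ennreal ((R n)\<^sup>2) * indicator (N n) w \<le> (SUP t\<in>{0..T}. ennreal ((norm (X n t w))\<^sup>2))"
        proof (cases "w \<in> N n")
          case True
          then obtain s where s: "s \<in> {0..T}" "R n < norm (X n s w)" by (auto simp: N_def stay_def not_le)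
          have "ennreal ((R n)\<^sup>2) \<le> ennreal ((norm (X n s w))\<^sup>2)"
            using s R[of n] by (intro ennreal_leI power_mono) auto
          also have "\<dots> \<le> (SUP t\<in>{0..T}. ennreal ((norm (X n t w))\<^sup>2))" by (rule SUP_upper[OF s(1)])
          finally show ?thesis using True by simp
        qed simp
      qed
      finally have 1: "ennreal ((R n)\<^sup>2) * emeasure M (N n) \<le> ennreal B" using B(2) order_trans by blast
      have "emeasure M (\<Inter>n. N n) \<le> emeasure M (N n)" by (intro emeasure_mono Nn) auto
      also have "emeasure M (N n) = ennreal (measure M (N n))" by (rule emeasure_eq_measure)
      also have "\<dots> \<le> ennreal (B * inverse (real (Suc n)))"
      proof (rule ennreal_leI)
        have "(R n)\<^sup>2 * measure M (N n) \<le> B"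
          using 1 B(1) unfolding emeasure_eq_measure by (simp flip: ennreal_mult)
        \<comment> \<open>\<open>R n \<ge> 1\<close>, and the first power already makes the bound
          tend to zero.\<close>
        moreover have "R n * measure M (N n) \<le> (R n)\<^sup>2 * measure M (N n)"
          by (intro mult_right_mono) (auto simp: R_def power2_eq_square)
        ultimately have "R n * measure M (N n) \<le> B" by linarith
        then show "measure M (N n) \<le> B * inverse (real (Suc n))"
          using R[of n] unfolding R_def by (simp add: field_simps)
      qed
      finally show ?thesis .
    qed
    have "(\<lambda>n. ennreal (B * inverse (real (Suc n)))) \<longlonglongrightarrow> ennreal (B * 0)"
      by (intro tendsto_ennrealI tendsto_mult_left LIMSEQ_inverse_real_of_nat)
    then have "emeasure M (\<Inter>n. N n) \<le> ennreal (B * 0)" by (rule LIMSEQ_le_const) (use bd in auto)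
    then have "(\<Inter>n. N n) \<in> null_sets M" using Nn by (intro null_setsI) auto
    then show ?thesis by (rule AE_I') (auto simp: N_def)
  qed
  \<comment> \<open>Consistency and exhaustion are collected in one property, so that a single null
    set serves all indices and horizons.\<close>
  define good where "good w \<longleftrightarrow> (\<forall>n m. n \<le> m \<longrightarrow> (\<forall>t\<ge>0. stay (X n) (R n) t w \<longrightarrow> X n t w = X m t w)) \<and>
     (\<forall>k::nat. \<exists>n. stay (X n) (R n) (real k) w)" for w
  have "AE w in M. \<forall>k::nat. \<exists>n. stay (X n) (R n) (real k) w" unfolding AE_all_countable by (intro allI reach) simp
  with consist' have AEgood: "AE w in M. good w" by eventually_elim (simp add: good_def)
  then obtain N where N: "{w\<in>space M. \<not> good w} \<subseteq> N" "N \<in> null_sets M" by (auto elim!: AE_E simp: null_sets_def)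
  have good: "good w" if "w \<in> space M" "w \<notin> N" for w using N(1) that by blast
  \<comment> \<open>For a good path the sequence is eventually constant on each compact time
    interval, so the limit exists and is attained.\<close>
  define Y where "Y t w = (if w \<in> N then x0 else lim (\<lambda>n. X n t w))" for t w
  have ev: "\<exists>n. \<forall>m\<ge>n. \<forall>t\<in>{0..T}. X m t w = Y t w" if w: "w \<in> space M" "w \<notin> N" for w T
  proof -
    obtain k :: nat where k: "T \<le> real k" using real_arch_simple by blast
    obtain n where n: "stay (X n) (R n) (real k) w" using good[OF w] unfolding good_def by blast
    have eq: "X m t w = X n t w" if "m \<ge> n" "t \<in> {0..T}" for m t
    proof -
      have "stay (X n) (R n) t w" using n that k by (auto simp: stay_def)
      then show ?thesis using good[OF w] that unfolding good_def by simp
    qed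
    have Yn: "Y t w = X n t w" if t: "t \<in> {0..T}" for t
    proof -
      have "(\<lambda>m. X m t w) \<longlonglongrightarrow> X n t w"
        by (rule tendsto_eventually, rule eventually_sequentiallyI[of n]) (rule eq[OF _ t])
      then show ?thesis using w(2) by (simp add: Y_def limI)
    qed
    have "X m t w = Y t w" if "n \<le> m" "t \<in> {0..T}" for m t
      unfolding Yn[OF that(2)] by (rule eq[OF that])
    then show ?thesis by blast
  qed
  have stayY: "X n t w = Y t w" if w: "w \<in> space M" "w \<notin> N" and t: "0 \<le> t" "stay (X n) (R n) t w" for n t w
  proof -
    obtain k where k: "\<forall>m\<ge>k. \<forall>s\<in>{0..t}. X m s w = Y s w" using ev[OF w] by blast
    have "X n t w = X (max n k) t w" using good[OF w] t unfolding good_def by (meson max.cobounded1)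
    also have "\<dots> = Y t w" using k t(1) by simp
    finally show ?thesis .
  qed
  have Yc: "cont_adapted Y"
    unfolding cont_adapted_def
  proof (intro conjI allI impI ballI)
    fix t :: real assume t: "0 \<le> t"
    show "Y t \<in> borel_measurable (F t)"
    proof (rule borel_measurable_LIMSEQ_metric)
      show "(\<lambda>w. if w \<in> N then x0 else X n t w) \<in> borel_measurable (F t)" for n
        by (rule measurable_F_modify[OF t cont_adapted_F[OF Xc t] N(2)]) simp
      fix w assume "w \<in> space (F t)"
      then have w: "w \<in> space M" using space_F[OF t] by simp
      show "(\<lambda>n. if w \<in> N then x0 else X n t w) \<longlonglongrightarrow> Y t w"
      proof (cases "w \<in> N")
        case False
        then obtain n where "\<forall>m\<ge>n. \<forall>s\<in>{0..t}. X m s w = Y s w" using ev[OF w] by blast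
        then show ?thesis using False t by (intro tendsto_eventually eventually_sequentiallyI[of n]) simp
      qed (simp add: Y_def)
    qed
  next
    fix w assume w: "w \<in> space M"
    show "continuous_on {0..} (\<lambda>t. Y t w)"
    proof (cases "w \<in> N")
      case False
      show ?thesis unfolding continuous_on_atLeast_iff
      proof (intro allI impI)
        fix T :: real assume "0 \<le> T"
        obtain n where n: "\<forall>m\<ge>n. \<forall>s\<in>{0..T}. X m s w = Y s w" using ev[OF w False] by blast
        have "continuous_on {0..T} (\<lambda>t. X n t w)" by (rule cont_adapted_cont_Icc[OF Xc w order_refl])
        then show "continuous_on {0..T} (\<lambda>t. Y t w)" using n by (subst continuous_on_cong[OF refl, of _ _ "\<lambda>t. X n t w"]) auto
      qed
    qed (simp add: Y_def)
  qed
  have YS: "S2_process Y"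
    unfolding S2_process_def
  proof (intro conjI Yc allI impI)
    fix T :: real assume T: "0 \<le> T"
    obtain B where B: "B \<ge> 0" "\<And>n. ES (X n) T \<le> ennreal B" using mom[OF T] by blast
    \<comment> \<open>Fatou's lemma carries the uniform moment bound over to the limit.\<close>
    have "ES Y T \<le> (\<integral>\<^sup>+ w. liminf (\<lambda>n. SUP t\<in>{0..T}. ennreal ((norm (X n t w))\<^sup>2)) \<partial>M)"
    proof (rule nn_integral_mono_AE)
      show "AE w in M. (SUP t\<in>{0..T}. ennreal ((norm (Y t w))\<^sup>2)) \<le> liminf (\<lambda>n. SUP t\<in>{0..T}. ennreal ((norm (X n t w))\<^sup>2))"
        using AE_not_in[OF N(2)] AE_space
      proof eventually_elim
        fix w assume w: "w \<notin> N" "w \<in> space M"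
        obtain n where n: "\<forall>m\<ge>n. \<forall>s\<in>{0..T}. X m s w = Y s w" using ev[OF w(2,1)] by blast
        have "(\<lambda>n. SUP t\<in>{0..T}. ennreal ((norm (X n t w))\<^sup>2)) \<longlonglongrightarrow> (SUP t\<in>{0..T}. ennreal ((norm (Y t w))\<^sup>2))"
          by (rule tendsto_eventually, rule eventually_sequentiallyI[of n]) (use n in \<open>auto intro!: SUP_cong\<close>)
        then show "(SUP t\<in>{0..T}. ennreal ((norm (Y t w))\<^sup>2)) \<le> liminf (\<lambda>n. SUP t\<in>{0..T}. ennreal ((norm (X n t w))\<^sup>2))"
          by (simp add: lim_imp_Liminf)
      qed
    qed
    also have "\<dots> \<le> liminf (\<lambda>n. ES (X n) T)" by (rule nn_integral_liminf) (rule sup_sq_measurable[OF Xc T])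
    also have "\<dots> \<le> liminf (\<lambda>n. ennreal B)" by (intro Liminf_mono always_eventually allI B)
    also have "\<dots> < \<infinity>" by (simp add: Liminf_const)
    finally show "ES Y T < \<infinity>" .
  qed
  \<comment> \<open>The stochastic integrals are not passed to the limit directly. Instead the
    right-hand side \<open>Z\<close> built from \<open>Y\<close> is compared with
    \<open>X n\<close>: while the \<open>n\<close>-th path stays in its ball the coefficients
    coincide, so \<open>evo_unique\<close> applies with \<open>L = 0\<close>.\<close>
  define Z where "Z t w = x0 + evo (\<lambda>s w. b (Y s w)) (coeff_I g Y) t w" for t w
  have ZS: "S2_process Z" unfolding Z_def[abs_def] by (rule evo_coeff_S2[OF r YS])
  have "AE w in M. \<forall>t\<ge>0. stay (X n) (R n) t w \<and> w \<in> space M - N \<longrightarrow> X n t w = Z t w" for n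
  proof (rule evo_unique[where L = 0, OF XS ZS regular_S2(1)[OF rn XS] regular_S2(1)[OF r YS] regular_S2(2)[OF rn XS] regular_S2(2)[OF r YS]
        coeff_I(2)[OF rn XS] coeff_I(2)[OF r YS] XE])
    show "AE w in M. \<forall>t\<ge>0. Z t w = x0 + evo (\<lambda>s w. b (Y s w)) (coeff_I g Y) t w" by (simp add: Z_def)
    \<comment> \<open>Restriction to good paths is a killing predicate because null sets belong to
      every \<open>F t\<close>.\<close>
    have "killing (\<lambda>t w. w \<in> space M - N)"
      unfolding killing_def
    proof (intro conjI allI impI ballI)
      fix t :: real assume t: "0 \<le> t"
      have "space (F t) - N \<in> sets (F t)" using null_sets_F[OF t N(2)] by auto
      moreover have "{w\<in>space M. w \<in> space M - N} = space (F t) - N" using space_F[OF t] by auto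
      ultimately show "{w\<in>space M. w \<in> space M - N} \<in> sets (F t)" by simp
    next
      fix t w assume "0 < (t::real)" "\<forall>s\<in>{0..<t}. w \<in> space M - N"
      then show "w \<in> space M - N" by (metis atLeastLessThan_iff order_refl)
    qed auto
    then show "killing (\<lambda>t w. stay (X n) (R n) t w \<and> w \<in> space M - N)"
      by (rule killing_conj[OF killing_stay[OF Xc less_imp_le[OF R]]])
    fix s w assume s: "0 \<le> s" "w \<in> space M" "stay (X n) (R n) s w \<and> w \<in> space M - N"
    then have "norm (X n s w) \<le> R n" by (simp add: stay_def)
    then have "trunc (R n) (X n s w) = X n s w" by (rule ident) simp
    moreover have "X n s w = Y s w" using stayY s by auto
    ultimately have "bn n (X n s w) = b (Y s w)" "gn n i (X n s w) = g i (Y s w)" for i by (simp_all add: bn_def gn_def)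
    then show "cf (\<lambda>s w. bn n (X n s w) - b (Y s w)) (\<lambda>i s w. gn n i (X n s w) - g i (Y s w)) s w \<le> 0 * (norm (X n s w - Z s w))\<^sup>2"
      by (simp add: cf_def)
  qed simp_all
  then have "AE w in M. \<forall>n. \<forall>t\<ge>0. stay (X n) (R n) t w \<and> w \<in> space M - N \<longrightarrow> X n t w = Z t w"
    by (simp add: AE_all_countable)
  then have "AE w in M. \<forall>t\<ge>0. Y t w = Z t w"
    using AE_not_in[OF N(2)] AE_space
  proof eventually_elim
    fix w assume *: "\<forall>n. \<forall>t\<ge>0. stay (X n) (R n) t w \<and> w \<in> space M - N \<longrightarrow> X n t w = Z t w" and w: "w \<notin> N" "w \<in> space M"
    show "\<forall>t\<ge>0. Y t w = Z t w"
    proof (intro allI impI)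
      fix t :: real assume t: "0 \<le> t"
      obtain k :: nat where k: "t \<le> real k" using real_arch_simple by blast
      obtain n where "stay (X n) (R n) (real k) w" using good[OF w(2,1)] unfolding good_def by blast
      then have st: "stay (X n) (R n) t w" using k by (auto simp: stay_def)
      have "Y t w = X n t w" using stayY[OF w(2,1) t st] by simp
      also have "\<dots> = Z t w" using * st t w by blast
      finally show "Y t w = Z t w" .
    qed
  qed
  then have "solves b g x0 Y" unfolding solves_def using YS by (simp add: Z_def)
  then show "\<exists>X. solves b g x0 X" by blast
qed

end

subsection \<open>Predictable processes\<close>

context stochastic_basis
begin

lemma predictable_generators:
  "{{s<..t} \<times> A | s t A. 0 \<le> s \<and> s < t \<and> A \<in> sets (F s)} \<union> {{0} \<times> A | A. A \<in> sets (F 0)} \<subseteq> Pow ({0..} \<times> space M)"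
  using sets_F_M[THEN sets.sets_into_space] by fastforce

lemma space_predictable: "space (predictable_algebra M F) = {0..} \<times> space M"
  unfolding predictable_algebra_def by (rule space_measure_of[OF predictable_generators])

lemma predictable_rectangle:
  "0 \<le> s \<Longrightarrow> s < t \<Longrightarrow> A \<in> sets (F s) \<Longrightarrow> {s<..t} \<times> A \<in> sets (predictable_algebra M F)"
  "A \<in> sets (F 0) \<Longrightarrow> {0} \<times> A \<in> sets (predictable_algebra M F)"
  unfolding predictable_algebra_def sets_measure_of[OF predictable_generators] by (intro sigma_sets.Basic; blast)+

text \<open>A generating rectangle that meets time \<open>t\<close> has an event known no later than
  \<open>t\<close>, so the section at \<open>t\<close> is measurable.\<close>

lemma predictable_adapted:
  assumes X: "predictable M F X" and t: "0 \<le> t"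
  shows "X t \<in> borel_measurable (F t)"
proof -
  have "Pair t \<in> measurable (F t) (predictable_algebra M F)"
    unfolding predictable_algebra_def
  proof (rule measurable_measure_of[OF predictable_generators])
    show "Pair t \<in> space (F t) \<rightarrow> {0..} \<times> space M" using t space_F[OF t] by auto
    fix y assume "y \<in> {{s<..t} \<times> A | s t A. 0 \<le> s \<and> s < t \<and> A \<in> sets (F s)} \<union> {{0} \<times> A | A. A \<in> sets (F 0)}"
    then consider s r A where "y = {s<..r} \<times> A" "0 \<le> s" "A \<in> sets (F s)" | A where "y = {0} \<times> A" "A \<in> sets (F 0)" by blast
    then show "Pair t -` y \<inter> space (F t) \<in> sets (F t)"
    proof cases
      case 1
      show ?thesis
      proof (cases "t \<in> {s<..r}")
        case True
        then have "A \<in> sets (F t)" using 1 F_mono[of s t] by auto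
        moreover have "Pair t -` y \<inter> space (F t) = A \<inter> space (F t)" using True 1 by auto
        ultimately show ?thesis by auto
      qed (use 1 in auto)
    next
      case 2
      show ?thesis
      proof (cases "t = 0")
        case True
        then have "Pair t -` y \<inter> space (F t) = A \<inter> space (F t)" using 2 by auto
        then show ?thesis using 2 True by auto
      qed (use 2 in auto)
    qed
  qed
  from measurable_compose[OF this X[unfolded predictable_def]] show ?thesis by simp
qed

text \<open>At positive times the left-grid approximation uses values at strictly earlier times, so
  it is built from predictable rectangles; continuity gives the limit.\<close>

lemma cont_adapted_predictable:
  fixes X :: "real \<Rightarrow> 'w \<Rightarrow> 'b::{real_normed_vector, second_countable_topology}"
  assumes X: "cont_adapted X"
  shows "predictable M F X"
  unfolding predictable_def
proof (rule borel_measurable_LIMSEQ_metric)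
  let ?g = "\<lambda>n k. real k / real (Suc n)"
  have lg0: "left_grid 1 n 0 = 0" for n by (simp add: left_grid_def)
  show "(\<lambda>(t, w). X (left_grid 1 n t) w) \<in> borel_measurable (predictable_algebra M F)" for n
  proof (rule measurableI)
    fix A :: "'b set" assume A: "A \<in> sets borel"
    have pre: "X s -` A \<inter> space M \<in> sets (F s)" if "0 \<le> s" for s
      using measurable_sets[OF cont_adapted_F[OF X that] A] space_F[OF that] by simp
    have lgk: "left_grid 1 n t = ?g n k" if "?g n k < t" "t \<le> ?g n (Suc k)" for k t
      using left_grid_on_interval[of 1 k n t] that by simp
    have "(\<lambda>(t, w). X (left_grid 1 n t) w) -` A \<inter> space (predictable_algebra M F)
      = {0} \<times> (X 0 -` A \<inter> space M) \<union> (\<Union>k. {?g n k<..?g n (Suc k)} \<times> (X (?g n k) -` A \<inter> space M))"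
    proof (intro set_eqI iffI)
      fix x assume "x \<in> (\<lambda>(t, w). X (left_grid 1 n t) w) -` A \<inter> space (predictable_algebra M F)"
      then obtain t w where x: "x = (t, w)" "0 \<le> t" "w \<in> space M" "X (left_grid 1 n t) w \<in> A"
        by (auto simp: space_predictable)
      show "x \<in> {0} \<times> (X 0 -` A \<inter> space M) \<union> (\<Union>k. {?g n k<..?g n (Suc k)} \<times> (X (?g n k) -` A \<inter> space M))"
      proof (cases "t = 0")
        case False
        define k where "k = nat (\<lceil>t * real (Suc n)\<rceil> - 1)"
        have "0 < t * real (Suc n)" using False x by (intro mult_pos_pos) auto
        then have "real k = real_of_int \<lceil>t * real (Suc n)\<rceil> - 1" unfolding k_def by (simp add: of_nat_nat)
        then have "real k < t * real (Suc n)" "t * real (Suc n) \<le> real (Suc k)" by linarith+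
        then have k: "?g n k < t" "t \<le> ?g n (Suc k)" by (simp_all only: pos_divide_less_eq pos_le_divide_eq of_nat_0_less_iff zero_less_Suc)
        then show ?thesis using x lgk[OF k] by auto
      qed (use x lg0 in auto)
    next
      fix x assume "x \<in> {0} \<times> (X 0 -` A \<inter> space M) \<union> (\<Union>k. {?g n k<..?g n (Suc k)} \<times> (X (?g n k) -` A \<inter> space M))"
      then show "x \<in> (\<lambda>(t, w). X (left_grid 1 n t) w) -` A \<inter> space (predictable_algebra M F)"
      proof
        assume "x \<in> {0} \<times> (X 0 -` A \<inter> space M)"
        then show ?thesis by (auto simp: space_predictable lg0)
      next
        assume "x \<in> (\<Union>k. {?g n k<..?g n (Suc k)} \<times> (X (?g n k) -` A \<inter> space M))"
        then obtain k t w where x: "x = (t, w)" "?g n k < t" "t \<le> ?g n (Suc k)" "X (?g n k) w \<in> A" "w \<in> space M" by auto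
        have "0 \<le> ?g n k" by simp
        then have "0 \<le> t" using x(2) by linarith
        then show ?thesis using x lgk[OF x(2,3)] by (simp add: space_predictable)
      qed
    qed
    also have "\<dots> \<in> sets (predictable_algebra M F)"
    proof -
      have "{?g n k<..?g n (Suc k)} \<times> (X (?g n k) -` A \<inter> space M) \<in> sets (predictable_algebra M F)" for k
        by (intro predictable_rectangle(1) pre divide_strict_right_mono) simp_all
      then show ?thesis by (intro sets.Un sets.countable_UN image_subsetI predictable_rectangle(2) pre order_refl)
    qed
    finally show "(\<lambda>(t, w). X (left_grid 1 n t) w) -` A \<inter> space (predictable_algebra M F) \<in> sets (predictable_algebra M F)" .
  qed simp
  fix x assume "x \<in> space (predictable_algebra M F)"
  then obtain t w where x: "x = (t, w)" "0 \<le> t" "w \<in> space M" by (auto simp: space_predictable)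
  have "(\<lambda>n. X (left_grid 1 n t) w) \<longlonglongrightarrow> X t w"
  proof (cases "t = 0")
    case False
    then have t: "0 < t" using x by simp
    show ?thesis
      by (rule continuous_on_tendsto_compose[OF cont_adapted_cont[OF X x(3)] left_grid_tendsto[OF t zero_less_one]])
         (use left_grid(1)[OF t zero_less_one] x in auto)
  qed (simp add: lg0)
  then show "(\<lambda>n. (\<lambda>(t, w). X (left_grid 1 n t) w) x) \<longlonglongrightarrow> (\<lambda>(t, w). X t w) x" using x by simp
qed

end

subsection \<open>Operator-valued integrands of finite rank\<close>

text \<open>\<open>W0\<close> is the given noise and \<open>W\<close> its modification with
  continuous paths: the theory is built on \<open>W\<close>, while the definition of a solution
  refers to \<open>W0\<close>.\<close>

locale operator_sde = sde M F W C J h u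
  for M :: "'w measure" and F and W :: "real \<Rightarrow> 'w \<Rightarrow> 'k::{real_inner, banach, second_countable_topology}" and C
    and J :: "'i set" and h u :: "'i \<Rightarrow> 'k" +
  fixes W0 :: "real \<Rightarrow> 'w \<Rightarrow> 'k"
  assumes W0: "AE w in M. \<forall>t\<ge>0. W t w = W0 t w"
begin

text \<open>The finite-rank operator that reads its argument along \<open>h i\<close> and acts along
  \<open>u i\<close>, with weight \<open>c i\<close>.\<close>

definition op :: "('i \<Rightarrow> real) \<Rightarrow> 'k \<Rightarrow> 'k" where
  "op c v = (\<Sum>i\<in>J. (c i * (v \<bullet> h i)) *\<^sub>R u i)"

lemma op_bounded_linear: "bounded_linear (op c)"
  unfolding op_def[abs_def]
  by (intro bounded_linear_sum bounded_linear_scaleR_const bounded_linear_const_mult bounded_linear_inner_left)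

lemma op_diff: "op c v - op d v = op (\<lambda>i. c i - d i) v"
  by (simp add: op_def sum_subtractf left_diff_distrib scaleR_diff_left)

lemma op_inner: "op c v \<bullet> e = v \<bullet> (\<Sum>i\<in>J. (u i \<bullet> e) *\<^sub>R (c i *\<^sub>R h i))"
  by (simp add: op_def inner_sum_left inner_sum_right mult_ac)

lemma adjoint_op: "adjoint (op c) = (\<lambda>e. \<Sum>i\<in>J. (u i \<bullet> e) *\<^sub>R (c i *\<^sub>R h i))"
  by (rule adjoint_unique) (simp add: op_inner)

text \<open>Bessel's inequality for the output vectors \<open>u i\<close> bounds the diagonal sums
  uniformly over all finite orthonormal sets, hence their supremum.\<close>

lemma hs_op_le: obtains K where "0 \<le> K" "\<And>c. hs_norm_sq C (op c) \<le> ennreal K * (\<Sum>i\<in>J. ennreal ((c i)\<^sup>2))"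
proof -
  obtain K where K: "0 \<le> K" "\<And>x. norm (C x) \<le> norm x * K" using bounded_linear.nonneg_bounded[OF C_lin] by blast
  define H where "H = (\<Sum>i\<in>J. (norm (h i))\<^sup>2)"
  define K' where "K' = K * (real (card J) * H)"
  have H: "0 \<le> H" by (simp add: H_def sum_nonneg)
  have "(\<Sum>e\<in>B. ennreal (C (adjoint (op c) e) \<bullet> adjoint (op c) e)) \<le> ennreal K' * (\<Sum>i\<in>J. ennreal ((c i)\<^sup>2))"
    if B: "finite B" "orthonormal B" for B c
  proof -
    have 1: "C (adjoint (op c) e) \<bullet> adjoint (op c) e \<le> K * (real (card J) * (\<Sum>i\<in>J. (c i)\<^sup>2 * H * (u i \<bullet> e)\<^sup>2))" for e
    proof -
      let ?a = "adjoint (op c) e"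
      have "C ?a \<bullet> ?a \<le> norm (C ?a) * norm ?a" by (rule norm_cauchy_schwarz)
      also have "\<dots> \<le> (norm ?a * K) * norm ?a" by (intro mult_right_mono K) simp
      also have "\<dots> = K * (norm ?a)\<^sup>2" by (simp add: power2_eq_square)
      also have "(norm ?a)\<^sup>2 \<le> real (card J) * (\<Sum>i\<in>J. (norm ((u i \<bullet> e) *\<^sub>R (c i *\<^sub>R h i)))\<^sup>2)"
        unfolding adjoint_op by (rule power2_norm_sum_le[OF J])
      also have "(\<Sum>i\<in>J. (norm ((u i \<bullet> e) *\<^sub>R (c i *\<^sub>R h i)))\<^sup>2) \<le> (\<Sum>i\<in>J. (c i)\<^sup>2 * H * (u i \<bullet> e)\<^sup>2)"
      proof (rule sum_mono)
        fix i assume i: "i \<in> J"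
        have "(norm (h i))\<^sup>2 \<le> H" unfolding H_def by (rule member_le_sum[OF i _ J]) simp
        then have "(c i)\<^sup>2 * (norm (h i))\<^sup>2 * (u i \<bullet> e)\<^sup>2 \<le> (c i)\<^sup>2 * H * (u i \<bullet> e)\<^sup>2"
          by (intro mult_right_mono mult_left_mono) auto
        then show "(norm ((u i \<bullet> e) *\<^sub>R (c i *\<^sub>R h i)))\<^sup>2 \<le> (c i)\<^sup>2 * H * (u i \<bullet> e)\<^sup>2"
          by (simp add: power_mult_distrib mult_ac)
      qed
      finally show ?thesis using K by (simp add: mult_left_mono)
    qed
    have "(\<Sum>e\<in>B. C (adjoint (op c) e) \<bullet> adjoint (op c) e) \<le> (\<Sum>e\<in>B. K * (real (card J) * (\<Sum>i\<in>J. (c i)\<^sup>2 * H * (u i \<bullet> e)\<^sup>2)))"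
      by (rule sum_mono[OF 1])
    also have "\<dots> = K * (real (card J) * (\<Sum>i\<in>J. (c i)\<^sup>2 * H * (\<Sum>e\<in>B. (u i \<bullet> e)\<^sup>2)))"
      by (simp only: sum_distrib_left[symmetric] sum.swap[of _ J B])
    also have "\<dots> \<le> K * (real (card J) * (\<Sum>i\<in>J. (c i)\<^sup>2 * H * 1))"
    proof (intro mult_left_mono sum_mono)
      fix i assume "i \<in> J"
      then have "(norm (u i))\<^sup>2 \<le> 1\<^sup>2" by (intro power_mono u) auto
      then show "(\<Sum>e\<in>B. (u i \<bullet> e)\<^sup>2) \<le> 1" using bessel_inequality[OF B, of "u i"] by simp
    qed (use K H in auto)
    also have "\<dots> = K' * (\<Sum>i\<in>J. (c i)\<^sup>2)" by (simp add: K'_def sum_distrib_left mult_ac)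
    finally have "ennreal (\<Sum>e\<in>B. C (adjoint (op c) e) \<bullet> adjoint (op c) e) \<le> ennreal (K' * (\<Sum>i\<in>J. (c i)\<^sup>2))" by (rule ennreal_leI)
    moreover have "0 \<le> K'" using K H by (simp add: K'_def)
    ultimately show ?thesis by (simp add: C_psd ennreal_mult sum_nonneg)
  qed
  then show thesis
    by (intro that[of K']) (use K H in \<open>auto simp: hs_norm_sq_def K'_def intro!: SUP_least\<close>)
qed

lemma qf_le_hs_norm_sq:
  assumes A: "bounded_linear A" and e: "norm e = 1" and a: "\<And>x. A x \<bullet> e = x \<bullet> a"
  shows "qf a \<le> hs_norm_sq C A"
proof -
  have "x \<bullet> adjoint A e = x \<bullet> a" for x using adjoint_inner[OF A, of x e] a[of x] by simp
  then have "adjoint A e = a" using vector_eq_ldot by blast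
  then have "qf a = (\<Sum>e\<in>{e}. ennreal (C (adjoint A e) \<bullet> adjoint A e))" by (simp add: qf_def)
  also have "\<dots> \<le> hs_norm_sq C A"
    unfolding hs_norm_sq_def by (rule SUP_upper) (use e in \<open>simp add: orthonormal_def\<close>)
  finally show ?thesis .
qed

section \<open>The constructed integral satisfies the definition of a stochastic integral\<close>

abbreviation J_int :: "('i \<Rightarrow> 'k \<Rightarrow> real) \<Rightarrow> (real \<Rightarrow> 'w \<Rightarrow> 'k) \<Rightarrow> real \<Rightarrow> 'w \<Rightarrow> 'k" where
  "J_int g X t w \<equiv> \<Sum>i\<in>J. coeff_I g X i t w *\<^sub>R u i"

lemma J_int_S2:
  assumes "regular b g" "S2_process X"
  shows "S2_process (J_int g X)"
  by (intro S2_sum S2_scaleR_left coeff_I(1)[OF assms])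

lemma simple_function_op:
  assumes "\<And>i. i \<in> J \<Longrightarrow> simple_function N (c i)"
  shows "simple_function N (\<lambda>w. op (\<lambda>i. c i w))"
proof -
  have "simple_function N (\<lambda>w v. \<Sum>i\<in>I. (c i w * (v \<bullet> h i)) *\<^sub>R u i)" if "finite I" "I \<subseteq> J" for I
    using that
  proof (induction I)
    case (insert j I)
    have "simple_function N (\<lambda>w. (\<lambda>f a v. (a * (v \<bullet> h j)) *\<^sub>R u j + f v) (\<lambda>v. \<Sum>i\<in>I. (c i w * (v \<bullet> h i)) *\<^sub>R u i) (c j w))"
      by (rule simple_function_compose2[where h = "\<lambda>f a v. (a * (v \<bullet> h j)) *\<^sub>R u j + f v"]) (use insert assms in auto)
    then show ?case using insert by simp
  qed simp
  from this[OF J order_refl] show ?thesis by (simp add: op_def[abs_def])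
qed

lemma grid_data:
  assumes r: "regular b g" and X: "S2_process X"
  shows "elementary_data F (Suc n * Suc n) (grid n) (\<lambda>k w. op (\<lambda>i. rnd n (g i (X (grid n k) w))))"
  unfolding elementary_data_def
proof (intro conjI allI impI ballI op_bounded_linear simple_function_op grid_mono)
  fix k i assume i: "i \<in> J"
  show "simple_function (F (grid n k)) (\<lambda>w. rnd n (g i (X (grid n k) w)))"
  proof (rule simple_function_borel_measurable)
    show "(\<lambda>w. rnd n (g i (X (grid n k) w))) \<in> borel_measurable (F (grid n k))"
      by (rule measurable_compose[OF cont_adapted_F[OF S2_cont_adapted[OF regular_S2(2)[OF r X i]] grid_mono(1)] rnd_measurable])
  qed (auto intro: finite_subset[OF _ rnd_finite_range[of n]])
qed

lemma grid_process:
  "elementary_process (Suc n * Suc n) (grid n) (\<lambda>k w. op (\<lambda>i. rnd n (\<gamma> i (grid n k) w))) s w v = op (\<lambda>i. step (\<gamma> i) n s w) v"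
proof -
  have "(\<Sum>k<Suc n * Suc n. if s \<in> {grid n k<..grid n (Suc k)} then op (\<lambda>i. rnd n (\<gamma> i (grid n k) w)) v else 0)
    = (\<Sum>k<Suc n * Suc n. \<Sum>i\<in>J. ((if s \<in> {grid n k<..grid n (Suc k)} then rnd n (\<gamma> i (grid n k) w) else 0) * (v \<bullet> h i)) *\<^sub>R u i)"
  proof (intro sum.cong refl)
    fix k
    show "(if s \<in> {grid n k<..grid n (Suc k)} then op (\<lambda>i. rnd n (\<gamma> i (grid n k) w)) v else 0)
      = (\<Sum>i\<in>J. ((if s \<in> {grid n k<..grid n (Suc k)} then rnd n (\<gamma> i (grid n k) w) else 0) * (v \<bullet> h i)) *\<^sub>R u i)"
      by (cases "s \<in> {grid n k<..grid n (Suc k)}")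
         (simp_all only: op_def if_True if_False simp_thms mult_zero_left scale_zero_left sum.neutral_const)
  qed
  also have "\<dots> = op (\<lambda>i. step (\<gamma> i) n s w) v"
    unfolding op_def step_def by (subst sum.swap) (simp only: sum_distrib_right scaleR_sum_left)
  finally show ?thesis unfolding elementary_process_def .
qed

lemma grid_integral:
  "elementary_integral (Suc n * Suc n) (grid n) (\<lambda>k w. op (\<lambda>i. rnd n (\<gamma> i (grid n k) w))) W t w
    = (\<Sum>i\<in>J. step_int (\<gamma> i) (h i) n t w *\<^sub>R u i)"
  unfolding elementary_integral_def op_def step_int_def
  by (subst sum.swap) (simp only: scaleR_sum_left)

text \<open>The two processes agree only at nonnegative times, so the partition points have to be
  shown nonnegative.\<close>

lemma elementary_integral_W0:
  assumes "\<forall>t\<ge>0. W t w = W0 t w" "elementary_data F m \<tau> A" "0 \<le> t"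
  shows "elementary_integral m \<tau> A W t w = elementary_integral m \<tau> A W0 t w"
proof -
  have \<tau>: "0 \<le> \<tau> k" if "k \<le> m" for k
    using that
  proof (induction k)
    case (Suc k)
    then show ?case using assms(2) unfolding elementary_data_def by (meson Suc_le_lessD less_imp_le order_trans)
  qed (use assms(2) in \<open>simp add: elementary_data_def\<close>)
  show ?thesis unfolding elementary_integral_def using assms(1,3) \<tau> by (intro sum.cong refl) simp
qed


text \<open>Step processes with rounded values are elementary and converge on all horizons at once.
  One grid can serve all directions because each full sequence of step integrals converges.\<close>

lemma J_int_is_stochastic_integral:
  assumes r: "regular b g" and X: "S2_process X"
  shows "is_stochastic_integral M F C W0 (\<lambda>t w. op (\<lambda>i. g i (X t w))) (J_int g X)"
  unfolding is_stochastic_integral_def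
proof (intro conjI allI impI ballI op_bounded_linear)
  note Jca = S2_cont_adapted[OF J_int_S2[OF r X]] and \<gamma> = regular_S2(2)[OF r X]
  show "predictable M F (\<lambda>t w. op (\<lambda>i. g i (X t w)) v)" for v
  proof (rule cont_adapted_predictable[OF cont_adapted_compose[OF S2_cont_adapted[OF X]]])
    show "continuous_on UNIV (\<lambda>x. op (\<lambda>i. g i x) v)"
      unfolding op_def by (intro continuous_intros) (use r in \<open>simp add: regular_def\<close>)
  qed
  show "J_int g X t \<in> borel_measurable (F t)" if "0 \<le> t" for t by (rule cont_adapted_F[OF Jca that])
  show "AE w in M. continuous_on {0..} (\<lambda>t. J_int g X t w)" using cont_adapted_cont[OF Jca] by (intro AE_I2)
  fix T :: real assume T: "0 < T"
  let ?A = "\<lambda>n k w. op (\<lambda>i. rnd n (g i (X (grid n k) w)))" and ?m = "\<lambda>n. Suc n * Suc n"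
  let ?\<gamma> = "\<lambda>i s w. g i (X s w)"
  obtain K where K: "0 \<le> K" "\<And>c. hs_norm_sq C (op c) \<le> ennreal K * (\<Sum>i\<in>J. ennreal ((c i)\<^sup>2))" using hs_op_le by blast
  show "\<exists>m \<tau> A. (\<forall>n. elementary_data F (m n) (\<tau> n) (A n)) \<and>
      (\<lambda>n. \<integral>\<^sup>+ w. (\<integral>\<^sup>+ s\<in>{0..T}. hs_norm_sq C (\<lambda>h. elementary_process (m n) (\<tau> n) (A n) s w h - op (\<lambda>i. g i (X s w)) h) \<partial>lborel) \<partial>M) \<longlonglongrightarrow> 0 \<and>
      (\<lambda>n. \<integral>\<^sup>+ w. (SUP t\<in>{0..T}. ennreal ((norm (elementary_integral (m n) (\<tau> n) (A n) W0 t w - J_int g X t w))\<^sup>2)) \<partial>M) \<longlonglongrightarrow> 0"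
  proof (intro exI[of _ ?m] exI[of _ grid] exI[of _ ?A] conjI allI grid_data[OF r X])
    have lim: "(\<lambda>n. ennreal K * (\<Sum>i\<in>J. EI T (\<lambda>s w. ennreal ((step (?\<gamma> i) n s w - ?\<gamma> i s w)\<^sup>2)))) \<longlonglongrightarrow> ennreal K * (\<Sum>i\<in>J. 0)"
      by (intro ennreal_tendsto_cmult tendsto_sum step_tendsto \<gamma>) (use T in auto)
    show "(\<lambda>n. \<integral>\<^sup>+ w. (\<integral>\<^sup>+ s\<in>{0..T}. hs_norm_sq C (\<lambda>h. elementary_process (?m n) (grid n) (?A n) s w h - op (\<lambda>i. g i (X s w)) h) \<partial>lborel) \<partial>M) \<longlonglongrightarrow> 0"
    proof (rule ennreal_tendsto_0_le[OF lim[unfolded sum.neutral_const mult_zero_right]])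
      fix n
      have [measurable]: "(\<lambda>x. (step (?\<gamma> i) n (fst x) (snd x) - ?\<gamma> i (fst x) (snd x))\<^sup>2) \<in> borel_measurable (PT T)" if "i \<in> J" for i
        using step_measurable_PT[OF S2_cont_adapted[OF \<gamma>[OF that]], of n T] measurable_PT_cont[OF S2_cont_adapted[OF \<gamma>[OF that]], of T]
        by measurable
      have "(\<integral>\<^sup>+ w. (\<integral>\<^sup>+ s\<in>{0..T}. hs_norm_sq C (\<lambda>h. elementary_process (?m n) (grid n) (?A n) s w h - op (\<lambda>i. g i (X s w)) h) \<partial>lborel) \<partial>M)
        = (\<integral>\<^sup>+ w. (\<integral>\<^sup>+ s\<in>{0..T}. hs_norm_sq C (op (\<lambda>i. step (?\<gamma> i) n s w - ?\<gamma> i s w)) \<partial>lborel) \<partial>M)"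
        by (simp only: grid_process[where \<gamma> = ?\<gamma>] op_diff)
      also have "\<dots> \<le> (\<integral>\<^sup>+ w. (\<integral>\<^sup>+ s\<in>{0..T}. ennreal K * (\<Sum>i\<in>J. ennreal ((step (?\<gamma> i) n s w - ?\<gamma> i s w)\<^sup>2)) \<partial>lborel) \<partial>M)"
        by (intro nn_integral_mono mult_right_mono K) simp
      also have "\<dots> = EI T (\<lambda>s w. ennreal K * (\<Sum>i\<in>J. ennreal ((step (?\<gamma> i) n s w - ?\<gamma> i s w)\<^sup>2)))"
        by (rule EI_eq_time_space[symmetric]) (measurable; assumption)
      also have "\<dots> = ennreal K * EI T (\<lambda>s w. \<Sum>i\<in>J. ennreal ((step (?\<gamma> i) n s w - ?\<gamma> i s w)\<^sup>2))"
        by (rule EI_cmult) (measurable; assumption)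
      also have "EI T (\<lambda>s w. \<Sum>i\<in>J. ennreal ((step (?\<gamma> i) n s w - ?\<gamma> i s w)\<^sup>2)) = (\<Sum>i\<in>J. EI T (\<lambda>s w. ennreal ((step (?\<gamma> i) n s w - ?\<gamma> i s w)\<^sup>2)))"
        by (rule EI_sum) measurable
      finally show "(\<integral>\<^sup>+ w. (\<integral>\<^sup>+ s\<in>{0..T}. hs_norm_sq C (\<lambda>h. elementary_process (?m n) (grid n) (?A n) s w h - op (\<lambda>i. g i (X s w)) h) \<partial>lborel) \<partial>M)
        \<le> ennreal K * (\<Sum>i\<in>J. EI T (\<lambda>s w. ennreal ((step (?\<gamma> i) n s w - ?\<gamma> i s w)\<^sup>2)))" by simp
    qed
    let ?d = "\<lambda>n i t w. step_int (?\<gamma> i) (h i) n t w - Ito (?\<gamma> i) (h i) t w"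
    have lim: "(\<lambda>n. ennreal (real (card J)) * (\<Sum>i\<in>J. ES (?d n i) T)) \<longlonglongrightarrow> ennreal (real (card J)) * (\<Sum>i\<in>J. 0)"
      by (intro ennreal_tendsto_cmult tendsto_sum step_int_tendsto_Ito \<gamma>) (use T in auto)
    show "(\<lambda>n. \<integral>\<^sup>+ w. (SUP t\<in>{0..T}. ennreal ((norm (elementary_integral (?m n) (grid n) (?A n) W0 t w - J_int g X t w))\<^sup>2)) \<partial>M) \<longlonglongrightarrow> 0"
    proof (rule ennreal_tendsto_0_le[OF lim[unfolded sum.neutral_const mult_zero_right]])
      fix n
      have m: "(\<lambda>w. SUP t\<in>{0..T}. ennreal ((norm (?d n i t w))\<^sup>2)) \<in> borel_measurable M" if "i \<in> J" for i
        using T by (intro sup_sq_measurable cont_adapted_diff elem_cont_adapted[OF elem_step_int] S2_cont_adapted Ito(1) \<gamma> that) auto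
      have "(\<integral>\<^sup>+ w. (SUP t\<in>{0..T}. ennreal ((norm (elementary_integral (?m n) (grid n) (?A n) W0 t w - J_int g X t w))\<^sup>2)) \<partial>M)
        \<le> (\<integral>\<^sup>+ w. ennreal (real (card J)) * (\<Sum>i\<in>J. SUP t\<in>{0..T}. ennreal ((norm (?d n i t w))\<^sup>2)) \<partial>M)"
      proof (rule nn_integral_mono_AE, use W0 in eventually_elim, rule SUP_least)
        fix w t assume w: "\<forall>t\<ge>0. W t w = W0 t w" and t: "t \<in> {0..T}"
        have "elementary_integral (?m n) (grid n) (?A n) W0 t w - J_int g X t w = (\<Sum>i\<in>J. ?d n i t w *\<^sub>R u i)"
        proof -
          have "elementary_integral (?m n) (grid n) (?A n) W0 t w = (\<Sum>i\<in>J. step_int (?\<gamma> i) (h i) n t w *\<^sub>R u i)"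
            using elementary_integral_W0[OF w grid_data[OF r X, of n], of t] grid_integral[where \<gamma> = ?\<gamma>, of n t w] t by (metis atLeastAtMost_iff)
          then show ?thesis by (simp only: coeff_I_def scaleR_diff_left sum_subtractf)
        qed
        then have "(norm (elementary_integral (?m n) (grid n) (?A n) W0 t w - J_int g X t w))\<^sup>2 \<le> real (card J) * (\<Sum>i\<in>J. (norm (?d n i t w *\<^sub>R u i))\<^sup>2)"
          by (simp only: power2_norm_sum_le[OF J])
        also have "\<dots> \<le> real (card J) * (\<Sum>i\<in>J. (norm (?d n i t w))\<^sup>2)"
          using u by (intro mult_left_mono sum_mono power_mono) (auto simp: mult_left_le)
        finally have "ennreal ((norm (elementary_integral (?m n) (grid n) (?A n) W0 t w - J_int g X t w))\<^sup>2) \<le> ennreal (real (card J) * (\<Sum>i\<in>J. (norm (?d n i t w))\<^sup>2))"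
          by (rule ennreal_leI)
        also have "\<dots> = ennreal (real (card J)) * (\<Sum>i\<in>J. ennreal ((norm (?d n i t w))\<^sup>2))"
          by (simp add: ennreal_mult sum_nonneg)
        also have "\<dots> \<le> ennreal (real (card J)) * (\<Sum>i\<in>J. SUP t\<in>{0..T}. ennreal ((norm (?d n i t w))\<^sup>2))"
          by (intro mult_left_mono sum_mono SUP_upper t) auto
        finally show "ennreal ((norm (elementary_integral (?m n) (grid n) (?A n) W0 t w - J_int g X t w))\<^sup>2)
          \<le> ennreal (real (card J)) * (\<Sum>i\<in>J. SUP t\<in>{0..T}. ennreal ((norm (?d n i t w))\<^sup>2))" .
      qed
      also have "\<dots> = ennreal (real (card J)) * (\<integral>\<^sup>+ w. (\<Sum>i\<in>J. SUP t\<in>{0..T}. ennreal ((norm (?d n i t w))\<^sup>2)) \<partial>M)"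
        by (rule nn_integral_cmult) (intro borel_measurable_sum m)
      also have "(\<integral>\<^sup>+ w. (\<Sum>i\<in>J. SUP t\<in>{0..T}. ennreal ((norm (?d n i t w))\<^sup>2)) \<partial>M) = (\<Sum>i\<in>J. ES (?d n i) T)"
        by (rule nn_integral_sum) (rule m)
      finally show "(\<integral>\<^sup>+ w. (SUP t\<in>{0..T}. ennreal ((norm (elementary_integral (?m n) (grid n) (?A n) W0 t w - J_int g X t w))\<^sup>2)) \<partial>M)
        \<le> ennreal (real (card J)) * (\<Sum>i\<in>J. ES (?d n i) T)" .
    qed
  qed
qed

section \<open>Arbitrary stochastic integrals paired with a vector\<close>

text \<open>\<open>elem\<close> admits only fixed directions with real multipliers, so a simple
  vector-valued integrand is split according to its finitely many values.\<close>

lemma elem_simple: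
  assumes ab: "0 \<le> a" "a \<le> b" and c: "simple_function (F a) c"
  obtains \<psi> S where "elem \<psi> S" "\<And>s w. w \<in> space M \<Longrightarrow> \<psi> s w = (if s \<in> {a<..b} then c w else 0)"
    "\<And>t w. w \<in> space M \<Longrightarrow> S t w = (W (min t b) w - W (min t a) w) \<bullet> c w"
proof -
  define V where "V = c ` space (F a)"
  have V: "finite V" using c by (simp add: V_def simple_function_def)
  let ?i = "\<lambda>v w. indicator (c -` {v} \<inter> space (F a)) w :: real"
  have "elem (\<lambda>s w. (if s \<in> {a<..b} then ?i v w else 0) *\<^sub>R v) (\<lambda>t w. ?i v w * ((W (min t b) w - W (min t a) w) \<bullet> v))" if "v \<in> V" for v
    by (rule elem_single[OF ab borel_measurable_indicator, of _ 1])
       (use c that in \<open>auto simp: simple_function_def V_def indicator_def\<close>)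
  note e = elem_sum[of V, OF this]
  have i: "?i v w = (if v = c w then 1 else 0)" if "w \<in> space M" for v w
    using that space_F[OF ab(1)] by (auto simp: indicator_def)
  have cV: "c w \<in> V" if "w \<in> space M" for w using that space_F[OF ab(1)] by (simp add: V_def)
  show thesis
  proof (rule that[OF e])
    fix w assume w: "w \<in> space M"
    show "(\<Sum>v\<in>V. (if s \<in> {a<..b} then ?i v w else 0) *\<^sub>R v) = (if s \<in> {a<..b} then c w else 0)" for s
    proof (cases "s \<in> {a<..b}")
      case True
      then show ?thesis
        unfolding i[OF w] using V cV[OF w] by (simp add: if_distrib[where f = "\<lambda>x. x *\<^sub>R _"] cong: if_cong)
    qed (simp only: if_False scale_zero_left sum.neutral_const)
    show "(\<Sum>v\<in>V. ?i v w * ((W (min t b) w - W (min t a) w) \<bullet> v)) = (W (min t b) w - W (min t a) w) \<bullet> c w" for t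
      unfolding i[OF w] using V cV[OF w] by (simp add: if_distrib[where f = "\<lambda>x. x * _"] cong: if_cong)
  qed
qed

text \<open>The adjoint moves the pairing with \<open>e\<close> from the output of the operator to
  the noise, and a simple operator-valued function stays simple under this map.\<close>

lemma elementary_elem:
  assumes d: "elementary_data F m \<tau> A"
  obtains \<psi> S where "elem \<psi> S"
    "\<And>s w. w \<in> space M \<Longrightarrow> bounded_linear (elementary_process m \<tau> A s w)"
    "\<And>s w x. w \<in> space M \<Longrightarrow> elementary_process m \<tau> A s w x \<bullet> e = x \<bullet> \<psi> s w"
    "\<And>t w. w \<in> space M \<Longrightarrow> elementary_integral m \<tau> A W t w \<bullet> e = S t w"
proof -
  have \<tau>: "0 \<le> \<tau> k" if "k \<le> m" for k
    using that
  proof (induction k)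
    case (Suc k)
    then show ?case using d unfolding elementary_data_def by (meson Suc_le_lessD less_imp_le order_trans)
  qed (use d in \<open>simp add: elementary_data_def\<close>)
  have lin: "bounded_linear (A k w)" if "k < m" "w \<in> space M" for k w
    using d that space_F[OF \<tau>[of k]] by (simp add: elementary_data_def)
  \<comment> \<open>Integrand and integral are packed into one witness, so that choice over
    \<open>k\<close> yields both at once.\<close>
  have "\<exists>p. elem (fst p) (snd p) \<and> (\<forall>s. \<forall>w\<in>space M. fst p s w = (if s \<in> {\<tau> k<..\<tau> (Suc k)} then adjoint (A k w) e else 0)) \<and>
     (\<forall>t. \<forall>w\<in>space M. snd p t w = (W (min t (\<tau> (Suc k))) w - W (min t (\<tau> k)) w) \<bullet> adjoint (A k w) e)" if k: "k < m" for k
  proof -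
    have s: "simple_function (F (\<tau> k)) (\<lambda>w. adjoint (A k w) e)"
      using d k by (intro simple_function_compose1[where g = "\<lambda>f. adjoint f e"]) (simp add: elementary_data_def)
    have "\<tau> k \<le> \<tau> (Suc k)" using d k by (auto simp: elementary_data_def less_imp_le)
    from elem_simple[OF \<tau> this s] k obtain \<psi> S where "elem \<psi> S" "\<And>s w. w \<in> space M \<Longrightarrow> \<psi> s w = (if s \<in> {\<tau> k<..\<tau> (Suc k)} then adjoint (A k w) e else 0)"
      "\<And>t w. w \<in> space M \<Longrightarrow> S t w = (W (min t (\<tau> (Suc k))) w - W (min t (\<tau> k)) w) \<bullet> adjoint (A k w) e"
      by (metis less_imp_le)
    then show ?thesis by (intro exI[of _ "(\<psi>, S)"]) auto
  qed
  then obtain p where p: "\<And>k. k < m \<Longrightarrow> elem (fst (p k)) (snd (p k))"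
    "\<And>k s w. k < m \<Longrightarrow> w \<in> space M \<Longrightarrow> fst (p k) s w = (if s \<in> {\<tau> k<..\<tau> (Suc k)} then adjoint (A k w) e else 0)"
    "\<And>k t w. k < m \<Longrightarrow> w \<in> space M \<Longrightarrow> snd (p k) t w = (W (min t (\<tau> (Suc k))) w - W (min t (\<tau> k)) w) \<bullet> adjoint (A k w) e"
    by metis
  show thesis
  proof (rule that[OF elem_sum[of "{..<m}" "\<lambda>k. fst (p k)" "\<lambda>k. snd (p k)"]])
    fix w assume w: "w \<in> space M"
    show "bounded_linear (elementary_process m \<tau> A s w)" for s
      unfolding elementary_process_def[abs_def]
    proof (rule bounded_linear_sum)
      fix k assume "k \<in> {..<m}"
      then show "bounded_linear (\<lambda>v. if s \<in> {\<tau> k<..\<tau> (Suc k)} then A k w v else 0)"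
        using lin[OF _ w, of k] by (cases "s \<in> {\<tau> k<..\<tau> (Suc k)}") (auto intro: bounded_linear_zero)
    qed
    show "elementary_process m \<tau> A s w x \<bullet> e = x \<bullet> (\<Sum>k<m. fst (p k) s w)" for s x
      unfolding elementary_process_def inner_sum_left inner_sum_right
      by (intro sum.cong refl) (use p(2)[OF _ w] adjoint_inner[OF lin[OF _ w]] in auto)
    show "elementary_integral m \<tau> A W t w \<bullet> e = (\<Sum>k<m. snd (p k) t w)" for t
      unfolding elementary_integral_def inner_sum_left
      by (intro sum.cong refl) (use p(3)[OF _ w] adjoint_inner[OF lin[OF _ w]] in auto)
  qed (use p(1) in auto)
qed


text \<open>Pairing with a unit vector turns the operator-valued integral into a real one with the adjoint integrand.\<close>

lemma itoL_of_stochastic_integral: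
  assumes i: "is_stochastic_integral M F C W0 \<Phi> I" and e: "norm e = 1" and T: "0 < T"
    and \<phi>: "(\<lambda>x. \<phi> (fst x) (snd x)) \<in> borel_measurable (PT T)"
    and adj: "AE w in M. \<forall>t\<ge>0. \<forall>x. \<Phi> t w x \<bullet> e = x \<bullet> \<phi> t w"
  shows "itoL T \<phi> (\<lambda>t w. I t w \<bullet> e)"
proof -
  have \<Phi>: "bounded_linear (\<Phi> t w)" if "0 \<le> t" "w \<in> space M" for t w
    using i that by (simp add: is_stochastic_integral_def)
  have "\<exists>m \<tau> A. (\<forall>n::nat. elementary_data F (m n) (\<tau> n) (A n)) \<and>
      (\<lambda>n. \<integral>\<^sup>+ w. (\<integral>\<^sup>+ s\<in>{0..T}. hs_norm_sq C (\<lambda>h. elementary_process (m n) (\<tau> n) (A n) s w h - \<Phi> s w h) \<partial>lborel) \<partial>M) \<longlonglongrightarrow> 0 \<and>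
      (\<lambda>n. \<integral>\<^sup>+ w. (SUP t\<in>{0..T}. ennreal ((norm (elementary_integral (m n) (\<tau> n) (A n) W0 t w - I t w))\<^sup>2)) \<partial>M) \<longlonglongrightarrow> 0"
    using i T unfolding is_stochastic_integral_def by simp
  then obtain m \<tau> A where d: "\<And>n. elementary_data F (m n) (\<tau> n) (A n)"
    and 1: "(\<lambda>n. \<integral>\<^sup>+ w. (\<integral>\<^sup>+ s\<in>{0..T}. hs_norm_sq C (\<lambda>h. elementary_process (m n) (\<tau> n) (A n) s w h - \<Phi> s w h) \<partial>lborel) \<partial>M) \<longlonglongrightarrow> 0"
    and 2: "(\<lambda>n. \<integral>\<^sup>+ w. (SUP t\<in>{0..T}. ennreal ((norm (elementary_integral (m n) (\<tau> n) (A n) W0 t w - I t w))\<^sup>2)) \<partial>M) \<longlonglongrightarrow> 0"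
    by (elim exE conjE) blast
  let ?EP = "\<lambda>n. elementary_process (m n) (\<tau> n) (A n)"
  have "\<exists>p. elem (fst p) (snd p) \<and> (\<forall>w\<in>space M. (\<forall>s. bounded_linear (?EP n s w)) \<and> (\<forall>s x. ?EP n s w x \<bullet> e = x \<bullet> fst p s w) \<and>
     (\<forall>t. elementary_integral (m n) (\<tau> n) (A n) W t w \<bullet> e = snd p t w))" for n
    by (rule elementary_elem[OF d[of n], of e]) (metis fst_conv snd_conv)
  then obtain p where p: "\<And>n. elem (fst (p n)) (snd (p n))"
    "\<And>n w s. w \<in> space M \<Longrightarrow> bounded_linear (?EP n s w)"
    "\<And>n w s x. w \<in> space M \<Longrightarrow> ?EP n s w x \<bullet> e = x \<bullet> fst (p n) s w"
    "\<And>n w t. w \<in> space M \<Longrightarrow> elementary_integral (m n) (\<tau> n) (A n) W t w \<bullet> e = snd (p n) t w" by metis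
  have "(\<lambda>n. EI T (\<lambda>s w. qf (fst (p n) s w - \<phi> s w))) \<longlonglongrightarrow> 0"
  proof (rule ennreal_tendsto_0_le[OF 1])
    fix n
    note [measurable] = \<phi> elem_measurable_PT[OF p(1), of n T]
    have "EI T (\<lambda>s w. qf (fst (p n) s w - \<phi> s w)) = (\<integral>\<^sup>+ w. (\<integral>\<^sup>+ s\<in>{0..T}. qf (fst (p n) s w - \<phi> s w) \<partial>lborel) \<partial>M)"
      by (rule EI_eq_time_space) measurable
    \<comment> \<open>Monotonicity is available without knowing that the Hilbert-Schmidt norm is
      measurable.\<close>
    also have "\<dots> \<le> (\<integral>\<^sup>+ w. (\<integral>\<^sup>+ s\<in>{0..T}. hs_norm_sq C (\<lambda>h. ?EP n s w h - \<Phi> s w h) \<partial>lborel) \<partial>M)"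
    proof (rule nn_integral_mono_AE)
      show "AE w in M. (\<integral>\<^sup>+ s\<in>{0..T}. qf (fst (p n) s w - \<phi> s w) \<partial>lborel)
        \<le> (\<integral>\<^sup>+ s\<in>{0..T}. hs_norm_sq C (\<lambda>h. ?EP n s w h - \<Phi> s w h) \<partial>lborel)"
        using adj AE_space
      proof eventually_elim
        fix w assume w: "\<forall>t\<ge>0. \<forall>x. \<Phi> t w x \<bullet> e = x \<bullet> \<phi> t w" "w \<in> space M"
        have "qf (fst (p n) s w - \<phi> s w) \<le> hs_norm_sq C (\<lambda>h. ?EP n s w h - \<Phi> s w h)" if "0 \<le> s" for s
          by (rule qf_le_hs_norm_sq[OF bounded_linear_sub[OF p(2)[OF w(2)] \<Phi>[OF that w(2)]] e])
             (use w that p(3)[OF w(2)] in \<open>simp add: inner_diff_left inner_diff_right\<close>)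
        then show "(\<integral>\<^sup>+ s\<in>{0..T}. qf (fst (p n) s w - \<phi> s w) \<partial>lborel)
          \<le> (\<integral>\<^sup>+ s\<in>{0..T}. hs_norm_sq C (\<lambda>h. ?EP n s w h - \<Phi> s w h) \<partial>lborel)"
          by (intro nn_integral_mono) (auto split: split_indicator)
      qed
    qed
    finally show "EI T (\<lambda>s w. qf (fst (p n) s w - \<phi> s w))
      \<le> (\<integral>\<^sup>+ w. (\<integral>\<^sup>+ s\<in>{0..T}. hs_norm_sq C (\<lambda>h. ?EP n s w h - \<Phi> s w h) \<partial>lborel) \<partial>M)" .
  qed
  moreover have "(\<lambda>n. \<integral>\<^sup>+ w. ennreal ((snd (p n) t w - I t w \<bullet> e)\<^sup>2) \<partial>M) \<longlonglongrightarrow> 0" if t: "t \<in> {0..T}" for t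
  proof (rule ennreal_tendsto_0_le[OF 2], rule nn_integral_mono_AE)
    fix n
    show "AE w in M. ennreal ((snd (p n) t w - I t w \<bullet> e)\<^sup>2)
      \<le> (SUP t\<in>{0..T}. ennreal ((norm (elementary_integral (m n) (\<tau> n) (A n) W0 t w - I t w))\<^sup>2))"
      using W0 AE_space
    proof eventually_elim
      fix w assume w: "\<forall>t\<ge>0. W t w = W0 t w" "w \<in> space M"
      let ?d = "elementary_integral (m n) (\<tau> n) (A n) W0 t w - I t w"
      have "snd (p n) t w - I t w \<bullet> e = ?d \<bullet> e"
        using p(4)[OF w(2), of n t, symmetric] elementary_integral_W0[OF w(1) d[of n], of t] t by (simp add: inner_diff_left)
      then have "(snd (p n) t w - I t w \<bullet> e)\<^sup>2 \<le> (norm ?d)\<^sup>2"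
        using Cauchy_Schwarz_ineq2[of ?d e] e by (simp add: abs_le_square_iff[symmetric])
      then have "ennreal ((snd (p n) t w - I t w \<bullet> e)\<^sup>2) \<le> ennreal ((norm ?d)\<^sup>2)" by (rule ennreal_leI)
      also have "\<dots> \<le> (SUP t\<in>{0..T}. ennreal ((norm (elementary_integral (m n) (\<tau> n) (A n) W0 t w - I t w))\<^sup>2))"
        by (rule SUP_upper[OF t])
      finally show "ennreal ((snd (p n) t w - I t w \<bullet> e)\<^sup>2)
        \<le> (SUP t\<in>{0..T}. ennreal ((norm (elementary_integral (m n) (\<tau> n) (A n) W0 t w - I t w))\<^sup>2))" .
    qed
  qed
  ultimately show ?thesis unfolding itoL_def using p(1)
    by (intro exI[of _ "\<lambda>n. fst (p n)"] exI[of _ "\<lambda>n. snd (p n)"]) auto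
qed

text \<open>Paired with a unit vector, both integrals are at each time L^2 limits of the same
  elementary integrals. Equality extends from countably many directions and times by density and
  continuity.\<close>

lemma stochastic_integral_unique:
  assumes i: "is_stochastic_integral M F C W0 \<Phi> I" and r: "regular b g" and X: "S2_process X"
    and \<Phi>: "AE w in M. \<forall>t\<ge>0. \<Phi> t w = op (\<lambda>i. g i (X t w))"
  shows "AE w in M. \<forall>t\<ge>0. I t w = J_int g X t w"
proof -
  note Jca = S2_cont_adapted[OF J_int_S2[OF r X]]
  have Im: "I t \<in> borel_measurable M" if "0 \<le> t" for t
    using i that measurable_F_M unfolding is_stochastic_integral_def by blast
  have Ic: "AE w in M. continuous_on {0..} (\<lambda>t. I t w)" using i unfolding is_stochastic_integral_def by blast
  have comp: "AE w in M. I t w \<bullet> e = J_int g X t w \<bullet> e" if e: "norm e = 1" and t: "0 \<le> t" for e t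
  proof -
    define \<phi> where "\<phi> s w = (\<Sum>i\<in>J. (u i \<bullet> e) *\<^sub>R (g i (X s w) *\<^sub>R h i))" for s w
    have it: "ito \<phi> (\<lambda>t w. J_int g X t w \<bullet> e)"
      using ito_sum[of J, OF ito_scale[OF coeff_I(2)[OF r X]], of "\<lambda>i. i" "\<lambda>i. u i \<bullet> e"]
      unfolding \<phi>_def[abs_def] by (simp add: inner_sum_left mult.commute)
    have "itoL (t + 1) \<phi> (\<lambda>t w. I t w \<bullet> e)"
    proof (rule itoL_of_stochastic_integral[OF i e _ ito_PT[OF it]])
      show "AE w in M. \<forall>t\<ge>0. \<forall>x. \<Phi> t w x \<bullet> e = x \<bullet> \<phi> t w"
        using \<Phi> by eventually_elim (simp add: op_inner \<phi>_def)
    qed (use t in simp)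
    then obtain \<psi> S where S0: "\<forall>n. elem (\<psi> n) (S n)" and S2: "(\<lambda>n. EI (t + 1) (\<lambda>s w. qf (\<psi> n s w - \<phi> s w))) \<longlonglongrightarrow> 0"
      and S3: "\<forall>t\<in>{0..t + 1}. (\<lambda>n. \<integral>\<^sup>+ w. ennreal ((S n t w - I t w \<bullet> e)\<^sup>2) \<partial>M) \<longlonglongrightarrow> 0"
      unfolding itoL_def by blast
    have S: "elem (\<psi> n) (S n)" for n using S0 by simp
    \<comment> \<open>The 8 is 2 * 4: a split square and the factor of
      \<open>ito_L2\<close>.\<close>
    have le: "(\<integral>\<^sup>+ w. ennreal ((J_int g X t w \<bullet> e - I t w \<bullet> e)\<^sup>2) \<partial>M)
      \<le> 2 * (\<integral>\<^sup>+ w. ennreal ((S n t w - I t w \<bullet> e)\<^sup>2) \<partial>M) + 8 * EI (t + 1) (\<lambda>s w. qf (\<psi> n s w - \<phi> s w))" for n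
    proof -
      note [measurable] = Im[OF t] cont_adapted_M[OF Jca t] cont_adapted_M[OF elem_cont_adapted[OF S] t]
      have "(\<integral>\<^sup>+ w. ennreal ((J_int g X t w \<bullet> e - I t w \<bullet> e)\<^sup>2) \<partial>M)
        = (\<integral>\<^sup>+ w. ennreal (((S n t w - I t w \<bullet> e) + - (S n t w - J_int g X t w \<bullet> e))\<^sup>2) \<partial>M)" by (simp add: algebra_simps)
      also have "\<dots> \<le> 2 * (\<integral>\<^sup>+ w. ennreal ((S n t w - I t w \<bullet> e)\<^sup>2) \<partial>M) + 2 * (\<integral>\<^sup>+ w. ennreal ((- (S n t w - J_int g X t w \<bullet> e))\<^sup>2) \<partial>M)"
        by (rule nn_sq_add_le) measurable
      also have "(\<integral>\<^sup>+ w. ennreal ((- (S n t w - J_int g X t w \<bullet> e))\<^sup>2) \<partial>M) = (\<integral>\<^sup>+ w. ennreal ((S n t w - J_int g X t w \<bullet> e)\<^sup>2) \<partial>M)"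
        by (simp only: power2_minus)
      also have "\<dots> \<le> 4 * EI t (\<lambda>s w. qf (\<psi> n s w - \<phi> s w))" by (rule ito_L2[OF ito_diff[OF ito_elem[OF S] it] t])
      also have "EI t (\<lambda>s w. qf (\<psi> n s w - \<phi> s w)) \<le> EI (t + 1) (\<lambda>s w. qf (\<psi> n s w - \<phi> s w))"
      proof (rule EI_mono_time)
        note [measurable] = ito_PT[OF it] elem_measurable_PT[OF S]
        show "(\<lambda>x. qf (\<psi> n (fst x) (snd x) - \<phi> (fst x) (snd x))) \<in> borel_measurable (PT T)" for T by measurable
      qed (use t in auto)
      finally show ?thesis by (simp add: add_left_mono mult_left_mono mult.assoc[symmetric])
    qed
    have "(\<lambda>n. 2 * (\<integral>\<^sup>+ w. ennreal ((S n t w - I t w \<bullet> e)\<^sup>2) \<partial>M) + 8 * EI (t + 1) (\<lambda>s w. qf (\<psi> n s w - \<phi> s w))) \<longlonglongrightarrow> 0"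
      by (rule ennreal_tendsto_add_0[OF bspec[OF S3] S2]) (use t in auto)
    then have "(\<integral>\<^sup>+ w. ennreal ((J_int g X t w \<bullet> e - I t w \<bullet> e)\<^sup>2) \<partial>M) \<le> 0"
      by (rule LIMSEQ_le_const) (use le in blast)
    then have "(\<integral>\<^sup>+ w. ennreal ((J_int g X t w \<bullet> e - I t w \<bullet> e)\<^sup>2) \<partial>M) = 0" by simp
    moreover have "(\<lambda>w. ennreal ((J_int g X t w \<bullet> e - I t w \<bullet> e)\<^sup>2)) \<in> borel_measurable M"
    proof -
      note [measurable] = Im[OF t] cont_adapted_M[OF Jca t]
      show ?thesis by measurable
    qed
    ultimately have "AE w in M. ennreal ((J_int g X t w \<bullet> e - I t w \<bullet> e)\<^sup>2) = 0" by (simp only: nn_integral_0_iff_AE)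
    then show ?thesis by eventually_elim simp
  qed
  obtain D0 :: "'k set" where D0: "countable D0" "\<And>S. open S \<Longrightarrow> S \<noteq> {} \<Longrightarrow> \<exists>d\<in>D0. d \<in> S" using countable_dense_setE by blast
  \<comment> \<open>The pairing is available for unit vectors only, so a countable dense set is
    normalised. It still detects every nonzero \<open>v\<close>, since a dense set meets the open
    half-space where the pairing with \<open>v\<close> is positive.\<close>
  define D where "D = sgn ` (D0 - {0})"
  have D: "countable D" unfolding D_def by (intro countable_image countable_Diff D0(1))
  have D_1: "norm d = 1" if "d \<in> D" for d
    using that unfolding D_def by (elim imageE) (simp add: norm_sgn)
  have D_0: "v = 0" if v: "\<And>d. d \<in> D \<Longrightarrow> v \<bullet> d = 0" for v
  proof (rule ccontr)
    assume v0: "v \<noteq> 0"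
    have "open {x. 0 < v \<bullet> x}" by (intro open_Collect_less continuous_intros)
    moreover have "v \<in> {x. 0 < v \<bullet> x}" using v0 by simp
    ultimately obtain d where d: "d \<in> D0" "0 < v \<bullet> d" using D0(2)[of "{x. 0 < v \<bullet> x}"] by blast
    then have "sgn d \<in> D" unfolding D_def by auto
    then have "v \<bullet> sgn d = 0" by (rule v)
    then show False using d by (auto simp: sgn_div_norm)
  qed
  have "AE w in M. \<forall>d\<in>D. \<forall>n k. I (real k / real (Suc n)) w \<bullet> d = J_int g X (real k / real (Suc n)) w \<bullet> d"
    unfolding AE_ball_countable[OF D] AE_all_countable
    by (intro ballI allI comp D_1) (auto intro: divide_nonneg_nonneg)
  then show ?thesis using Ic AE_space
  proof eventually_elim
    fix w assume *: "\<forall>d\<in>D. \<forall>n k. I (real k / real (Suc n)) w \<bullet> d = J_int g X (real k / real (Suc n)) w \<bullet> d"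
      and c: "continuous_on {0..} (\<lambda>t. I t w)" and w: "w \<in> space M"
    have eq: "I (real k / real (Suc n)) w = J_int g X (real k / real (Suc n)) w" for k n
    proof -
      have "(I (real k / real (Suc n)) w - J_int g X (real k / real (Suc n)) w) \<bullet> d = 0" if "d \<in> D" for d
        using spec[OF spec[OF bspec[OF * that], of n], of k] by (simp only: inner_diff_left diff_self)
      from D_0[OF this] show ?thesis by simp
    qed
    show "\<forall>t\<ge>0. I t w = J_int g X t w"
    proof (intro allI impI)
      fix t :: real assume t: "0 \<le> t"
      obtain r :: "nat \<Rightarrow> nat" where r: "(\<lambda>n. real (r n) / real (Suc n)) \<longlonglongrightarrow> t" using rational_approx[OF t] by blast
      have "(\<lambda>n. I (real (r n) / real (Suc n)) w) \<longlonglongrightarrow> I t w"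
        by (rule continuous_on_tendsto_compose[OF c r]) (use t in auto)
      moreover have "(\<lambda>n. J_int g X (real (r n) / real (Suc n)) w) \<longlonglongrightarrow> J_int g X t w"
        by (rule continuous_on_tendsto_compose[OF cont_adapted_cont[OF Jca w] r]) (use t in auto)
      ultimately show "I t w = J_int g X t w" unfolding eq by (rule LIMSEQ_unique)
    qed
  qed
qed


section \<open>Strong solutions and the equation with real integrals\<close>

text \<open>An arbitrary strong solution is continuous only almost surely. After a change on a null
  set it is adapted, by predictability, and \<open>stochastic_integral_unique\<close> identifies its
  integral; uniqueness can then be argued within \<open>solves\<close>.\<close>

lemma strong_solution_solves:
  assumes r: "regular b g" and gs: "global_strong_solution M F C W0 b (\<lambda>x. op (\<lambda>i. g i x)) x0 X"
  obtains Y where "solves b g x0 Y" "AE w in M. \<forall>t\<ge>0. X t w = Y t w"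
proof -
  have pr: "predictable M F X" and c: "AE w in M. continuous_on {0..} (\<lambda>t. X t w)"
    and sq: "\<And>T. T > 0 \<Longrightarrow> ES X T < \<infinity>" using gs by (simp_all add: global_strong_solution_def)
  obtain I where I: "is_stochastic_integral M F C W0 (\<lambda>t w. op (\<lambda>i. g i (X t w))) I"
    and eq: "AE w in M. \<forall>t\<ge>0. set_integrable lborel {0..t} (\<lambda>s. b (X s w)) \<and>
       X t w = x0 + (LINT s:{0..t}|lborel. b (X s w)) + I t w"
    using gs unfolding global_strong_solution_def by blast
  obtain N where N: "{w\<in>space M. \<not> continuous_on {0..} (\<lambda>t. X t w)} \<subseteq> N" "N \<in> null_sets M"
    using c by (auto elim!: AE_E simp: null_sets_def)
  define Y where "Y t w = (if w \<in> N then 0 else X t w)" for t w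
  have XY: "AE w in M. \<forall>t. X t w = Y t w" using AE_not_in[OF N(2)] by eventually_elim (simp add: Y_def)
  have Yc: "cont_adapted Y"
    unfolding cont_adapted_def
  proof (intro conjI allI impI ballI)
    show "Y t \<in> borel_measurable (F t)" if t: "0 \<le> t" for t
      unfolding Y_def[abs_def] by (rule measurable_F_modify[OF t predictable_adapted[OF pr t] N(2)]) simp
    show "continuous_on {0..} (\<lambda>t. Y t w)" if "w \<in> space M" for w
      using N(1) that by (cases "w \<in> N") (auto simp: Y_def)
  qed
  have YS: "S2_process Y"
    unfolding S2_process_def
  proof (intro conjI Yc allI impI)
    fix T :: real assume T: "0 \<le> T"
    have "ES Y T \<le> ES Y (T + 1)" by (intro nn_integral_mono SUP_subset_mono) auto
    also have "\<dots> = ES X (T + 1)" using XY by (intro nn_integral_cong_AE, eventually_elim) simp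
    also have "\<dots> < \<infinity>" using T by (intro sq) simp
    finally show "ES Y T < \<infinity>" .
  qed
  have "AE w in M. \<forall>t\<ge>0. op (\<lambda>i. g i (X t w)) = op (\<lambda>i. g i (Y t w))" using XY by eventually_elim simp
  from stochastic_integral_unique[OF I r YS this] eq XY
  have "AE w in M. \<forall>t\<ge>0. Y t w = x0 + evo (\<lambda>s w. b (Y s w)) (coeff_I g Y) t w"
    by eventually_elim (simp add: evo_def add.assoc)
  then have "solves b g x0 Y" using YS by (simp add: solves_def)
  moreover have "AE w in M. \<forall>t\<ge>0. X t w = Y t w" using XY by eventually_elim simp
  ultimately show thesis by (rule that)
qed

lemma solves_strong_solution:
  assumes r: "regular b g" and s: "solves b g x0 X"
  shows "global_strong_solution M F C W0 b (\<lambda>x. op (\<lambda>i. g i x)) x0 X"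
  unfolding global_strong_solution_def
proof (intro conjI exI[of _ "J_int g X"])
  have X: "S2_process X" and eq: "AE w in M. \<forall>t\<ge>0. X t w = x0 + evo (\<lambda>s w. b (X s w)) (coeff_I g X) t w"
    using s by (simp_all add: solves_def)
  note Xc = S2_cont_adapted[OF X]
  show "predictable M F X" by (rule cont_adapted_predictable[OF Xc])
  show "AE w in M. continuous_on {0..} (\<lambda>t. X t w)" using cont_adapted_cont[OF Xc] by (intro AE_I2)
  show "\<forall>T>0. ES X T < \<infinity>" using S2_ES[OF X] by simp
  show "is_stochastic_integral M F C W0 (\<lambda>t w. op (\<lambda>i. g i (X t w))) (J_int g X)"
    by (rule J_int_is_stochastic_integral[OF r X])
  show "AE w in M. \<forall>t\<ge>0. set_integrable lborel {0..t} (\<lambda>s. b (X s w)) \<and>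
     X t w = x0 + (LINT s:{0..t}|lborel. b (X s w)) + J_int g X t w"
    using eq AE_space
  proof eventually_elim
    fix w assume *: "\<forall>t\<ge>0. X t w = x0 + evo (\<lambda>s w. b (X s w)) (coeff_I g X) t w" and w: "w \<in> space M"
    have "set_integrable lborel {0..t} (\<lambda>s. b (X s w))" for t
      by (rule borel_integrable_atLeastAtMost'[OF cont_adapted_cont_Icc[OF S2_cont_adapted[OF regular_S2(1)[OF r X]] w order_refl]])
    then show "\<forall>t\<ge>0. set_integrable lborel {0..t} (\<lambda>s. b (X s w)) \<and>
       X t w = x0 + (LINT s:{0..t}|lborel. b (X s w)) + J_int g X t w"
      using * by (simp add: evo_def add.assoc)
  qed
qed

lemma loc_Lip_unique_strong_solution:
  assumes l: "loc_Lip b g" and G: "0 \<le> G"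
    and gr: "\<And>x. norm (b x) \<le> G * norm x" "\<And>x i. i \<in> J \<Longrightarrow> \<bar>g i x\<bar> \<le> G * norm x"
  shows "unique_global_strong_solution M F C W0 b (\<lambda>x. op (\<lambda>i. g i x)) x0"
  unfolding unique_global_strong_solution_def
proof (intro conjI allI impI)
  have sol: "regular b g" "\<And>x0. \<exists>X. solves b g x0 X" using loc_Lip_solution[OF l G gr] by blast+
  show "\<exists>X. global_strong_solution M F C W0 b (\<lambda>x. op (\<lambda>i. g i x)) x0 X"
    using sol(2)[of x0] solves_strong_solution[OF sol(1)] by blast
  fix X Y assume XY: "global_strong_solution M F C W0 b (\<lambda>x. op (\<lambda>i. g i x)) x0 X" "global_strong_solution M F C W0 b (\<lambda>x. op (\<lambda>i. g i x)) x0 Y"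
  obtain X' where X': "solves b g x0 X'" "AE w in M. \<forall>t\<ge>0. X t w = X' t w" using strong_solution_solves[OF sol(1) XY(1)] by blast
  obtain Y' where Y': "solves b g x0 Y'" "AE w in M. \<forall>t\<ge>0. Y t w = Y' t w" using strong_solution_solves[OF sol(1) XY(2)] by blast
  from loc_Lip_unique[OF l sol(1) X'(1) Y'(1)] X'(2) Y'(2)
  show "AE w in M. \<forall>t\<ge>0. X t w = Y t w" by eventually_elim simp
qed

end

subsection \<open>The interacting particle system\<close>

theorem theorem4p2:
  fixes Q :: "'h::{real_inner, banach, second_countable_topology} \<Rightarrow> 'h"
    and V :: "'h set" and E :: "'h \<Rightarrow> real"
    and \<alpha> lam \<sigma> :: real
    and M :: "'w measure" and F :: "real \<Rightarrow> 'w measure"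
    and W :: "real \<Rightarrow> 'w \<Rightarrow> 'h ^ 'n"
    and x0 :: "'h ^ 'n"
  assumes "\<not> finite_dimensional (UNIV :: 'h set)"
    and "covariance_operator Q"
    and "stochastic_basis M F"
    and "independent_Q_wiener M F Q W"
    and "\<alpha> > 0" and "lam > 0" and "\<sigma> > 0"
    and "admissible_objective E"
    and "active_subspace V Q E"
  shows "unique_global_strong_solution M F (diag_op Q) W
           (\<lambda>X. - lam *\<^sub>R consensus_drift \<alpha> E X)
           (\<lambda>X u. \<sigma> *\<^sub>R block_diffusion V (consensus_drift \<alpha> E X) u)
           x0"
proof -
  interpret SB: stochastic_basis M F by fact
  obtain W' where W': "hilbert_noise M F W' (diag_op Q)" "AE w in M. \<forall>t\<ge>0. W' t w = W t w"
    by (rule SB.independent_Q_wiener_hilbert_noise[OF assms(2,4)])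
  have "finite_dimensional V" using assms(9) by (simp add: active_subspace_def)
  then obtain B where B: "finite B" "orthonormal B" "span B = V" using orthonormal_finite_basis by blast
  \<comment> \<open>The pair \<open>(i, e)\<close> names the component of the \<open>i\<close>-th
    noise along \<open>e\<close>. Since the diffusion is block-diagonal with multiples of a
    projection, \<open>a p\<close> is both the direction in which the noise is read and the
    direction in which it acts.\<close>
  define a :: "'n \<times> 'h \<Rightarrow> 'h ^ 'n" where "a p = axis (fst p) (snd p)" for p
  interpret hilbert_noise M F W' "diag_op Q" by fact
  interpret operator_sde M F W' "diag_op Q" "UNIV \<times> B" a a W
  proof unfold_locales
    show "norm (a p) \<le> 1" if "p \<in> UNIV \<times> B" for p
      using that B(2) norm_vec_le_sum[of "a p"] by (auto simp: a_def axis_def orthonormal_def if_distrib cong: if_cong)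
  qed (use B W' in auto)
  let ?D = "consensus_drift \<alpha> E :: 'h ^ 'n \<Rightarrow> 'h ^ 'n"
  let ?b = "\<lambda>X. - lam *\<^sub>R ?D X" and ?g = "\<lambda>p X. \<sigma> * norm (?D X $ fst p)"
  have "\<sigma> *\<^sub>R block_diffusion V (?D X) v = op (\<lambda>p. ?g p X) v" for X v
  proof (subst vec_eq_iff, rule allI)
    fix i
    have "op (\<lambda>p. ?g p X) v $ i = (\<Sum>j\<in>UNIV. \<Sum>e\<in>B. (\<sigma> * norm (?D X $ j) * (v $ j \<bullet> e)) *\<^sub>R (axis j e $ i))"
      by (simp add: op_def a_def inner_axis sum.cartesian_product split_beta)
    also have "\<dots> = (\<Sum>j\<in>UNIV. if j = i then \<Sum>e\<in>B. (\<sigma> * norm (?D X $ i) * (v $ i \<bullet> e)) *\<^sub>R e else 0)"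
      by (intro sum.cong refl) (simp add: axis_def)
    also have "\<dots> = (\<sigma> * norm (?D X $ i)) *\<^sub>R orth_proj V (v $ i)"
      by (simp add: orth_proj_expand[OF B] scaleR_sum_right)
    finally show "(\<sigma> *\<^sub>R block_diffusion V (?D X) v) $ i = op (\<lambda>p. ?g p X) v $ i"
      by (simp add: block_diffusion_def diffusion_def)
  qed
  then have S: "(\<lambda>X u. \<sigma> *\<^sub>R block_diffusion V (?D X) u) = (\<lambda>X. op (\<lambda>p. ?g p X))" by blast
  define n where "n = real CARD('n)"
  \<comment> \<open>\<open>lam * n + \<sigma>\<close> serves as a common factor: the drift costs
    \<open>lam * n\<close> and each noise coefficient costs \<open>\<sigma>\<close>.\<close>
  have c: "0 \<le> n" "0 \<le> lam * n" "lam * n \<le> lam * n + \<sigma>" "\<sigma> \<le> lam * n + \<sigma>" using assms(6,7) by (auto simp: n_def)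
  \<comment> \<open>The crude comparison with the sum of the component norms is enough; it is the
    origin of the factor \<open>n\<close>.\<close>
  have bound: "norm (x :: 'h ^ 'n) \<le> n * K" if "\<And>i. norm (x $ i) \<le> K" for x K
    using order_trans[OF norm_vec_le_sum sum_mono[of UNIV, OF that]] by (simp add: n_def)
  have "loc_Lip ?b ?g"
    unfolding loc_Lip_def
  proof (intro allI impI)
    fix R :: real assume "R > 0"
    then obtain L where L: "L \<ge> 0" "\<And>X Y i. norm X \<le> R \<Longrightarrow> norm Y \<le> R \<Longrightarrow> norm (?D X $ i - ?D Y $ i) \<le> L * norm (X - Y)"
      using consensus_drift_local_Lipschitz[OF assms(5,8), of R, where 'n = 'n] by (metis less_imp_le)
    show "\<exists>L\<ge>0. \<forall>X Y. norm X \<le> R \<longrightarrow> norm Y \<le> R \<longrightarrow> norm (?b X - ?b Y) \<le> L * norm (X - Y) \<and>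
      (\<forall>p\<in>UNIV \<times> B. \<bar>?g p X - ?g p Y\<bar> \<le> L * norm (X - Y))"
    proof (intro exI[of _ "(lam * n + \<sigma>) * L"] conjI allI impI ballI)
      fix X Y :: "'h ^ 'n" assume XY: "norm X \<le> R" "norm Y \<le> R"
      have L0: "0 \<le> L * norm (X - Y)" using L by simp
      have "norm (?b X - ?b Y) = lam * norm (?D X - ?D Y)"
        using assms(6) norm_scaleR[of "- lam" "?D X - ?D Y"] by (simp add: scaleR_diff_right)
      also have "\<dots> \<le> lam * (n * (L * norm (X - Y)))"
        using assms(6) by (intro mult_left_mono bound) (use L(2)[OF XY] in auto)
      also have "\<dots> \<le> (lam * n + \<sigma>) * (L * norm (X - Y))" using mult_right_mono[OF c(3) L0] by (simp add: mult.assoc)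
      finally show "norm (?b X - ?b Y) \<le> (lam * n + \<sigma>) * L * norm (X - Y)" by (simp only: mult.assoc)
      fix p :: "'n \<times> 'h"
      have "\<bar>?g p X - ?g p Y\<bar> = \<sigma> * \<bar>norm (?D X $ fst p) - norm (?D Y $ fst p)\<bar>"
        using assms(7) by (simp add: abs_mult flip: right_diff_distrib)
      also have "\<dots> \<le> \<sigma> * (L * norm (X - Y))"
        using assms(7) order_trans[OF norm_triangle_ineq3 L(2)[OF XY]] by (intro mult_left_mono) auto
      also have "\<dots> \<le> (lam * n + \<sigma>) * (L * norm (X - Y))" by (rule mult_right_mono[OF c(4) L0])
      finally show "\<bar>?g p X - ?g p Y\<bar> \<le> (lam * n + \<sigma>) * L * norm (X - Y)" by (simp only: mult.assoc)
    qed (use c L assms(7) in auto)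
  qed
  moreover have "0 \<le> (lam * n + \<sigma>) * 2" using c assms(7) by simp
  moreover have "norm (?b X) \<le> (lam * n + \<sigma>) * 2 * norm X" for X
  proof -
    have "norm (?b X) = lam * norm (?D X)" using assms(6) by simp
    also have "\<dots> \<le> lam * (n * (2 * norm X))"
      using assms(6) by (intro mult_left_mono bound norm_consensus_drift_nth_le[OF assms(5,8)]) auto
    also have "\<dots> \<le> (lam * n + \<sigma>) * (2 * norm X)" using mult_right_mono[OF c(3), of "2 * norm X"] by (simp add: mult.assoc)
    finally show ?thesis by (simp only: mult.assoc)
  qed
  moreover have "\<bar>?g p X\<bar> \<le> (lam * n + \<sigma>) * 2 * norm X" for p X
  proof -
    have "\<bar>?g p X\<bar> \<le> \<sigma> * (2 * norm X)"
      using assms(7) norm_consensus_drift_nth_le[OF assms(5,8), of X "fst p"] by (simp add: abs_mult)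
    also have "\<dots> \<le> (lam * n + \<sigma>) * (2 * norm X)" by (rule mult_right_mono[OF c(4)]) simp
    finally show ?thesis by (simp only: mult.assoc)
  qed
  ultimately show ?thesis unfolding S by (rule loc_Lip_unique_strong_solution)
qed

end
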